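(* Let $\varphi$ be a bounded triangle potential. Suppose $\varphi$ is eventually increasing and let $z>0$. Then every stationary Gibbs measure for $\varphi$ and $z$ is tempered, so that $\mathscr G_\Theta^{\mathrm{tp}}(z,\varphi)=\mathscr G_\Theta(z,\varphi)$.
   Context: **Configurations and Delaunay triangulation.** $\Omega$ is the set of all locally finite subsets (configurations) $\omega$ of $\mathbb R^2$, with the $\sigma$-algebra $\mathcal F$ generated by the counting variables $N_\Delta(\omega)=\mathrm{card}(\omega\cap\Delta)$, $\Delta\subset\mathbb R^2$ bounded Borel. Write $\omega_\Delta=\omega\cap\Delta$, $\mathrm{pr}_\Delta:\omega\mapsto\omega_\Delta$, and $P_\Delta=P\circ\mathrm{pr}_\Delta^{-1}$ for a probability measure $P$ on $(\Omega,\mathcal F)$. A triangle (tile) is a set $\tau$ of three non-collinear points of $\mathbb R^2$; $B(\tau)$ is the open disc with $\tau\subset\partial B(\tau)$, $c(\tau)$ its centre, $\varrho(\tau)$ its radius. The Delaunay triangulation of $\omega$ is $\mathsf D(\omega)=\{\tau\subset\omega:\mathrm{card}\,\tau=3,\ \omega\cap B(\tau)=\emptyset\}$; if $n\ge4$ points of $\omega$ lie on a circle with no points of $\omega$ inside, only the tiles of one triangulation of the convex polygon spanned by these points are kept, namely the smallest one in lexicographic order (points of $\mathbb R^2$ ordered lexicographically, triangles written as increasing triples and ordered lexicographically in $(\mathbb R^2)^3$, finite collections of triangles ordered lexicographically). $\mathcal T_0$ is the set of tiles with $c(\tau)=0$. **Stationary point processes.** $\mathscr P_\Theta$ is the set of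 probability measures $P$ on $(\Omega,\mathcal F)$ invariant under all shifts $\vartheta_x:\omega\mapsto\omega-x$, $x\in\mathbb R^2$, with finite intensity $z(P)=|\Delta|^{-1}\int N_\Delta\,dP<\infty$ ($\Delta$ any bounded Borel set with $|\Delta|>0$). The centred tile distribution $\mu_P$ of $P\in\mathscr P_\Theta$ is the finite measure on $\mathcal T_0$ with $\int dx\int\mu_P(d\tau) f(x,\tau)=\int P(d\omega)\sum_{\tau\in\mathsf D(\omega)}f(c(\tau),\tau-c(\tau))$ for all measurable $f\ge0$ on $\mathbb R^2\times\mathcal T_0$. $P\in\mathscr P_\Theta$ is tempered if $\int|B(\tau)|\,\mu_P(d\tau)<\infty$. $\Pi^z$ is the Poisson point process on $\mathbb R^2$ with intensity $z>0$. **Potential.** A triangle potential is a measurable function $\varphi:\mathcal T_0\to\mathbb R$, extended to all tiles by $\varphi(\tau)=\varphi(\tau-c(\tau))$; it is bounded if $|\varphi|\le c_\varphi$ for some constant $c_\varphi<\infty$. It is eventually increasing if there are $r_\varphi<\infty$ and a measurable nondecreasing $\psi:[r_\varphi,\infty)\to\mathbb R$ with $\varphi(\tau)=\psi(\varrho(\tau))$ whenever $\varrho(\tau)\ge r_\varphi$. **Gibbs measures.** For bounded Borel $\Lambda$ and $\omega,\zeta\in\Omega$, $H_{\Lambda,\omega}(\zeta)=\sum\varphi(\tau)$, the sum over all $\tau\in\mathsf D(\zeta_\Lambda\cup\omega_{\Lambda^c})$ with $B(\tau)\cap\Lambda\ne\emptyset$. A configuration $\omega$ is admissible if for every bounded Borel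 $\Lambda$ there is a bounded Borel $\bar\Lambda(\omega)\supset\Lambda$ such that $B(\tau)\subset\bar\Lambda(\omega)$ whenever $\zeta\in\Omega$, $\tau\in\mathsf D(\zeta_\Lambda\cup\omega_{\Lambda^c})$ and $B(\tau)\cap\Lambda\neq\emptyset$. $\Omega^*$ is the set of admissible configurations. For $\omega\in\Omega^*$, $Z_{\Lambda,z,\omega}=\int e^{-H_{\Lambda,\omega}}\,d\Pi^z_\Lambda$ (finite) and $G_{\Lambda,z,\omega}(A)=Z_{\Lambda,z,\omega}^{-1}\int\mathbf 1_A(\zeta\cup\omega_{\Lambda^c})e^{-H_{\Lambda,\omega}(\zeta)}\,\Pi^z_\Lambda(d\zeta)$, $A\in\mathcal F$. A probability measure $P$ on $(\Omega,\mathcal F)$ is a Gibbs measure for $\varphi$ and $z$ if $P(\Omega^* )=1$ and $P=\int P(d\omega)\,G_{\Lambda,z,\omega}$ for all bounded Borel $\Lambda$. $\mathscr G_\Theta(z,\varphi)$ is the set of stationary Gibbs measures (those in $\mathscr P_\Theta$), and $\mathscr G^{\mathrm{tp}}_\Theta(z,\varphi)$ the set of tempered ones. *)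

theory Defs
  imports "HOL-Probability.Probability" "HOL-Library.List_Lexorder"
begin

section \<open>Configurations in the plane\<close>

type_synonym plane = "real ^ 2"

definition bounded_borel :: "plane set set" where
  "bounded_borel = {\<Delta> \<in> sets borel. bounded \<Delta>}"

definition configurations :: "plane set set" where
  "configurations = {\<omega>. \<forall>\<Delta>. bounded \<Delta> \<longrightarrow> finite (\<omega> \<inter> \<Delta>)}"

definition count_in :: "plane set \<Rightarrow> plane set \<Rightarrow> nat" where
  "count_in \<Delta> \<omega> = card (\<omega> \<inter> \<Delta>)"

definition config_space :: "plane set measure" where
  "config_space = sigma configurations
     {{\<omega> \<in> configurations. count_in \<Delta> \<omega> = k} | \<Delta> k. \<Delta> \<in> bounded_borel}"

definition shift :: "plane \<Rightarrow> plane set \<Rightarrow> plane set" where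
  "shift x \<omega> = (\<lambda>y. y - x) ` \<omega>"

definition point_process :: "plane set measure \<Rightarrow> bool" where
  "point_process P \<longleftrightarrow> prob_space P \<and> sets P = sets config_space"

definition restricted_process :: "plane set \<Rightarrow> plane set measure \<Rightarrow> plane set measure" where
  "restricted_process \<Delta> P = distr P config_space (\<lambda>\<omega>. \<omega> \<inter> \<Delta>)"


section \<open>Delaunay triangulation\<close>

definition tile :: "plane set \<Rightarrow> bool" where
  "tile \<tau> \<longleftrightarrow> card \<tau> = 3 \<and> \<not> collinear \<tau>"

definition tile_centre :: "plane set \<Rightarrow> plane" where
  "tile_centre \<tau> = (THE c. \<exists>r>0. \<tau> \<subseteq> sphere c r)"

definition tile_radius :: "plane set \<Rightarrow> real" where
  "tile_radius \<tau> = (THE r. \<tau> \<subseteq> sphere (tile_centre \<tau>) r)"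

definition tile_disc :: "plane set \<Rightarrow> plane set" where
  "tile_disc \<tau> = ball (tile_centre \<tau>) (tile_radius \<tau>)"

definition centred_tiles :: "plane set set" where
  "centred_tiles = {\<tau>. tile \<tau> \<and> tile_centre \<tau> = 0}"

text \<open>
  The library orders the plane, as a vector type, componentwise. The lexicographic orders needed
  here are therefore taken from lists: a point becomes the list of its two coordinates, a triangle
  the increasing list of its points, and a finite collection of triangles the increasing list of
  its triangles.
\<close>

definition point_list :: "plane \<Rightarrow> real list" where
  "point_list x = [x $ 1, x $ 2]"

definition tile_list :: "plane set \<Rightarrow> real list list" where
  "tile_list \<tau> = sorted_list_of_set (point_list ` \<tau>)"

definition tiles_list :: "plane set set \<Rightarrow> real list list list" where
  "tiles_list T = sorted_list_of_set (tile_list ` T)"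

definition triangulates :: "plane set set \<Rightarrow> plane set \<Rightarrow> bool" where
  "triangulates T V \<longleftrightarrow>
     (\<forall>\<tau>\<in>T. tile \<tau> \<and> \<tau> \<subseteq> V) \<and>
     triangulation ((\<lambda>\<tau>. convex hull \<tau>) ` T) \<and>
     (\<Union>\<tau>\<in>T. convex hull \<tau>) = convex hull V"

definition least_triangulation :: "plane set \<Rightarrow> plane set set" where
  "least_triangulation V = arg_min tiles_list (\<lambda>T. triangulates T V)"

definition delaunay :: "plane set \<Rightarrow> plane set set" where
  "delaunay \<omega> = {\<tau>. \<tau> \<subseteq> \<omega> \<and> tile \<tau> \<and> \<omega> \<inter> tile_disc \<tau> = {} \<and>
     (let V = \<omega> \<inter> sphere (tile_centre \<tau>) (tile_radius \<tau>)
      in card V \<ge> 4 \<longrightarrow> \<tau> \<in> least_triangulation V)}"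


section \<open>Stationary and tempered point processes\<close>

definition intensity :: "plane set measure \<Rightarrow> plane set \<Rightarrow> ennreal" where
  "intensity P \<Delta> = (\<integral>\<^sup>+ \<omega>. of_nat (count_in \<Delta> \<omega>) \<partial>P) / emeasure lborel \<Delta>"

text \<open>For shift-invariant measures the intensity does not depend on the set it is computed from.\<close>

definition stationary_processes :: "plane set measure set" where
  "stationary_processes = {P. point_process P \<and>
     (\<forall>x. distr P config_space (shift x) = P) \<and>
     (\<forall>\<Delta>\<in>bounded_borel. emeasure lborel \<Delta> > 0 \<longrightarrow> intensity P \<Delta> < \<infinity>)}"

text \<open>A tile is a finite configuration; centred tiles carry the trace \<open>\<sigma>\<close>-algebra.\<close>

definition centred_tile_space :: "plane set measure" where
  "centred_tile_space = restrict_space config_space centred_tiles"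

definition is_tile_distribution :: "plane set measure \<Rightarrow> plane set measure \<Rightarrow> bool" where
  "is_tile_distribution P \<mu> \<longleftrightarrow>
     finite_measure \<mu> \<and> sets \<mu> = sets centred_tile_space \<and>
     (\<forall>f :: plane \<times> plane set \<Rightarrow> ennreal.
        f \<in> borel_measurable (borel \<Otimes>\<^sub>M centred_tile_space) \<longrightarrow>
        (\<integral>\<^sup>+ x. (\<integral>\<^sup>+ \<tau>. f (x, \<tau>) \<partial>\<mu>) \<partial>lborel) =
        (\<integral>\<^sup>+ \<omega>. (\<integral>\<^sup>+ \<tau>. f (tile_centre \<tau>, shift (tile_centre \<tau>) \<tau>)
                 \<partial>count_space (delaunay \<omega>)) \<partial>P))"

definition tile_distribution :: "plane set measure \<Rightarrow> plane set measure" where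
  "tile_distribution P = (THE \<mu>. is_tile_distribution P \<mu>)"

definition tempered :: "plane set measure \<Rightarrow> bool" where
  "tempered P \<longleftrightarrow>
     (\<integral>\<^sup>+ \<tau>. emeasure lborel (tile_disc \<tau>) \<partial>tile_distribution P) < \<infinity>"

definition is_poisson_process :: "real \<Rightarrow> plane set measure \<Rightarrow> bool" where
  "is_poisson_process z P \<longleftrightarrow> point_process P \<and>
     (\<forall>\<Delta>\<in>bounded_borel. \<forall>k. measure P {\<omega> \<in> space P. count_in \<Delta> \<omega> = k} =
        (z * measure lborel \<Delta>) ^ k / fact k * exp (- (z * measure lborel \<Delta>))) \<and>
     (\<forall>\<Delta> :: nat \<Rightarrow> plane set. range \<Delta> \<subseteq> bounded_borel \<longrightarrow> disjoint_family \<Delta> \<longrightarrow>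
        prob_space.indep_vars P (\<lambda>_. count_space UNIV) (\<lambda>i. count_in (\<Delta> i)) UNIV)"

definition poisson_process :: "real \<Rightarrow> plane set measure" where
  "poisson_process z = (THE P. is_poisson_process z P)"


section \<open>Triangle potentials\<close>

text \<open>A potential is a function on centred tiles; its values elsewhere are never used.\<close>

definition triangle_potential :: "(plane set \<Rightarrow> real) \<Rightarrow> bool" where
  "triangle_potential \<phi> \<longleftrightarrow> \<phi> \<in> borel_measurable centred_tile_space"

definition tile_energy :: "(plane set \<Rightarrow> real) \<Rightarrow> plane set \<Rightarrow> real" where
  "tile_energy \<phi> \<tau> = \<phi> (shift (tile_centre \<tau>) \<tau>)"

definition bounded_potential :: "(plane set \<Rightarrow> real) \<Rightarrow> bool" where
  "bounded_potential \<phi> \<longleftrightarrow> (\<exists>c. \<forall>\<tau>\<in>centred_tiles. \<bar>\<phi> \<tau>\<bar> \<le> c)"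

definition eventually_increasing :: "(plane set \<Rightarrow> real) \<Rightarrow> bool" where
  "eventually_increasing \<phi> \<longleftrightarrow>
     (\<exists>(r::real) (\<psi>::real \<Rightarrow> real).
        \<psi> \<in> borel_measurable (restrict_space borel {r..}) \<and> mono_on {r..} \<psi> \<and>
        (\<forall>\<tau>. tile \<tau> \<longrightarrow> r \<le> tile_radius \<tau> \<longrightarrow> tile_energy \<phi> \<tau> = \<psi> (tile_radius \<tau>)))"


section \<open>Gibbs measures\<close>

text \<open>For admissible \<open>\<omega>\<close> the sum has finitely many terms.\<close>

definition hamiltonian ::
    "(plane set \<Rightarrow> real) \<Rightarrow> plane set \<Rightarrow> plane set \<Rightarrow> plane set \<Rightarrow> real" where
  "hamiltonian \<phi> \<Lambda> \<omega> \<zeta> =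
     (\<Sum>\<tau> | \<tau> \<in> delaunay ((\<zeta> \<inter> \<Lambda>) \<union> (\<omega> - \<Lambda>)) \<and> tile_disc \<tau> \<inter> \<Lambda> \<noteq> {}. tile_energy \<phi> \<tau>)"

definition admissible :: "plane set set" where
  "admissible = {\<omega> \<in> configurations. \<forall>\<Lambda>\<in>bounded_borel. \<exists>\<Lambda>'\<in>bounded_borel. \<Lambda> \<subseteq> \<Lambda>' \<and>
     (\<forall>\<zeta>\<in>configurations. \<forall>\<tau>\<in>delaunay ((\<zeta> \<inter> \<Lambda>) \<union> (\<omega> - \<Lambda>)).
        tile_disc \<tau> \<inter> \<Lambda> \<noteq> {} \<longrightarrow> tile_disc \<tau> \<subseteq> \<Lambda>')}"

definition partition_function ::
    "(plane set \<Rightarrow> real) \<Rightarrow> plane set \<Rightarrow> real \<Rightarrow> plane set \<Rightarrow> ennreal" where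
  "partition_function \<phi> \<Lambda> z \<omega> =
     (\<integral>\<^sup>+ \<zeta>. ennreal (exp (- hamiltonian \<phi> \<Lambda> \<omega> \<zeta>))
        \<partial>restricted_process \<Lambda> (poisson_process z))"

definition gibbs_kernel ::
    "(plane set \<Rightarrow> real) \<Rightarrow> plane set \<Rightarrow> real \<Rightarrow> plane set \<Rightarrow> plane set set \<Rightarrow> ennreal" where
  "gibbs_kernel \<phi> \<Lambda> z \<omega> A =
     (\<integral>\<^sup>+ \<zeta>. indicator A (\<zeta> \<union> (\<omega> - \<Lambda>)) * ennreal (exp (- hamiltonian \<phi> \<Lambda> \<omega> \<zeta>))
        \<partial>restricted_process \<Lambda> (poisson_process z)) / partition_function \<phi> \<Lambda> z \<omega>"

text \<open>
  \<open>P(\<Omega>\<^sup>*) = 1\<close> is stated as an almost-everywhere property, which does not presuppose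
  that the set of admissible configurations is measurable.
  The kernel is meaningful for admissible boundary conditions only. Its values for other
  \<open>\<omega>\<close> form part of the integrand below, but only on a null set.
\<close>

definition gibbs_measure :: "(plane set \<Rightarrow> real) \<Rightarrow> real \<Rightarrow> plane set measure \<Rightarrow> bool" where
  "gibbs_measure \<phi> z P \<longleftrightarrow> point_process P \<and> (AE \<omega> in P. \<omega> \<in> admissible) \<and>
     (\<forall>\<Lambda>\<in>bounded_borel. \<forall>A\<in>sets config_space.
        emeasure P A = (\<integral>\<^sup>+ \<omega>. gibbs_kernel \<phi> \<Lambda> z \<omega> A \<partial>P))"

definition stationary_gibbs :: "real \<Rightarrow> (plane set \<Rightarrow> real) \<Rightarrow> plane set measure set" where
  "stationary_gibbs z \<phi> = {P \<in> stationary_processes. gibbs_measure \<phi> z P}"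

definition tempered_gibbs :: "real \<Rightarrow> (plane set \<Rightarrow> real) \<Rightarrow> plane set measure set" where
  "tempered_gibbs z \<phi> = {P \<in> stationary_gibbs z \<phi>. tempered P}"

end

theory Submission
  imports Defs
begin

text \<open>
  By stationarity (mass transport), \<open>P\<close> is tempered as soon as the expected number of Delaunay discs
  that cover a point \<open>x\<close> far away from the configuration, averaged over \<open>x\<close> in the unit box, is finite.
  Insert such a point \<open>x\<close> into the configuration: the tiles whose disc contains \<open>x\<close> are replaced by at
  least as many tiles with vertex \<open>x\<close>. All these tiles are large, so their energy is a
  nondecreasing function of the circumradius, and since flipping a diagonal to a Delaunay edge decreases the
  circumradii, the energy grows by at most a constant. Hence the Gibbs property together with the Mecke
  formula of the Poisson process bounds the expected covering number by the expected number of tiles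
  at a typical point. The latter is finite because every vertex is the middle one, with respect to the first
  coordinate, of at most two tiles. Cocircular points do not occur almost surely, again by the
  Mecke formula, so the tie-breaking rule of the triangulation plays no role.
\<close>


section \<open>Circles through two points and the diagonal flip\<close>

text \<open>A bounded potential alone controls the energy change only by the number of tiles
  concerned, which has no bound. Monotonicity is used tile by tile: if the edge \<open>ab\<close>
  separates \<open>x\<close> from a destroyed tile \<open>abc\<close>, the flip replaces
  \<open>abc\<close>, \<open>xab\<close> by \<open>xac\<close>, \<open>xbc\<close> and gives
  \<psi>(xac) + \<psi>(xbc) - \<psi>(xab) \<le> \<psi>(abc), each tile standing for its radius.
  Summed over the destroyed tiles the left sides telescope to the energy of the new ones, so no
  order of flips has to be chosen. The exception is a tile around \<open>x\<close>: three new tiles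
  against one old one, whence the constant 4 K. The inserted point keeps distance 2 r from the
  configuration, so that every tile involved, also an auxiliary \<open>xab\<close>, has radius at
  least r. In an empty disc of radius \<rho> this still allows the concentric disc of radius \<rho>
  - 2 r, which suffices for the area. The Poisson process and the tile distribution are definite
  descriptions, so both have to be constructed and shown to be unique. The Gibbs kernel contains the
  tie-breaking rule and is replaced by a measurable expression before Fubini and the Mecke formula
  are applied.\<close>

definition cross :: "plane \<Rightarrow> plane \<Rightarrow> plane \<Rightarrow> real" where
  "cross a b c = (b$1 - a$1) * (c$2 - a$2) - (b$2 - a$2) * (c$1 - a$1)"

text \<open>\<open>cross a b c\<close> is twice the signed area of the triangle, so this quotient is
  the cotangent of the angle at \<open>c\<close>, signed by the orientation. By the inscribed angle
  theorem it labels the circles through \<open>a\<close> and \<open>b\<close>: the points of one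
  circle, on either side of the chord, have equal values.\<close>

definition cot_angle :: "plane \<Rightarrow> plane \<Rightarrow> plane \<Rightarrow> real" where
  "cot_angle a b c = ((c - a) \<bullet> (c - b)) / cross a b c"

text \<open>The midpoint of \<open>a\<close> and \<open>b\<close>, moved along the left normal of
  \<open>b - a\<close> by \<open>s / 2\<close> times its length. This is the centre of the circle
  through \<open>a\<close> and \<open>b\<close> whose points \<open>p\<close> have
  \<open>cot_angle a b p = s\<close>.\<close>

definition pencil_centre :: "plane \<Rightarrow> plane \<Rightarrow> real \<Rightarrow> plane" where
  "pencil_centre a b s = vector [(a$1 + b$1 - s * (b$2 - a$2)) / 2, (a$2 + b$2 + s * (b$1 - a$1)) / 2]"

lemma inner_plane: "(x::plane) \<bullet> y = x$1 * y$1 + x$2 * y$2"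
  by (simp add: inner_vec_def sum_2)

lemma dist_plane_sq: "(dist (x::plane) y)\<^sup>2 = (x$1 - y$1)\<^sup>2 + (x$2 - y$2)\<^sup>2"
  unfolding dist_norm power2_norm_eq_inner inner_plane by (simp add: power2_eq_square)

lemma plane_eq_iff: "(x::plane) = y \<longleftrightarrow> x$1 = y$1 \<and> x$2 = y$2"
  by (simp add: vec_eq_iff forall_2)

lemma cross_swap: "cross b a c = - cross a b c" "cross a c b = - cross a b c"
  by (simp_all add: cross_def algebra_simps)

lemma cross_rotate: "cross b c a = cross a b c"
  by (simp add: cross_def algebra_simps)

lemma cross_same [simp]: "cross a a c = 0" "cross a b a = 0" "cross a b b = 0"
  by (simp_all add: cross_def)

lemma cot_angle_swap: "cot_angle b a c = - cot_angle a b c"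
  by (simp add: cot_angle_def cross_swap(1)[of b a] inner_commute)

lemma collinear_iff_cross: "collinear {a, b, c :: plane} \<longleftrightarrow> cross a b c = 0"
proof
  assume "collinear {a, b, c}"
  then obtain u where u: "\<And>x y. x \<in> {a,b,c} \<Longrightarrow> y \<in> {a,b,c} \<Longrightarrow> \<exists>k. x - y = k *\<^sub>R u"
    unfolding collinear_def by blast
  obtain k l where "b - a = k *\<^sub>R u" "c - a = l *\<^sub>R u" using u[of b a] u[of c a] by auto
  then have "b$1 - a$1 = k * u$1" "b$2 - a$2 = k * u$2" "c$1 - a$1 = l * u$1" "c$2 - a$2 = l * u$2"
    by (simp_all add: plane_eq_iff)
  then show "cross a b c = 0" by (simp add: cross_def)
next
  assume c0: "cross a b c = 0"
  show "collinear {a, b, c}"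
  proof (cases "a = b")
    case True then show ?thesis by (simp add: collinear_2)
  next
    case False
    then have L: "(b$1 - a$1)\<^sup>2 + (b$2 - a$2)\<^sup>2 \<noteq> 0"
      by (auto simp: plane_eq_iff sum_power2_eq_zero_iff)
    \<comment> \<open>The coefficient of the orthogonal projection of \<open>c - a\<close> onto
      \<open>b - a\<close>.\<close>
    define t where "t = ((c$1 - a$1) * (b$1 - a$1) + (c$2 - a$2) * (b$2 - a$2)) / ((b$1 - a$1)\<^sup>2 + (b$2 - a$2)\<^sup>2)"
    have "t * ((b$1 - a$1)\<^sup>2 + (b$2 - a$2)\<^sup>2) = (c$1 - a$1) * (b$1 - a$1) + (c$2 - a$2) * (b$2 - a$2)"
      using L by (simp add: t_def)
    moreover have "(b$1 - a$1) * (c$2 - a$2) = (b$2 - a$2) * (c$1 - a$1)"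
      using c0 by (simp add: cross_def)
    ultimately have "((b$1 - a$1)\<^sup>2 + (b$2 - a$2)\<^sup>2) * (c$1 - a$1) = ((b$1 - a$1)\<^sup>2 + (b$2 - a$2)\<^sup>2) * (t * (b$1 - a$1))"
      "((b$1 - a$1)\<^sup>2 + (b$2 - a$2)\<^sup>2) * (c$2 - a$2) = ((b$1 - a$1)\<^sup>2 + (b$2 - a$2)\<^sup>2) * (t * (b$2 - a$2))"
      by algebra+
    then have "c$1 - a$1 = t * (b$1 - a$1) \<and> c$2 - a$2 = t * (b$2 - a$2)"
      using L by (metis mult_left_cancel)
    then have "c - a = t *\<^sub>R (b - a)" by (simp add: plane_eq_iff)
    then have "c = (1 - t) *\<^sub>R a + t *\<^sub>R b" by (simp add: algebra_simps)
    then show ?thesis using collinear_3_affine_hull[OF False, of c]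
      by (auto simp: affine_hull_2 insert_commute) (metis diff_add_cancel)
  qed
qed

lemma tile_iff_cross: "tile {a, b, c} \<longleftrightarrow> cross a b c \<noteq> 0"
proof -
  have "cross a b c \<noteq> 0 \<Longrightarrow> card {a, b, c} = 3"
    by (cases "a = b"; cases "a = c"; cases "b = c") (auto simp: cross_def)
  then show ?thesis by (auto simp: tile_def collinear_iff_cross)
qed

lemma tile_obtain:
  assumes "tile \<tau>"
  obtains a b c where "\<tau> = {a, b, c}" "cross a b c > 0" "a \<noteq> b" "b \<noteq> c" "a \<noteq> c"
proof -
  obtain a b c where abc: "\<tau> = {a, b, c}" "a \<noteq> b" "b \<noteq> c" "a \<noteq> c"
    using assms unfolding tile_def card_3_iff by auto
  then have "cross a b c \<noteq> 0" using assms tile_iff_cross by auto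
  moreover have "cross a b c < 0 \<Longrightarrow> cross b a c > 0" by (simp add: cross_swap(1)[of b])
  moreover have "\<tau> = {b, a, c}" using abc by auto
  ultimately show ?thesis using that[of a b c] that[of b a c] abc by (cases "cross a b c > 0") force+
qed

text \<open>The power of \<open>p\<close> with respect to a circle of the pencil is affine in the
  parameter \<open>s\<close>, with slope \<open>- cross a b p\<close>. All in-circle tests below
  reduce to this linear relation.\<close>

lemma dist_pencil_centre:
  "(dist p (pencil_centre a b s))\<^sup>2 = (dist a (pencil_centre a b s))\<^sup>2 + (p - a) \<bullet> (p - b) - s * cross a b p"
  unfolding dist_plane_sq pencil_centre_def cross_def inner_plane
  by (simp add: field_simps power2_eq_square)

lemma dist_pencil_centre_base:
  "(dist a (pencil_centre a b s))\<^sup>2 = (dist a b)\<^sup>2 / 4 * (1 + s\<^sup>2)"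
  unfolding dist_plane_sq pencil_centre_def by (simp add: field_simps power2_eq_square)

lemma circumcentre_unique:
  assumes "cross a b c \<noteq> 0" "{a, b, c} \<subseteq> sphere o1 r1" "{a, b, c} \<subseteq> sphere o2 r2"
  shows "o1 = (o2 :: plane)"
proof -
  have "(dist o1 a)\<^sup>2 = (dist o1 b)\<^sup>2" "(dist o1 a)\<^sup>2 = (dist o1 c)\<^sup>2"
     "(dist o2 a)\<^sup>2 = (dist o2 b)\<^sup>2" "(dist o2 a)\<^sup>2 = (dist o2 c)\<^sup>2" using assms by auto
  then have "o1$1 = o2$1 \<and> o1$2 = o2$2"
    using assms(1) unfolding dist_plane_sq cross_def by algebra
  then show ?thesis by (simp add: plane_eq_iff)
qed

lemma tile_circle_unique:
  assumes "tile \<tau>" "\<tau> \<subseteq> sphere q r"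
  shows "tile_centre \<tau> = q" "tile_radius \<tau> = r"
proof -
  obtain a b c where abc: "\<tau> = {a, b, c}" "cross a b c > 0" "a \<noteq> b"
    using assms(1) by (rule tile_obtain)
  have r: "r > 0"
  proof (rule ccontr)
    assume "\<not> r > 0"
    moreover have "dist q a = r" "dist q b = r" using assms abc by auto
    ultimately have "dist q a = 0" "dist q b = 0"
      using zero_le_dist[of q a] zero_le_dist[of q b] by linarith+
    then show False using abc by auto
  qed
  show 1: "tile_centre \<tau> = q" unfolding tile_centre_def
  proof (rule the_equality)
    show "\<exists>r>0. \<tau> \<subseteq> sphere q r" using r assms by auto
    show "\<And>c'. \<exists>r>0. \<tau> \<subseteq> sphere c' r \<Longrightarrow> c' = q"
      using circumcentre_unique assms(2) abc by (metis less_irrefl)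
  qed
  show "tile_radius \<tau> = r" unfolding tile_radius_def 1
    by (rule the_equality) (use assms abc in auto)
qed

text \<open>The power of \<open>c\<close> vanishes at \<open>s = cot_angle a b c\<close>. The
  explicit centre replaces the definite description, here for the geometry and later for
  measurability.\<close>

lemma tile_pencil:
  assumes "cross a b c \<noteq> 0"
  shows "tile_centre {a, b, c} = pencil_centre a b (cot_angle a b c)"
    and "tile_radius {a, b, c} = dist a (pencil_centre a b (cot_angle a b c))"
proof -
  define q where "q = pencil_centre a b (cot_angle a b c)"
  have *: "(dist p q)\<^sup>2 = (dist a q)\<^sup>2" if "p \<in> {a, b, c}" for p
    using that assms unfolding q_def dist_pencil_centre[of p] by (auto simp: cot_angle_def)
  have "dist p q = dist a q" if "p \<in> {a, b, c}" for p
    using *[OF that] by (rule power2_eq_imp_eq) auto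
  then have "{a, b, c} \<subseteq> sphere q (dist a q)"
    unfolding subset_iff mem_sphere dist_commute[of q] by blast
  then show "tile_centre {a, b, c} = pencil_centre a b (cot_angle a b c)"
    and "tile_radius {a, b, c} = dist a (pencil_centre a b (cot_angle a b c))"
    using tile_circle_unique[of "{a, b, c}" q "dist a q"] assms unfolding q_def tile_iff_cross by simp_all
qed

text \<open>The law of sines for the side \<open>ab\<close> and the opposite angle, since 1 + cot^2
  = 1 / sin^2. Squares and cotangents make it unnecessary to speak of angles and their
  branches.\<close>

lemma tile_radius_sq:
  assumes "cross a b c \<noteq> 0"
  shows "(tile_radius {a, b, c})\<^sup>2 = (dist a b)\<^sup>2 / 4 * (1 + (cot_angle a b c)\<^sup>2)"
  by (simp add: tile_pencil(2)[OF assms] dist_pencil_centre_base)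

text \<open>For fixed \<open>a\<close> and \<open>b\<close> the test is linear in the cotangent of
  the third vertex. This is what orders the tiles at a given edge.\<close>

lemma in_tile_disc_iff:
  assumes "cross a b c \<noteq> 0"
  shows "p \<in> tile_disc {a, b, c} \<longleftrightarrow> (p - a) \<bullet> (p - b) < cot_angle a b c * cross a b p"
proof -
  define q where "q = pencil_centre a b (cot_angle a b c)"
  have "p \<in> tile_disc {a, b, c} \<longleftrightarrow> dist p q < dist a q"
    by (simp add: tile_disc_def tile_pencil[OF assms] q_def dist_commute)
  also have "\<dots> \<longleftrightarrow> (dist p q)\<^sup>2 < (dist a q)\<^sup>2"
    using abs_le_square_iff[of "dist a q" "dist p q"] by (simp add: not_le[symmetric])
  finally show ?thesis unfolding q_def dist_pencil_centre[of p] by linarith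
qed

lemma on_tile_circle_iff:
  assumes "cross a b c \<noteq> 0"
  shows "p \<in> sphere (tile_centre {a, b, c}) (tile_radius {a, b, c})
    \<longleftrightarrow> (p - a) \<bullet> (p - b) = cot_angle a b c * cross a b p"
proof -
  define q where "q = pencil_centre a b (cot_angle a b c)"
  have "p \<in> sphere (tile_centre {a, b, c}) (tile_radius {a, b, c}) \<longleftrightarrow> dist p q = dist a q"
    by (simp add: tile_pencil[OF assms] q_def dist_commute)
  also have "\<dots> \<longleftrightarrow> (dist p q)\<^sup>2 = (dist a q)\<^sup>2" by (simp add: power2_eq_iff_nonneg)
  finally show ?thesis unfolding q_def dist_pencil_centre[of p] by linarith
qed

lemma tile_on_circle:
  assumes "tile \<tau>" shows "\<tau> \<subseteq> sphere (tile_centre \<tau>) (tile_radius \<tau>)"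
  using assms
proof (rule tile_obtain)
  fix a b c assume "\<tau> = {a, b, c}" "cross a b c > 0"
  then show ?thesis using on_tile_circle_iff[of a b c] by (auto simp: cot_angle_def)
qed

lemma tile_radius_pos: "tile \<tau> \<Longrightarrow> tile_radius \<tau> > 0"
proof (erule tile_obtain)
  fix a b c assume *: "\<tau> = {a, b, c}" "cross a b c > 0" "a \<noteq> b"
  have "(tile_radius \<tau>)\<^sup>2 = (dist a b)\<^sup>2 / 4 * (1 + (cot_angle a b c)\<^sup>2)"
    using * tile_radius_sq[of a b c] by simp
  also have "\<dots> > 0" using * by (intro mult_pos_pos add_pos_nonneg) auto
  finally have "(tile_radius \<tau>)\<^sup>2 > 0" .
  moreover have "tile_radius \<tau> \<ge> 0" using * tile_pencil(2)[of a b c] by simp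
  ultimately show ?thesis by (cases "tile_radius \<tau> = 0") auto
qed

lemma finite_tile: "tile \<tau> \<Longrightarrow> finite \<tau>"
  by (metis tile_def card.infinite zero_neq_numeral)

lemma dist_le_tile_diameter:
  assumes "tile \<tau>" "a \<in> \<tau>" "b \<in> \<tau>" shows "dist a b \<le> 2 * tile_radius \<tau>"
proof -
  have "dist (tile_centre \<tau>) a = tile_radius \<tau>" "dist (tile_centre \<tau>) b = tile_radius \<tau>"
    using tile_on_circle[OF assms(1)] assms by auto
  then show ?thesis using dist_triangle2[of a b "tile_centre \<tau>"] by (simp add: dist_commute)
qed

text \<open>If \<open>x\<close> lies in the circumdisc of \<open>abc\<close> beyond the edge \<open>ab\<close>, then replacing the diagonal
  \<open>ab\<close> of the quadrilateral \<open>axbc\<close> by \<open>xc\<close> decreases the ordered pair of circumradii. The variables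
  of the proof are the cotangents of the angles that the two diagonals form with the sides.\<close>

lemma flip_radii:
  assumes c: "cross a b c > 0" and x: "cross a b x < 0" and disc: "x \<in> tile_disc {a, b, c}"
  defines "r1 \<equiv> tile_radius {a, b, c}" and "r2 \<equiv> tile_radius {x, a, b}"
    and "r3 \<equiv> tile_radius {x, a, c}" and "r4 \<equiv> tile_radius {x, b, c}"
  shows "cross c a x > 0" "cross b c x > 0"
    and "(r3 \<le> r1 \<or> r3 \<le> r2) \<and> (r4 \<le> r1 \<or> r4 \<le> r2) \<and> (r3 \<le> r1 \<and> r3 \<le> r2 \<or> r4 \<le> r1 \<and> r4 \<le> r2)"
proof -
  define C where "C = cross a b c"
  define X where "X = - cross a b x"
  define A where "A = cross c a x"
  define B where "B = cross b c x"
  have CX: "C > 0" "X > 0" using c x by (auto simp: C_def X_def)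
  \<comment> \<open>This is \<open>- C\<close> times the power of \<open>x\<close> with respect to
    the circumcircle of \<open>abc\<close>, hence positive for \<open>x\<close> in the disc.\<close>
  define \<Delta> where "\<Delta> = - X * ((c - a) \<bullet> (c - b)) - C * ((x - a) \<bullet> (x - b))"
  have D: "\<Delta> > 0"
  proof -
    have "(x - a) \<bullet> (x - b) < ((c - a) \<bullet> (c - b)) / C * (- X)"
      using disc c by (simp add: in_tile_disc_iff cot_angle_def C_def X_def)
    then show ?thesis using CX by (simp add: \<Delta>_def field_simps)
  qed
  have L: "(dist a b)\<^sup>2 > 0" using c by (auto simp: cross_def)
  \<comment> \<open>The right-hand side is a sum of nonnegative terms with \<open>\<Delta>\<close>
    positive, so \<open>A\<close> and likewise \<open>B\<close> are positive: the quadrilateral is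
    strictly convex and \<open>xc\<close> is its other diagonal.\<close>
  have eA: "(dist a b)\<^sup>2 * A = \<Delta> + X * (dist c a)\<^sup>2 + C * (dist x a)\<^sup>2"
    unfolding A_def \<Delta>_def X_def C_def cross_def dist_plane_sq inner_plane
    by (simp add: power2_eq_square algebra_simps)
  have eB: "(dist a b)\<^sup>2 * B = \<Delta> + X * (dist c b)\<^sup>2 + C * (dist x b)\<^sup>2"
    unfolding B_def \<Delta>_def X_def C_def cross_def dist_plane_sq inner_plane
    by (simp add: power2_eq_square algebra_simps)
  have A: "A > 0" using eA D CX L
    by (smt (verit) mult_nonneg_nonneg zero_le_power2 zero_less_mult_pos)
  have B: "B > 0" using eB D CX L
    by (smt (verit) mult_nonneg_nonneg zero_le_power2 zero_less_mult_pos)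
  show "cross c a x > 0" "cross b c x > 0" using A B by (auto simp: A_def B_def)
  \<comment> \<open>Cotangents of angles: \<open>p\<close>, \<open>p'\<close> at \<open>a\<close>,
    \<open>b\<close> in the triangle \<open>abc\<close>; \<open>q\<close>, \<open>q'\<close> at
    \<open>a\<close>, \<open>b\<close> in \<open>abx\<close>; \<open>w\<close>, \<open>y\<close> at
    \<open>x\<close>, \<open>c\<close> in \<open>xac\<close>; \<open>w'\<close>, \<open>y'\<close>
    at \<open>x\<close>, \<open>c\<close> in \<open>xbc\<close>; \<open>u\<close>, \<open>u'\<close>
    the full angles of the quadrilateral at \<open>a\<close> and \<open>b\<close>.\<close>
  define p where "p = ((c - a) \<bullet> (b - a)) / C"
  define p' where "p' = ((c - b) \<bullet> (a - b)) / C"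
  define q where "q = ((x - a) \<bullet> (b - a)) / X"
  define q' where "q' = ((x - b) \<bullet> (a - b)) / X"
  define w where "w = ((a - x) \<bullet> (c - x)) / A"
  define y where "y = ((a - c) \<bullet> (x - c)) / A"
  define w' where "w' = ((b - x) \<bullet> (c - x)) / B"
  define y' where "y' = ((b - c) \<bullet> (x - c)) / B"
  define u where "u = ((x - a) \<bullet> (c - a)) / A"
  define u' where "u' = ((x - b) \<bullet> (c - b)) / B"
  note defs = C_def X_def A_def B_def \<Delta>_def cross_def dist_plane_sq inner_plane
  have cx: "(dist x c)\<^sup>2 > 0" using c x by auto
  have pq: "p + q = (dist a b)\<^sup>2 * A / (C * X)"
    unfolding p_def q_def using CX by (simp add: field_simps, unfold defs, simp add: algebra_simps power2_eq_square)
  have pq': "p' + q' = (dist a b)\<^sup>2 * B / (C * X)"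
    unfolding p'_def q'_def using CX by (simp add: field_simps, unfold defs, simp add: algebra_simps power2_eq_square)
  have wy: "w + y = (dist x c)\<^sup>2 / A"
    unfolding w_def y_def using A by (simp add: field_simps, unfold defs, simp add: algebra_simps power2_eq_square)
  have wy': "w' + y' = (dist x c)\<^sup>2 / B"
    unfolding w'_def y'_def using B by (simp add: field_simps, unfold defs, simp add: algebra_simps power2_eq_square)
  have ww: "w + w' = (dist x c)\<^sup>2 * X / (A * B)"
    unfolding w'_def w_def using A B by (simp add: field_simps, unfold defs, simp add: algebra_simps power2_eq_square)
  have yy: "y + y' = (dist x c)\<^sup>2 * C / (A * B)"
    unfolding y'_def y_def using A B by (simp add: field_simps, unfold defs, simp add: algebra_simps power2_eq_square)
  have pp: "p + p' = (dist a b)\<^sup>2 / C"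
    unfolding p'_def p_def using CX by (simp add: field_simps, unfold defs, simp add: algebra_simps power2_eq_square)
  have qq: "q + q' = (dist a b)\<^sup>2 / X"
    unfolding q'_def q_def using CX by (simp add: field_simps, unfold defs, simp add: algebra_simps power2_eq_square)
  \<comment> \<open>Inscribed angles: since the circle through \<open>a\<close>, \<open>b\<close>,
    \<open>c\<close> contains \<open>x\<close> inside, every side of the quadrilateral is seen under
    a larger angle after the flip, hence with a smaller cotangent.\<close>
  have d1: "p' - w = \<Delta> / (C * A)"
    unfolding p'_def w_def using CX A by (simp add: field_simps, unfold defs, simp add: algebra_simps power2_eq_square)
  have d2: "q' - y = \<Delta> / (X * A)"
    unfolding q'_def y_def using CX A by (simp add: field_simps, unfold defs, simp add: algebra_simps power2_eq_square)
  have d3: "p - w' = \<Delta> / (C * B)"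
    unfolding p_def w'_def using CX B by (simp add: field_simps, unfold defs, simp add: algebra_simps power2_eq_square)
  have d4: "q - y' = \<Delta> / (X * B)"
    unfolding q_def y'_def using CX B by (simp add: field_simps, unfold defs, simp add: algebra_simps power2_eq_square)
  \<comment> \<open>The addition formula for the cotangent: the angle of \<open>u\<close> is the sum
    of those of \<open>p\<close> and \<open>q\<close>, and it is \<pi> minus the sum of those of
    \<open>w\<close> and \<open>y\<close>.\<close>
  have u1: "u * (p + q) = p * q - 1"
    unfolding pq unfolding u_def p_def q_def using CX A by (simp add: field_simps, unfold defs, simp add: algebra_simps power2_eq_square)
  have u2: "u * (w + y) = 1 - w * y"
    unfolding wy unfolding u_def w_def y_def using A by (simp add: field_simps, unfold defs, simp add: algebra_simps power2_eq_square)
  have u1': "u' * (p' + q') = p' * q' - 1"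
    unfolding pq' unfolding u'_def p'_def q'_def using CX B by (simp add: field_simps, unfold defs, simp add: algebra_simps power2_eq_square)
  have u2': "u' * (w' + y') = 1 - w' * y'"
    unfolding wy' unfolding u'_def w'_def y'_def using B by (simp add: field_simps, unfold defs, simp add: algebra_simps power2_eq_square)
  have pos: "p + q > 0" "p' + q' > 0" "w + y > 0" "w' + y' > 0" "w + w' > 0" "y + y' > 0" "p + p' > 0" "q + q' > 0"
    "p' - w > 0" "q' - y > 0" "p - w' > 0" "q - y' > 0"
    unfolding pq pq' wy wy' ww yy pp qq d1 d2 d3 d4 using A B CX L cx D by simp_all
  have ra: "r1\<^sup>2 = (dist a c)\<^sup>2 / 4 * (1 + p'\<^sup>2)" "r3\<^sup>2 = (dist a c)\<^sup>2 / 4 * (1 + w\<^sup>2)"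
    "r2\<^sup>2 = (dist a x)\<^sup>2 / 4 * (1 + q'\<^sup>2)" "r3\<^sup>2 = (dist a x)\<^sup>2 / 4 * (1 + y\<^sup>2)"
    "r1\<^sup>2 = (dist b c)\<^sup>2 / 4 * (1 + p\<^sup>2)" "r4\<^sup>2 = (dist b c)\<^sup>2 / 4 * (1 + w'\<^sup>2)"
    "r2\<^sup>2 = (dist b x)\<^sup>2 / 4 * (1 + q\<^sup>2)" "r4\<^sup>2 = (dist b x)\<^sup>2 / 4 * (1 + y'\<^sup>2)"
  proof -
    have s: "{a, b, c} = {a, c, b}" "{x, a, c} = {a, c, x}" "{x, a, b} = {a, x, b}" "{x, a, c} = {a, x, c}"
      "{a, b, c} = {b, c, a}" "{x, b, c} = {b, c, x}" "{x, a, b} = {b, x, a}" "{x, b, c} = {b, x, c}" by auto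
    have t: "cross a c b = - C" "cross a c x = - A" "cross a x b = X" "cross a x c = A" "cross b c a = C"
      "cross b c x = B" "cross b x a = - X" "cross b x c = - B"
      unfolding C_def A_def X_def B_def by (simp_all add: cross_def algebra_simps)
    have v: "(cot_angle a c b)\<^sup>2 = p'\<^sup>2" "(cot_angle a c x)\<^sup>2 = w\<^sup>2" "(cot_angle a x b)\<^sup>2 = q'\<^sup>2" "(cot_angle a x c)\<^sup>2 = y\<^sup>2"
      "(cot_angle b c a)\<^sup>2 = p\<^sup>2" "(cot_angle b c x)\<^sup>2 = w'\<^sup>2" "(cot_angle b x a)\<^sup>2 = q\<^sup>2" "(cot_angle b x c)\<^sup>2 = y'\<^sup>2"
      unfolding cot_angle_def t p_def p'_def q_def q'_def w_def w'_def y_def y'_def power_divide inner_plane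
      by (simp_all add: power2_eq_square algebra_simps)
    show "r1\<^sup>2 = (dist a c)\<^sup>2 / 4 * (1 + p'\<^sup>2)" unfolding r1_def s(1) v(1)[symmetric]
      using tile_radius_sq[of a c b] t CX by simp
    show "r3\<^sup>2 = (dist a c)\<^sup>2 / 4 * (1 + w\<^sup>2)" unfolding r3_def s(2) v(2)[symmetric]
      using tile_radius_sq[of a c x] t A by simp
    show "r2\<^sup>2 = (dist a x)\<^sup>2 / 4 * (1 + q'\<^sup>2)" unfolding r2_def s(3) v(3)[symmetric]
      using tile_radius_sq[of a x b] t CX by simp
    show "r3\<^sup>2 = (dist a x)\<^sup>2 / 4 * (1 + y\<^sup>2)" unfolding r3_def s(4) v(4)[symmetric]
      using tile_radius_sq[of a x c] t A by simp
    show "r1\<^sup>2 = (dist b c)\<^sup>2 / 4 * (1 + p\<^sup>2)" unfolding r1_def s(5) v(5)[symmetric]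
      using tile_radius_sq[of b c a] t CX by simp
    show "r4\<^sup>2 = (dist b c)\<^sup>2 / 4 * (1 + w'\<^sup>2)" unfolding r4_def s(6) v(6)[symmetric]
      using tile_radius_sq[of b c x] t B by simp
    show "r2\<^sup>2 = (dist b x)\<^sup>2 / 4 * (1 + q\<^sup>2)" unfolding r2_def s(7) v(7)[symmetric]
      using tile_radius_sq[of b x a] t CX by simp
    show "r4\<^sup>2 = (dist b x)\<^sup>2 / 4 * (1 + y'\<^sup>2)" unfolding r4_def s(8) v(8)[symmetric]
      using tile_radius_sq[of b x c] t B by simp
  qed
  have "cross x a b < 0" using x cross_rotate[of a b x] by linarith
  then have "tile {a, b, c}" "tile {x, a, b}" using c unfolding tile_iff_cross by (metis less_irrefl)+
  then have nn: "r1 \<ge> 0" "r2 \<ge> 0" unfolding r1_def r2_def using tile_radius_pos less_imp_le by blast+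
  \<comment> \<open>Two circles over the same chord are compared by the squares of the cotangents.
    The difference \<open>t - s\<close> is always positive here, so only the sign of the sum
    \<open>t + s\<close> is at issue.\<close>
  have le: "r \<le> r'" if "r\<^sup>2 = k\<^sup>2 / 4 * (1 + s\<^sup>2)" "r'\<^sup>2 = k\<^sup>2 / 4 * (1 + t\<^sup>2)" "t - s > 0" "t + s \<ge> 0" "r' \<ge> 0"
    for r r' k s t :: real
  proof -
    have "s\<^sup>2 \<le> t\<^sup>2" using that(3,4) by (intro abs_le_square_iff[THEN iffD1]) auto
    then have "r\<^sup>2 \<le> r'\<^sup>2" unfolding that by (intro mult_left_mono) auto
    then show ?thesis using that(5) by (rule power2_le_imp_le)
  qed
  have f1: "r3 \<le> r1" if "w + p' \<ge> 0" by (rule le[OF ra(2,1)]) (use that pos nn in auto)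
  have f2: "r3 \<le> r2" if "y + q' \<ge> 0" by (rule le[OF ra(4,3)]) (use that pos nn in auto)
  have f3: "r4 \<le> r1" if "w' + p \<ge> 0" by (rule le[OF ra(6,5)]) (use that pos nn in auto)
  have f4: "r4 \<le> r2" if "y' + q \<ge> 0" by (rule le[OF ra(8,7)]) (use that pos nn in auto)
  \<comment> \<open>Two angles of the triangle \<open>xac\<close> add up to less than \<pi>. The
    next three bounds have the same origin.\<close>
  have uw: "- w < u" using u2 pos(3)
  proof -
    have "(u + w) * (w + y) = 1 + w * w" using u2 by (simp add: algebra_simps)
    also have "\<dots> > 0" by (simp add: add_pos_nonneg)
    finally show ?thesis using pos(3) by (simp add: zero_less_mult_iff)
  qed
  have uy: "- y < u"
  proof -
    have "(u + y) * (w + y) = 1 + y * y" using u2 by (simp add: algebra_simps)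
    also have "\<dots> > 0" by (simp add: add_pos_nonneg)
    finally show ?thesis using pos(3) by (simp add: zero_less_mult_iff)
  qed
  have uw': "- w' < u'"
  proof -
    have "(u' + w') * (w' + y') = 1 + w' * w'" using u2' by (simp add: algebra_simps)
    also have "\<dots> > 0" by (simp add: add_pos_nonneg)
    finally show ?thesis using pos(4) by (simp add: zero_less_mult_iff)
  qed
  have uy': "- y' < u'"
  proof -
    have "(u' + y') * (w' + y') = 1 + y' * y'" using u2' by (simp add: algebra_simps)
    also have "\<dots> > 0" by (simp add: add_pos_nonneg)
    finally show ?thesis using pos(4) by (simp add: zero_less_mult_iff)
  qed
  have uq: "u < q \<and> u < p"
  proof -
    have "(q - u) * (p + q) = 1 + q * q" "(p - u) * (p + q) = 1 + p * p" using u1 by (simp_all add: algebra_simps)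
    then have "(q - u) * (p + q) > 0" "(p - u) * (p + q) > 0" by (simp_all add: add_pos_nonneg)
    then show ?thesis using pos(1) by (simp add: zero_less_mult_iff)
  qed
  have uq': "u' < q' \<and> u' < p'"
  proof -
    have "(q' - u') * (p' + q') = 1 + q' * q'" "(p' - u') * (p' + q') = 1 + p' * p'" using u1' by (simp_all add: algebra_simps)
    then have "(q' - u') * (p' + q') > 0" "(p' - u') * (p' + q') > 0" by (simp_all add: add_pos_nonneg)
    then show ?thesis using pos(2) by (simp add: zero_less_mult_iff)
  qed
  have "w + p' \<ge> 0 \<or> y + q' \<ge> 0" using pos by linarith
  moreover have "w' + p \<ge> 0 \<or> y' + q \<ge> 0" using pos by linarith
  \<comment> \<open>If the first alternative fails, then \<open>p' < - w\<close> or
    \<open>q' < - y\<close>, and \<open>u' < p', q'\<close> and \<open>- w, - y < u\<close> give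
    \<open>u' < u\<close>. If the second fails, the same argument gives
    \<open>u < u'\<close>.\<close>
  moreover have "w + p' \<ge> 0 \<and> y + q' \<ge> 0 \<or> w' + p \<ge> 0 \<and> y' + q \<ge> 0"
    using pos uw uy uw' uy' uq uq' by linarith
  ultimately show "(r3 \<le> r1 \<or> r3 \<le> r2) \<and> (r4 \<le> r1 \<or> r4 \<le> r2) \<and> (r3 \<le> r1 \<and> r3 \<le> r2 \<or> r4 \<le> r1 \<and> r4 \<le> r2)"
    using f1 f2 f3 f4 by blast
qed

section \<open>The cavity of an inserted point\<close>

definition empty_disc_tiles :: "plane set \<Rightarrow> plane set set" where
  "empty_disc_tiles \<omega> = {\<tau>. \<tau> \<subseteq> \<omega> \<and> tile \<tau> \<and> \<omega> \<inter> tile_disc \<tau> = {}}"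

definition general_position :: "plane set \<Rightarrow> bool" where
  "general_position \<omega> \<longleftrightarrow>
     (\<forall>\<tau>. \<tau> \<subseteq> \<omega> \<longrightarrow> tile \<tau> \<longrightarrow> \<omega> \<inter> sphere (tile_centre \<tau>) (tile_radius \<tau>) \<subseteq> \<tau>)"

text \<open>The three exclusions serve different purposes: distinct abscissae single out the middle
  vertex of a tile, non-collinearity makes \<open>x\<close> span a tile with any two points, and the
  circles preserve general position.\<close>

definition degenerate :: "plane \<Rightarrow> plane set \<Rightarrow> bool" where
  "degenerate x \<omega> \<longleftrightarrow> (\<exists>a\<in>\<omega>. x$1 = a$1) \<or> (\<exists>a\<in>\<omega>. \<exists>b\<in>\<omega>. a \<noteq> b \<and> cross a b x = 0) \<or>
     (\<exists>\<tau>. \<tau> \<subseteq> \<omega> \<and> tile \<tau> \<and> x \<in> sphere (tile_centre \<tau>) (tile_radius \<tau>))"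

lemma delaunay_general_position:
  assumes "general_position \<omega>" shows "delaunay \<omega> = empty_disc_tiles \<omega>"
proof -
  have "\<not> 4 \<le> card (\<omega> \<inter> sphere (tile_centre \<tau>) (tile_radius \<tau>))" if "\<tau> \<subseteq> \<omega>" "tile \<tau>" for \<tau>
  proof -
    have "card (\<omega> \<inter> sphere (tile_centre \<tau>) (tile_radius \<tau>)) \<le> card \<tau>"
      using assms that by (intro card_mono finite_tile) (auto simp: general_position_def)
    then show ?thesis using that by (simp add: tile_def)
  qed
  then show ?thesis unfolding delaunay_def empty_disc_tiles_def Let_def by blast
qed

text \<open>Only circles through \<open>x\<close> are new. If such a circle through
  \<open>x\<close>, \<open>p\<close>, \<open>q\<close> met another point \<open>y\<close> of
  \<open>U\<close>, then \<open>{p, q, y}\<close> would be a tile of \<open>U\<close> with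
  \<open>x\<close> on its circle, which nondegeneracy excludes.\<close>

lemma general_position_insert:
  assumes "general_position U" "\<not> degenerate x U" shows "general_position (insert x U)"
  unfolding general_position_def
proof (intro allI impI subsetI)
  fix \<tau> y assume \<tau>: "\<tau> \<subseteq> insert x U" "tile \<tau>"
    and y: "y \<in> insert x U \<inter> sphere (tile_centre \<tau>) (tile_radius \<tau>)"
  show "y \<in> \<tau>"
  proof (cases "x \<in> \<tau>")
    case False
    then have "\<tau> \<subseteq> U" using \<tau> by auto
    then show ?thesis using assms y \<tau> unfolding general_position_def degenerate_def by blast
  next
    case True
    obtain a b c where abc: "\<tau> = {a, b, c}" "cross a b c > 0" "a \<noteq> b" "b \<noteq> c" "a \<noteq> c"
      using \<tau>(2) by (rule tile_obtain)
    obtain p q where pq: "\<tau> = {x, p, q}" "p \<in> U" "q \<in> U" "p \<noteq> q" "x \<noteq> p" "x \<noteq> q"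
    proof -
      from True abc consider "x = a" | "x = b" | "x = c" by auto
      then show thesis by cases (use that[of b c] that[of a c] that[of a b] abc \<tau>(1) in auto)
    qed
    show ?thesis
    proof (rule ccontr)
      assume ny: "y \<notin> \<tau>"
      then have yU: "y \<in> U" using y True by auto
      have "x \<in> sphere (tile_centre {p, q, y}) (tile_radius {p, q, y})" "tile {p, q, y}"
      proof -
        have on: "{x, p, q, y} \<subseteq> sphere (tile_centre \<tau>) (tile_radius \<tau>)"
          using tile_on_circle[OF \<tau>(2)] y pq by auto
        \<comment> \<open>A line meets a circle in at most two points, and \<open>y\<close> differs
          from \<open>p\<close> and \<open>q\<close>.\<close>
        have "cross p q y \<noteq> 0"
        proof
          assume z: "cross p q y = 0"
          have c: "cross p q x \<noteq> 0" using \<tau>(2) cross_rotate[of p q x] unfolding pq(1) tile_iff_cross by auto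
          have "\<tau> = {p, q, x}" using pq by auto
          then have "(y - p) \<bullet> (y - q) = 0" using on on_tile_circle_iff[OF c, of y] z by auto
          then have "y = p \<or> y = q"
          proof -
            have e1: "(q$1 - p$1) * (y$2 - p$2) = (q$2 - p$2) * (y$1 - p$1)" using z by (simp add: cross_def)
            have e2: "(y$1 - p$1) * (y$1 - q$1) + (y$2 - p$2) * (y$2 - q$2) = 0"
              using \<open>(y - p) \<bullet> (y - q) = 0\<close> by (simp add: inner_plane)
            \<comment> \<open>The product of the squared distances of \<open>y\<close> from
              \<open>p\<close> and from \<open>q\<close>: it vanishes because \<open>y - p\<close>
              and \<open>y - q\<close> are parallel as well as orthogonal.\<close>
            have "((y$1 - p$1)\<^sup>2 + (y$2 - p$2)\<^sup>2) * ((y$1 - q$1)\<^sup>2 + (y$2 - q$2)\<^sup>2) = 0"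
              using e1 e2 by algebra
            then show ?thesis by (auto simp: plane_eq_iff sum_power2_eq_zero_iff)
          qed
          then show False using ny pq by auto
        qed
        then show t: "tile {p, q, y}" by (simp add: tile_iff_cross)
        show "x \<in> sphere (tile_centre {p, q, y}) (tile_radius {p, q, y})"
          using tile_circle_unique[OF t, of "tile_centre \<tau>" "tile_radius \<tau>"] on by auto
      qed
      moreover have "{p, q, y} \<subseteq> U" using pq yU by auto
      ultimately have "degenerate x U" unfolding degenerate_def
        by (intro disjI2 exI[of _ "{p, q, y}"] conjI)
      then show False using assms(2) by simp
    qed
  qed
qed

text \<open>Negative iff the edge opposite to \<open>v\<close> separates \<open>x\<close> from
  \<open>v\<close>. Swapping the endpoints changes the sign of both determinants, so the value
  depends on the unordered edge only.\<close>

definition edge_sign :: "plane \<Rightarrow> plane set \<Rightarrow> plane \<Rightarrow> real" where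
  "edge_sign x \<tau> v = (if \<exists>a b. \<tau> - {v} = {a, b} \<and> cross a b v * cross a b x < 0 then - 1 else 1)"

lemma edge_sign_eq:
  assumes "\<tau> - {v} = {a, b}"
  shows "edge_sign x \<tau> v = (if cross a b v * cross a b x < 0 then - 1 else 1)"
proof -
  have "(\<exists>a' b'. \<tau> - {v} = {a', b'} \<and> cross a' b' v * cross a' b' x < 0) \<longleftrightarrow> cross a b v * cross a b x < 0"
    unfolding assms by (auto simp: doubleton_eq_iff cross_swap(1)[of b a])
  then show ?thesis by (simp add: edge_sign_def)
qed

lemma edge_signs:
  assumes "a \<noteq> b" "b \<noteq> c" "a \<noteq> c" "cross a b c > 0"
  shows "edge_sign x {a, b, c} c = (if cross a b x < 0 then - 1 else 1)"
    "edge_sign x {a, b, c} a = (if cross b c x < 0 then - 1 else 1)"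
    "edge_sign x {a, b, c} b = (if cross c a x < 0 then - 1 else 1)"
proof -
  have s: "{a, b, c} - {c} = {a, b}" "{a, b, c} - {a} = {b, c}" "{a, b, c} - {b} = {c, a}" using assms by auto
  have r: "cross b c a = cross a b c" "cross c a b = cross a b c" by (simp_all add: cross_def algebra_simps)
  show "edge_sign x {a, b, c} c = (if cross a b x < 0 then - 1 else 1)"
    "edge_sign x {a, b, c} a = (if cross b c x < 0 then - 1 else 1)"
    "edge_sign x {a, b, c} b = (if cross c a x < 0 then - 1 else 1)"
    unfolding edge_sign_eq[OF s(1)] edge_sign_eq[OF s(2)] edge_sign_eq[OF s(3)] r
    using assms(4) by (auto simp: mult_less_0_iff)
qed

text \<open>Assumption \<open>half\<close> rules out a boundary of the convex hull: applied to
  \<open>a b\<close> and to \<open>b a\<close> it puts points of \<open>U\<close> on both sides of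
  every line, so the empty circles through two points are limited on both sides. Admissibility will
  provide it.\<close>

locale cavity =
  fixes U :: "plane set" and x :: plane
  assumes conf: "U \<in> configurations"
    and gp: "general_position U"
    and half: "\<And>a b. a \<noteq> b \<Longrightarrow> \<exists>p\<in>U. cross a b p > 0"
    and nd: "\<not> degenerate x U"
begin

definition removed :: "plane set set" where
  "removed = {\<tau> \<in> empty_disc_tiles U. x \<in> tile_disc \<tau>}"

definition new :: "plane set set" where
  "new = {\<nu> \<in> empty_disc_tiles (insert x U). x \<in> \<nu>}"

lemma x_notin: "x \<notin> U"
  using nd unfolding degenerate_def by blast

lemma cross_x_nz: "a \<in> U \<Longrightarrow> b \<in> U \<Longrightarrow> a \<noteq> b \<Longrightarrow> cross a b x \<noteq> 0"
  using nd unfolding degenerate_def by blast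

text \<open>The open disc of the pencil circle with parameter \<open>s\<close> contains no point of
  \<open>U\<close>. Each point imposes a linear inequality on \<open>s\<close>, so the possible
  parameters form an interval.\<close>

definition empty_pencil :: "plane \<Rightarrow> plane \<Rightarrow> real \<Rightarrow> bool" where
  "empty_pencil a b s \<longleftrightarrow> (\<forall>q\<in>U. s * cross a b q \<le> (q - a) \<bullet> (q - b))"

lemma empty_disc_tiles_pencil:
  assumes "a \<in> U" "b \<in> U" "p \<in> U" "cross a b p \<noteq> 0"
  shows "{a, b, p} \<in> empty_disc_tiles U \<longleftrightarrow> empty_pencil a b (cot_angle a b p)"
  using assms in_tile_disc_iff[OF assms(4)]
  by (auto simp: empty_disc_tiles_def empty_pencil_def tile_iff_cross not_less)

lemma new_pencil:
  assumes "a \<in> U" "b \<in> U" "cross a b x \<noteq> 0"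
  shows "{a, b, x} \<in> new \<longleftrightarrow> empty_pencil a b (cot_angle a b x)"
proof -
  have "x \<notin> tile_disc {a, b, x}" using in_tile_disc_iff[OF assms(3), of x] assms(3) by (simp add: cot_angle_def)
  then show ?thesis using assms in_tile_disc_iff[OF assms(3)]
    by (auto simp: new_def empty_disc_tiles_def empty_pencil_def tile_iff_cross not_less)
qed

text \<open>Points to the left of \<open>ab\<close> with cotangent at most \<open>s\<close> lie in
  one closed disc, so local finiteness leaves finitely many candidates. The minimizer sees
  \<open>ab\<close> under the largest angle and limits the interval of empty circles.\<close>

lemma extremal_point:
  assumes "a \<noteq> b"
  obtains p where "p \<in> U" "cross a b p > 0"
    "\<And>q. q \<in> U \<Longrightarrow> cross a b q > 0 \<Longrightarrow> cot_angle a b p \<le> cot_angle a b q"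
proof -
  obtain p0 where p0: "p0 \<in> U" "cross a b p0 > 0" using half[OF assms] by auto
  define s where "s = cot_angle a b p0"
  define T where "T = {p \<in> U. cross a b p > 0 \<and> cot_angle a b p \<le> s}"
  let ?q = "pencil_centre a b s"
  have "T \<subseteq> U \<inter> cball ?q (dist a ?q)"
  proof
    fix p assume p: "p \<in> T"
    then have "(p - a) \<bullet> (p - b) \<le> s * cross a b p"
      by (auto simp: T_def cot_angle_def pos_divide_le_eq)
    then have "(dist p ?q)\<^sup>2 \<le> (dist a ?q)\<^sup>2" unfolding dist_pencil_centre[of p] by simp
    then have "dist p ?q \<le> dist a ?q" by (rule power2_le_imp_le) simp
    then show "p \<in> U \<inter> cball ?q (dist a ?q)" using p by (simp add: T_def dist_commute)
  qed
  moreover have "finite (U \<inter> cball ?q (dist a ?q))"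
    using conf unfolding configurations_def by auto
  ultimately have "finite T" by (rule finite_subset)
  moreover have "p0 \<in> T" using p0 by (simp add: T_def s_def)
  ultimately obtain p where "p \<in> T" "\<And>q. q \<in> T \<Longrightarrow> cot_angle a b p \<le> cot_angle a b q"
    using arg_min_if_finite[of T "cot_angle a b"] by (metis empty_iff not_le)
  then show thesis using that[of p] unfolding T_def by (smt (verit) mem_Collect_eq)
qed

text \<open>The parameters of the empty circles through \<open>a\<close> and \<open>b\<close> form
  the interval from \<open>sm\<close> to \<open>sp\<close>, whose ends belong to the two tiles at
  the edge. The tile on the side of \<open>x\<close> is removed iff \<open>sx < sp\<close>, the
  other one, counted negatively, iff \<open>sx < sm\<close>. The difference is 1 exactly if
  \<open>sx\<close> lies in the interval, that is, if the circle through \<open>a\<close>,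
  \<open>b\<close>, \<open>x\<close> is empty. If no circle is empty, both sides vanish.\<close>

lemma edge_sum_pos:
  assumes ab: "a \<in> U" "b \<in> U" and pos: "cross a b x > 0"
  defines "F \<equiv> {(\<tau>, v). \<tau> \<in> removed \<and> v \<in> \<tau> \<and> \<tau> - {v} = {a, b}}"
  shows "finite F \<and> (\<Sum>(\<tau>, v)\<in>F. edge_sign x \<tau> v) = (if {a, b, x} \<in> new then 1 else 0)"
proof -
  have nab: "a \<noteq> b" using pos by auto
  obtain P where P: "P \<in> U" "cross a b P > 0"
    "\<And>q. q \<in> U \<Longrightarrow> cross a b q > 0 \<Longrightarrow> cot_angle a b P \<le> cot_angle a b q"
    using extremal_point[OF nab] by blast
  obtain M where M': "M \<in> U" "cross b a M > 0"
    "\<And>q. q \<in> U \<Longrightarrow> cross b a q > 0 \<Longrightarrow> cot_angle b a M \<le> cot_angle b a q"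
    using extremal_point[OF nab[symmetric]] by blast
  then have M: "M \<in> U" "cross a b M < 0"
    "\<And>q. q \<in> U \<Longrightarrow> cross a b q < 0 \<Longrightarrow> cot_angle a b q \<le> cot_angle a b M"
    by (simp_all add: cross_swap(1)[of b a] cot_angle_swap[of b a])
  define sp sm sx where "sp = cot_angle a b P" and "sm = cot_angle a b M" and "sx = cot_angle a b x"
  \<comment> \<open>Every disc of the pencil cuts the line \<open>ab\<close> in the same segment, so
    the points of \<open>U\<close> on this line impose a condition that does not depend on
    \<open>s\<close>.\<close>
  define Z where "Z \<longleftrightarrow> (\<forall>q\<in>U. cross a b q = 0 \<longrightarrow> 0 \<le> (q - a) \<bullet> (q - b))"
  have cot: "(q - a) \<bullet> (q - b) = cot_angle a b q * cross a b q" if "cross a b q \<noteq> 0" for q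
    using that by (simp add: cot_angle_def)
  have emp: "empty_pencil a b s \<longleftrightarrow> Z \<and> s \<le> sp \<and> sm \<le> s" for s
  proof
    assume e: "empty_pencil a b s"
    have "s * cross a b P \<le> sp * cross a b P" "s * cross a b M \<le> sm * cross a b M"
      using e P(1,2) M(1,2) cot[of P] cot[of M] unfolding empty_pencil_def sp_def sm_def by auto
    then have "s \<le> sp" "sm \<le> s" using P M by (auto simp: mult_le_cancel_right)
    moreover have Z unfolding Z_def using e unfolding empty_pencil_def by fastforce
    ultimately show "Z \<and> s \<le> sp \<and> sm \<le> s" by simp
  next
    assume e: "Z \<and> s \<le> sp \<and> sm \<le> s"
    show "empty_pencil a b s" unfolding empty_pencil_def
    proof
      fix q assume q: "q \<in> U"
      consider "cross a b q = 0" | "cross a b q > 0" | "cross a b q < 0" by linarith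
      then show "s * cross a b q \<le> (q - a) \<bullet> (q - b)"
      proof cases
        case 1 then show ?thesis using e q by (auto simp: Z_def)
      next
        case 2
        then have "s \<le> cot_angle a b q" using P(3)[OF q] e by (simp add: sp_def)
        then show ?thesis using 2 cot[of q] by (simp add: mult_right_mono)
      next
        case 3
        then have "cot_angle a b q \<le> s" using M(3)[OF q] e by (simp add: sm_def)
        then show ?thesis using 3 cot[of q] by (simp add: mult_right_mono_neg)
      qed
    qed
  qed
  have F_iff: "(\<tau>, v) \<in> F \<longleftrightarrow> v \<in> U \<and> cross a b v \<noteq> 0 \<and> \<tau> = {a, b, v} \<and> empty_pencil a b (cot_angle a b v) \<and> sx < cot_angle a b v"
    for \<tau> v
  proof -
    have 1: "\<tau> \<in> removed \<and> v \<in> \<tau> \<and> \<tau> - {v} = {a, b} \<longleftrightarrow> v \<in> U \<and> cross a b v \<noteq> 0 \<and> \<tau> = {a, b, v} \<and> \<tau> \<in> removed"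
    proof
      assume l: "\<tau> \<in> removed \<and> v \<in> \<tau> \<and> \<tau> - {v} = {a, b}"
      then have "\<tau> = {a, b, v}" by auto
      moreover have "v \<in> U" "tile \<tau>" using l by (auto simp: removed_def empty_disc_tiles_def)
      ultimately show "v \<in> U \<and> cross a b v \<noteq> 0 \<and> \<tau> = {a, b, v} \<and> \<tau> \<in> removed"
        using l by (simp add: tile_iff_cross)
    next
      assume r: "v \<in> U \<and> cross a b v \<noteq> 0 \<and> \<tau> = {a, b, v} \<and> \<tau> \<in> removed"
      then have "v \<noteq> a" "v \<noteq> b" by auto
      then show "\<tau> \<in> removed \<and> v \<in> \<tau> \<and> \<tau> - {v} = {a, b}" using r by auto
    qed
    have 2: "{a, b, v} \<in> removed \<longleftrightarrow> empty_pencil a b (cot_angle a b v) \<and> sx < cot_angle a b v"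
      if "v \<in> U" "cross a b v \<noteq> 0"
    proof -
      have "x \<in> tile_disc {a, b, v} \<longleftrightarrow> sx * cross a b x < cot_angle a b v * cross a b x"
        using in_tile_disc_iff[OF that(2)] cot[of x] pos by (simp add: sx_def)
      also have "\<dots> \<longleftrightarrow> sx < cot_angle a b v" using pos by simp
      finally show ?thesis using empty_disc_tiles_pencil[OF ab that] by (simp add: removed_def)
    qed
    show ?thesis unfolding F_def using 1 2 by auto
  qed
  \<comment> \<open>Equal cotangents mean points cocircular with \<open>a\<close> and
    \<open>b\<close>, which general position forbids unless they coincide.\<close>
  have uniq: "v = w" if "v \<in> U" "w \<in> U" "cross a b v \<noteq> 0" "cross a b w \<noteq> 0" "cot_angle a b v = cot_angle a b w" for v w
  proof -
    have "w \<in> sphere (tile_centre {a, b, v}) (tile_radius {a, b, v})"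
      using on_tile_circle_iff[OF that(3)] cot[OF that(4)] that(5) by simp
    then have "w \<in> {a, b, v}" using gp that ab unfolding general_position_def tile_iff_cross[symmetric]
      by (metis (no_types, lifting) IntI empty_subsetI insert_subset subsetD)
    then show ?thesis using that by auto
  qed
  \<comment> \<open>Nondegeneracy of \<open>x\<close> excludes equality, so weak and strict
    inequalities for \<open>sx\<close> are interchangeable.\<close>
  have nx: "sx \<noteq> cot_angle a b v" if "v \<in> U" "cross a b v \<noteq> 0" for v
  proof
    assume "sx = cot_angle a b v"
    then have "x \<in> sphere (tile_centre {a, b, v}) (tile_radius {a, b, v})"
      using on_tile_circle_iff[OF that(2)] cot[of x] pos by (simp add: sx_def)
    moreover have "tile {a, b, v}" "{a, b, v} \<subseteq> U" using that ab by (simp_all add: tile_iff_cross)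
    ultimately show False using nd unfolding degenerate_def by blast
  qed
  have sub: "(\<tau>, v) = ({a, b, P}, P) \<or> (\<tau>, v) = ({a, b, M}, M)" if F: "(\<tau>, v) \<in> F" for \<tau> v
  proof -
    from F have v: "v \<in> U" "cross a b v \<noteq> 0" "\<tau> = {a, b, v}" "cot_angle a b v \<le> sp" "sm \<le> cot_angle a b v"
      using F_iff emp by auto
    show ?thesis
    proof (cases "cross a b v > 0")
      case True
      then have "cot_angle a b v = sp" using P(3)[OF v(1)] v by (simp add: sp_def)
      then have "v = P" using uniq[of v P] v P by (simp add: sp_def)
      then show ?thesis using v by simp
    next
      case False
      then have "cot_angle a b v = sm" using M(3)[OF v(1)] v by (simp add: sm_def)
      then have "v = M" using uniq[of v M] v M by (simp add: sm_def)
      then show ?thesis using v by simp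
    qed
  qed
  have FP: "({a, b, P}, P) \<in> F \<longleftrightarrow> Z \<and> sm \<le> sp \<and> sx < sp" using F_iff emp P by (auto simp: sp_def)
  have FM: "({a, b, M}, M) \<in> F \<longleftrightarrow> Z \<and> sm \<le> sp \<and> sx < sm" using F_iff emp M by (auto simp: sm_def)
  have PM: "P \<noteq> M" using P M by auto
  have "{a, b, P} - {P} = {a, b}" "{a, b, M} - {M} = {a, b}" using P M by auto
  then have sg: "edge_sign x {a, b, P} P = 1" "edge_sign x {a, b, M} M = - 1"
    using P M pos by (auto simp: edge_sign_eq mult_less_0_iff)
  have n: "{a, b, x} \<in> new \<longleftrightarrow> Z \<and> sx \<le> sp \<and> sm \<le> sx"
    using new_pencil[OF ab] pos emp by (simp add: sx_def)
  have ne: "sx \<noteq> sp" "sx \<noteq> sm" using nx P M by (auto simp: sp_def sm_def)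
  have F_eq: "F = (if Z \<and> sm \<le> sp \<and> sx < sp then {({a, b, P}, P)} else {}) \<union> (if Z \<and> sm \<le> sp \<and> sx < sm then {({a, b, M}, M)} else {})"
    using sub FP FM by (auto split: if_splits)
  show ?thesis unfolding F_eq using n ne sg PM by (cases Z) auto
qed

lemma edge_sum:
  assumes ab: "a \<in> U" "b \<in> U" and "a \<noteq> b"
  defines "F \<equiv> {(\<tau>, v). \<tau> \<in> removed \<and> v \<in> \<tau> \<and> \<tau> - {v} = {a, b}}"
  shows "(\<Sum>(\<tau>, v)\<in>F. edge_sign x \<tau> v) = (if insert x {a, b} \<in> new then 1 else 0)"
proof -
  have s: "{b, a} = {a, b}" "{a, b, x} = insert x {a, b}" "{b, a, x} = insert x {a, b}" by auto
  consider "cross a b x > 0" | "cross b a x > 0"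
    using cross_x_nz[OF assms(1-3)] cross_swap(1)[of b a x] by linarith
  then show ?thesis unfolding F_def
  proof cases
    case 1 then show "(\<Sum>(\<tau>, v)\<in>{(\<tau>, v). \<tau> \<in> removed \<and> v \<in> \<tau> \<and> \<tau> - {v} = {a, b}}. edge_sign x \<tau> v) = (if insert x {a, b} \<in> new then 1 else 0)"
      using edge_sum_pos[OF ab] unfolding s by blast
  next
    case 2 then show "(\<Sum>(\<tau>, v)\<in>{(\<tau>, v). \<tau> \<in> removed \<and> v \<in> \<tau> \<and> \<tau> - {v} = {a, b}}. edge_sign x \<tau> v) = (if insert x {a, b} \<in> new then 1 else 0)"
      using edge_sum_pos[OF ab(2,1)] unfolding s by blast
  qed
qed

text \<open>Both tiles adjacent to an edge contribute with opposite signs, so only the edges on the boundary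
  of the cavity survive, and these span the new tiles with apex \<open>x\<close>.\<close>

lemma signed_edge_sum:
  assumes fin: "finite removed"
  shows "finite new"
    and "(\<Sum>\<tau>\<in>removed. \<Sum>v\<in>\<tau>. edge_sign x \<tau> v * g (insert x (\<tau> - {v}))) = sum g new"
proof -
  define Pr where "Pr = Sigma removed (\<lambda>\<tau>. \<tau>)"
  define e where "e = (\<lambda>(\<tau>, v::plane). \<tau> - {v} :: plane set)"
  define E where "E = e ` Pr"
  have rt: "tile \<tau>" "\<tau> \<subseteq> U" if "\<tau> \<in> removed" for \<tau> using that by (auto simp: removed_def empty_disc_tiles_def)
  have fP: "finite Pr" unfolding Pr_def using fin rt finite_tile by (intro finite_SigmaI) auto
  have edge: "\<exists>a b. d = {a, b} \<and> a \<in> U \<and> b \<in> U \<and> a \<noteq> b" if d: "d \<in> E" for d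
  proof -
    obtain \<tau> v where tv: "\<tau> \<in> removed" "v \<in> \<tau>" "d = \<tau> - {v}"
      using d unfolding E_def e_def Pr_def by blast
    have "card d = 2" using tv rt[OF tv(1)] finite_tile by (auto simp: tile_def)
    then show ?thesis unfolding card_2_iff using tv rt[OF tv(1)] by (metis Diff_iff insertI1 insertI2 subsetD)
  qed
  have fib: "{p \<in> Pr. e p = {a, b}} = {(\<tau>, v). \<tau> \<in> removed \<and> v \<in> \<tau> \<and> \<tau> - {v} = {a, b}}" for a b
    by (auto simp: Pr_def e_def)
  have inner: "(\<Sum>p\<in>{p \<in> Pr. e p = d}. edge_sign x (fst p) (snd p) * g (insert x (e p))) = (if insert x d \<in> new then g (insert x d) else 0)"
    if d: "d \<in> E" for d
  proof -
    obtain a b where ab: "d = {a, b}" "a \<in> U" "b \<in> U" "a \<noteq> b" using edge[OF d] by blast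
    have "(\<Sum>p\<in>{p \<in> Pr. e p = d}. edge_sign x (fst p) (snd p) * g (insert x (e p))) =
        (\<Sum>p\<in>{p \<in> Pr. e p = d}. edge_sign x (fst p) (snd p)) * g (insert x d)"
      unfolding sum_distrib_right by (intro sum.cong) auto
    also have "(\<Sum>p\<in>{p \<in> Pr. e p = d}. edge_sign x (fst p) (snd p)) = (if insert x d \<in> new then 1 else 0)"
      using edge_sum[OF ab(2-4)] unfolding ab(1) fib by (simp add: case_prod_beta)
    finally show ?thesis by simp
  qed
  have img: "(insert x) ` {d \<in> E. insert x d \<in> new} = new"
  proof
    show "new \<subseteq> (insert x) ` {d \<in> E. insert x d \<in> new}"
    proof
      fix \<nu> assume \<nu>: "\<nu> \<in> new"
      then have t: "tile \<nu>" "x \<in> \<nu>" "\<nu> \<subseteq> insert x U" by (auto simp: new_def empty_disc_tiles_def)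
      then have "card (\<nu> - {x}) = 2" using finite_tile by (simp add: tile_def)
      then obtain a b where ab: "\<nu> - {x} = {a, b}" "a \<noteq> b" by (auto simp: card_2_iff)
      then have U: "a \<in> U" "b \<in> U" using t by auto
      have n: "insert x {a, b} = \<nu>" using ab t by auto
      \<comment> \<open>A sum with value 1 is not empty; hence the edge of a new tile opposite to
        \<open>x\<close> is an edge of some removed tile.\<close>
      then have "(\<Sum>(\<tau>, v)\<in>{p \<in> Pr. e p = {a, b}}. edge_sign x \<tau> v) = 1"
        using edge_sum[OF U ab(2)] \<nu> unfolding fib by simp
      then have "{p \<in> Pr. e p = {a, b}} \<noteq> {}" by (metis sum.empty zero_neq_one)
      then have "{a, b} \<in> E" by (auto simp: E_def)
      then show "\<nu> \<in> (insert x) ` {d \<in> E. insert x d \<in> new}" using n \<nu> by (intro image_eqI[of _ _ "{a, b}"]) auto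
    qed
  qed auto
  have fE: "finite E" using fP by (simp add: E_def)
  then have "finite {d \<in> E. insert x d \<in> new}" by simp
  then have "finite ((insert x) ` {d \<in> E. insert x d \<in> new})" by (rule finite_imageI)
  then show "finite new" unfolding img .
  have "(\<Sum>\<tau>\<in>removed. \<Sum>v\<in>\<tau>. edge_sign x \<tau> v * g (insert x (\<tau> - {v}))) =
      (\<Sum>p\<in>Pr. edge_sign x (fst p) (snd p) * g (insert x (e p)))"
    unfolding Pr_def e_def using fin rt finite_tile by (subst sum.Sigma) (auto simp: case_prod_beta)
  \<comment> \<open>Pairs of a tile and a vertex are grouped by the edge opposite to the vertex; the
    argument of \<open>g\<close> is constant on each group.\<close>
  also have "\<dots> = (\<Sum>d\<in>E. \<Sum>p\<in>{p \<in> Pr. e p = d}. edge_sign x (fst p) (snd p) * g (insert x (e p)))"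
    by (rule sum.group[symmetric]) (use fP in \<open>auto simp: E_def\<close>)
  also have "\<dots> = (\<Sum>d\<in>E. if insert x d \<in> new then g (insert x d) else 0)"
    by (intro sum.cong refl inner)
  also have "\<dots> = (\<Sum>d\<in>{d \<in> E. insert x d \<in> new}. g (insert x d))"
    using fE by (simp add: sum.inter_filter)
  also have "\<dots> = sum g ((insert x) ` {d \<in> E. insert x d \<in> new})"
  proof -
    have "inj_on (insert x) {d \<in> E. insert x d \<in> new}"
    proof (rule inj_onI)
      fix d d' assume d: "d \<in> {d \<in> E. insert x d \<in> new}" "d' \<in> {d \<in> E. insert x d \<in> new}" "insert x d = insert x d'"
      have "x \<notin> d" "x \<notin> d'" using edge d x_notin by auto
      then show "d = d'" using d(3) by (metis insert_ident)
    qed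
    then show ?thesis by (simp add: sum.reindex)
  qed
  finally show "(\<Sum>\<tau>\<in>removed. \<Sum>v\<in>\<tau>. edge_sign x \<tau> v * g (insert x (\<tau> - {v}))) = sum g new"
    unfolding img .
qed

end

text \<open>\<open>L\<close> is the difference of the powers with respect to two circles. Its
  quadratic terms cancel, so it is affine and interpolates by barycentric coordinates, written here
  as areas.\<close>

lemma circle_radical_identity:
  fixes a b c x p q :: plane and k :: real
  assumes L_def: "L = (\<lambda>y. (dist y p)\<^sup>2 - (dist y q)\<^sup>2 - k)"
  shows "cross a b c * L x = cross b c x * L a + cross c a x * L b + cross a b x * L c"
  unfolding L_def cross_def dist_plane_sq by (simp add: algebra_simps power2_eq_square)

text \<open>The difference of the powers with respect to the two circumcircles is an affine function,
  nonpositive on the first tile and nonnegative on the second one.\<close>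

lemma empty_disc_tiles_separated:
  assumes gp: "general_position U" and t: "\<tau> \<in> empty_disc_tiles U" "\<tau>' \<in> empty_disc_tiles U"
  defines "L \<equiv> \<lambda>y. (dist y (tile_centre \<tau>))\<^sup>2 - (dist y (tile_centre \<tau>'))\<^sup>2
                      - ((tile_radius \<tau>)\<^sup>2 - (tile_radius \<tau>')\<^sup>2)"
  shows "v \<in> \<tau> \<Longrightarrow> L v \<le> 0" "v \<in> \<tau>' \<Longrightarrow> L v \<ge> 0"
    and "v \<in> \<tau> \<Longrightarrow> L v = 0 \<Longrightarrow> v \<in> \<tau>'"
proof -
  have T: "tile \<tau>" "tile \<tau>'" "\<tau> \<subseteq> U" "\<tau>' \<subseteq> U" "U \<inter> tile_disc \<tau> = {}" "U \<inter> tile_disc \<tau>' = {}"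
    using t by (auto simp: empty_disc_tiles_def)
  have on: "dist v (tile_centre \<tau>) = tile_radius \<tau>" if "v \<in> \<tau>" for v
    using tile_on_circle[OF T(1)] that by (auto simp: dist_commute)
  have on': "dist v (tile_centre \<tau>') = tile_radius \<tau>'" if "v \<in> \<tau>'" for v
    using tile_on_circle[OF T(2)] that by (auto simp: dist_commute)
  have out: "dist v (tile_centre \<tau>') \<ge> tile_radius \<tau>'" if "v \<in> \<tau>" for v
    using T(3,6) that by (auto simp: tile_disc_def dist_commute not_less[symmetric])
  have out': "dist v (tile_centre \<tau>) \<ge> tile_radius \<tau>" if "v \<in> \<tau>'" for v
    using T(4,5) that by (auto simp: tile_disc_def dist_commute not_less[symmetric])
  have r: "tile_radius \<tau> \<ge> 0" "tile_radius \<tau>' \<ge> 0" using tile_radius_pos T by (auto simp: less_imp_le)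
  show "v \<in> \<tau> \<Longrightarrow> L v \<le> 0" using on[of v] power_mono[OF out r(2), of v 2] by (simp add: L_def)
  show "v \<in> \<tau>' \<Longrightarrow> L v \<ge> 0" using on'[of v] power_mono[OF out' r(1), of v 2] by (simp add: L_def)
  show "v \<in> \<tau>'" if v: "v \<in> \<tau>" "L v = 0"
  proof -
    have "(dist v (tile_centre \<tau>'))\<^sup>2 = (tile_radius \<tau>')\<^sup>2" using v on[OF v(1)] by (simp add: L_def)
    then have "dist v (tile_centre \<tau>') = tile_radius \<tau>'" by (rule power2_eq_imp_eq) (use r in auto)
    then have "v \<in> U \<inter> sphere (tile_centre \<tau>') (tile_radius \<tau>')"
      using v T by (auto simp: dist_commute[of v])
    then show ?thesis using gp T unfolding general_position_def by blast
  qed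
qed

lemma tile_eqI:
  assumes "tile \<tau>" "tile \<tau>'" "\<tau> \<subseteq> \<tau>'" shows "\<tau> = \<tau>'"
  using card_subset_eq[OF finite_tile[OF assms(2)] assms(3)] assms(1,2) by (simp add: tile_def)

lemma weighted_nonpos_zero:
  fixes u v w a b c :: real
  assumes "u > 0" "v > 0" "w > 0" "a \<le> 0" "b \<le> 0" "c \<le> 0" "u * a + v * b + w * c \<ge> 0"
  shows "a = 0 \<and> b = 0 \<and> c = 0"
proof -
  have "u * a \<le> 0" "v * b \<le> 0" "w * c \<le> 0" using assms by (simp_all add: mult_nonneg_nonpos)
  then have "u * a = 0" "v * b = 0" "w * c = 0" using assms(7) by linarith+
  then show ?thesis using assms by simp
qed

section \<open>Number and energy of the new tiles\<close>

context cavity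
begin

definition inside :: "plane set \<Rightarrow> bool" where
  "inside \<tau> \<longleftrightarrow> (\<exists>a b c. \<tau> = {a, b, c} \<and> cross a b c > 0 \<and> cross a b x > 0 \<and> cross b c x > 0 \<and> cross c a x > 0)"

text \<open>By interpolation, \<open>L x\<close> is a positive combination of the nonnegative values
  on \<open>\<tau>'\<close> and also of the nonpositive values on \<open>\<tau>\<close>. Therefore
  \<open>L\<close> vanishes on \<open>\<tau>\<close>, and the vertices of \<open>\<tau>\<close> are
  vertices of \<open>\<tau>'\<close>.\<close>

lemma inside_unique:
  assumes "\<tau> \<in> removed" "\<tau>' \<in> removed" "inside \<tau>" "inside \<tau>'" shows "\<tau> = \<tau>'"
proof -
  have t: "\<tau> \<in> empty_disc_tiles U" "\<tau>' \<in> empty_disc_tiles U" using assms by (auto simp: removed_def)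
  define k where "k = (tile_radius \<tau>)\<^sup>2 - (tile_radius \<tau>')\<^sup>2"
  define L where "L = (\<lambda>y. (dist y (tile_centre \<tau>))\<^sup>2 - (dist y (tile_centre \<tau>'))\<^sup>2 - k)"
  have sep: "\<And>v. v \<in> \<tau> \<Longrightarrow> L v \<le> 0" "\<And>v. v \<in> \<tau>' \<Longrightarrow> L v \<ge> 0" "\<And>v. v \<in> \<tau> \<Longrightarrow> L v = 0 \<Longrightarrow> v \<in> \<tau>'"
    using empty_disc_tiles_separated[OF gp t] unfolding L_def k_def by blast+
  obtain a b c where 1: "\<tau> = {a, b, c}" "cross a b c > 0" "cross a b x > 0" "cross b c x > 0" "cross c a x > 0"
    using assms(3) by (auto simp: inside_def)
  obtain a' b' c' where 2: "\<tau>' = {a', b', c'}" "cross a' b' c' > 0" "cross a' b' x > 0" "cross b' c' x > 0" "cross c' a' x > 0"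
    using assms(4) by (auto simp: inside_def)
  have L1: "cross a b c * L x = cross b c x * L a + cross c a x * L b + cross a b x * L c"
    by (rule circle_radical_identity[OF L_def])
  have L2: "cross a' b' c' * L x = cross b' c' x * L a' + cross c' a' x * L b' + cross a' b' x * L c'"
    by (rule circle_radical_identity[OF L_def])
  have "cross a' b' c' * L x \<ge> 0" unfolding L2 using 2 sep(2)
    by (intro add_nonneg_nonneg mult_nonneg_nonneg) auto
  then have "L x \<ge> 0" using 2 by (simp add: zero_le_mult_iff)
  then have "cross b c x * L a + cross c a x * L b + cross a b x * L c \<ge> 0"
    unfolding L1[symmetric] using 1 by simp
  then have "L a = 0 \<and> L b = 0 \<and> L c = 0"
    by (intro weighted_nonpos_zero) (use 1 sep(1) in auto)
  then have "\<tau> \<subseteq> \<tau>'" using sep(3) 1(1) by auto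
  then show ?thesis using tile_eqI t by (auto simp: empty_disc_tiles_def)
qed

lemma sum_over_tile:
  fixes f :: "plane \<Rightarrow> real"
  assumes "a \<noteq> b" "b \<noteq> c" "a \<noteq> c" shows "sum f {a, b, c} = f a + f b + f c"
  using assms by simp

text \<open>As \<open>x\<close> lies in the circumdisc, at most one edge separates it from the tile:
  by \<open>flip_radii\<close>, one negative determinant makes the other two positive. In the second
  case the vertices are named so that this edge is \<open>ab\<close>.\<close>

lemma removed_cases:
  assumes "\<tau> \<in> removed"
  obtains (inside) "inside \<tau>" "\<And>v. v \<in> \<tau> \<Longrightarrow> edge_sign x \<tau> v = 1"
  | (outside) a b c where "\<tau> = {a, b, c}" "cross a b c > 0" "cross a b x < 0" "a \<noteq> b" "b \<noteq> c" "a \<noteq> c"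
      "edge_sign x \<tau> a = 1" "edge_sign x \<tau> b = 1" "edge_sign x \<tau> c = - 1"
proof -
  have t: "tile \<tau>" "\<tau> \<subseteq> U" "x \<in> tile_disc \<tau>" using assms by (auto simp: removed_def empty_disc_tiles_def)
  obtain a b c where abc: "\<tau> = {a, b, c}" "cross a b c > 0" "a \<noteq> b" "b \<noteq> c" "a \<noteq> c"
    using t(1) by (rule tile_obtain)
  have ga: thesis if neg: "\<tau> = {a, b, c}" "cross a b c > 0" "cross a b x < 0" for a b c
  proof -
    have d: "a \<noteq> b" "b \<noteq> c" "a \<noteq> c" using neg by auto
    have "x \<in> tile_disc {a, b, c}" using t neg by simp
    then have "cross c a x > 0" "cross b c x > 0" using flip_radii(1,2)[OF neg(2,3)] by auto
    then show thesis using outside[OF neg d] edge_signs[OF d neg(2)] neg by simp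
  qed
  have nz: "cross a b x \<noteq> 0" "cross b c x \<noteq> 0" "cross c a x \<noteq> 0" using abc t cross_x_nz[of a b] cross_x_nz[of b c] cross_x_nz[of c a] by simp_all
  have r: "cross b c a = cross a b c" "cross c a b = cross a b c" by (simp_all add: cross_def algebra_simps)
  have perm: "\<tau> = {b, c, a}" "\<tau> = {c, a, b}" using abc(1) by auto
  show thesis
  proof (cases "cross a b x < 0 \<or> cross b c x < 0 \<or> cross c a x < 0")
    case True
    then show ?thesis using ga[OF abc(1,2)] ga[OF perm(1)] ga[OF perm(2)] abc(2) unfolding r by blast
  next
    case False
    then have p: "cross a b x > 0" "cross b c x > 0" "cross c a x > 0" using nz by auto
    then have "inside \<tau>" using abc by (auto simp: inside_def)
    moreover have "edge_sign x \<tau> v = 1" if "v \<in> \<tau>" for v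
      using that p edge_signs[OF abc(3-5,2)] unfolding abc(1) by auto
    ultimately show ?thesis by (rule inside)
  qed
qed

text \<open>Take \<open>g = 1\<close> in the signed edge sum. The signs of a removed tile add up to
  3, or to 1 + 1 - 1.\<close>

lemma cavity_card:
  assumes "finite removed" shows "card removed \<le> card new"
proof -
  have "1 \<le> (\<Sum>v\<in>\<tau>. edge_sign x \<tau> v * 1)" if "\<tau> \<in> removed" for \<tau>
    using that
  proof (cases rule: removed_cases)
    case inside
    have "card \<tau> = 3" using that by (auto simp: removed_def empty_disc_tiles_def tile_def)
    then show ?thesis using inside by simp
  next
    case (outside a b c)
    then show ?thesis by (simp add: sum_over_tile)
  qed
  then have "(\<Sum>\<tau>\<in>removed. 1) \<le> (\<Sum>\<tau>\<in>removed. \<Sum>v\<in>\<tau>. edge_sign x \<tau> v * 1)"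
    by (rule sum_mono)
  also have "\<dots> = (\<Sum>\<nu>\<in>new. 1)" by (rule signed_edge_sum(2)[OF assms])
  finally show ?thesis by simp
qed

text \<open>In the signed edge sum let \<open>g\<close> be \<open>\<psi>\<close> of the radius. For
  a tile separated from \<open>x\<close> by an edge, the flip bounds the two positive terms minus
  the negative one by the energy of the tile. The tile around \<open>x\<close> has three positive
  terms, at most \<open>3 * K\<close>, against its own energy, at least \<open>- K\<close>.\<close>

lemma cavity_energy:
  fixes \<psi> :: "real \<Rightarrow> real"
  assumes fin: "finite removed" and mono: "mono_on {r..} \<psi>"
    and far: "\<And>a. a \<in> U \<Longrightarrow> 2 * r \<le> dist x a"
    and large: "\<And>\<tau>. \<tau> \<in> removed \<Longrightarrow> r \<le> tile_radius \<tau>"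
    and bnd: "\<And>\<tau>. tile \<tau> \<Longrightarrow> r \<le> tile_radius \<tau> \<Longrightarrow> \<bar>\<psi> (tile_radius \<tau>)\<bar> \<le> K"
    and K: "0 \<le> K"
  shows "(\<Sum>\<nu>\<in>new. \<psi> (tile_radius \<nu>)) \<le> (\<Sum>\<tau>\<in>removed. \<psi> (tile_radius \<tau>)) + 4 * K"
proof -
  define h where "h = (\<lambda>\<nu>. \<psi> (tile_radius \<nu>))"
  have rt: "tile \<tau>" "\<tau> \<subseteq> U" "x \<in> tile_disc \<tau>" if "\<tau> \<in> removed" for \<tau>
    using that by (auto simp: removed_def empty_disc_tiles_def)
  \<comment> \<open>The segment from \<open>x\<close> to \<open>a\<close> is a chord, hence at most
    twice the radius; this is the reason for the factor 2 in \<open>far\<close>. The bound covers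
    the tiles over all edges, including those whose contributions cancel.\<close>
  have big: "tile {x, a, b}" "r \<le> tile_radius {x, a, b}" if "a \<in> U" "b \<in> U" "a \<noteq> b" for a b
  proof -
    show t: "tile {x, a, b}" using cross_x_nz[OF that] cross_rotate[of a b x] by (simp add: tile_iff_cross)
    show "r \<le> tile_radius {x, a, b}"
      using dist_le_tile_diameter[OF t, of x a] far[OF that(1)] by simp
  qed
  define J where "J = {\<tau> \<in> removed. inside \<tau>}"
  have J: "card J \<le> 1"
  proof -
    have "finite J" using fin by (simp add: J_def)
    then show ?thesis using inside_unique card_le_Suc0_iff_eq[of J] unfolding J_def by auto
  qed
  have step: "(\<Sum>v\<in>\<tau>. edge_sign x \<tau> v * h (insert x (\<tau> - {v}))) \<le> h \<tau> + (if \<tau> \<in> J then 4 * K else 0)"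
    if \<tau>: "\<tau> \<in> removed" for \<tau>
    using \<tau>
  proof (cases rule: removed_cases)
    case inside
    obtain a b c where abc: "\<tau> = {a, b, c}" "cross a b c > 0" "a \<noteq> b" "b \<noteq> c" "a \<noteq> c"
      using rt(1)[OF \<tau>] by (rule tile_obtain)
    have "h (insert x (\<tau> - {v})) \<le> K" if "v \<in> \<tau>" for v
    proof -
      have "card (\<tau> - {v}) = 2" using abc that by auto
      then obtain p q where "\<tau> - {v} = {p, q}" "p \<noteq> q" by (auto simp: card_2_iff)
      moreover have "p \<in> U" "q \<in> U" using calculation rt(2)[OF \<tau>] by auto
      ultimately show ?thesis using big[of p q] bnd[of "{x, p, q}"] by (auto simp: h_def)
    qed
    then have "(\<Sum>v\<in>\<tau>. edge_sign x \<tau> v * h (insert x (\<tau> - {v}))) \<le> (\<Sum>v\<in>\<tau>. K)"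
      using inside by (intro sum_mono) simp
    also have "\<dots> = 3 * K" using rt(1)[OF \<tau>] by (simp add: tile_def)
    also have "\<dots> \<le> h \<tau> + 4 * K" using bnd[OF rt(1)[OF \<tau>] large[OF \<tau>]] by (simp add: h_def)
    finally show ?thesis using inside \<tau> by (simp add: J_def)
  next
    case (outside a b c)
    have U: "a \<in> U" "b \<in> U" "c \<in> U" using rt(2)[OF \<tau>] outside by auto
    have s: "insert x (\<tau> - {a}) = {x, b, c}" "insert x (\<tau> - {b}) = {x, a, c}" "insert x (\<tau> - {c}) = {x, a, b}"
      using outside by auto
    have "x \<in> tile_disc {a, b, c}" using rt(3)[OF \<tau>] outside by simp
    note fl = flip_radii(3)[OF outside(2,3) this]
    define r1 where "r1 = tile_radius {a, b, c}"
    define r2 where "r2 = tile_radius {x, a, b}"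
    define r3 where "r3 = tile_radius {x, a, c}"
    define r4 where "r4 = tile_radius {x, b, c}"
    have ge: "r1 \<ge> r" "r2 \<ge> r" "r3 \<ge> r" "r4 \<ge> r"
      unfolding r1_def r2_def r3_def r4_def using large[OF \<tau>] big U outside by auto
    have m: "\<psi> s \<le> \<psi> t" if "s \<le> t" "s \<ge> r" "t \<ge> r" for s t
      using mono that by (auto simp: mono_on_def)
    have "\<psi> r3 + \<psi> r4 \<le> \<psi> r1 + \<psi> r2"
    proof -
      \<comment> \<open>One of \<open>r3\<close>, \<open>r4\<close> lies below both
        \<open>r1\<close> and \<open>r2\<close>, the other one below at least one of them. The
        latter is paired first, and the former takes the remaining radius.\<close>
      consider "r3 \<le> r1" "r3 \<le> r2" "r4 \<le> r1 \<or> r4 \<le> r2" | "r4 \<le> r1" "r4 \<le> r2" "r3 \<le> r1 \<or> r3 \<le> r2"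
        using fl unfolding r1_def r2_def r3_def r4_def by blast
      then show ?thesis
      proof cases
        case 1 then show ?thesis using m[of r3 r1] m[of r3 r2] m[of r4 r1] m[of r4 r2] ge by linarith
      next
        case 2 then show ?thesis using m[of r3 r1] m[of r3 r2] m[of r4 r1] m[of r4 r2] ge by linarith
      qed
    qed
    moreover have "(\<Sum>v\<in>\<tau>. edge_sign x \<tau> v * h (insert x (\<tau> - {v}))) = \<psi> r4 + \<psi> r3 - \<psi> r2"
    proof -
      have "(\<Sum>v\<in>\<tau>. edge_sign x \<tau> v * h (insert x (\<tau> - {v}))) = (\<Sum>v\<in>{a, b, c}. edge_sign x \<tau> v * h (insert x (\<tau> - {v})))"
        using outside by simp
      also have "\<dots> = h (insert x (\<tau> - {a})) + h (insert x (\<tau> - {b})) - h (insert x (\<tau> - {c}))"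
        unfolding sum_over_tile[OF outside(4-6)] outside(7-9) by simp
      finally show ?thesis unfolding s by (simp add: h_def r2_def r3_def r4_def)
    qed
    moreover have "0 \<le> K" using bnd[OF rt(1)[OF \<tau>] large[OF \<tau>]] by linarith
    ultimately show ?thesis using outside(1) by (simp add: h_def r1_def)
  qed
  have JK: "(\<Sum>\<tau>\<in>removed. if \<tau> \<in> J then 4 * K else 0) \<le> 4 * K"
  proof -
    have "(\<Sum>\<tau>\<in>removed. if \<tau> \<in> J then 4 * K else 0) = real (card J) * (4 * K)"
      using fin by (simp add: sum.If_cases J_def Int_def)
    also have "\<dots> \<le> 1 * (4 * K)" using J K by (intro mult_right_mono) auto
    finally show ?thesis by simp
  qed
  have "sum h new = (\<Sum>\<tau>\<in>removed. \<Sum>v\<in>\<tau>. edge_sign x \<tau> v * h (insert x (\<tau> - {v})))"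
    by (rule signed_edge_sum(2)[OF fin, symmetric])
  also have "\<dots> \<le> (\<Sum>\<tau>\<in>removed. h \<tau> + (if \<tau> \<in> J then 4 * K else 0))" by (intro sum_mono step)
  also have "\<dots> = sum h removed + (\<Sum>\<tau>\<in>removed. if \<tau> \<in> J then 4 * K else 0)" by (rule sum.distrib)
  finally have le: "sum h new \<le> sum h removed + (\<Sum>\<tau>\<in>removed. if \<tau> \<in> J then 4 * K else 0)" .
  then show ?thesis using JK unfolding h_def by linarith
qed

end

section \<open>Measurability of sums over points and tiles\<close>

lemma count_generator_closed:
  "{{\<omega> \<in> configurations. count_in \<Delta> \<omega> = k} | \<Delta> k. \<Delta> \<in> bounded_borel} \<subseteq> Pow configurations"
  by auto

lemma space_config_space [simp]: "space config_space = configurations"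
  unfolding config_space_def by (rule space_measure_of[OF count_generator_closed])

lemma sets_config_space:
  "sets config_space = sigma_sets configurations
     {{\<omega> \<in> configurations. count_in \<Delta> \<omega> = k} | \<Delta> k. \<Delta> \<in> bounded_borel}"
  unfolding config_space_def by (rule sets_measure_of[OF count_generator_closed])

lemma config_finite: "\<omega> \<in> configurations \<Longrightarrow> bounded B \<Longrightarrow> finite (\<omega> \<inter> B)"
  by (auto simp: configurations_def)

lemma config_subset: "\<omega> \<in> configurations \<Longrightarrow> \<omega>' \<subseteq> \<omega> \<Longrightarrow> \<omega>' \<in> configurations"
  unfolding configurations_def by (auto intro: finite_subset[of "\<omega>' \<inter> _" "\<omega> \<inter> _"])

lemma config_Un: "\<omega> \<in> configurations \<Longrightarrow> \<omega>' \<in> configurations \<Longrightarrow> \<omega> \<union> \<omega>' \<in> configurations"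
  by (auto simp: configurations_def Int_Un_distrib2)

lemma config_finite_set: "finite \<omega> \<Longrightarrow> \<omega> \<in> configurations"
  by (auto simp: configurations_def)

lemma config_insert: "\<omega> \<in> configurations \<Longrightarrow> insert x \<omega> \<in> configurations"
  using config_Un[OF config_finite_set, of "{x}" \<omega>] by simp

lemma config_countable: "\<omega> \<in> configurations \<Longrightarrow> countable \<omega>"
proof -
  assume w: "\<omega> \<in> configurations"
  have "\<omega> = (\<Union>n::nat. \<omega> \<inter> ball 0 (real n))"
    using reals_Archimedean2 by (auto simp: dist_norm)
  moreover have "countable (\<Union>n::nat. \<omega> \<inter> ball 0 (real n))"
    using config_finite[OF w, of "ball 0 _"] by (intro countable_UN) (auto intro: countable_finite)
  ultimately show ?thesis by simp
qed

lemma measurable_count_in [measurable]: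
  assumes "\<Delta> \<in> bounded_borel" shows "count_in \<Delta> \<in> measurable config_space (count_space UNIV)"
  unfolding measurable_count_space_eq2_countable
proof (intro conjI ballI)
  fix k
  have "count_in \<Delta> -` {k} \<inter> space config_space = {\<omega> \<in> configurations. count_in \<Delta> \<omega> = k}" by auto
  then show "count_in \<Delta> -` {k} \<inter> space config_space \<in> sets config_space"
    unfolding sets_config_space using assms by (auto intro!: sigma_sets.Basic)
qed auto

lemma measurable_configI:
  assumes "\<And>s. s \<in> space S \<Longrightarrow> \<kappa> s \<in> configurations"
    and "\<And>\<Delta>. \<Delta> \<in> bounded_borel \<Longrightarrow> (\<lambda>s. count_in \<Delta> (\<kappa> s)) \<in> measurable S (count_space UNIV)"
  shows "\<kappa> \<in> measurable S config_space"
  unfolding config_space_def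
proof (rule measurable_measure_of[OF count_generator_closed])
  show "\<kappa> \<in> space S \<rightarrow> configurations" using assms by auto
  fix Y assume "Y \<in> {{\<omega> \<in> configurations. count_in \<Delta> \<omega> = k} | \<Delta> k. \<Delta> \<in> bounded_borel}"
  then obtain \<Delta> k where Y: "Y = {\<omega> \<in> configurations. count_in \<Delta> \<omega> = k}" "\<Delta> \<in> bounded_borel" by auto
  have "\<kappa> -` Y \<inter> space S = (\<lambda>s. count_in \<Delta> (\<kappa> s)) -` {k} \<inter> space S" using Y assms(1) by auto
  then show "\<kappa> -` Y \<inter> space S \<in> sets S" using assms(2)[OF Y(2)] by (simp add: measurable_sets)
qed

lemma measurable_config_space_in: "\<kappa> \<in> measurable S config_space \<Longrightarrow> s \<in> space S \<Longrightarrow> \<kappa> s \<in> configurations"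
  using measurable_space[of \<kappa> S config_space s] by simp

lemma bounded_borel_Int: "\<Delta> \<in> bounded_borel \<Longrightarrow> B \<in> sets borel \<Longrightarrow> \<Delta> \<inter> B \<in> bounded_borel"
  by (auto simp: bounded_borel_def bounded_Int)

text \<open>On a rectangle \<open>C \<times> D\<close> the number of points is
  \<open>count_in (D \<inter> B)\<close> cut off by \<open>C\<close>; a Dynkin argument does the
  rest. The bounded set \<open>B\<close> keeps the counts finite, as the subtraction for complements
  requires.\<close>

lemma emeasure_points_measurable:
  assumes \<kappa>: "\<kappa> \<in> measurable S config_space" and B: "B \<in> bounded_borel"
    and X: "X \<in> sets (S \<Otimes>\<^sub>M (borel :: plane measure))"
  shows "(\<lambda>s. emeasure (count_space (\<kappa> s \<inter> B)) {x \<in> \<kappa> s \<inter> B. (s, x) \<in> X}) \<in> borel_measurable S"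
proof -
  note [measurable] = \<kappa>
  define e where "e X s = emeasure (count_space (\<kappa> s \<inter> B)) {x \<in> \<kappa> s \<inter> B. (s, x) \<in> X}" for X s
  have fin: "finite (\<kappa> s \<inter> B)" if "s \<in> space S" for s
    using config_finite[OF measurable_config_space_in[OF \<kappa> that]] B by (auto simp: bounded_borel_def)
  have "X \<in> sigma_sets (space S \<times> space borel) {a \<times> b |a b. a \<in> sets S \<and> b \<in> sets (borel :: plane measure)}"
    using X by (simp add: sets_pair_measure)
  with Int_stable_pair_measure_generator pair_measure_closed
  have "e X \<in> borel_measurable S"
  proof (induct rule: sigma_sets_induct_disjoint)
    case (basic X)
    then obtain C D where CD: "X = C \<times> D" "C \<in> sets S" "D \<in> sets borel" by auto
    have DB: "D \<inter> B \<in> bounded_borel" using bounded_borel_Int[OF B CD(3)] by (simp add: Int_commute)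
    have "(\<lambda>s. of_nat (count_in (D \<inter> B) (\<kappa> s)) * indicator C s :: ennreal) \<in> borel_measurable S"
      using CD(2) measurable_compose[OF \<kappa> measurable_count_in[OF DB]] by measurable
    moreover have "e X s = of_nat (count_in (D \<inter> B) (\<kappa> s)) * indicator C s" if "s \<in> space S" for s
    proof -
      have "{x \<in> \<kappa> s \<inter> B. (s, x) \<in> X} = (if s \<in> C then \<kappa> s \<inter> (D \<inter> B) else {})" using CD by auto
      moreover have "finite (\<kappa> s \<inter> (D \<inter> B))" using fin[OF that] by (rule rev_finite_subset) auto
      moreover have "emeasure (count_space (\<kappa> s \<inter> B)) (\<kappa> s \<inter> (D \<inter> B)) = of_nat (card (\<kappa> s \<inter> (D \<inter> B)))"
        using calculation(2) by (intro emeasure_count_space_finite) auto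
      ultimately show ?thesis unfolding e_def by (auto simp: count_in_def)
    qed
    ultimately show ?case by (subst measurable_cong) auto
  next
    case empty
    then show ?case by (simp add: e_def)
  next
    case (compl X)
    have "(\<lambda>s. of_nat (count_in B (\<kappa> s)) - e X s) \<in> borel_measurable S"
      using compl(2) measurable_compose[OF \<kappa> measurable_count_in[OF B]] by measurable
    moreover have "e (space S \<times> space borel - X) s = of_nat (count_in B (\<kappa> s)) - e X s" if "s \<in> space S" for s
    proof -
      have "{x \<in> \<kappa> s \<inter> B. (s, x) \<in> space S \<times> space borel - X} = (\<kappa> s \<inter> B) - {x \<in> \<kappa> s \<inter> B. (s, x) \<in> X}"
        using that by auto
      then have "e (space S \<times> space borel - X) s = of_nat (card ((\<kappa> s \<inter> B) - {x \<in> \<kappa> s \<inter> B. (s, x) \<in> X}))"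
        unfolding e_def using fin[OF that] by (subst emeasure_count_space_finite) auto
      also have "card ((\<kappa> s \<inter> B) - {x \<in> \<kappa> s \<inter> B. (s, x) \<in> X}) = card (\<kappa> s \<inter> B) - card {x \<in> \<kappa> s \<inter> B. (s, x) \<in> X}"
        using rev_finite_subset[OF fin[OF that], of "{x \<in> \<kappa> s \<inter> B. (s, x) \<in> X}"] by (intro card_Diff_subset) auto
      also have "of_nat \<dots> = (of_nat (count_in B (\<kappa> s)) - e X s :: ennreal)"
      proof -
        let ?Y = "{x \<in> \<kappa> s \<inter> B. (s, x) \<in> X}"
        have "finite ?Y" by (rule rev_finite_subset[OF fin[OF that]]) auto
        then have "e X s = of_nat (card ?Y)" unfolding e_def by (intro emeasure_count_space_finite) auto
        moreover have "card ?Y \<le> card (\<kappa> s \<inter> B)" by (rule card_mono[OF fin[OF that]]) auto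
        ultimately show ?thesis by (simp add: count_in_def of_nat_diff ennreal_of_nat_eq_real_of_nat ennreal_minus)
      qed
      finally show ?thesis .
    qed
    ultimately show ?case by (subst measurable_cong) auto
  next
    case (union A)
    have "(\<lambda>s. \<Sum>i. e (A i) s) \<in> borel_measurable S"
      using union(3) by measurable
    moreover have "e (\<Union>i. A i) s = (\<Sum>i. e (A i) s)" for s
    proof -
      have "{x \<in> \<kappa> s \<inter> B. (s, x) \<in> (\<Union>i. A i)} = (\<Union>i. {x \<in> \<kappa> s \<inter> B. (s, x) \<in> A i})" by auto
      moreover have "disjoint_family (\<lambda>i. {x \<in> \<kappa> s \<inter> B. (s, x) \<in> A i})"
        using union(1) by (auto simp: disjoint_family_on_def)
      ultimately show ?thesis unfolding e_def by (subst suminf_emeasure) auto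
    qed
    ultimately show ?case by simp
  qed
  then show ?thesis unfolding e_def .
qed

lemma nn_integral_points_bounded_measurable:
  assumes \<kappa>: "\<kappa> \<in> measurable S config_space" and B: "B \<in> bounded_borel"
    and F: "F \<in> borel_measurable (S \<Otimes>\<^sub>M (borel :: plane measure))"
  shows "(\<lambda>s. \<integral>\<^sup>+ x. F (s, x) \<partial>count_space (\<kappa> s \<inter> B)) \<in> borel_measurable S"
  using F
proof (induct rule: borel_measurable_induct)
  case (cong f g)
  have "(\<integral>\<^sup>+ x. f (s, x) \<partial>count_space (\<kappa> s \<inter> B)) = (\<integral>\<^sup>+ x. g (s, x) \<partial>count_space (\<kappa> s \<inter> B))" if "s \<in> space S" for s
    using cong(3) that by (intro nn_integral_cong) (auto simp: space_pair_measure)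
  then show ?case using cong(4) by (subst measurable_cong) auto
next
  case (set A)
  have "(\<integral>\<^sup>+ x. indicator A (s, x) \<partial>count_space (\<kappa> s \<inter> B)) = emeasure (count_space (\<kappa> s \<inter> B)) {x \<in> \<kappa> s \<inter> B. (s, x) \<in> A}" for s
  proof -
    have "(\<integral>\<^sup>+ x. indicator A (s, x) \<partial>count_space (\<kappa> s \<inter> B)) = (\<integral>\<^sup>+ x. indicator {x \<in> \<kappa> s \<inter> B. (s, x) \<in> A} x \<partial>count_space (\<kappa> s \<inter> B))"
      by (intro nn_integral_cong) (auto split: split_indicator)
    then show ?thesis by (subst (asm) nn_integral_indicator) auto
  qed
  then show ?case using emeasure_points_measurable[OF \<kappa> B set] by simp
next
  case (mult u c)
  then show ?case by (simp add: nn_integral_cmult)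
next
  case (add u v)
  then show ?case by (simp add: nn_integral_add)
next
  case (seq U)
  have "(\<integral>\<^sup>+ x. (SUP i. U i) (s, x) \<partial>count_space (\<kappa> s \<inter> B)) = (SUP i. \<integral>\<^sup>+ x. U i (s, x) \<partial>count_space (\<kappa> s \<inter> B))" for s
    unfolding SUP_apply using seq(4)
    by (intro nn_integral_monotone_convergence_SUP) (auto simp: incseq_def le_fun_def)
  then show ?case using seq(3) by simp
qed

text \<open>Sums over the points of a configuration depend measurably on the configuration; all other
  measurability statements about configurations and tiles are derived from this one.\<close>

lemma nn_integral_points_measurable:
  assumes \<kappa>: "\<kappa> \<in> measurable S config_space"
    and F: "F \<in> borel_measurable (S \<Otimes>\<^sub>M (borel :: plane measure))"
  shows "(\<lambda>s. \<integral>\<^sup>+ x. F (s, x) \<partial>count_space (\<kappa> s)) \<in> borel_measurable S"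
proof -
  have "(\<integral>\<^sup>+ x. F (s, x) \<partial>count_space (\<kappa> s)) = (SUP n::nat. \<integral>\<^sup>+ x. F (s, x) \<partial>count_space (\<kappa> s \<inter> ball 0 (real n)))" for s
  proof -
    have "(\<integral>\<^sup>+ x. F (s, x) \<partial>count_space (\<kappa> s)) = (\<integral>\<^sup>+ x. (SUP n::nat. F (s, x) * indicator (\<kappa> s \<inter> ball 0 (real n)) x) \<partial>count_space UNIV)"
    proof (subst nn_integral_count_space_indicator, simp, intro nn_integral_cong)
      fix x
      show "F (s, x) * indicator (\<kappa> s) x = (SUP n::nat. F (s, x) * indicator (\<kappa> s \<inter> ball 0 (real n)) x)"
      proof (rule antisym)
        obtain n :: nat where "norm x < n" using reals_Archimedean2 by auto
        then have "F (s, x) * indicator (\<kappa> s) x \<le> F (s, x) * indicator (\<kappa> s \<inter> ball 0 (real n)) x"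
          by (auto split: split_indicator)
        then show "F (s, x) * indicator (\<kappa> s) x \<le> (SUP n::nat. F (s, x) * indicator (\<kappa> s \<inter> ball 0 (real n)) x)"
          by (rule SUP_upper2[OF UNIV_I])
      qed (auto intro!: SUP_least mult_left_mono split: split_indicator)
    qed
    also have "\<dots> = (SUP n::nat. \<integral>\<^sup>+ x. F (s, x) * indicator (\<kappa> s \<inter> ball 0 (real n)) x \<partial>count_space UNIV)"
    proof (rule nn_integral_monotone_convergence_SUP)
      show "incseq (\<lambda>n x. F (s, x) * indicator (\<kappa> s \<inter> ball 0 (real n)) x)"
      proof (intro incseq_SucI le_funI mult_left_mono)
        fix n x
        have "\<kappa> s \<inter> ball 0 (real n) \<subseteq> \<kappa> s \<inter> ball 0 (real (Suc n))" by auto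
        then show "indicator (\<kappa> s \<inter> ball 0 (real n)) x \<le> (indicator (\<kappa> s \<inter> ball 0 (real (Suc n))) x :: ennreal)"
          by (rule indicator_leI[OF subsetD])
      qed auto
    qed auto
    also have "\<dots> = (SUP n::nat. \<integral>\<^sup>+ x. F (s, x) \<partial>count_space (\<kappa> s \<inter> ball 0 (real n)))"
      by (simp add: nn_integral_count_space_indicator)
    finally show ?thesis .
  qed
  moreover have "(\<lambda>s. SUP n::nat. \<integral>\<^sup>+ x. F (s, x) \<partial>count_space (\<kappa> s \<inter> ball 0 (real n))) \<in> borel_measurable S"
  proof (rule borel_measurable_SUP)
    fix n :: nat
    show "(\<lambda>s. \<integral>\<^sup>+ x. F (s, x) \<partial>count_space (\<kappa> s \<inter> ball 0 (real n))) \<in> borel_measurable S"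
      by (rule nn_integral_points_bounded_measurable[OF \<kappa> _ F]) (auto simp: bounded_borel_def)
  qed auto
  ultimately show ?thesis by simp
qed

lemma nn_integral_points_measurable' [measurable (raw)]:
  assumes "\<kappa> \<in> measurable S config_space"
    and "(\<lambda>p. F (fst p) (snd p)) \<in> borel_measurable (S \<Otimes>\<^sub>M (borel :: plane measure))"
  shows "(\<lambda>s. \<integral>\<^sup>+ x. F s x \<partial>count_space (\<kappa> s)) \<in> borel_measurable S"
  using nn_integral_points_measurable[OF assms] by simp

text \<open>Some point satisfies the predicate iff the sum of the indicators over all points is
  nonzero, so quantifiers over points reduce to sums over points.\<close>

lemma pred_points_ex:
  assumes \<kappa>: "\<kappa> \<in> measurable S config_space"
    and [measurable]: "Measurable.pred (S \<Otimes>\<^sub>M (borel :: plane measure)) (\<lambda>p. P (fst p) (snd p))"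
  shows "Measurable.pred S (\<lambda>s. \<exists>x\<in>\<kappa> s. P s x)"
proof -
  have "(\<lambda>s. \<integral>\<^sup>+ x. (if P s x then 1 else 0) \<partial>count_space (\<kappa> s)) \<in> borel_measurable S"
    using \<kappa> by (rule nn_integral_points_measurable') measurable
  then have "Measurable.pred S (\<lambda>s. (\<integral>\<^sup>+ x. (if P s x then 1 else 0) \<partial>count_space (\<kappa> s)) \<noteq> (0::ennreal))"
    by measurable
  moreover have "(\<integral>\<^sup>+ x. (if P s x then 1 else 0) \<partial>count_space (\<kappa> s)) \<noteq> (0::ennreal) \<longleftrightarrow> (\<exists>x\<in>\<kappa> s. P s x)" for s
    by (subst nn_integral_0_iff_AE) (auto simp: AE_count_space)
  ultimately show ?thesis by simp
qed

lemma pred_points_all: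
  assumes \<kappa>: "\<kappa> \<in> measurable S config_space"
    and [measurable]: "Measurable.pred (S \<Otimes>\<^sub>M (borel :: plane measure)) (\<lambda>p. P (fst p) (snd p))"
  shows "Measurable.pred S (\<lambda>s. \<forall>x\<in>\<kappa> s. P s x)"
proof -
  have "Measurable.pred S (\<lambda>s. \<not> (\<exists>x\<in>\<kappa> s. \<not> P s x))"
    using pred_points_ex[OF \<kappa>, of "\<lambda>s x. \<not> P s x"] by measurable
  then show ?thesis by simp
qed

lemma pred_point_in:
  assumes \<kappa>: "\<kappa> \<in> measurable S config_space" and g: "g \<in> borel_measurable S"
  shows "Measurable.pred S (\<lambda>s. g s \<in> \<kappa> s)"
proof -
  have "Measurable.pred S (\<lambda>s. \<exists>x\<in>\<kappa> s. x = g s)"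
  proof (rule pred_points_ex[OF \<kappa>])
    have "{p \<in> space (S \<Otimes>\<^sub>M borel). snd p = g (fst p)} \<in> sets (S \<Otimes>\<^sub>M borel)"
      using g by measurable
    then show "Measurable.pred (S \<Otimes>\<^sub>M borel) (\<lambda>p. snd p = g (fst p))" by (simp add: pred_def)
  qed
  then show ?thesis by simp
qed

lemma measurable_natI:
  assumes "(\<lambda>s. of_nat (n s) :: ennreal) \<in> borel_measurable S"
  shows "n \<in> measurable S (count_space (UNIV :: nat set))"
  unfolding measurable_count_space_eq2_countable
proof (intro conjI ballI)
  fix k
  have "n -` {k} \<inter> space S = (\<lambda>s. of_nat (n s) :: ennreal) -` {of_nat k} \<inter> space S" by auto
  then show "n -` {k} \<inter> space S \<in> sets S" using assms by (simp add: measurable_sets)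
qed auto

lemma measurable_config_insert [measurable (raw)]:
  assumes \<kappa>: "\<kappa> \<in> measurable S config_space" and g: "g \<in> borel_measurable S"
  shows "(\<lambda>s. insert (g s) (\<kappa> s)) \<in> measurable S config_space"
proof (rule measurable_configI)
  fix \<Delta> assume D: "\<Delta> \<in> bounded_borel"
  note [measurable] = measurable_compose[OF \<kappa> measurable_count_in[OF D]] pred_point_in[OF \<kappa> g] g
  have [measurable]: "\<Delta> \<in> sets borel" using D by (simp add: bounded_borel_def)
  have "(\<lambda>s. count_in \<Delta> (\<kappa> s) + (if g s \<in> \<Delta> \<and> g s \<notin> \<kappa> s then 1 else 0)) \<in> measurable S (count_space UNIV)"
    by measurable
  moreover have "count_in \<Delta> (insert (g s) (\<kappa> s)) = count_in \<Delta> (\<kappa> s) + (if g s \<in> \<Delta> \<and> g s \<notin> \<kappa> s then 1 else 0)"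
    if "s \<in> space S" for s
  proof -
    have "finite (\<kappa> s \<inter> \<Delta>)" using config_finite[OF measurable_config_space_in[OF \<kappa> that]] D by (auto simp: bounded_borel_def)
    then show ?thesis by (auto simp: count_in_def insert_absorb)
  qed
  ultimately show "(\<lambda>s. count_in \<Delta> (insert (g s) (\<kappa> s))) \<in> measurable S (count_space UNIV)"
    by (subst measurable_cong) auto
qed (use measurable_config_space_in[OF \<kappa>] config_insert in auto)

lemma measurable_config_remove [measurable (raw)]:
  assumes \<kappa>: "\<kappa> \<in> measurable S config_space" and g: "g \<in> borel_measurable S"
  shows "(\<lambda>s. \<kappa> s - {g s}) \<in> measurable S config_space"
proof (rule measurable_configI)
  fix \<Delta> assume D: "\<Delta> \<in> bounded_borel"
  note [measurable] = measurable_compose[OF \<kappa> measurable_count_in[OF D]] pred_point_in[OF \<kappa> g] g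
  have [measurable]: "\<Delta> \<in> sets borel" using D by (simp add: bounded_borel_def)
  have "(\<lambda>s. count_in \<Delta> (\<kappa> s) - (if g s \<in> \<Delta> \<and> g s \<in> \<kappa> s then 1 else 0)) \<in> measurable S (count_space UNIV)"
    by measurable
  moreover have "count_in \<Delta> (\<kappa> s - {g s}) = count_in \<Delta> (\<kappa> s) - (if g s \<in> \<Delta> \<and> g s \<in> \<kappa> s then 1 else 0)"
    if "s \<in> space S" for s
  proof -
    have "finite (\<kappa> s \<inter> \<Delta>)" using config_finite[OF measurable_config_space_in[OF \<kappa> that]] D by (auto simp: bounded_borel_def)
    moreover have "(\<kappa> s - {g s}) \<inter> \<Delta> = (\<kappa> s \<inter> \<Delta>) - {g s}" by auto
    ultimately show ?thesis by (simp add: count_in_def card_Diff_singleton_if)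
  qed
  ultimately show "(\<lambda>s. count_in \<Delta> (\<kappa> s - {g s})) \<in> measurable S (count_space UNIV)"
    by (subst measurable_cong) auto
qed (use measurable_config_space_in[OF \<kappa>] in \<open>auto intro: config_subset[OF _ Diff_subset]\<close>)

lemma measurable_config_patch [measurable (raw)]:
  assumes \<kappa>: "\<kappa> \<in> measurable S config_space" and \<kappa>': "\<kappa>' \<in> measurable S config_space" and B: "B \<in> sets borel"
  shows "(\<lambda>s. (\<kappa> s \<inter> B) \<union> (\<kappa>' s - B)) \<in> measurable S config_space"
proof (rule measurable_configI)
  fix \<Delta> assume D: "\<Delta> \<in> bounded_borel"
  have D': "\<Delta> \<inter> B \<in> bounded_borel" "\<Delta> \<inter> - B \<in> bounded_borel" using D B by (auto intro: bounded_borel_Int)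
  note [measurable] = measurable_compose[OF \<kappa> measurable_count_in[OF D'(1)]] measurable_compose[OF \<kappa>' measurable_count_in[OF D'(2)]]
  have "(\<lambda>s. count_in (\<Delta> \<inter> B) (\<kappa> s) + count_in (\<Delta> \<inter> - B) (\<kappa>' s)) \<in> measurable S (count_space UNIV)" by measurable
  moreover have "count_in \<Delta> ((\<kappa> s \<inter> B) \<union> (\<kappa>' s - B)) = count_in (\<Delta> \<inter> B) (\<kappa> s) + count_in (\<Delta> \<inter> - B) (\<kappa>' s)"
    if "s \<in> space S" for s
  proof -
    have "finite (\<kappa> s \<inter> (\<Delta> \<inter> B))" "finite (\<kappa>' s \<inter> (\<Delta> \<inter> - B))"
      using config_finite[OF measurable_config_space_in[OF \<kappa> that]] config_finite[OF measurable_config_space_in[OF \<kappa>' that]] D'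
      by (auto simp: bounded_borel_def)
    moreover have "((\<kappa> s \<inter> B) \<union> (\<kappa>' s - B)) \<inter> \<Delta> = (\<kappa> s \<inter> (\<Delta> \<inter> B)) \<union> (\<kappa>' s \<inter> (\<Delta> \<inter> - B))" by auto
    ultimately show ?thesis by (simp add: count_in_def card_Un_disjoint disjoint_iff)
  qed
  ultimately show "(\<lambda>s. count_in \<Delta> ((\<kappa> s \<inter> B) \<union> (\<kappa>' s - B))) \<in> measurable S (count_space UNIV)"
    by (subst measurable_cong) auto
qed (use measurable_config_space_in[OF \<kappa>] measurable_config_space_in[OF \<kappa>'] in \<open>auto intro!: config_Un intro: config_subset\<close>)

lemma config_empty: "{} \<in> configurations"
  by (simp add: configurations_def)

lemma measurable_config_restrict [measurable (raw)]:
  assumes \<kappa>: "\<kappa> \<in> measurable S config_space" and B: "B \<in> sets borel"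
  shows "(\<lambda>s. \<kappa> s \<inter> B) \<in> measurable S config_space"
  using measurable_config_patch[OF \<kappa> measurable_const[of "{}"] B] config_empty by simp

lemma shift_eq: "shift x \<omega> = {y. y + x \<in> \<omega>}"
  unfolding shift_def by (auto simp: image_iff) (metis add_diff_cancel)

lemma shift_config: "\<omega> \<in> configurations \<Longrightarrow> shift x \<omega> \<in> configurations"
proof -
  assume w: "\<omega> \<in> configurations"
  have "finite (shift x \<omega> \<inter> \<Delta>)" if "bounded \<Delta>" for \<Delta>
  proof -
    have "shift x \<omega> \<inter> \<Delta> = (\<lambda>y. y - x) ` (\<omega> \<inter> (\<lambda>y. y + x) ` \<Delta>)" unfolding shift_def by force
    moreover have "bounded ((\<lambda>y. y + x) ` \<Delta>)" using bounded_translation[OF that, of x] by (simp add: add.commute)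
    ultimately show ?thesis using config_finite[OF w] by simp
  qed
  then show ?thesis by (simp add: configurations_def)
qed

lemma measurable_config_shift [measurable (raw)]:
  assumes \<kappa>: "\<kappa> \<in> measurable S config_space" and g: "g \<in> borel_measurable S"
  shows "(\<lambda>s. shift (g s) (\<kappa> s)) \<in> measurable S config_space"
proof (rule measurable_configI)
  fix \<Delta> assume D: "\<Delta> \<in> bounded_borel"
  then have [measurable]: "\<Delta> \<in> sets borel" by (simp add: bounded_borel_def)
  note [measurable] = g
  have "(\<lambda>s. \<integral>\<^sup>+ x. indicator \<Delta> (x - g s) \<partial>count_space (\<kappa> s)) \<in> borel_measurable S"
    by (rule nn_integral_points_measurable'[OF \<kappa>]) measurable
  moreover have "of_nat (count_in \<Delta> (shift (g s) (\<kappa> s))) = (\<integral>\<^sup>+ x. indicator \<Delta> (x - g s) \<partial>count_space (\<kappa> s))"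
    if "s \<in> space S" for s
  proof -
    have fin: "finite (shift (g s) (\<kappa> s) \<inter> \<Delta>)"
      using config_finite[OF shift_config[OF measurable_config_space_in[OF \<kappa> that]]] D by (auto simp: bounded_borel_def)
    have b: "bij_betw (\<lambda>y. y - g s) (\<kappa> s) (shift (g s) (\<kappa> s))"
      unfolding shift_def by (auto simp: bij_betw_def inj_on_def)
    have "(\<integral>\<^sup>+ x. indicator \<Delta> (x - g s) \<partial>count_space (\<kappa> s)) = (\<integral>\<^sup>+ x. indicator \<Delta> x \<partial>count_space (shift (g s) (\<kappa> s)))"
      by (rule nn_integral_bij_count_space[OF b])
    also have "\<dots> = (\<integral>\<^sup>+ x. indicator (shift (g s) (\<kappa> s) \<inter> \<Delta>) x \<partial>count_space (shift (g s) (\<kappa> s)))"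
      by (intro nn_integral_cong) (auto split: split_indicator)
    also have "\<dots> = of_nat (count_in \<Delta> (shift (g s) (\<kappa> s)))"
      using fin by (subst nn_integral_indicator) (auto simp: count_in_def emeasure_count_space_finite)
    finally show ?thesis by simp
  qed
  ultimately have "(\<lambda>s. of_nat (count_in \<Delta> (shift (g s) (\<kappa> s))) :: ennreal) \<in> borel_measurable S"
    by (subst measurable_cong) auto
  then show "(\<lambda>s. count_in \<Delta> (shift (g s) (\<kappa> s))) \<in> measurable S (count_space UNIV)"
    by (rule measurable_natI)
qed (use measurable_config_space_in[OF \<kappa>] shift_config in auto)


section \<open>Measurability of the geometric quantities and of sums over tiles\<close>

lemma measurable_plane_component [measurable]: "(\<lambda>x::plane. x $ i) \<in> borel_measurable borel"
  by (intro borel_measurable_continuous_onI continuous_intros)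

lemma plane_vector_axis: "(vector [p, q] :: plane) = p *\<^sub>R axis 1 1 + q *\<^sub>R axis 2 1"
  by (simp add: plane_eq_iff axis_def)

lemma measurable_cross [measurable (raw)]:
  assumes [measurable]: "a \<in> borel_measurable S" "b \<in> borel_measurable S" "c \<in> borel_measurable S"
  shows "(\<lambda>s. cross (a s) (b s) (c s)) \<in> borel_measurable S"
  unfolding cross_def by measurable

lemma measurable_cot_angle [measurable (raw)]:
  assumes [measurable]: "a \<in> borel_measurable S" "b \<in> borel_measurable S" "c \<in> borel_measurable S"
  shows "(\<lambda>s. cot_angle (a s) (b s) (c s)) \<in> borel_measurable S"
  unfolding cot_angle_def by measurable

lemma measurable_pencil_centre [measurable (raw)]:
  assumes [measurable]: "a \<in> borel_measurable S" "b \<in> borel_measurable S" "t \<in> borel_measurable S"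
  shows "(\<lambda>s. pencil_centre (a s) (b s) (t s)) \<in> borel_measurable S"
  unfolding pencil_centre_def plane_vector_axis by measurable

text \<open>The order serves to list the vertices of a tile in exactly one way.\<close>

definition plane_less :: "plane \<Rightarrow> plane \<Rightarrow> bool" where
  "plane_less a b \<longleftrightarrow> a$1 < b$1 \<or> a$1 = b$1 \<and> a$2 < b$2"

lemma plane_less_linear: "a = b \<or> plane_less a b \<or> plane_less b a"
  by (auto simp: plane_less_def plane_eq_iff)

lemma plane_less_trans: "plane_less a b \<Longrightarrow> plane_less b c \<Longrightarrow> plane_less a c"
  by (auto simp: plane_less_def)

lemma plane_less_asym: "plane_less a b \<Longrightarrow> \<not> plane_less b a"
  by (auto simp: plane_less_def)

lemma plane_less_irrefl: "\<not> plane_less a a"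
  by (auto simp: plane_less_def)

lemma measurable_plane_less [measurable (raw)]:
  assumes [measurable]: "a \<in> borel_measurable S" "b \<in> borel_measurable S"
  shows "Measurable.pred S (\<lambda>s. plane_less (a s) (b s))"
  unfolding plane_less_def by measurable

definition ordered_tiles :: "(plane \<times> plane \<times> plane) set" where
  "ordered_tiles = {(a, b, c). plane_less a b \<and> plane_less b c \<and> cross a b c \<noteq> 0}"

lemma sorted_triple_unique:
  assumes "{a, b, c} = {a', b', c'}" "plane_less a b" "plane_less b c" "plane_less a' b'" "plane_less b' c'"
  shows "a = a' \<and> b = b' \<and> c = c'"
proof -
  have "a \<in> {a', b', c'}" "b \<in> {a', b', c'}" "c \<in> {a', b', c'}" "a' \<in> {a, b, c}" "b' \<in> {a, b, c}" "c' \<in> {a, b, c}"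
    using assms(1) by blast+
  then show ?thesis
    using assms(2-5) plane_less_trans[OF assms(2,3)] plane_less_trans[OF assms(4,5)]
    by (auto dest: plane_less_asym simp: plane_less_irrefl)
qed

lemma bij_ordered_tiles: "bij_betw (\<lambda>(a, b, c). {a, b, c}) ordered_tiles {\<tau>. tile \<tau>}"
  unfolding bij_betw_def
proof
  show "inj_on (\<lambda>(a, b, c). {a, b, c}) ordered_tiles"
  proof (rule inj_onI)
    fix t t' assume t: "t \<in> ordered_tiles" "t' \<in> ordered_tiles" "(case t of (a, b, c) \<Rightarrow> {a, b, c}) = (case t' of (a, b, c) \<Rightarrow> {a, b, c})"
    obtain a b c a' b' c' where "t = (a, b, c)" "t' = (a', b', c')" by (metis prod_cases3)
    then show "t = t'"
      using t sorted_triple_unique[of a b c a' b' c'] by (simp add: ordered_tiles_def)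
  qed
  show "(\<lambda>(a, b, c). {a, b, c}) ` ordered_tiles = {\<tau>. tile \<tau>}"
  proof
    show "{\<tau>. tile \<tau>} \<subseteq> (\<lambda>(a, b, c). {a, b, c}) ` ordered_tiles"
    proof
      fix \<tau> assume "\<tau> \<in> {\<tau>. tile \<tau>}"
      then have t0: "tile \<tau>" by simp
      obtain a b c where t: "\<tau> = {a, b, c}" "a \<noteq> b" "b \<noteq> c" "a \<noteq> c"
        using tile_obtain[OF t0] by blast
      have "\<exists>a b c. \<tau> = {a, b, c} \<and> plane_less a b \<and> plane_less b c"
      proof -
        have e: "\<tau> = {a, c, b}" "\<tau> = {b, a, c}" "\<tau> = {b, c, a}" "\<tau> = {c, a, b}" "\<tau> = {c, b, a}" using t(1) by auto
        consider "plane_less a b \<and> plane_less b c" | "plane_less a c \<and> plane_less c b" | "plane_less b a \<and> plane_less a c"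
          | "plane_less b c \<and> plane_less c a" | "plane_less c a \<and> plane_less a b" | "plane_less c b \<and> plane_less b a"
          using plane_less_linear[of a b] plane_less_linear[of b c] plane_less_linear[of a c] t by blast
        then show ?thesis using t(1) e by cases blast+
      qed
      then obtain a b c where s: "\<tau> = {a, b, c}" "plane_less a b" "plane_less b c" by blast
      then have "(a, b, c) \<in> ordered_tiles" using t0 by (simp add: ordered_tiles_def tile_iff_cross)
      then show "\<tau> \<in> (\<lambda>(a, b, c). {a, b, c}) ` ordered_tiles" using s(1) by force
    qed
  qed (auto simp: ordered_tiles_def tile_iff_cross)
qed

definition empty_triple :: "plane set \<Rightarrow> plane \<Rightarrow> plane \<Rightarrow> plane \<Rightarrow> bool" where
  "empty_triple \<omega> a b c \<longleftrightarrow> plane_less a b \<and> plane_less b c \<and> cross a b c \<noteq> 0 \<and>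
     (\<forall>p\<in>\<omega>. \<not> (p - a) \<bullet> (p - b) < cot_angle a b c * cross a b p)"

text \<open>With each tile listed once by its increasing vertices, the sum over tiles becomes an
  iterated sum over points of \<open>\<omega>\<close>, for which measurability is known. Emptiness
  of the disc enters through the cotangent test, again a quantifier over points.\<close>

lemma nn_integral_empty_disc_tiles:
  "(\<integral>\<^sup>+ \<tau>. f \<tau> \<partial>count_space (empty_disc_tiles \<omega>)) =
    (\<integral>\<^sup>+ a. \<integral>\<^sup>+ b. \<integral>\<^sup>+ c. (if empty_triple \<omega> a b c then f {a, b, c} else 0)
      \<partial>count_space \<omega> \<partial>count_space \<omega> \<partial>count_space \<omega>)"
proof -
  define h where "h = (\<lambda>(a, b, c). {a, b, c} :: plane set)"
  define G where "G = (\<lambda>(a, b, c). (if empty_triple \<omega> a b c then f {a, b, c} else 0) * indicator \<omega> a * indicator \<omega> b * indicator \<omega> c)"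
  have iff: "h t \<in> empty_disc_tiles \<omega> \<longleftrightarrow> (case t of (a, b, c) \<Rightarrow> empty_triple \<omega> a b c \<and> a \<in> \<omega> \<and> b \<in> \<omega> \<and> c \<in> \<omega>)"
    if "t \<in> ordered_tiles" for t
    using that in_tile_disc_iff
    by (auto simp: h_def ordered_tiles_def empty_disc_tiles_def empty_triple_def tile_iff_cross)
  have b: "bij_betw h {t \<in> ordered_tiles. h t \<in> empty_disc_tiles \<omega>} (empty_disc_tiles \<omega>)"
  proof (rule bij_betw_subset[OF bij_ordered_tiles[folded h_def]])
    have "h ` ordered_tiles = {\<tau>. tile \<tau>}"
      using bij_betw_imp_surj_on[OF bij_ordered_tiles] by (simp add: h_def)
    moreover have "empty_disc_tiles \<omega> \<subseteq> {\<tau>. tile \<tau>}" by (auto simp: empty_disc_tiles_def)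
    ultimately have sub: "empty_disc_tiles \<omega> \<subseteq> h ` ordered_tiles" by simp
    show "h ` {t \<in> ordered_tiles. h t \<in> empty_disc_tiles \<omega>} = empty_disc_tiles \<omega>"
    proof (intro equalityI subsetI)
      fix \<tau> assume \<tau>: "\<tau> \<in> empty_disc_tiles \<omega>"
      then have "\<tau> \<in> h ` ordered_tiles" using sub by (rule subsetD[rotated])
      then obtain t where "\<tau> = h t" "t \<in> ordered_tiles" by (rule imageE)
      then show "\<tau> \<in> h ` {t \<in> ordered_tiles. h t \<in> empty_disc_tiles \<omega>}" using \<tau> by (intro image_eqI[of _ _ t]) simp_all
    qed (erule imageE, simp)
  qed auto
  have "(\<integral>\<^sup>+ \<tau>. f \<tau> \<partial>count_space (empty_disc_tiles \<omega>)) = (\<integral>\<^sup>+ t. f (h t) \<partial>count_space {t \<in> ordered_tiles. h t \<in> empty_disc_tiles \<omega>})"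
    by (rule nn_integral_bij_count_space[OF b, symmetric])
  also have "\<dots> = (\<integral>\<^sup>+ t. f (h t) * indicator {t \<in> ordered_tiles. h t \<in> empty_disc_tiles \<omega>} t \<partial>count_space UNIV)"
    by (simp add: nn_integral_count_space_indicator)
  also have "\<dots> = (\<integral>\<^sup>+ t. G t \<partial>count_space UNIV)"
  proof (intro nn_integral_cong)
    fix t :: "plane \<times> plane \<times> plane"
    obtain a b c where t: "t = (a, b, c)" by (cases t)
    show "f (h t) * indicator {t \<in> ordered_tiles. h t \<in> empty_disc_tiles \<omega>} t = G t"
    proof (cases "t \<in> ordered_tiles")
      case True
      then show ?thesis using iff[OF True] unfolding t G_def by (auto simp: h_def split: split_indicator)
    next
      case False
      then have "\<not> empty_triple \<omega> a b c" unfolding t by (auto simp: ordered_tiles_def empty_triple_def)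
      then show ?thesis using False unfolding t G_def by simp
    qed
  qed
  also have "\<dots> = (\<integral>\<^sup>+ a. \<integral>\<^sup>+ b. \<integral>\<^sup>+ c. G (a, b, c) \<partial>count_space UNIV \<partial>count_space UNIV \<partial>count_space UNIV)"
  proof -
    have "(\<integral>\<^sup>+ t. G t \<partial>count_space UNIV) = (\<integral>\<^sup>+ a. \<integral>\<^sup>+ t. G (a, t) \<partial>count_space UNIV \<partial>count_space UNIV)"
      by (rule nn_integral_fst_count_space[symmetric])
    also have "\<dots> = (\<integral>\<^sup>+ a. \<integral>\<^sup>+ b. \<integral>\<^sup>+ c. G (a, b, c) \<partial>count_space UNIV \<partial>count_space UNIV \<partial>count_space UNIV)"
      by (intro nn_integral_cong nn_integral_fst_count_space[symmetric])
    finally show ?thesis .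
  qed
  also have "\<dots> = (\<integral>\<^sup>+ a. \<integral>\<^sup>+ b. \<integral>\<^sup>+ c. (if empty_triple \<omega> a b c then f {a, b, c} else 0)
      \<partial>count_space \<omega> \<partial>count_space \<omega> \<partial>count_space \<omega>)"
  proof -
    have e: "(\<integral>\<^sup>+ x. g x \<partial>count_space \<omega>) = (\<integral>\<^sup>+ x. g x * indicator \<omega> x \<partial>count_space UNIV)" for g :: "plane \<Rightarrow> ennreal"
      by (simp add: nn_integral_count_space_indicator)
    show ?thesis unfolding e
      by (intro nn_integral_cong) (simp add: G_def nn_integral_cmult ac_simps)
  qed
  finally show ?thesis .
qed

lemma shift_tile:
  assumes "tile \<tau>"
  shows "tile (shift x \<tau>)" "tile_centre (shift x \<tau>) = tile_centre \<tau> - x" "tile_radius (shift x \<tau>) = tile_radius \<tau>"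
proof -
  obtain a b c where abc: "\<tau> = {a, b, c}" "cross a b c > 0" using assms by (rule tile_obtain)
  have s: "shift x \<tau> = {a - x, b - x, c - x}" by (simp add: shift_def abc)
  have "cross (a - x) (b - x) (c - x) = cross a b c" by (simp add: cross_def)
  then show t: "tile (shift x \<tau>)" unfolding s using abc by (simp add: tile_iff_cross)
  have "shift x \<tau> \<subseteq> sphere (tile_centre \<tau> - x) (tile_radius \<tau>)"
  proof
    fix y assume "y \<in> shift x \<tau>"
    then obtain z where "z \<in> \<tau>" "y = z - x" by (auto simp: shift_def)
    then show "y \<in> sphere (tile_centre \<tau> - x) (tile_radius \<tau>)" using tile_on_circle[OF assms] by (auto simp: dist_norm)
  qed
  then show "tile_centre (shift x \<tau>) = tile_centre \<tau> - x" "tile_radius (shift x \<tau>) = tile_radius \<tau>"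
    using tile_circle_unique[OF t] by auto
qed

lemma centred_tile_shift: "tile \<tau> \<Longrightarrow> shift (tile_centre \<tau>) \<tau> \<in> centred_tiles"
  using shift_tile by (auto simp: centred_tiles_def)

lemma centred_tiles_nonempty: "centred_tiles \<noteq> {}"
proof -
  have "tile {0, axis 1 1, axis 2 1}" by (simp add: tile_iff_cross cross_def axis_def)
  then show ?thesis using centred_tile_shift by blast
qed

lemma centred_tiles_config: "centred_tiles \<subseteq> configurations"
  using finite_tile config_finite_set by (auto simp: centred_tiles_def)

lemma space_centred_tile_space [simp]: "space centred_tile_space = centred_tiles"
  using centred_tiles_config by (auto simp: centred_tile_space_def space_restrict_space)

lemma measurable_centred_tile_config: "(\<lambda>\<tau>. \<tau>) \<in> measurable centred_tile_space config_space"
  unfolding centred_tile_space_def by (rule measurable_restrict_space1) simp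

lemma empty_triple_measurable:
  assumes \<kappa>: "\<kappa> \<in> measurable S config_space"
    and a: "a \<in> borel_measurable S" and b: "b \<in> borel_measurable S" and c: "c \<in> borel_measurable S"
  shows "Measurable.pred S (\<lambda>s. empty_triple (\<kappa> s) (a s) (b s) (c s))"
proof -
  note [measurable] = a b c
  have [measurable]: "Measurable.pred S (\<lambda>s. \<forall>p\<in>\<kappa> s. \<not> (p - a s) \<bullet> (p - b s) < cot_angle (a s) (b s) (c s) * cross (a s) (b s) p)"
    by (rule pred_points_all[OF \<kappa>]) measurable
  show ?thesis unfolding empty_triple_def by measurable
qed

lemma nn_integral_tiles_measurable:
  assumes \<kappa>: "\<kappa> \<in> measurable S config_space"
    and f: "(\<lambda>p. f (fst p) (fst (snd p)) (snd (snd p))) \<in> borel_measurable (S \<Otimes>\<^sub>M (borel \<Otimes>\<^sub>M centred_tile_space))"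
  shows "(\<lambda>s. \<integral>\<^sup>+ \<tau>. f s (tile_centre \<tau>) (shift (tile_centre \<tau>) \<tau>) \<partial>count_space (empty_disc_tiles (\<kappa> s))) \<in> borel_measurable S"
proof -
  obtain \<tau>0 where t0: "\<tau>0 \<in> centred_tiles" using centred_tiles_nonempty by auto
  define cc where "cc a b c = pencil_centre a b (cot_angle a b c)" for a b c
  \<comment> \<open>Collinear triples receive a fixed centred tile as default value, so that the map
    takes its values in \<open>centred_tiles\<close> everywhere. They do not contribute to the
    sum.\<close>
  define ct where "ct a b c = (if cross a b c \<noteq> 0 then {a - cc a b c, b - cc a b c, c - cc a b c} else \<tau>0)" for a b c
  have ct: "shift (tile_centre {a, b, c}) {a, b, c} = ct a b c" "tile_centre {a, b, c} = cc a b c" if "cross a b c \<noteq> 0" for a b c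
    using tile_pencil(1)[OF that] that by (simp_all add: ct_def cc_def shift_def)
  have ct': "shift (cc a b c) {a, b, c} = ct a b c" if "cross a b c \<noteq> 0" for a b c using ct[OF that] by simp
  have ctm: "(\<lambda>s. ct (a s) (b s) (c s)) \<in> measurable T centred_tile_space"
    if [measurable]: "a \<in> borel_measurable T" "b \<in> borel_measurable T" "c \<in> borel_measurable T" for a b c and T :: "'t measure"
    unfolding centred_tile_space_def
  proof (rule measurable_restrict_space2)
    show "(\<lambda>s. ct (a s) (b s) (c s)) \<in> space T \<rightarrow> centred_tiles"
    proof
      fix s
      show "ct (a s) (b s) (c s) \<in> centred_tiles"
      proof (cases "cross (a s) (b s) (c s) = 0")
        case True then show ?thesis using t0 by (simp add: ct_def)
      next
        case False
        then show ?thesis using ct(1)[OF False] centred_tile_shift[of "{a s, b s, c s}"] by (simp add: tile_iff_cross)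
      qed
    qed
    have [measurable]: "(\<lambda>s. \<tau>0) \<in> measurable T config_space" "(\<lambda>s. {}) \<in> measurable T config_space"
      using t0 centred_tiles_config config_empty by auto
    show "(\<lambda>s. ct (a s) (b s) (c s)) \<in> measurable T config_space"
      unfolding ct_def cc_def by measurable
  qed
  let ?F = "\<lambda>s a b c. if empty_triple (\<kappa> s) a b c then f s (cc a b c) (ct a b c) else 0"
  have F: "(\<lambda>t. ?F (s t) (a t) (b t) (c t)) \<in> borel_measurable T"
    if [measurable]: "s \<in> measurable T S" "a \<in> borel_measurable T" "b \<in> borel_measurable T" "c \<in> borel_measurable T" for a b c s and T :: "'t measure"
  proof -
    note [measurable] = empty_triple_measurable[OF measurable_compose[OF that(1) \<kappa>] that(2-4)] ctm[OF that(2-4)]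
    have "(\<lambda>t. (s t, cc (a t) (b t) (c t), ct (a t) (b t) (c t))) \<in> measurable T (S \<Otimes>\<^sub>M (borel \<Otimes>\<^sub>M centred_tile_space))"
      unfolding cc_def by measurable
    from measurable_compose[OF this f] have [measurable]: "(\<lambda>t. f (s t) (cc (a t) (b t) (c t)) (ct (a t) (b t) (c t))) \<in> borel_measurable T"
      by simp
    show ?thesis by measurable
  qed
  have "(\<lambda>s. \<integral>\<^sup>+ a. \<integral>\<^sup>+ b. \<integral>\<^sup>+ c. ?F s a b c \<partial>count_space (\<kappa> s) \<partial>count_space (\<kappa> s) \<partial>count_space (\<kappa> s)) \<in> borel_measurable S"
  proof (intro nn_integral_points_measurable'[OF \<kappa>] nn_integral_points_measurable'[OF measurable_compose[OF measurable_fst \<kappa>]]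
      nn_integral_points_measurable'[OF measurable_compose[OF measurable_fst measurable_compose[OF measurable_fst \<kappa>]]])
    show "(\<lambda>p. ?F (fst (fst (fst p))) (snd (fst (fst p))) (snd (fst p)) (snd p)) \<in> borel_measurable (((S \<Otimes>\<^sub>M borel) \<Otimes>\<^sub>M borel) \<Otimes>\<^sub>M borel)"
      by (rule F) measurable
  qed
  moreover have "(\<integral>\<^sup>+ \<tau>. f s (tile_centre \<tau>) (shift (tile_centre \<tau>) \<tau>) \<partial>count_space (empty_disc_tiles (\<kappa> s))) =
     (\<integral>\<^sup>+ a. \<integral>\<^sup>+ b. \<integral>\<^sup>+ c. ?F s a b c \<partial>count_space (\<kappa> s) \<partial>count_space (\<kappa> s) \<partial>count_space (\<kappa> s))" for s
    unfolding nn_integral_empty_disc_tiles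
    by (intro nn_integral_cong) (auto simp: empty_triple_def ct(2) ct')
  ultimately show ?thesis by simp
qed

section \<open>Void probabilities\<close>

definition void_event :: "plane set \<Rightarrow> plane set set" where
  "void_event B = {\<omega> \<in> configurations. \<omega> \<inter> B = {}}"

text \<open>The index of the half-open dyadic square of side length 2^-n that contains the
  point.\<close>

definition grid :: "nat \<Rightarrow> plane \<Rightarrow> int \<times> int" where
  "grid n x = (\<lfloor>2 ^ n * x$1\<rfloor>, \<lfloor>2 ^ n * x$2\<rfloor>)"

definition cell :: "nat \<Rightarrow> int \<times> int \<Rightarrow> plane set" where
  "cell n c = grid n -` {c}"

lemma in_cell [simp]: "x \<in> cell n c \<longleftrightarrow> grid n x = c"
  by (simp add: cell_def)

lemma cell_borel [measurable]: "cell n c \<in> sets borel"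
proof -
  have "cell n c = {x \<in> space borel. \<lfloor>2 ^ n * x$1\<rfloor> = fst c \<and> \<lfloor>2 ^ n * x$2\<rfloor> = snd c}"
    by (auto simp: cell_def grid_def)
  also have "\<dots> \<in> sets borel" by measurable
  finally show ?thesis .
qed

lemma cell_unoccupied_iff: "\<omega> \<inter> (\<Delta> \<inter> cell n c) = {} \<longleftrightarrow> c \<notin> grid n ` (\<omega> \<inter> \<Delta>)"
  unfolding disjoint_iff image_iff Int_iff in_cell Bex_def by metis

lemma finite_grid_image:
  assumes "bounded \<Delta>" shows "finite (grid n ` \<Delta>)"
proof -
  obtain K where K: "\<And>x. x \<in> \<Delta> \<Longrightarrow> norm x \<le> K" using assms by (auto simp: bounded_iff)
  define m where "m = \<lceil>2 ^ n * K\<rceil> + 1"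
  have "grid n ` \<Delta> \<subseteq> {-m..m} \<times> {-m..m}"
  proof
    fix c assume "c \<in> grid n ` \<Delta>"
    then obtain x where x: "x \<in> \<Delta>" "c = grid n x" by auto
    have "\<bar>\<lfloor>2 ^ n * x$i\<rfloor>\<bar> \<le> m" for i
    proof -
      have "\<bar>x$i\<bar> \<le> K" using component_le_norm_cart[of x i] K[OF x(1)] by linarith
      then have "\<bar>2 ^ n * x$i\<bar> \<le> 2 ^ n * K" by (simp add: abs_mult)
      then have "2 ^ n * x$i \<le> 2 ^ n * K" "- (2 ^ n * K) \<le> 2 ^ n * x$i" by linarith+
      then show ?thesis unfolding m_def by linarith
    qed
    from this[of 1] this[of 2] show "c \<in> {-m..m} \<times> {-m..m}" using x(2) by (auto simp: grid_def)
  qed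
  then show ?thesis by (rule finite_subset) simp
qed

lemma grid_separates:
  assumes "x \<noteq> y" shows "eventually (\<lambda>n. grid n x \<noteq> grid n y) sequentially"
proof -
  obtain i where i: "i = 1 \<or> i = 2" "x$i \<noteq> y$i" using assms by (auto simp: plane_eq_iff)
  define d where "d = \<bar>x$i - y$i\<bar>"
  have d: "d > 0" using i by (simp add: d_def)
  obtain N where N: "inverse d < 2 ^ N" using real_arch_pow[of 2 "inverse d"] by auto
  have "grid n x \<noteq> grid n y" if n: "n \<ge> N" for n
  proof
    assume "grid n x = grid n y"
    then have "\<lfloor>2 ^ n * x$i\<rfloor> = \<lfloor>2 ^ n * y$i\<rfloor>" using i(1) by (auto simp: grid_def)
    then have "\<bar>2 ^ n * x$i - 2 ^ n * y$i\<bar> < 1" by linarith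
    moreover have "\<bar>2 ^ n * x$i - 2 ^ n * y$i\<bar> = 2 ^ n * d"
      by (simp add: d_def abs_mult right_diff_distrib[symmetric])
    moreover have "(2::real) ^ N \<le> 2 ^ n" using n by simp
    then have "inverse d < 2 ^ n" using N by linarith
    then have "1 < 2 ^ n * d" using d by (simp add: field_simps)
    ultimately show False by linarith
  qed
  then show ?thesis by (auto simp: eventually_sequentially)
qed

text \<open>The grid eventually separates any two distinct points, so on a finite set the sequence
  is eventually constant.\<close>

lemma card_grid_tendsto:
  assumes "finite A" shows "(\<lambda>n. real (card (grid n ` A))) \<longlonglongrightarrow> real (card A)"
proof -
  have "\<forall>x\<in>A. \<forall>y\<in>A. eventually (\<lambda>n. x \<noteq> y \<longrightarrow> grid n x \<noteq> grid n y) sequentially"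
    using grid_separates by (auto elim: eventually_mono)
  then have "eventually (\<lambda>n. \<forall>x\<in>A. \<forall>y\<in>A. x \<noteq> y \<longrightarrow> grid n x \<noteq> grid n y) sequentially"
    using assms by (simp add: eventually_ball_finite)
  then have "eventually (\<lambda>n. real (card (grid n ` A)) = real (card A)) sequentially"
    by (rule eventually_mono) (auto intro!: card_image inj_onI)
  then show ?thesis by (rule tendsto_eventually)
qed

definition void_events :: "plane set \<Rightarrow> plane set set set" where
  "void_events \<Delta> = {void_event B | B. B \<in> bounded_borel \<and> B \<subseteq> \<Delta>}"

lemma void_events_closed: "void_events \<Delta> \<subseteq> Pow configurations"
  by (auto simp: void_events_def void_event_def)

lemma bounded_borel_Un: "A \<in> bounded_borel \<Longrightarrow> B \<in> bounded_borel \<Longrightarrow> A \<union> B \<in> bounded_borel"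
  by (auto simp: bounded_borel_def)

lemma void_event_Int: "void_event A \<inter> void_event B = void_event (A \<union> B)"
  by (auto simp: void_event_def)

lemma Int_stable_void_events: "Int_stable (void_events \<Delta>)"
proof (rule Int_stableI)
  fix a b assume "a \<in> void_events \<Delta>" "b \<in> void_events \<Delta>"
  then obtain A B where "a = void_event A" "b = void_event B" "A \<in> bounded_borel" "B \<in> bounded_borel" "A \<subseteq> \<Delta>" "B \<subseteq> \<Delta>"
    by (auto simp: void_events_def)
  then show "a \<inter> b \<in> void_events \<Delta>"
    unfolding void_events_def using bounded_borel_Un by (auto simp: void_event_Int)
qed

lemma void_event_sets [measurable]: "B \<in> bounded_borel \<Longrightarrow> void_event B \<in> sets config_space"
proof -
  assume B: "B \<in> bounded_borel"
  have "void_event B = {\<omega> \<in> configurations. count_in B \<omega> = 0}"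
    using B config_finite by (auto simp: void_event_def count_in_def bounded_borel_def)
  then show ?thesis unfolding sets_config_space using B by (auto intro!: sigma_sets.Basic)
qed

text \<open>The number of points in a bounded set is the limit of the numbers of occupied grid cells;
  hence the void events generate the \<open>\<sigma>\<close>-algebra.\<close>

lemma count_in_void_measurable:
  assumes D: "\<Delta> \<in> bounded_borel"
  shows "count_in \<Delta> \<in> measurable (sigma configurations (void_events \<Delta>)) (count_space UNIV)"
proof -
  define M where "M = sigma configurations (void_events \<Delta>)"
  have sp: "space M = configurations" unfolding M_def by (rule space_measure_of[OF void_events_closed])
  have st: "sets M = sigma_sets configurations (void_events \<Delta>)" unfolding M_def by (rule sets_measure_of[OF void_events_closed])
  have bd: "bounded \<Delta>" "\<Delta> \<in> sets borel" using D by (auto simp: bounded_borel_def)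
  have occ: "(\<lambda>\<omega>. real (card (grid n ` (\<omega> \<inter> \<Delta>)))) \<in> borel_measurable M" for n
  proof -
    define C where "C = grid n ` \<Delta>"
    have finC: "finite C" unfolding C_def by (rule finite_grid_image[OF bd(1)])
    have [measurable]: "void_event (\<Delta> \<inter> cell n c) \<in> sets M" for c
      unfolding st void_events_def using bounded_borel_Int[OF D cell_borel]
      by (intro sigma_sets.Basic CollectI exI[of _ "\<Delta> \<inter> cell n c"]) auto
    have "(\<lambda>\<omega>. \<Sum>c\<in>C. 1 - indicator (void_event (\<Delta> \<inter> cell n c)) \<omega> :: real) \<in> borel_measurable M" by measurable
    moreover have "real (card (grid n ` (\<omega> \<inter> \<Delta>))) = (\<Sum>c\<in>C. 1 - indicator (void_event (\<Delta> \<inter> cell n c)) \<omega>)"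
      if "\<omega> \<in> space M" for \<omega>
    proof -
      have "(\<Sum>c\<in>C. 1 - indicator (void_event (\<Delta> \<inter> cell n c)) \<omega> :: real) = (\<Sum>c\<in>C. if c \<in> grid n ` (\<omega> \<inter> \<Delta>) then 1 else 0)"
        using that unfolding sp by (intro sum.cong) (auto simp: void_event_def indicator_def cell_unoccupied_iff)
      also have "\<dots> = real (card (C \<inter> grid n ` (\<omega> \<inter> \<Delta>)))" using finC by (simp add: sum.If_cases)
      also have "C \<inter> grid n ` (\<omega> \<inter> \<Delta>) = grid n ` (\<omega> \<inter> \<Delta>)" by (auto simp: C_def)
      finally show ?thesis by simp
    qed
    ultimately show ?thesis by (subst measurable_cong) auto
  qed
  have "(\<lambda>\<omega>. real (count_in \<Delta> \<omega>)) \<in> borel_measurable M"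
  proof (rule borel_measurable_LIMSEQ_real[OF _ occ])
    fix \<omega> assume "\<omega> \<in> space M"
    then have "finite (\<omega> \<inter> \<Delta>)" using config_finite bd(1) by (simp add: sp)
    then show "(\<lambda>n. real (card (grid n ` (\<omega> \<inter> \<Delta>)))) \<longlonglongrightarrow> real (count_in \<Delta> \<omega>)"
      unfolding count_in_def by (rule card_grid_tendsto)
  qed
  then have "(\<lambda>\<omega>. of_nat (count_in \<Delta> \<omega>) :: ennreal) \<in> borel_measurable M"
    unfolding ennreal_of_nat_eq_real_of_nat by measurable
  then show ?thesis unfolding M_def[symmetric] by (rule measurable_natI)
qed

lemma sigma_void_events_mono:
  assumes "\<Delta> \<subseteq> \<Delta>'" shows "sigma_sets configurations (void_events \<Delta>) \<subseteq> sigma_sets configurations (void_events \<Delta>')"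
  using assms by (intro sigma_sets_mono') (auto simp: void_events_def)

lemma count_event_void_sets:
  assumes "\<Delta> \<in> bounded_borel"
  shows "{\<omega> \<in> configurations. count_in \<Delta> \<omega> \<in> K} \<in> sigma_sets configurations (void_events \<Delta>)"
proof -
  have "count_in \<Delta> -` K \<inter> space (sigma configurations (void_events \<Delta>)) \<in> sets (sigma configurations (void_events \<Delta>))"
    using count_in_void_measurable[OF assms] by (rule measurable_sets) simp
  moreover have "count_in \<Delta> -` K \<inter> configurations = {\<omega> \<in> configurations. count_in \<Delta> \<omega> \<in> K}" by auto
  ultimately show ?thesis
    unfolding space_measure_of[OF void_events_closed] sets_measure_of[OF void_events_closed] by simp
qed

lemma sets_config_space_void: "sets config_space = sigma_sets configurations (void_events UNIV)"
proof
  show "sigma_sets configurations (void_events UNIV) \<subseteq> sets config_space"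
  proof -
    have "void_events UNIV \<subseteq> sets config_space" by (auto simp: void_events_def)
    from sets.sigma_sets_subset[OF this] show ?thesis by simp
  qed
  show "sets config_space \<subseteq> sigma_sets configurations (void_events UNIV)"
    unfolding sets_config_space
  proof (rule sigma_sets_mono, safe)
    fix \<Delta> k assume "\<Delta> \<in> bounded_borel"
    then show "{\<omega> \<in> configurations. count_in \<Delta> \<omega> = k} \<in> sigma_sets configurations (void_events UNIV)"
      using count_event_void_sets[of \<Delta> "{k}"] sigma_void_events_mono[of \<Delta> UNIV] by auto
  qed
qed

lemma empty_bounded_borel: "{} \<in> bounded_borel"
  by (simp add: bounded_borel_def)

lemma void_event_empty: "void_event {} = configurations"
  by (auto simp: void_event_def)

text \<open>Void events are stable under intersection, because two sets are empty of points iff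
  their union is, and they generate the \<sigma>-algebra. Hence the avoidance probabilities
  determine the law.\<close>

lemma point_process_eqI:
  assumes "point_process P" "point_process P'"
    and "\<And>B. B \<in> bounded_borel \<Longrightarrow> emeasure P (void_event B) = emeasure P' (void_event B)"
  shows "P = P'"
proof (rule measure_eqI_generator_eq[OF Int_stable_void_events void_events_closed, of UNIV])
  show "range (\<lambda>_::nat. configurations) \<subseteq> void_events UNIV"
    using empty_bounded_borel void_event_empty by (auto simp: void_events_def)
  interpret prob_space P using assms(1) by (simp add: point_process_def)
  show "emeasure P configurations \<noteq> \<infinity>" by simp
qed (use assms sets_config_space_void in \<open>auto simp: void_events_def point_process_def\<close>)

lemma space_point_process: "point_process P \<Longrightarrow> space P = configurations"
  using sets_eq_imp_space_eq[of P config_space] by (simp add: point_process_def)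

text \<open>By Renyi's theorem the void probabilities alone determine a Poisson process.\<close>

locale poisson_voids = prob_space P for P :: "plane set measure" and z :: real +
  assumes z: "z > 0" and sets_P: "sets P = sets config_space"
    and void: "B \<in> bounded_borel \<Longrightarrow> prob (void_event B) = exp (- (z * measure lborel B))"
begin

lemma pp: "point_process P"
  using sets_P prob_space_axioms by (simp add: point_process_def)

lemma space_P: "space P = configurations"
  by (rule space_point_process[OF pp])

lemma void_in_events: "B \<in> bounded_borel \<Longrightarrow> void_event B \<in> events"
  using void_event_sets sets_P by simp

lemma count_measurable: "\<Delta> \<in> bounded_borel \<Longrightarrow> count_in \<Delta> \<in> measurable P (count_space UNIV)"
  using measurable_count_in measurable_cong_sets[OF sets_P refl] by blast

text \<open>For disjoint sets the avoidance probability of the union factorizes because the area is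
  additive. The void events inside a set form an intersection-stable system whose \<sigma>-algebra
  makes the count measurable, so independence passes to the counts.\<close>

lemma indep_counts:
  fixes \<Delta> :: "'i \<Rightarrow> plane set"
  assumes D: "\<And>i. i \<in> I \<Longrightarrow> \<Delta> i \<in> bounded_borel" and disj: "disjoint_family_on \<Delta> I"
  shows "indep_vars (\<lambda>_. count_space UNIV) (\<lambda>i. count_in (\<Delta> i)) I"
proof -
  have "indep_sets (\<lambda>i. void_events (\<Delta> i)) I"
  proof (rule indep_setsI)
    show "void_events (\<Delta> i) \<subseteq> events" for i using void_in_events by (auto simp: void_events_def)
    fix A J assume J: "J \<noteq> {}" "J \<subseteq> I" "finite J" "\<forall>j\<in>J. A j \<in> void_events (\<Delta> j)"
    then have "\<forall>j\<in>J. \<exists>B. A j = void_event B \<and> B \<in> bounded_borel \<and> B \<subseteq> \<Delta> j" by (auto simp: void_events_def)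
    then obtain B where B: "\<And>j. j \<in> J \<Longrightarrow> A j = void_event (B j) \<and> B j \<in> bounded_borel \<and> B j \<subseteq> \<Delta> j" by metis
    have U: "(\<Union>j\<in>J. B j) \<in> bounded_borel" using B J(3) by (auto simp: bounded_borel_def intro!: sets.finite_UN)
    have "(\<Inter>j\<in>J. A j) = void_event (\<Union>j\<in>J. B j)"
      using B J(1) by (auto simp: void_event_def)
    then have "prob (\<Inter>j\<in>J. A j) = exp (- (z * measure lborel (\<Union>j\<in>J. B j)))" using void[OF U] by simp
    also have "measure lborel (\<Union>j\<in>J. B j) = (\<Sum>j\<in>J. measure lborel (B j))"
    proof (rule measure_finite_Union[OF J(3)])
      show "disjoint_family_on B J"
        using disj B J(2) unfolding disjoint_family_on_def by blast
      show "emeasure lborel (B j) \<noteq> \<infinity>" if "j \<in> J" for j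
        using emeasure_bounded_finite[of "B j"] B[OF that] by (auto simp: bounded_borel_def)
    qed (use B in \<open>auto simp: bounded_borel_def\<close>)
    also have "exp (- (z * (\<Sum>j\<in>J. measure lborel (B j)))) = (\<Prod>j\<in>J. exp (- (z * measure lborel (B j))))"
      using J(3) by (simp add: exp_sum[symmetric] sum_negf sum_distrib_left)
    also have "\<dots> = (\<Prod>j\<in>J. prob (A j))" using B void by (intro prod.cong) auto
    finally show "prob (\<Inter>j\<in>J. A j) = (\<Prod>j\<in>J. prob (A j))" .
  qed
  then have ind: "indep_sets (\<lambda>i. sigma_sets (space P) (void_events (\<Delta> i))) I"
    by (rule indep_sets_sigma) (rule Int_stable_void_events)
  show ?thesis unfolding indep_vars_def2
  proof (intro conjI ballI)
    show "count_in (\<Delta> i) \<in> measurable P (count_space UNIV)" if "i \<in> I" for i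
      using count_measurable D[OF that] by simp
    show "indep_sets (\<lambda>i. {count_in (\<Delta> i) -` A \<inter> space P |A. A \<in> sets (count_space UNIV)}) I"
    proof (rule indep_sets_mono_sets[OF ind], safe)
      fix i A assume "i \<in> I"
      have "count_in (\<Delta> i) -` A \<inter> space P = {\<omega> \<in> configurations. count_in (\<Delta> i) \<omega> \<in> A}" unfolding space_P by auto
      then show "count_in (\<Delta> i) -` A \<inter> space P \<in> sigma_sets (space P) (void_events (\<Delta> i))"
        using count_event_void_sets[OF D[OF \<open>i \<in> I\<close>]] unfolding space_P by simp
    qed
  qed
qed

end

text \<open>Convexity of the exponential from below,
  \<open>exp (- y) \<le> 1 - y + y\<^sup>2\<close> from above. For \<open>t = 1 - s\<close> and
  \<open>y\<close> the mean number of points in a cell, the bounds differ by a factor whose product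
  over all cells tends to 1 as the mesh shrinks.\<close>

lemma exp_mix_bounds:
  fixes t y :: real
  assumes "0 \<le> t" "t \<le> 1" "0 \<le> y"
  shows "exp (- (t * y)) \<le> (1 - t) + t * exp (- y)" "(1 - t) + t * exp (- y) \<le> exp (- (t * y) + t * y\<^sup>2)"
proof -
  have "exp ((1 - t) *\<^sub>R 0 + t *\<^sub>R (- y)) \<le> (1 - t) * exp 0 + t * exp (- y)"
    using convex_onD[OF exp_convex, of t 0 "- y"] assms by simp
  then show "exp (- (t * y)) \<le> (1 - t) + t * exp (- y)" by simp
  have "exp (- y) \<le> 1 - y + y\<^sup>2"
  proof -
    have "1 + y \<le> exp y" by (rule exp_ge_add_one_self)
    then have "exp (- y) * (1 + y) \<le> 1" using assms by (simp add: exp_minus field_simps)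
    moreover have "1 \<le> (1 - y + y\<^sup>2) * (1 + y)"
    proof -
      have "(1 - y + y\<^sup>2) * (1 + y) = 1 + y ^ 3" by (simp add: algebra_simps power2_eq_square power3_eq_cube)
      then show ?thesis using assms by simp
    qed
    ultimately have "exp (- y) * (1 + y) \<le> (1 - y + y\<^sup>2) * (1 + y)" by linarith
    then show ?thesis using assms by (simp add: mult_le_cancel_right)
  qed
  then have "t * exp (- y) \<le> t * (1 - y + y\<^sup>2)" using assms by (intro mult_left_mono) auto
  then have "(1 - t) + t * exp (- y) \<le> 1 + (- (t * y) + t * y\<^sup>2)" by (simp add: algebra_simps)
  also have "\<dots> \<le> exp (- (t * y) + t * y\<^sup>2)" by (rule exp_ge_add_one_self)
  finally show "(1 - t) + t * exp (- y) \<le> exp (- (t * y) + t * y\<^sup>2)" .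
qed

text \<open>Generating functions give the identity on the interval (0, 1) only. Once the
  coefficients of the difference below \<open>m\<close> vanish, the series divided by
  \<open>s ^ m\<close> is zero there, while it tends to coefficient \<open>m\<close> at 0.\<close>

lemma power_series_eq_right:
  fixes p q :: "nat \<Rightarrow> real"
  assumes sp: "summable (\<lambda>k. \<bar>p k\<bar>)" and sq: "summable (\<lambda>k. \<bar>q k\<bar>)"
    and eq: "\<And>s. 0 < s \<Longrightarrow> s < 1 \<Longrightarrow> (\<Sum>k. p k * s ^ k) = (\<Sum>k. q k * s ^ k)"
  shows "p k = q k"
proof -
  define a where "a k = p k - q k" for k
  have sa: "summable (\<lambda>k. \<bar>a k\<bar>)"
    by (rule summable_comparison_test'[OF summable_add[OF sp sq], of 0]) (auto simp: a_def)
  have sm: "summable (\<lambda>k. c (k + m) * s ^ k)" if "summable (\<lambda>k. \<bar>c k\<bar>)" "\<bar>s\<bar> < 1" for c :: "nat \<Rightarrow> real" and s m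
  proof (rule summable_comparison_test')
    show "summable (\<lambda>k. \<bar>c (k + m)\<bar>)" using that(1) by (rule summable_ignore_initial_segment)
    show "norm (c (k + m) * s ^ k) \<le> \<bar>c (k + m)\<bar>" if "k \<ge> 0" for k
      using \<open>\<bar>s\<bar> < 1\<close> by (simp add: abs_mult power_abs mult_left_le power_le_one)
  qed
  have "a k = 0"
  proof (induct k rule: less_induct)
    case (less m)
    define f where "f s = (\<Sum>k. a (k + m) * s ^ k)" for s
    have zero: "f s = 0" if "0 < s" "s < 1" for s
    proof -
      have "(\<Sum>k. a k * s ^ k) = (\<Sum>k. p k * s ^ k) - (\<Sum>k. q k * s ^ k)"
        using suminf_diff[OF sm[OF sp, of s 0] sm[OF sq, of s 0]] that by (simp add: a_def left_diff_distrib)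
      also have "\<dots> = 0" using eq[OF that] by simp
      finally have "0 = (\<Sum>k. a k * s ^ k)" by simp
      also have "\<dots> = (\<Sum>k. a (k + m) * s ^ (k + m)) + (\<Sum>k<m. a k * s ^ k)"
        using sm[OF sa, of s 0] that by (intro suminf_split_initial_segment) auto
      also have "(\<Sum>k<m. a k * s ^ k) = 0" using less by simp
      also have "(\<Sum>k. a (k + m) * s ^ (k + m)) = s ^ m * f s"
        unfolding f_def using sm[OF sa, of s m] that by (subst suminf_mult[symmetric]) (auto simp: power_add ac_simps)
      finally show ?thesis using that by simp
    qed
    have "(f \<longlongrightarrow> a (0 + m)) (at 0)"
      by (rule powser_limit_0[of 1]) (auto simp: f_def intro!: summable_sums sm[OF sa])
    then have "(f \<longlongrightarrow> a m) (at_right 0)" by (auto intro: tendsto_within_subset)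
    moreover have "((\<lambda>_. 0) \<longlongrightarrow> 0) (at_right (0::real))" by simp
    then have "(f \<longlongrightarrow> 0) (at_right 0)"
      by (rule Lim_transform_eventually) (auto simp: eventually_at_right_field zero intro!: exI[of _ 1])
    ultimately show "a m = 0" using tendsto_unique trivial_limit_at_right_real by blast
  qed
  then show ?thesis by (simp add: a_def)
qed

lemma measure_cell_le: "measure lborel (cell n c) \<le> (1 / 2 ^ n)\<^sup>2"
proof -
  define u :: plane where "u = vector [of_int (fst c) / 2 ^ n, of_int (snd c) / 2 ^ n]"
  define v :: plane where "v = vector [(of_int (fst c) + 1) / 2 ^ n, (of_int (snd c) + 1) / 2 ^ n]"
  have "cell n c \<subseteq> cbox u v"
  proof
    fix x assume "x \<in> cell n c"
    then have "\<lfloor>2 ^ n * x$1\<rfloor> = fst c" "\<lfloor>2 ^ n * x$2\<rfloor> = snd c" by (auto simp: grid_def)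
    then have "of_int (fst c) \<le> 2 ^ n * x$1" "2 ^ n * x$1 \<le> of_int (fst c) + 1"
      "of_int (snd c) \<le> 2 ^ n * x$2" "2 ^ n * x$2 \<le> of_int (snd c) + 1" by linarith+
    then show "x \<in> cbox u v"
      by (simp add: u_def v_def mem_box_cart forall_2 field_simps)
  qed
  then have "measure lborel (cell n c) \<le> measure lborel (cbox u v)"
    by (intro measure_mono_fmeasurable) auto
  also have "\<dots> = (\<Prod>i\<in>UNIV. v$i - u$i)"
    by (rule content_cbox_cart) (simp add: u_def v_def interval_ne_empty_cart forall_2 divide_right_mono)
  also have "\<dots> = (1 / 2 ^ n)\<^sup>2"
    by (simp add: UNIV_2 u_def v_def field_simps power2_eq_square)
  finally show ?thesis .
qed

section \<open>The Poisson law of the counts\<close>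

context poisson_voids
begin

lemma void_iff_count: "B \<in> bounded_borel \<Longrightarrow> \<omega> \<in> configurations \<Longrightarrow> \<omega> \<in> void_event B \<longleftrightarrow> count_in B \<omega> = 0"
  using config_finite by (auto simp: void_event_def count_in_def bounded_borel_def)

text \<open>The count is the limit of the number of occupied cells, which is a sum of independent
  indicators with known probabilities. Its generating function is a product of factors
  \<open>s + (1 - s) * exp (- y n c)\<close>, and dominated convergence allows the limit on the
  other side.\<close>

lemma count_generating_function:
  assumes D: "\<Delta> \<in> bounded_borel" and s: "0 < s" "s < 1"
  shows "expectation (\<lambda>\<omega>. s ^ count_in \<Delta> \<omega>) = exp (- ((1 - s) * (z * measure lborel \<Delta>)))"
proof -
  have bd: "bounded \<Delta>" "\<Delta> \<in> sets borel" using D by (auto simp: bounded_borel_def)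
  define C where "C n = grid n ` \<Delta>" for n
  have finC: "finite (C n)" for n unfolding C_def by (rule finite_grid_image[OF bd(1)])
  define B where "B n c = \<Delta> \<inter> cell n c" for n c
  have B: "B n c \<in> bounded_borel" for n c unfolding B_def by (rule bounded_borel_Int[OF D cell_borel])
  define y where "y n c = z * measure lborel (B n c)" for n c
  have y0: "y n c \<ge> 0" for n c using z by (simp add: y_def)
  define Y where "Y = z * measure lborel \<Delta>"
  have fm: "B n c \<in> fmeasurable lborel" "cell n c \<in> fmeasurable lborel" "\<Delta> \<in> fmeasurable lborel" for n c
  proof -
    have "bounded (cell n c)"
    proof -
      have "cell n c \<subseteq> cbox (vector [of_int (fst c) / 2 ^ n, of_int (snd c) / 2 ^ n]) (vector [(of_int (fst c) + 1) / 2 ^ n, (of_int (snd c) + 1) / 2 ^ n])"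
      proof
        fix x assume "x \<in> cell n c"
        then have "\<lfloor>2 ^ n * x$1\<rfloor> = fst c" "\<lfloor>2 ^ n * x$2\<rfloor> = snd c" by (auto simp: grid_def)
        then have "of_int (fst c) \<le> 2 ^ n * x$1" "2 ^ n * x$1 \<le> of_int (fst c) + 1"
          "of_int (snd c) \<le> 2 ^ n * x$2" "2 ^ n * x$2 \<le> of_int (snd c) + 1" by linarith+
        then show "x \<in> cbox (vector [of_int (fst c) / 2 ^ n, of_int (snd c) / 2 ^ n]) (vector [(of_int (fst c) + 1) / 2 ^ n, (of_int (snd c) + 1) / 2 ^ n])"
          by (simp add: mem_box_cart forall_2 field_simps)
      qed
      then show ?thesis using bounded_cbox bounded_subset by blast
    qed
    moreover have "A \<in> fmeasurable lborel" if "bounded A" "A \<in> sets borel" for A :: "plane set"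
      using that emeasure_bounded_finite[OF that(1)] by (intro fmeasurableI) auto
    ultimately show "B n c \<in> fmeasurable lborel" "cell n c \<in> fmeasurable lborel" "\<Delta> \<in> fmeasurable lborel"
      using B[of n c] bd by (auto simp: bounded_borel_def)
  qed
  have sumY: "(\<Sum>c\<in>C n. y n c) = Y" for n
  proof -
    have "\<Delta> = (\<Union>c\<in>C n. B n c)" by (auto simp: B_def C_def)
    then have "measure lborel \<Delta> = measure lborel (\<Union>c\<in>C n. B n c)" by simp
    also have "\<dots> = (\<Sum>c\<in>C n. measure lborel (B n c))"
    proof (rule measure_finite_Union[OF finC])
      show "disjoint_family_on (B n) (C n)" by (auto simp: disjoint_family_on_def B_def)
      show "emeasure lborel (B n c) \<noteq> \<infinity>" for c using fm(1)[of n c] by (auto simp: fmeasurable_def)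
    qed (use B in \<open>auto simp: bounded_borel_def\<close>)
    finally show ?thesis by (simp add: y_def Y_def sum_distrib_left)
  qed
  have ysmall: "y n c \<le> z * (1 / 2 ^ n)\<^sup>2" for n c
  proof -
    have "measure lborel (B n c) \<le> measure lborel (cell n c)"
      using fm by (intro measure_mono_fmeasurable) (auto simp: B_def)
    then show ?thesis unfolding y_def using measure_cell_le[of n c] z by (intro mult_left_mono) auto
  qed
  have step: "expectation (\<lambda>\<omega>. s ^ card (grid n ` (\<omega> \<inter> \<Delta>))) = (\<Prod>c\<in>C n. s + (1 - s) * exp (- y n c))" for n
  proof -
    \<comment> \<open>An occupied cell contributes one factor \<open>s\<close>, whatever the number
      of its points.\<close>
    let ?f = "\<lambda>k::nat. if k = 0 then 1 else s"
    have "expectation (\<lambda>\<omega>. s ^ card (grid n ` (\<omega> \<inter> \<Delta>))) = expectation (\<lambda>\<omega>. \<Prod>c\<in>C n. ?f (count_in (B n c) \<omega>))"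
    proof (intro Bochner_Integration.integral_cong refl)
      fix \<omega> assume w: "\<omega> \<in> space P"
      have "(\<Prod>c\<in>C n. ?f (count_in (B n c) \<omega>)) = (\<Prod>c\<in>C n. if c \<in> grid n ` (\<omega> \<inter> \<Delta>) then s else 1)"
      proof (intro prod.cong refl)
        fix c assume "c \<in> C n"
        have "count_in (B n c) \<omega> = 0 \<longleftrightarrow> \<omega> \<inter> B n c = {}"
          using void_iff_count[OF B] w unfolding space_P by (auto simp: void_event_def)
        also have "\<dots> \<longleftrightarrow> c \<notin> grid n ` (\<omega> \<inter> \<Delta>)" unfolding B_def by (rule cell_unoccupied_iff)
        finally show "?f (count_in (B n c) \<omega>) = (if c \<in> grid n ` (\<omega> \<inter> \<Delta>) then s else 1)" by simp
      qed
      also have "\<dots> = s ^ card (C n \<inter> grid n ` (\<omega> \<inter> \<Delta>))" using finC by (simp add: prod.If_cases)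
      also have "C n \<inter> grid n ` (\<omega> \<inter> \<Delta>) = grid n ` (\<omega> \<inter> \<Delta>)" by (auto simp: C_def)
      finally show "s ^ card (grid n ` (\<omega> \<inter> \<Delta>)) = (\<Prod>c\<in>C n. ?f (count_in (B n c) \<omega>))" by simp
    qed
    also have "\<dots> = (\<Prod>c\<in>C n. expectation (\<lambda>\<omega>. ?f (count_in (B n c) \<omega>)))"
    proof (rule indep_vars_lebesgue_integral[OF finC])
      have "indep_vars (\<lambda>_. count_space UNIV) (\<lambda>c. count_in (B n c)) (C n)"
        by (rule indep_counts[OF B]) (auto simp: disjoint_family_on_def B_def)
      then show "indep_vars (\<lambda>_. borel) (\<lambda>c \<omega>. ?f (count_in (B n c) \<omega>)) (C n)"
        by (rule indep_vars_compose2) simp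
      show "integrable P (\<lambda>\<omega>. ?f (count_in (B n c) \<omega>))" for c
      proof (rule integrable_const_bound[of _ 1])
        show "(\<lambda>\<omega>. ?f (count_in (B n c) \<omega>)) \<in> borel_measurable P"
          using count_measurable[OF B] by (rule measurable_compose) simp
      qed (use s in auto)
    qed
    also have "\<dots> = (\<Prod>c\<in>C n. s + (1 - s) * exp (- y n c))"
    proof (intro prod.cong refl)
      fix c
      have "expectation (\<lambda>\<omega>. ?f (count_in (B n c) \<omega>)) = expectation (\<lambda>\<omega>. s + (1 - s) * indicator (void_event (B n c)) \<omega>)"
        using void_iff_count[OF B] by (intro Bochner_Integration.integral_cong refl) (auto simp: space_P indicator_def)
      also have "\<dots> = s + (1 - s) * prob (void_event (B n c))"
      proof -
        have "integrable P (indicat_real (void_event (B n c)))"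
          by (intro integrable_real_indicator void_in_events[OF B]) (simp add: emeasure_eq_measure)
        then show ?thesis using void_in_events[OF B, of n c] by (simp add: prob_space)
      qed
      finally show "expectation (\<lambda>\<omega>. ?f (count_in (B n c) \<omega>)) = s + (1 - s) * exp (- y n c)"
        using void[OF B] by (simp add: y_def)
    qed
    finally show ?thesis .
  qed
  have lim1: "(\<lambda>n. expectation (\<lambda>\<omega>. s ^ card (grid n ` (\<omega> \<inter> \<Delta>)))) \<longlonglongrightarrow> expectation (\<lambda>\<omega>. s ^ count_in \<Delta> \<omega>)"
  proof (rule integral_dominated_convergence[where w="\<lambda>_. 1"])
    show "(\<lambda>\<omega>. s ^ count_in \<Delta> \<omega>) \<in> borel_measurable P"
      using count_measurable[OF D] by (rule measurable_compose) simp
    have conv: "(\<lambda>n. s ^ card (grid n ` (\<omega> \<inter> \<Delta>))) \<longlonglongrightarrow> s ^ count_in \<Delta> \<omega>" if "\<omega> \<in> configurations" for \<omega>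
    proof -
      have "finite (\<omega> \<inter> \<Delta>)" using config_finite[OF that] bd(1) by simp
      from card_grid_tendsto[OF this] have "(\<lambda>n. s powr real (card (grid n ` (\<omega> \<inter> \<Delta>)))) \<longlonglongrightarrow> s powr real (count_in \<Delta> \<omega>)"
        using s unfolding count_in_def by (intro tendsto_powr tendsto_const) auto
      then show ?thesis using s by (simp add: powr_realpow)
    qed
    then show "AE \<omega> in P. (\<lambda>n. s ^ card (grid n ` (\<omega> \<inter> \<Delta>))) \<longlonglongrightarrow> s ^ count_in \<Delta> \<omega>"
      by (intro AE_I2) (simp add: space_P)
    show "(\<lambda>\<omega>. s ^ card (grid n ` (\<omega> \<inter> \<Delta>))) \<in> borel_measurable P" for n
    proof -
      have [measurable]: "void_event (B n c) \<in> sets P" for c using void_in_events[OF B] .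
      have "(\<lambda>\<omega>. \<Prod>c\<in>C n. s + (1 - s) * indicator (void_event (B n c)) \<omega>) \<in> borel_measurable P" by measurable
      moreover have "s ^ card (grid n ` (\<omega> \<inter> \<Delta>)) = (\<Prod>c\<in>C n. s + (1 - s) * indicator (void_event (B n c)) \<omega>)" if "\<omega> \<in> space P" for \<omega>
      proof -
        have "(\<Prod>c\<in>C n. s + (1 - s) * indicator (void_event (B n c)) \<omega>) = (\<Prod>c\<in>C n. if c \<in> grid n ` (\<omega> \<inter> \<Delta>) then s else 1)"
          using that unfolding space_P by (intro prod.cong) (auto simp: void_event_def indicator_def B_def cell_unoccupied_iff)
        also have "\<dots> = s ^ card (C n \<inter> grid n ` (\<omega> \<inter> \<Delta>))" using finC by (simp add: prod.If_cases)
        also have "C n \<inter> grid n ` (\<omega> \<inter> \<Delta>) = grid n ` (\<omega> \<inter> \<Delta>)" by (auto simp: C_def)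
        finally show ?thesis by simp
      qed
      ultimately show ?thesis by (subst measurable_cong) auto
    qed
    show "AE \<omega> in P. norm (s ^ card (grid n ` (\<omega> \<inter> \<Delta>))) \<le> 1" for n
      using s by (intro AE_I2) (simp add: power_le_one)
  qed simp
  have lim2: "(\<lambda>n. \<Prod>c\<in>C n. s + (1 - s) * exp (- y n c)) \<longlonglongrightarrow> exp (- ((1 - s) * Y))"
  proof (rule real_tendsto_sandwich)
    show "\<forall>\<^sub>F n in sequentially. exp (- ((1 - s) * Y)) \<le> (\<Prod>c\<in>C n. s + (1 - s) * exp (- y n c))"
    proof (rule always_eventually, rule allI)
      fix n
      have "exp (- ((1 - s) * Y)) = (\<Prod>c\<in>C n. exp (- ((1 - s) * y n c)))"
        unfolding sumY[of n, symmetric] using finC by (simp add: exp_sum[symmetric] sum_negf sum_distrib_left)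
      also have "\<dots> \<le> (\<Prod>c\<in>C n. s + (1 - s) * exp (- y n c))"
      proof (intro prod_mono conjI)
        fix c
        show "exp (- ((1 - s) * y n c)) \<le> s + (1 - s) * exp (- y n c)"
          using exp_mix_bounds(1)[of "1 - s" "y n c"] s y0 by simp
      qed simp
      finally show "exp (- ((1 - s) * Y)) \<le> (\<Prod>c\<in>C n. s + (1 - s) * exp (- y n c))" .
    qed
    show "\<forall>\<^sub>F n in sequentially. (\<Prod>c\<in>C n. s + (1 - s) * exp (- y n c)) \<le> exp (- ((1 - s) * Y) + (1 - s) * (z * (1 / 2 ^ n)\<^sup>2 * Y))"
    proof (rule always_eventually, rule allI)
      fix n
      have "(\<Prod>c\<in>C n. s + (1 - s) * exp (- y n c)) \<le> (\<Prod>c\<in>C n. exp (- ((1 - s) * y n c) + (1 - s) * (y n c)\<^sup>2))"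
      proof (intro prod_mono conjI)
        fix c
        show "s + (1 - s) * exp (- y n c) \<le> exp (- ((1 - s) * y n c) + (1 - s) * (y n c)\<^sup>2)"
          using exp_mix_bounds(2)[of "1 - s" "y n c"] s y0 by simp
        show "0 \<le> s + (1 - s) * exp (- y n c)" using s by simp
      qed
      also have "\<dots> = exp (\<Sum>c\<in>C n. - ((1 - s) * y n c) + (1 - s) * (y n c)\<^sup>2)" using finC by (simp add: exp_sum)
      also have "\<dots> \<le> exp (- ((1 - s) * Y) + (1 - s) * (z * (1 / 2 ^ n)\<^sup>2 * Y))"
      proof -
        \<comment> \<open>Each \<open>y n c\<close> is at most \<open>z\<close> times the squared
          mesh, so the sum of the squares is at most that small number times the total
          \<open>Y\<close>, which does not depend on \<open>n\<close>.\<close>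
        have "(\<Sum>c\<in>C n. (y n c)\<^sup>2) \<le> (\<Sum>c\<in>C n. z * (1 / 2 ^ n)\<^sup>2 * y n c)"
          unfolding power2_eq_square[of "y n _"] using ysmall y0 by (intro sum_mono mult_right_mono) auto
        also have "\<dots> = z * (1 / 2 ^ n)\<^sup>2 * Y" by (simp add: sum_distrib_left[symmetric] sumY)
        finally have "(1 - s) * (\<Sum>c\<in>C n. (y n c)\<^sup>2) \<le> (1 - s) * (z * (1 / 2 ^ n)\<^sup>2 * Y)" using s by (intro mult_left_mono) auto
        then show ?thesis unfolding sum.distrib sum_negf sum_distrib_left[symmetric] sumY by simp
      qed
      finally show "(\<Prod>c\<in>C n. s + (1 - s) * exp (- y n c)) \<le> exp (- ((1 - s) * Y) + (1 - s) * (z * (1 / 2 ^ n)\<^sup>2 * Y))" .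
    qed
    have h: "(\<lambda>n. 1 / 2 ^ n :: real) \<longlonglongrightarrow> 0" by (simp add: LIMSEQ_divide_realpow_zero)
    have "(\<lambda>n. exp (- ((1 - s) * Y) + (1 - s) * (z * (1 / 2 ^ n)\<^sup>2 * Y))) \<longlonglongrightarrow> exp (- ((1 - s) * Y) + (1 - s) * (z * 0\<^sup>2 * Y))"
      by (intro tendsto_intros h)
    moreover have "- ((1 - s) * Y) + (1 - s) * (z * 0\<^sup>2 * Y) = - ((1 - s) * Y)" by simp
    ultimately show "(\<lambda>n. exp (- ((1 - s) * Y) + (1 - s) * (z * (1 / 2 ^ n)\<^sup>2 * Y))) \<longlonglongrightarrow> exp (- ((1 - s) * Y))"
      by (simp only:)
  qed simp
  show ?thesis using LIMSEQ_unique[OF lim1 lim2[folded step]] by (simp add: Y_def)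
qed

lemma count_distribution:
  assumes D: "\<Delta> \<in> bounded_borel"
  shows "prob {\<omega> \<in> space P. count_in \<Delta> \<omega> = k} =
    (z * measure lborel \<Delta>) ^ k / fact k * exp (- (z * measure lborel \<Delta>))"
proof -
  define Y where "Y = z * measure lborel \<Delta>"
  have Y: "Y \<ge> 0" using z by (simp add: Y_def)
  define p where "p k = prob {\<omega> \<in> space P. count_in \<Delta> \<omega> = k}" for k
  define q where "q k = Y ^ k / fact k * exp (- Y)" for k
  note [measurable] = count_measurable[OF D]
  have ind: "(\<lambda>k. s ^ k * indicator {\<omega> \<in> space P. count_in \<Delta> \<omega> = k} \<omega>) sums (s ^ count_in \<Delta> \<omega>)"
    if "\<omega> \<in> space P" for \<omega> and s :: real
  proof -
    have "(\<lambda>r. if r = count_in \<Delta> \<omega> then s ^ r else 0) = (\<lambda>k. s ^ k * indicator {\<omega> \<in> space P. count_in \<Delta> \<omega> = k} \<omega>)"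
      using that by (auto simp: indicator_def)
    then show ?thesis using sums_single[of "count_in \<Delta> \<omega>" "\<lambda>k. s ^ k"] by simp
  qed
  \<comment> \<open>The value \<open>s = 1\<close> is included because it yields the summability of
    \<open>p\<close>.\<close>
  have series: "(\<lambda>k. p k * s ^ k) sums expectation (\<lambda>\<omega>. s ^ count_in \<Delta> \<omega>)" if "0 < s" "s \<le> 1" for s
  proof -
    have "(\<lambda>k. expectation (\<lambda>\<omega>. s ^ k * indicator {\<omega> \<in> space P. count_in \<Delta> \<omega> = k} \<omega>)) sums
      expectation (\<lambda>\<omega>. \<Sum>k. s ^ k * indicator {\<omega> \<in> space P. count_in \<Delta> \<omega> = k} \<omega>)"
    proof (rule sums_integral)
      show "integrable P (\<lambda>\<omega>. s ^ k * indicator {\<omega> \<in> space P. count_in \<Delta> \<omega> = k} \<omega>)" for k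
        by (intro integrable_mult_right integrable_real_indicator) (auto simp: emeasure_eq_measure)
      show "AE \<omega> in P. summable (\<lambda>k. norm (s ^ k * indicator {\<omega> \<in> space P. count_in \<Delta> \<omega> = k} \<omega>))"
      proof (rule AE_I2)
        fix \<omega> assume "\<omega> \<in> space P"
        from sums_summable[OF ind[OF this]] show "summable (\<lambda>k. norm (s ^ k * indicator {\<omega> \<in> space P. count_in \<Delta> \<omega> = k} \<omega>))"
          using \<open>0 < s\<close> by (simp add: abs_mult)
      qed
      show "summable (\<lambda>k. expectation (\<lambda>\<omega>. norm (s ^ k * indicator {\<omega> \<in> space P. count_in \<Delta> \<omega> = k} \<omega>)))"
      proof -
        have "summable (\<lambda>k. p k)"
        proof (rule bounded_imp_summable[of _ 1])
          show "0 \<le> p k" for k by (simp add: p_def)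
          show "(\<Sum>k\<le>n. p k) \<le> 1" for n
          proof -
            have "(\<Sum>k\<le>n. p k) = prob (\<Union>k\<le>n. {\<omega> \<in> space P. count_in \<Delta> \<omega> = k})"
              unfolding p_def by (intro finite_measure_finite_Union[symmetric]) (auto simp: disjoint_family_on_def)
            then show ?thesis by simp
          qed
        qed
        then have "summable (\<lambda>k. s ^ k * p k)"
          by (rule summable_comparison_test'[where N=0]) (use that in \<open>auto simp: p_def abs_mult power_le_one mult_left_le_one_le\<close>)
        then show ?thesis using \<open>0 < s\<close> by (simp add: abs_mult p_def)
      qed
    qed
    moreover have "expectation (\<lambda>\<omega>. \<Sum>k. s ^ k * indicator {\<omega> \<in> space P. count_in \<Delta> \<omega> = k} \<omega>) = expectation (\<lambda>\<omega>. s ^ count_in \<Delta> \<omega>)"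
    proof (intro Bochner_Integration.integral_cong refl)
      fix \<omega> assume "\<omega> \<in> space P"
      from ind[OF this]
      show "(\<Sum>k. s ^ k * indicator {\<omega> \<in> space P. count_in \<Delta> \<omega> = k} \<omega>) = s ^ count_in \<Delta> \<omega>" by (simp add: sums_iff)
    qed
    ultimately show ?thesis by (simp add: p_def mult.commute)
  qed
  have qser: "(\<lambda>k. q k * s ^ k) sums exp (- ((1 - s) * Y))" for s
  proof -
    have "(\<lambda>k. (Y * s) ^ k /\<^sub>R fact k) sums exp (Y * s)" by (rule exp_converges)
    then have "(\<lambda>k. exp (- Y) * ((Y * s) ^ k /\<^sub>R fact k)) sums (exp (- Y) * exp (Y * s))" by (rule sums_mult)
    moreover have "exp (- Y) * ((Y * s) ^ k /\<^sub>R fact k) = q k * s ^ k" for k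
      by (simp add: q_def power_mult_distrib field_simps)
    moreover have "exp (- Y) * exp (Y * s) = exp (- ((1 - s) * Y))" by (simp add: exp_add[symmetric] algebra_simps)
    ultimately show ?thesis by simp
  qed
  have "p k = q k"
  proof (rule power_series_eq_right)
    show "summable (\<lambda>k. \<bar>p k\<bar>)" using sums_summable[OF series[of 1]] by (simp add: p_def)
    show "summable (\<lambda>k. \<bar>q k\<bar>)" using sums_summable[OF qser[of 1]] Y by (simp add: q_def)
    show "(\<Sum>k. p k * s ^ k) = (\<Sum>k. q k * s ^ k)" if "0 < s" "s < 1" for s
      using series[of s] qser[of s] count_generating_function[OF D that] that by (simp add: sums_iff Y_def)
  qed
  then show ?thesis by (simp add: p_def q_def Y_def)
qed

lemma is_poisson: "is_poisson_process z P"
  unfolding is_poisson_process_def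
proof (intro conjI ballI allI impI)
  fix \<Delta> :: "nat \<Rightarrow> plane set" assume "range \<Delta> \<subseteq> bounded_borel" "disjoint_family \<Delta>"
  then show "indep_vars (\<lambda>_. count_space UNIV) (\<lambda>i. count_in (\<Delta> i)) UNIV" by (intro indep_counts) auto
qed (use pp count_distribution in auto)

end

section \<open>The Poisson process and its Mecke formula\<close>

lemma poisson_voids_unique: "poisson_voids P z \<Longrightarrow> poisson_voids P' z \<Longrightarrow> P = P'"
  by (rule point_process_eqI)
    (auto simp: poisson_voids.pp poisson_voids.void poisson_voids_def finite_measure.emeasure_eq_measure prob_space.finite_measure)

lemma is_poisson_process_voids:
  assumes z: "z > 0" and P: "is_poisson_process z P" shows "poisson_voids P z"
proof -
  have pp: "point_process P" using P by (simp add: is_poisson_process_def)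
  have "measure P (void_event B) = exp (- (z * measure lborel B))" if B: "B \<in> bounded_borel" for B
  proof -
    have "measure P {\<omega> \<in> space P. count_in B \<omega> = 0} = exp (- (z * measure lborel B))"
      using P B unfolding is_poisson_process_def by simp
    moreover have "{\<omega> \<in> space P. count_in B \<omega> = 0} = void_event B"
      using B config_finite unfolding space_point_process[OF pp]
      by (auto simp: void_event_def count_in_def bounded_borel_def)
    ultimately show ?thesis by simp
  qed
  then show ?thesis using pp z
    by (simp add: poisson_voids_def poisson_voids_axioms_def point_process_def)
qed

lemma bounded_cell: "bounded (cell n c)"
proof -
  have "cell n c \<subseteq> cbox (vector [of_int (fst c) / 2 ^ n, of_int (snd c) / 2 ^ n]) (vector [(of_int (fst c) + 1) / 2 ^ n, (of_int (snd c) + 1) / 2 ^ n])"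
  proof
    fix x assume "x \<in> cell n c"
    then have "\<lfloor>2 ^ n * x$1\<rfloor> = fst c" "\<lfloor>2 ^ n * x$2\<rfloor> = snd c" by (auto simp: grid_def)
    then have "of_int (fst c) \<le> 2 ^ n * x$1" "2 ^ n * x$1 \<le> of_int (fst c) + 1"
      "of_int (snd c) \<le> 2 ^ n * x$2" "2 ^ n * x$2 \<le> of_int (snd c) + 1" by linarith+
    then show "x \<in> cbox (vector [of_int (fst c) / 2 ^ n, of_int (snd c) / 2 ^ n]) (vector [(of_int (fst c) + 1) / 2 ^ n, (of_int (snd c) + 1) / 2 ^ n])"
      by (simp add: mem_box_cart forall_2 field_simps)
  qed
  then show ?thesis using bounded_cbox bounded_subset by blast
qed

lemma measure_unit_cell_pos: "measure lborel (cell 0 c) > 0"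
proof -
  define m :: plane where "m = vector [of_int (fst c) + 1/2, of_int (snd c) + 1/2]"
  have "ball m (1/2) \<subseteq> cell 0 c"
  proof
    fix x assume "x \<in> ball m (1/2)"
    then have "norm (x - m) < 1/2" by (simp add: dist_norm norm_minus_commute)
    then have "\<bar>(x - m)$i\<bar> < 1/2" for i using component_le_norm_cart[of "x - m" i] by linarith
    from this[of 1] this[of 2] have "\<bar>x$1 - (of_int (fst c) + 1/2)\<bar> < 1/2" "\<bar>x$2 - (of_int (snd c) + 1/2)\<bar> < 1/2"
      by (simp_all add: m_def)
    then have "\<lfloor>x$1\<rfloor> = fst c" "\<lfloor>x$2\<rfloor> = snd c" by linarith+
    then show "x \<in> cell 0 c" by (simp add: grid_def prod_eq_iff)
  qed
  moreover have "cell 0 c \<in> fmeasurable lborel"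
    using emeasure_bounded_finite[OF bounded_cell] by (intro fmeasurableI) auto
  ultimately have "measure lborel (ball m (1/2)) \<le> measure lborel (cell 0 c)"
    by (intro measure_mono_fmeasurable) auto
  moreover have "measure lborel (ball m (1/2)) > 0"
    using content_ball_pos[of "1/2" m] by simp
  ultimately show ?thesis by linarith
qed

text \<open>Thinning: if each of a Poisson number of points with mean \<open>l\<close> independently
  hits a set with probability \<open>p\<close>, the series is the probability that none of them
  does.\<close>

lemma poisson_mixture_sums:
  fixes l p :: real
  shows "(\<lambda>n. l ^ n / fact n * exp (- l) * (1 - p) ^ n) sums exp (- (l * p))"
proof -
  have "(\<lambda>n. exp (- l) * ((l * (1 - p)) ^ n /\<^sub>R fact n)) sums (exp (- l) * exp (l * (1 - p)))"
    by (intro sums_mult exp_converges)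
  moreover have "exp (- l) * exp (l * (1 - p)) = exp (- (l * p))" by (simp add: exp_add[symmetric] algebra_simps)
  moreover have "exp (- l) * ((l * (1 - p)) ^ n /\<^sub>R fact n) = l ^ n / fact n * exp (- l) * (1 - p) ^ n" for n
    unfolding power_mult_distrib real_scaleR_def by (simp add: divide_inverse ac_simps)
  ultimately show ?thesis by simp
qed

text \<open>The Poisson process is built from independent Poisson numbers of independent uniform points
  in the unit cells. That coinciding points are not counted twice does not affect the void
  probabilities.\<close>

lemma poisson_voids_exists:
  assumes z: "z > 0" shows "\<exists>P. poisson_voids P z"
proof -
  define Q where "Q c = cell 0 c" for c
  define l where "l c = z * measure lborel (Q c)" for c
  have l: "l c > 0" for c using z measure_unit_cell_pos by (simp add: l_def Q_def)
  have Qfin: "emeasure lborel (Q c) = ennreal (measure lborel (Q c))" "measure lborel (Q c) > 0" for c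
    using emeasure_bounded_finite[OF bounded_cell, of 0 c] measure_unit_cell_pos[of c]
    by (auto simp: Q_def emeasure_eq_ennreal_measure)
  have Qb[measurable]: "Q c \<in> sets borel" for c by (simp add: Q_def)
  define U where "U c = uniform_measure lborel (Q c)" for c
  have U: "prob_space (U c)" for c unfolding U_def
    by (rule prob_space_uniform_measure) (use Qfin[of c] in auto)
  have Us[measurable_cong]: "sets (U c) = sets borel" for c by (simp add: U_def)
  define V where "V c = PiM (UNIV :: nat set) (\<lambda>_. U c)" for c
  have V: "prob_space (V c)" for c unfolding V_def by (intro prob_space_PiM U)
  define M where "M c = measure_pmf (poisson_pmf (l c)) \<Otimes>\<^sub>M V c" for c
  have M: "prob_space (M c)" for c unfolding M_def by (intro prob_space_pair V measure_pmf.prob_space_axioms)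
  interpret MP: product_prob_space M UNIV by (rule product_prob_spaceI) (rule M)
  \<comment> \<open>A uniform point of a cell lies in this cell only almost surely. Discarding the
    points outside their cell makes every outcome locally finite.\<close>
  define \<kappa> where "\<kappa> w = {x. \<exists>c k. k < fst (w c) \<and> x = snd (w c) k \<and> x \<in> Q c}" for w :: "int \<times> int \<Rightarrow> nat \<times> (nat \<Rightarrow> plane)"
  have conf: "\<kappa> w \<in> configurations" for w
    unfolding configurations_def
  proof (safe)
    fix \<Delta> :: "plane set" assume "bounded \<Delta>"
    then have "finite (\<Union>c\<in>grid 0 ` \<Delta>. (snd (w c)) ` {..<fst (w c)})" by (intro finite_UN_I finite_grid_image) auto
    moreover have "\<kappa> w \<inter> \<Delta> \<subseteq> (\<Union>c\<in>grid 0 ` \<Delta>. (snd (w c)) ` {..<fst (w c)})"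
      by (auto simp: \<kappa>_def Q_def)
    ultimately show "finite (\<kappa> w \<inter> \<Delta>)" by (rule finite_subset[rotated])
  qed
  define E where "E B c = {p \<in> space (M c). \<forall>k. k < fst p \<longrightarrow> snd p k \<notin> B \<inter> Q c}" for B c
  have E: "E B c \<in> sets (M c)" if [measurable]: "B \<in> sets borel" for B c
  proof -
    have [measurable]: "fst \<in> measurable (M c) (count_space UNIV)"
      unfolding M_def using measurable_fst[of "measure_pmf (poisson_pmf (l c))" "V c"] by simp
    have [measurable]: "(\<lambda>p. snd p k) \<in> borel_measurable (M c)" for k
    proof -
      have "(\<lambda>x. x k) \<in> measurable (V c) (U c)" unfolding V_def by (rule measurable_component_singleton) simp
      then have "(\<lambda>x. x k) \<in> borel_measurable (V c)" by (simp add: measurable_cong_sets[OF refl Us])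
      then show ?thesis unfolding M_def by measurable
    qed
    show ?thesis unfolding E_def by measurable
  qed
  \<comment> \<open>Only the cells that meet \<open>B\<close> matter. They are finitely many, so the
    event is measurable in the infinite product and its probability is a finite product.\<close>
  have pre: "\<kappa> -` void_event B \<inter> space (PiM UNIV M) = {w \<in> space (PiM UNIV M). \<forall>c\<in>grid 0 ` B. w c \<in> E B c}" for B
  proof -
    have "\<kappa> w \<inter> B = {} \<longleftrightarrow> (\<forall>c\<in>grid 0 ` B. w c \<in> E B c)" if w: "w \<in> space (PiM UNIV M)" for w
    proof
      assume e: "\<kappa> w \<inter> B = {}"
      have "snd (w c) k \<notin> B \<inter> Q c" if "k < fst (w c)" for c k
      proof
        assume "snd (w c) k \<in> B \<inter> Q c"
        then have "snd (w c) k \<in> \<kappa> w \<inter> B" using that unfolding \<kappa>_def by blast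
        then show False using e by simp
      qed
      then show "\<forall>c\<in>grid 0 ` B. w c \<in> E B c" using w unfolding E_def space_PiM by blast
    next
      assume r: "\<forall>c\<in>grid 0 ` B. w c \<in> E B c"
      show "\<kappa> w \<inter> B = {}"
      proof (rule ccontr)
        assume "\<kappa> w \<inter> B \<noteq> {}"
        then obtain c k where ck: "k < fst (w c)" "snd (w c) k \<in> Q c" "snd (w c) k \<in> B" by (auto simp: \<kappa>_def)
        then have "c \<in> grid 0 ` B" by (intro image_eqI[of _ _ "snd (w c) k"]) (auto simp: Q_def)
        then show False using r ck by (auto simp: E_def)
      qed
    qed
    then show ?thesis using conf by (auto simp: void_event_def)
  qed
  have pre_sets: "{w \<in> space (PiM UNIV M). \<forall>c\<in>grid 0 ` B. w c \<in> E B c} \<in> sets (PiM UNIV M)" if B: "B \<in> bounded_borel" for B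
  proof (rule sets.sets_Collect_finite_All)
    show "finite (grid 0 ` B)" using B by (simp add: bounded_borel_def finite_grid_image)
    fix c
    have "E B c \<in> sets (M c)" using B by (intro E) (simp add: bounded_borel_def)
    then have "(\<lambda>w. w c) -` E B c \<inter> space (PiM UNIV M) \<in> sets (PiM UNIV M)"
      by (rule measurable_sets[rotated]) (rule measurable_component_singleton, simp)
    moreover have "(\<lambda>w. w c) -` E B c \<inter> space (PiM UNIV M) = {w \<in> space (PiM UNIV M). w c \<in> E B c}" by auto
    ultimately show "{w \<in> space (PiM UNIV M). w c \<in> E B c} \<in> sets (PiM UNIV M)" by simp
  qed
  have \<kappa>: "\<kappa> \<in> measurable (PiM UNIV M) config_space"
  proof (rule measurable_sigma_sets[OF sets_config_space_void void_events_closed])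
    show "\<kappa> \<in> space (PiM UNIV M) \<rightarrow> configurations" using conf by auto
    show "\<kappa> -` y \<inter> space (PiM UNIV M) \<in> sets (PiM UNIV M)" if "y \<in> void_events UNIV" for y
      using that pre pre_sets by (auto simp: void_events_def)
  qed
  have EM: "emeasure (M c) (E B c) = ennreal (exp (- (z * measure lborel (B \<inter> Q c))))" if B: "B \<in> bounded_borel" for B c
  proof -
    have Bb: "B \<inter> Q c \<in> sets borel" using B by (auto simp: bounded_borel_def)
    define p where "p = measure lborel (B \<inter> Q c) / measure lborel (Q c)"
    have fmQ: "Q c \<in> fmeasurable lborel" using Qfin[of c] by (intro fmeasurableI) auto
    have p1: "p \<le> 1" "0 \<le> p"
      using measure_mono_fmeasurable[of "B \<inter> Q c" "Q c" lborel] Bb fmQ Qfin(2)[of c] by (auto simp: p_def)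
    interpret Uc: prob_space "U c" by (rule U)
    interpret Vc: prob_space "V c" by (rule V)
    interpret UP: product_prob_space "\<lambda>_::nat. U c" UNIV by (rule product_prob_spaceI) (rule U)
    have mU: "Uc.prob (B \<inter> Q c) = p"
    proof -
      have 1: "emeasure lborel (B \<inter> Q c) = ennreal (measure lborel (B \<inter> Q c))"
        using fmeasurableI2[OF fmQ, of "B \<inter> Q c"] Bb by (simp add: emeasure_eq_measure2)
      have 2: "Q c \<inter> (B \<inter> Q c) = B \<inter> Q c" by auto
      have "emeasure (U c) (B \<inter> Q c) = emeasure lborel (Q c \<inter> (B \<inter> Q c)) / emeasure lborel (Q c)"
        unfolding U_def by (rule emeasure_uniform_measure) (use Bb in auto)
      also have "\<dots> = ennreal p" unfolding 2 1 Qfin(1) p_def by (rule divide_ennreal) (use Qfin(2) in auto)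
      finally show ?thesis using p1 by (simp add: Uc.emeasure_eq_measure)
    qed
    \<comment> \<open>Given \<open>n\<close> points in the cell, each of them avoids
      \<open>B\<close> independently with probability \<open>1 - p\<close>.\<close>
    have slice: "emeasure (V c) (Pair n -` E B c) = ennreal ((1 - p) ^ n)" for n
    proof -
      have "Pair n -` E B c = {x \<in> space (V c). \<forall>k\<in>{..<n}. x k \<in> space (U c) - (B \<inter> Q c)}"
        by (auto simp: E_def M_def space_pair_measure V_def space_PiM U_def)
      then have "emeasure (V c) (Pair n -` E B c) = (\<Prod>k<n. emeasure (U c) (space (U c) - (B \<inter> Q c)))"
        unfolding V_def using Bb Us[of c] by (simp only:) (rule UP.emeasure_PiM_Collect, auto)
      also have "\<dots> = ennreal (1 - p) ^ n"
        using Uc.prob_compl[of "B \<inter> Q c"] Bb Us[of c] mU by (simp add: Uc.emeasure_eq_measure)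
      finally show ?thesis using p1 by (simp add: ennreal_power)
    qed
    have "emeasure (M c) (E B c) = (\<integral>\<^sup>+ n. emeasure (V c) (Pair n -` E B c) \<partial>measure_pmf (poisson_pmf (l c)))"
      unfolding M_def by (rule Vc.emeasure_pair_measure_alt) (use E[of B c] B in \<open>auto simp: bounded_borel_def M_def\<close>)
    also have "\<dots> = (\<integral>\<^sup>+ n. ennreal (pmf (poisson_pmf (l c)) n) * ennreal ((1 - p) ^ n) \<partial>count_space UNIV)"
      unfolding slice by (rule nn_integral_measure_pmf)
    also have "\<dots> = (\<Sum>n. ennreal (l c ^ n / fact n * exp (- l c) * (1 - p) ^ n))"
      unfolding nn_integral_count_space_nat using l[of c] p1 by (simp add: pmf_poisson[OF l] ennreal_mult'[symmetric])
    also have "\<dots> = ennreal (exp (- (l c * p)))"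
      using l[of c] p1 by (intro suminf_ennreal_eq poisson_mixture_sums) auto
    also have "l c * p = z * measure lborel (B \<inter> Q c)" using Qfin(2)[of c] by (simp add: l_def p_def)
    finally show ?thesis .
  qed
  define P where "P = distr (PiM UNIV M) config_space \<kappa>"
  interpret P: prob_space P unfolding P_def by (rule MP.P.prob_space_distr[OF \<kappa>])
  have "P.prob (void_event B) = exp (- (z * measure lborel B))" if B: "B \<in> bounded_borel" for B
  proof -
    have bd: "bounded B" "B \<in> sets borel" using B by (auto simp: bounded_borel_def)
    define C where "C = grid 0 ` B"
    have finC: "finite C" unfolding C_def by (rule finite_grid_image[OF bd(1)])
    have "emeasure P (void_event B) = emeasure (PiM UNIV M) {w \<in> space (PiM UNIV M). \<forall>c\<in>C. w c \<in> E B c}"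
      unfolding P_def C_def pre[symmetric] using void_event_sets[OF B] by (rule emeasure_distr[OF \<kappa>])
    also have "\<dots> = (\<Prod>c\<in>C. emeasure (M c) (E B c))"
      by (rule MP.emeasure_PiM_Collect) (use finC E bd in auto)
    also have "\<dots> = (\<Prod>c\<in>C. ennreal (exp (- (z * measure lborel (B \<inter> Q c)))))" using EM[OF B] by simp
    also have "\<dots> = ennreal (\<Prod>c\<in>C. exp (- (z * measure lborel (B \<inter> Q c))))" by (rule prod_ennreal) simp
    also have "(\<Prod>c\<in>C. exp (- (z * measure lborel (B \<inter> Q c)))) = exp (- (z * (\<Sum>c\<in>C. measure lborel (B \<inter> Q c))))"
      using finC by (simp add: exp_sum[symmetric] sum_negf sum_distrib_left)
    also have "(\<Sum>c\<in>C. measure lborel (B \<inter> Q c)) = measure lborel (\<Union>c\<in>C. B \<inter> Q c)"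
    proof (rule measure_finite_Union[symmetric, OF finC])
      show "disjoint_family_on (\<lambda>c. B \<inter> Q c) C" by (auto simp: disjoint_family_on_def Q_def)
      show "emeasure lborel (B \<inter> Q c) \<noteq> \<infinity>" for c
        using emeasure_bounded_finite[of "B \<inter> Q c"] bd by (auto simp: bounded_Int)
    qed (use bd in auto)
    also have "(\<Union>c\<in>C. B \<inter> Q c) = B" by (auto simp: C_def Q_def)
    finally show ?thesis by (simp add: P.emeasure_eq_measure)
  qed
  then have "poisson_voids P z"
    using z by (intro poisson_voids.intro P.prob_space_axioms poisson_voids_axioms.intro) (auto simp: P_def)
  then show ?thesis by blast
qed

text \<open>The construction gives existence and the void probabilities give uniqueness, so the
  definite description denotes the constructed process.\<close>

lemma poisson_process_voids:
  assumes "z > 0" shows "poisson_voids (poisson_process z) z"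
proof -
  obtain P where P: "poisson_voids P z" using poisson_voids_exists[OF assms] by blast
  have "poisson_process z = P" unfolding poisson_process_def
    using poisson_voids.is_poisson[OF P] poisson_voids_unique[OF _ P] is_poisson_process_voids[OF assms]
    by (intro the_equality) auto
  then show ?thesis using P by simp
qed

section \<open>The Mecke formula\<close>

context poisson_voids
begin

lemma nn_integral_independent_counts:
  fixes g h :: "nat \<Rightarrow> ennreal"
  assumes C: "C \<in> bounded_borel" and D: "D \<in> bounded_borel" and disj: "C \<inter> D = {}"
  shows "(\<integral>\<^sup>+ \<omega>. g (count_in C \<omega>) * h (count_in D \<omega>) \<partial>P) =
    (\<integral>\<^sup>+ \<omega>. g (count_in C \<omega>) \<partial>P) * (\<integral>\<^sup>+ \<omega>. h (count_in D \<omega>) \<partial>P)"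
proof -
  define \<Delta> where "\<Delta> b = (if b then C else D)" for b
  define G where "G b = (if b then g else h)" for b
  have "indep_vars (\<lambda>_. count_space UNIV) (\<lambda>b. count_in (\<Delta> b)) UNIV"
    using disj C D by (intro indep_counts) (auto simp: \<Delta>_def disjoint_family_on_def)
  then have "indep_vars (\<lambda>_. borel) (\<lambda>b \<omega>. G b (count_in (\<Delta> b) \<omega>)) UNIV"
    by (rule indep_vars_compose2) simp
  from indep_vars_nn_integral[OF _ this] show ?thesis by (simp add: UNIV_bool G_def \<Delta>_def mult.commute)
qed

lemma nn_integral_count:
  assumes D: "\<Delta> \<in> bounded_borel"
  shows "(\<integral>\<^sup>+ \<omega>. of_nat (count_in \<Delta> \<omega>) \<partial>P) = ennreal (z * measure lborel \<Delta>)"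
proof -
  note [measurable] = count_measurable[OF D]
  define Y where "Y = z * measure lborel \<Delta>"
  have Y: "Y \<ge> 0" using z by (simp add: Y_def)
  have "(\<integral>\<^sup>+ \<omega>. of_nat (count_in \<Delta> \<omega>) \<partial>P) = (\<integral>\<^sup>+ \<omega>. (\<Sum>k. of_nat k * indicator {\<omega> \<in> space P. count_in \<Delta> \<omega> = k} \<omega>) \<partial>P)"
  proof (intro nn_integral_cong)
    fix \<omega> assume w: "\<omega> \<in> space P"
    have "(\<Sum>k. of_nat k * indicator {\<omega> \<in> space P. count_in \<Delta> \<omega> = k} \<omega> :: ennreal) = (\<Sum>k\<in>{count_in \<Delta> \<omega>}. of_nat k * indicator {\<omega> \<in> space P. count_in \<Delta> \<omega> = k} \<omega>)"
      by (rule suminf_finite) auto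
    then show "of_nat (count_in \<Delta> \<omega>) = (\<Sum>k. of_nat k * indicator {\<omega> \<in> space P. count_in \<Delta> \<omega> = k} \<omega> :: ennreal)" using w by simp
  qed
  also have "\<dots> = (\<Sum>k. of_nat k * emeasure P {\<omega> \<in> space P. count_in \<Delta> \<omega> = k})"
    by (subst nn_integral_suminf) (auto simp: nn_integral_cmult)
  also have "\<dots> = (\<Sum>k. ennreal (real k * (Y ^ k / fact k * exp (- Y))))"
    using Y by (simp add: emeasure_eq_measure count_distribution[OF D] Y_def ennreal_of_nat_eq_real_of_nat ennreal_mult'[symmetric])
  also have "\<dots> = ennreal Y"
  proof (rule suminf_ennreal_eq)
    have "(\<lambda>k. (Y * exp (- Y)) * (Y ^ k /\<^sub>R fact k)) sums ((Y * exp (- Y)) * exp Y)" by (intro sums_mult exp_converges)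
    moreover have "(Y * exp (- Y)) * exp Y = Y" by (simp add: exp_minus)
    moreover have "(Y * exp (- Y)) * (Y ^ k /\<^sub>R fact k) = real (Suc k) * (Y ^ Suc k / fact (Suc k) * exp (- Y))" for k
      by (simp add: field_simps del: of_nat_Suc)
    ultimately have "(\<lambda>k. real (Suc k) * (Y ^ Suc k / fact (Suc k) * exp (- Y))) sums Y" by simp
    from sums_Suc[OF this] show "(\<lambda>k. real k * (Y ^ k / fact k * exp (- Y))) sums Y" by simp
  qed (use Y in auto)
  finally show ?thesis by (simp add: Y_def)
qed

lemma nn_integral_count_eq:
  assumes D: "\<Delta> \<in> bounded_borel"
  shows "(\<integral>\<^sup>+ \<omega>. of_bool (count_in \<Delta> \<omega> = k) \<partial>P) = ennreal ((z * measure lborel \<Delta>) ^ k / fact k * exp (- (z * measure lborel \<Delta>)))"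
proof -
  note [measurable] = count_measurable[OF D]
  have "(\<integral>\<^sup>+ \<omega>. of_bool (count_in \<Delta> \<omega> = k) \<partial>P) = (\<integral>\<^sup>+ \<omega>. indicator {\<omega> \<in> space P. count_in \<Delta> \<omega> = k} \<omega> \<partial>P)"
    by (intro nn_integral_cong) (auto simp: indicator_def)
  also have "\<dots> = emeasure P {\<omega> \<in> space P. count_in \<Delta> \<omega> = k}" by simp
  finally show ?thesis by (simp add: emeasure_eq_measure count_distribution[OF D])
qed


lemma measurable_P_config: "(\<lambda>\<omega>. \<omega>) \<in> measurable P config_space"
  by (simp add: measurable_cong_sets[OF sets_P refl])

lemma mecke_measurable:
  assumes F: "F \<in> borel_measurable (borel \<Otimes>\<^sub>M config_space)" and L: "\<Lambda> \<in> sets borel"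
  shows "(\<lambda>\<omega>. \<integral>\<^sup>+ x. F (x, \<omega> - {x}) * indicator \<Lambda> x \<partial>count_space \<omega>) \<in> borel_measurable P"
    and "(\<lambda>x. indicator \<Lambda> x * (\<integral>\<^sup>+ \<omega>. F (x, \<omega>) \<partial>P)) \<in> borel_measurable lborel"
proof -
  note [measurable] = L F measurable_P_config
  have "(\<lambda>p. (snd p, fst p - {snd p})) \<in> measurable (P \<Otimes>\<^sub>M borel) (borel \<Otimes>\<^sub>M config_space)"
    using measurable_config_remove[OF measurable_compose[OF measurable_fst measurable_P_config] measurable_snd] by measurable
  from measurable_compose[OF this F] have [measurable]: "(\<lambda>p. F (snd p, fst p - {snd p})) \<in> borel_measurable (P \<Otimes>\<^sub>M borel)" .
  show "(\<lambda>\<omega>. \<integral>\<^sup>+ x. F (x, \<omega> - {x}) * indicator \<Lambda> x \<partial>count_space \<omega>) \<in> borel_measurable P"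
    by (rule nn_integral_points_measurable'[OF measurable_P_config]) measurable
  have [measurable]: "case_prod (\<lambda>x \<omega>. F (x, \<omega>)) \<in> borel_measurable (borel \<Otimes>\<^sub>M P)"
    using F by (simp add: measurable_cong_sets[OF sets_pair_measure_cong[OF refl sets_P] refl])
  show "(\<lambda>x. indicator \<Lambda> x * (\<integral>\<^sup>+ \<omega>. F (x, \<omega>) \<partial>P)) \<in> borel_measurable lborel"
    by measurable
qed

text \<open>With \<open>A'\<close> the part of \<open>A\<close> in \<open>\<Lambda>\<close>, a point
  \<open>x\<close> of \<open>A'\<close> such that the rest avoids \<open>B\<close> occurs in two
  ways: the whole configuration avoids \<open>B\<close> and \<open>x\<close> is in
  \<open>A' - B\<close>, or \<open>x\<close> is the only point in \<open>B\<close>. Both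
  contributions are products of functions of counts in disjoint sets and can be computed.\<close>

lemma mecke_generator:
  assumes L: "\<Lambda> \<in> bounded_borel" and A: "A \<in> sets borel" and B: "B \<in> bounded_borel"
  shows "(\<integral>\<^sup>+ \<omega>. \<integral>\<^sup>+ x. indicator (A \<times> void_event B) (x, \<omega> - {x}) * indicator \<Lambda> x \<partial>count_space \<omega> \<partial>P) =
    ennreal z * (\<integral>\<^sup>+ x. indicator \<Lambda> x * (\<integral>\<^sup>+ \<omega>. indicator (A \<times> void_event B) (x, \<omega>) \<partial>P) \<partial>lborel)"
proof -
  define A' where "A' = \<Lambda> \<inter> A"
  have A': "A' \<in> bounded_borel" unfolding A'_def by (rule bounded_borel_Int[OF L A])
  have Bb: "B \<in> sets borel" "A' \<in> sets borel" using B A' by (auto simp: bounded_borel_def)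
  have sets4: "A' - B \<in> bounded_borel" "A' \<inter> B \<in> bounded_borel" "B - A' \<in> bounded_borel"
    using bounded_borel_Int[OF A', of "- B"] bounded_borel_Int[OF A', of B] bounded_borel_Int[OF B, of "- A'"] Bb
    by (auto simp: Diff_eq)
  note [measurable] = count_measurable[OF sets4(1)] count_measurable[OF sets4(2)] count_measurable[OF sets4(3)] count_measurable[OF B]
  have pt: "(\<integral>\<^sup>+ x. indicator (A \<times> void_event B) (x, \<omega> - {x}) * indicator \<Lambda> x \<partial>count_space \<omega>) =
     of_nat (count_in (A' - B) \<omega>) * of_bool (count_in B \<omega> = 0)
     + of_bool (count_in (A' \<inter> B) \<omega> = 1) * of_bool (count_in (B - A') \<omega> = 0)"
    if w: "\<omega> \<in> configurations" for \<omega>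
  proof -
    have fin: "finite (\<omega> \<inter> C)" if "C \<in> bounded_borel" for C using config_finite[OF w] that by (auto simp: bounded_borel_def)
    define S where "S = {x \<in> \<omega> \<inter> A'. (\<omega> - {x}) \<inter> B = {}}"
    have fS: "finite S" by (rule finite_subset[OF _ fin[OF A']]) (auto simp: S_def)
    have "(\<integral>\<^sup>+ x. indicator (A \<times> void_event B) (x, \<omega> - {x}) * indicator \<Lambda> x \<partial>count_space \<omega>) = (\<integral>\<^sup>+ x. indicator S x \<partial>count_space \<omega>)"
      using config_subset[OF w Diff_subset] by (intro nn_integral_cong) (auto simp: S_def A'_def void_event_def split: split_indicator)
    also have "\<dots> = of_nat (card S)"
      using fS by (subst nn_integral_indicator) (auto simp: S_def emeasure_count_space_finite)
    also have "\<dots> = of_nat (count_in (A' - B) \<omega>) * of_bool (count_in B \<omega> = 0)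
     + of_bool (count_in (A' \<inter> B) \<omega> = 1) * of_bool (count_in (B - A') \<omega> = 0)"
    proof (cases "\<omega> \<inter> B = {}")
      case True
      then have "S = \<omega> \<inter> (A' - B)" by (auto simp: S_def)
      moreover have "count_in B \<omega> = 0" "count_in (A' \<inter> B) \<omega> = 0"
        using True by (simp_all add: count_in_def) (metis Int_empty_right Int_left_commute card.empty)
      ultimately show ?thesis by (simp add: count_in_def)
    next
      case False
      then have nB: "count_in B \<omega> \<noteq> 0" using fin[OF B] by (simp add: count_in_def)
      have "card S = of_bool (count_in (A' \<inter> B) \<omega> = 1 \<and> count_in (B - A') \<omega> = 0)"
      proof (cases "count_in (A' \<inter> B) \<omega> = 1 \<and> count_in (B - A') \<omega> = 0")
        case True
        then obtain x where x: "\<omega> \<inter> (A' \<inter> B) = {x}" "\<omega> \<inter> (B - A') = {}"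
          using fin[OF sets4(3)] by (auto simp: count_in_def card_1_singleton_iff)
        then have "\<omega> \<inter> B = {x}" by auto
        then have "S = {x}" using x by (auto simp: S_def)
        then show ?thesis using True by simp
      next
        case f: False
        have "S = {}"
        proof (rule ccontr)
          assume "S \<noteq> {}"
          then obtain x where x: "x \<in> \<omega>" "x \<in> A'" "(\<omega> - {x}) \<inter> B = {}" by (auto simp: S_def)
          then have "\<omega> \<inter> B = {x}" using False by auto
          then have "\<omega> \<inter> (A' \<inter> B) = {x}" "\<omega> \<inter> (B - A') = {}" using x by auto
          then show False using f by (simp add: count_in_def)
        qed
        then show ?thesis using f by simp
      qed
      then show ?thesis using nB by simp
    qed
    finally show ?thesis .
  qed
  have fmA: "C \<in> fmeasurable lborel" if "C \<in> bounded_borel" for C :: "plane set"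
    using emeasure_bounded_finite[of C] that by (intro fmeasurableI) (auto simp: bounded_borel_def)
  define a1 a2 a3 where "a1 = measure lborel (A' - B)" and "a2 = measure lborel (A' \<inter> B)" and "a3 = measure lborel (B - A')"
  have split: "measure lborel A' = a1 + a2" "measure lborel B = a2 + a3"
  proof -
    have "measure lborel ((A' - B) \<union> (A' \<inter> B)) = a1 + a2" unfolding a1_def a2_def
      by (rule measure_Union) (use fmA[OF sets4(1)] fmA[OF sets4(2)] fmA[OF sets4(3)] in \<open>auto simp: fmeasurable_def\<close>)
    moreover have "(A' - B) \<union> (A' \<inter> B) = A'" by auto
    ultimately show "measure lborel A' = a1 + a2" by simp
    have "measure lborel ((A' \<inter> B) \<union> (B - A')) = a2 + a3" unfolding a3_def a2_def
      by (rule measure_Union) (use fmA[OF sets4(1)] fmA[OF sets4(2)] fmA[OF sets4(3)] in \<open>auto simp: fmeasurable_def\<close>)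
    moreover have "(A' \<inter> B) \<union> (B - A') = B" by auto
    ultimately show "measure lborel B = a2 + a3" by simp
  qed
  have a0: "a1 \<ge> 0" "a2 \<ge> 0" "a3 \<ge> 0" by (simp_all add: a1_def a2_def a3_def)
  have "(\<integral>\<^sup>+ \<omega>. \<integral>\<^sup>+ x. indicator (A \<times> void_event B) (x, \<omega> - {x}) * indicator \<Lambda> x \<partial>count_space \<omega> \<partial>P) =
    (\<integral>\<^sup>+ \<omega>. of_nat (count_in (A' - B) \<omega>) * of_bool (count_in B \<omega> = 0)
     + of_bool (count_in (A' \<inter> B) \<omega> = 1) * of_bool (count_in (B - A') \<omega> = 0) \<partial>P)"
    by (intro nn_integral_cong) (simp add: pt space_P)
  also have "\<dots> = (\<integral>\<^sup>+ \<omega>. of_nat (count_in (A' - B) \<omega>) * of_bool (count_in B \<omega> = 0) \<partial>P)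
     + (\<integral>\<^sup>+ \<omega>. of_bool (count_in (A' \<inter> B) \<omega> = 1) * of_bool (count_in (B - A') \<omega> = 0) \<partial>P)"
    by (rule nn_integral_add) measurable
  also have "\<dots> = ennreal (z * a1) * ennreal (exp (- (z * (a2 + a3)))) + ennreal (z * a2 * exp (- (z * a2))) * ennreal (exp (- (z * a3)))"
  proof -
    have "(\<integral>\<^sup>+ \<omega>. of_nat (count_in (A' - B) \<omega>) * of_bool (count_in B \<omega> = 0) \<partial>P) = ennreal (z * a1) * ennreal (exp (- (z * (a2 + a3))))"
      using nn_integral_independent_counts[OF sets4(1) B, of of_nat "\<lambda>k. of_bool (k = 0)"] nn_integral_count[OF sets4(1)] nn_integral_count_eq[OF B, of 0]
      by (auto simp: a1_def split)
    moreover have "(\<integral>\<^sup>+ \<omega>. of_bool (count_in (A' \<inter> B) \<omega> = 1) * of_bool (count_in (B - A') \<omega> = 0) \<partial>P) = ennreal (z * a2 * exp (- (z * a2))) * ennreal (exp (- (z * a3)))"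
      using nn_integral_independent_counts[OF sets4(2,3), of "\<lambda>k. of_bool (k = 1)" "\<lambda>k. of_bool (k = 0)"] nn_integral_count_eq[OF sets4(2), of 1] nn_integral_count_eq[OF sets4(3), of 0]
      by (auto simp: a2_def a3_def)
    ultimately show ?thesis by simp
  qed
  \<comment> \<open>Both summands contain the avoidance probability of \<open>B\<close>, so they
    combine to \<open>z\<close> times the area of \<open>A'\<close> times this probability.\<close>
  also have "\<dots> = ennreal (z * (a1 + a2) * exp (- (z * (a2 + a3))))"
  proof -
    have e: "exp (- (z * (a2 + a3))) = exp (- (z * a2)) * exp (- (z * a3))" by (simp add: exp_add[symmetric] algebra_simps)
    have "z * a1 * exp (- (z * (a2 + a3))) + z * a2 * exp (- (z * a2)) * exp (- (z * a3)) = z * (a1 + a2) * exp (- (z * (a2 + a3)))"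
      unfolding e by (simp add: algebra_simps)
    then show ?thesis using z a0 by (simp add: ennreal_mult[symmetric] ennreal_plus[symmetric] del: ennreal_plus)
  qed
  also have "\<dots> = ennreal z * (ennreal (exp (- (z * measure lborel B))) * emeasure lborel A')"
  proof -
    have "emeasure lborel A' = ennreal (measure lborel A')" using fmA[OF A'] by (simp add: emeasure_eq_measure2)
    then show ?thesis using z a0
      by (simp add: split ennreal_mult[symmetric] ennreal_plus[symmetric] ac_simps del: ennreal_plus)
  qed
  also have "ennreal (exp (- (z * measure lborel B))) * emeasure lborel A' = (\<integral>\<^sup>+ x. ennreal (exp (- (z * measure lborel B))) * indicator A' x \<partial>lborel)"
    using Bb by (simp add: nn_integral_cmult)
  also have "\<dots> = (\<integral>\<^sup>+ x. indicator \<Lambda> x * (\<integral>\<^sup>+ \<omega>. indicator (A \<times> void_event B) (x, \<omega>) \<partial>P) \<partial>lborel)"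
  proof (intro nn_integral_cong)
    fix x
    have "(\<integral>\<^sup>+ \<omega>. indicator (A \<times> void_event B) (x, \<omega>) \<partial>P) = (\<integral>\<^sup>+ \<omega>. indicator A x * indicator (void_event B) \<omega> \<partial>P)"
      by (intro nn_integral_cong) (auto split: split_indicator)
    also have "\<dots> = indicator A x * ennreal (exp (- (z * measure lborel B)))"
      using void_in_events[OF B] void[OF B] by (simp add: nn_integral_cmult emeasure_eq_measure)
    finally show "ennreal (exp (- (z * measure lborel B))) * indicator A' x = indicator \<Lambda> x * (\<integral>\<^sup>+ \<omega>. indicator (A \<times> void_event B) (x, \<omega>) \<partial>P)"
      by (auto simp: A'_def split: split_indicator)
  qed
  finally show ?thesis .
qed

lemma sets_product_void:
  "sets ((borel :: plane measure) \<Otimes>\<^sub>M config_space) =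
    sigma_sets (UNIV \<times> configurations) {A \<times> V | A V. A \<in> sets borel \<and> V \<in> void_events UNIV}"
proof -
  have "sets ((borel :: plane measure) \<Otimes>\<^sub>M config_space) = sets (sigma (space borel \<times> space config_space) {A \<times> V | A V. A \<in> sets borel \<and> V \<in> void_events UNIV})"
  proof (rule sets_pair_eq)
    show "sets (borel :: plane measure) = sigma_sets (space borel) (sets borel)" by (metis sets.sigma_sets_eq)
    show "{UNIV} \<subseteq> sets (borel :: plane measure)" by simp
    show "{configurations} \<subseteq> void_events UNIV" using empty_bounded_borel void_event_empty by (auto simp: void_events_def)
  qed (use sets_config_space_void void_events_closed in auto)
  then show ?thesis using void_events_closed by (subst (asm) sets_measure_of) auto
qed

lemma mecke_sets:
  assumes L: "\<Lambda> \<in> bounded_borel" and X: "X \<in> sets (borel \<Otimes>\<^sub>M config_space)"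
  shows "(\<integral>\<^sup>+ \<omega>. \<integral>\<^sup>+ x. indicator X (x, \<omega> - {x}) * indicator \<Lambda> x \<partial>count_space \<omega> \<partial>P) =
    ennreal z * (\<integral>\<^sup>+ x. indicator \<Lambda> x * (\<integral>\<^sup>+ \<omega>. indicator X (x, \<omega>) \<partial>P) \<partial>lborel)"
proof -
  have Lb: "\<Lambda> \<in> sets borel" using L by (simp add: bounded_borel_def)
  define l where "l X \<omega> = (\<integral>\<^sup>+ x. indicator X (x, \<omega> - {x}) * indicator \<Lambda> x \<partial>count_space \<omega>)" for X and \<omega> :: "plane set"
  define r where "r X x = indicator \<Lambda> x * (\<integral>\<^sup>+ \<omega>. indicator X (x, \<omega>) \<partial>P)" for X and x :: plane
  let ?\<Omega> = "(UNIV :: plane set) \<times> configurations"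
  let ?G = "{A \<times> V | A V. A \<in> sets (borel :: plane measure) \<and> V \<in> void_events UNIV}"
  have GP: "?G \<subseteq> Pow ?\<Omega>" using void_events_closed by auto
  have gen: "X \<in> sigma_sets ?\<Omega> ?G \<longleftrightarrow> X \<in> sets (borel \<Otimes>\<^sub>M config_space)" for X using sets_product_void by simp
  have lm: "l X \<in> borel_measurable P" and rm: "r X \<in> borel_measurable lborel" if "X \<in> sets (borel \<Otimes>\<^sub>M config_space)" for X
    using mecke_measurable[OF borel_measurable_indicator[OF that] Lb] unfolding l_def r_def by auto
  have Xs: "(\<lambda>\<omega>. indicator X (x, \<omega>)) \<in> borel_measurable P" if "X \<in> sets (borel \<Otimes>\<^sub>M config_space)" for X x
    using measurable_compose[OF measurable_Pair1'[of x borel config_space] borel_measurable_indicator[OF that]]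
    by (simp add: measurable_cong_sets[OF sets_P refl])
  have "Int_stable ?G"
  proof (rule Int_stableI, safe)
    fix A V A' V' assume "A \<in> sets (borel :: plane measure)" "A' \<in> sets (borel :: plane measure)" "V \<in> void_events UNIV" "V' \<in> void_events UNIV"
    then show "\<exists>A'' V''. (A \<times> V) \<inter> (A' \<times> V') = A'' \<times> V'' \<and> A'' \<in> sets borel \<and> V'' \<in> void_events UNIV"
      using Int_stable_void_events[of UNIV] by (intro exI[of _ "A \<inter> A'"] exI[of _ "V \<inter> V'"]) (auto simp: Int_stable_def)
  qed
  then have "(\<integral>\<^sup>+ \<omega>. l X \<omega> \<partial>P) = ennreal z * (\<integral>\<^sup>+ x. r X x \<partial>lborel)"
    using GP X[folded gen]
  proof (induct rule: sigma_sets_induct_disjoint)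
    case (basic X)
    then obtain A B where "X = A \<times> void_event B" "A \<in> sets borel" "B \<in> bounded_borel" by (auto simp: void_events_def)
    then show ?case unfolding l_def r_def using mecke_generator[OF L] by simp
  next
    case empty
    then show ?case by (simp add: l_def r_def)
  next
    case (compl X)
    have X: "X \<in> sets (borel \<Otimes>\<^sub>M config_space)" using compl(1) gen by simp
    have O: "?\<Omega> \<in> sets (borel \<Otimes>\<^sub>M config_space)" using sets.top[of "borel \<Otimes>\<^sub>M config_space"] by (simp add: space_pair_measure)
    have XO: "?\<Omega> - X \<in> sets (borel \<Otimes>\<^sub>M config_space)" using X O by auto
    have sub: "X \<subseteq> ?\<Omega>" using sets.sets_into_space[OF X] by (simp add: space_pair_measure)
    have ind: "indicator ?\<Omega> p = (indicator X p + indicator (?\<Omega> - X) p :: ennreal)" for p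
      using sub by (auto split: split_indicator)
    have lO: "l ?\<Omega> \<omega> = l X \<omega> + l (?\<Omega> - X) \<omega>" for \<omega>
      unfolding l_def ind distrib_right by (rule nn_integral_add) auto
    have rO: "r ?\<Omega> x = r X x + r (?\<Omega> - X) x" for x
      unfolding r_def ind by (subst nn_integral_add) (use Xs[OF X] Xs[OF XO] in \<open>auto simp: distrib_left\<close>)
    have whole: "(\<integral>\<^sup>+ \<omega>. l ?\<Omega> \<omega> \<partial>P) = ennreal z * (\<integral>\<^sup>+ x. r ?\<Omega> x \<partial>lborel)"
      using mecke_generator[OF L sets.top[of borel] empty_bounded_borel] unfolding l_def r_def void_event_empty by simp
    \<comment> \<open>Finite because \<open>\<Lambda>\<close> is bounded; the complement case
      cancels a common summand in \<open>ennreal\<close>.\<close>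
    have fin: "ennreal z * (\<integral>\<^sup>+ x. r ?\<Omega> x \<partial>lborel) < \<infinity>"
    proof -
      have "r ?\<Omega> x \<le> indicator \<Lambda> x" for x
      proof -
        have "(\<integral>\<^sup>+ \<omega>. indicator ?\<Omega> (x, \<omega>) \<partial>P) \<le> (\<integral>\<^sup>+ \<omega>. 1 \<partial>P)" by (intro nn_integral_mono) (auto split: split_indicator)
        then show ?thesis by (auto simp: r_def emeasure_space_1 split: split_indicator)
      qed
      then have "(\<integral>\<^sup>+ x. r ?\<Omega> x \<partial>lborel) \<le> (\<integral>\<^sup>+ x. indicator \<Lambda> x \<partial>lborel)" by (intro nn_integral_mono)
      also have "\<dots> = emeasure lborel \<Lambda>" using Lb by simp
      also have "\<dots> < \<infinity>" using emeasure_bounded_finite[of \<Lambda>] L by (simp add: bounded_borel_def)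
      finally show ?thesis by (simp add: ennreal_mult_less_top)
    qed
    have "(\<integral>\<^sup>+ \<omega>. l X \<omega> \<partial>P) + (\<integral>\<^sup>+ \<omega>. l (?\<Omega> - X) \<omega> \<partial>P) = (\<integral>\<^sup>+ \<omega>. l ?\<Omega> \<omega> \<partial>P)"
      unfolding lO using lm[OF X] lm[OF XO] by (rule nn_integral_add[symmetric])
    also have "\<dots> = ennreal z * (\<integral>\<^sup>+ x. r X x \<partial>lborel) + ennreal z * (\<integral>\<^sup>+ x. r (?\<Omega> - X) x \<partial>lborel)"
      unfolding whole rO using rm[OF X] rm[OF XO] by (simp add: nn_integral_add distrib_left)
    finally have eq: "(\<integral>\<^sup>+ \<omega>. l X \<omega> \<partial>P) + (\<integral>\<^sup>+ \<omega>. l (?\<Omega> - X) \<omega> \<partial>P) = (\<integral>\<^sup>+ \<omega>. l X \<omega> \<partial>P) + ennreal z * (\<integral>\<^sup>+ x. r (?\<Omega> - X) x \<partial>lborel)"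
      unfolding compl(2) .
    have "(\<integral>\<^sup>+ \<omega>. l X \<omega> \<partial>P) \<noteq> \<top>"
    proof -
      have "(\<integral>\<^sup>+ \<omega>. l X \<omega> \<partial>P) \<le> (\<integral>\<^sup>+ \<omega>. l ?\<Omega> \<omega> \<partial>P)" by (intro nn_integral_mono) (simp add: lO)
      then show ?thesis using fin unfolding whole by (auto simp: top_unique)
    qed
    then show ?case using eq by (simp add: ennreal_add_left_cancel)
  next
    case (union X)
    have X: "X i \<in> sets (borel \<Otimes>\<^sub>M config_space)" for i using union(2) gen by auto
    have ind: "indicator (\<Union>i. X i) p = (\<Sum>i. indicator (X i) p :: ennreal)" for p
      using suminf_indicator[OF union(1), of p] by simp
    have "l (\<Union>i. X i) \<omega> = (\<Sum>i. l (X i) \<omega>)" for \<omega>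
      unfolding l_def ind ennreal_suminf_multc[symmetric] by (rule nn_integral_suminf) auto
    then have "(\<integral>\<^sup>+ \<omega>. l (\<Union>i. X i) \<omega> \<partial>P) = (\<Sum>i. \<integral>\<^sup>+ \<omega>. l (X i) \<omega> \<partial>P)"
      using lm[OF X] by (simp add: nn_integral_suminf)
    also have "\<dots> = (\<Sum>i. ennreal z * (\<integral>\<^sup>+ x. r (X i) x \<partial>lborel))" using union(3) by simp
    also have "\<dots> = ennreal z * (\<integral>\<^sup>+ x. (\<Sum>i. r (X i) x) \<partial>lborel)"
      using rm[OF X] by (simp add: nn_integral_suminf)
    also have "(\<lambda>x. \<Sum>i. r (X i) x) = r (\<Union>i. X i)"
      unfolding r_def ind by (subst nn_integral_suminf) (use Xs[OF X] in auto)
    finally show ?case .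
  qed
  then show ?thesis unfolding l_def r_def .
qed

theorem mecke:
  assumes L: "\<Lambda> \<in> bounded_borel" and F: "F \<in> borel_measurable (borel \<Otimes>\<^sub>M config_space)"
  shows "(\<integral>\<^sup>+ \<omega>. \<integral>\<^sup>+ x. F (x, \<omega> - {x}) * indicator \<Lambda> x \<partial>count_space \<omega> \<partial>P) =
    ennreal z * (\<integral>\<^sup>+ x. indicator \<Lambda> x * (\<integral>\<^sup>+ \<omega>. F (x, \<omega>) \<partial>P) \<partial>lborel)"
  using F
proof (induct rule: borel_measurable_induct)
  case (cong f g)
  have "(\<integral>\<^sup>+ \<omega>. \<integral>\<^sup>+ x. f (x, \<omega> - {x}) * indicator \<Lambda> x \<partial>count_space \<omega> \<partial>P) = (\<integral>\<^sup>+ \<omega>. \<integral>\<^sup>+ x. g (x, \<omega> - {x}) * indicator \<Lambda> x \<partial>count_space \<omega> \<partial>P)"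
    using cong(3) config_subset[OF _ Diff_subset] by (intro nn_integral_cong) (auto simp: space_P space_pair_measure)
  moreover have "(\<integral>\<^sup>+ x. indicator \<Lambda> x * (\<integral>\<^sup>+ \<omega>. f (x, \<omega>) \<partial>P) \<partial>lborel) = (\<integral>\<^sup>+ x. indicator \<Lambda> x * (\<integral>\<^sup>+ \<omega>. g (x, \<omega>) \<partial>P) \<partial>lborel)"
    using cong(3) by (intro nn_integral_cong arg_cong2[where f="(*)"] refl) (auto simp: space_P space_pair_measure)
  ultimately show ?case using cong(4) by simp
next
  case (set X)
  then show ?case by (rule mecke_sets[OF L])
next
  case (mult u c)
  have Lb: "\<Lambda> \<in> sets borel" using L by (simp add: bounded_borel_def)
  note m = mecke_measurable[OF mult(2) Lb]
  have us: "(\<lambda>\<omega>. u (x, \<omega>)) \<in> borel_measurable P" for x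
    using measurable_compose[OF measurable_Pair1'[of x borel config_space] mult(2)] by (simp add: measurable_cong_sets[OF sets_P refl])
  have "(\<integral>\<^sup>+ \<omega>. \<integral>\<^sup>+ x. c * u (x, \<omega> - {x}) * indicator \<Lambda> x \<partial>count_space \<omega> \<partial>P) = c * (\<integral>\<^sup>+ \<omega>. \<integral>\<^sup>+ x. u (x, \<omega> - {x}) * indicator \<Lambda> x \<partial>count_space \<omega> \<partial>P)"
    using m(1) by (simp add: nn_integral_cmult mult.assoc)
  moreover have "(\<integral>\<^sup>+ x. indicator \<Lambda> x * (\<integral>\<^sup>+ \<omega>. c * u (x, \<omega>) \<partial>P) \<partial>lborel) = c * (\<integral>\<^sup>+ x. indicator \<Lambda> x * (\<integral>\<^sup>+ \<omega>. u (x, \<omega>) \<partial>P) \<partial>lborel)"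
    using m(2) us by (simp add: nn_integral_cmult mult.left_commute)
  ultimately show ?case using mult(4) by (simp add: mult.left_commute)
next
  case (add u v)
  have Lb: "\<Lambda> \<in> sets borel" using L by (simp add: bounded_borel_def)
  note mu = mecke_measurable[OF add(1) Lb] and mv = mecke_measurable[OF add(4) Lb]
  have us: "(\<lambda>\<omega>. u (x, \<omega>)) \<in> borel_measurable P" "(\<lambda>\<omega>. v (x, \<omega>)) \<in> borel_measurable P" for x
    using measurable_compose[OF measurable_Pair1'[of x borel config_space] add(1)] measurable_compose[OF measurable_Pair1'[of x borel config_space] add(4)]
    by (simp_all add: measurable_cong_sets[OF sets_P refl])
  show ?case
    using add(3,7) mu mv us by (simp add: nn_integral_add distrib_right distrib_left)
next
  case (seq U)
  have Lb: "\<Lambda> \<in> sets borel" using L by (simp add: bounded_borel_def)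
  note m = mecke_measurable[OF seq(1) Lb]
  have us: "(\<lambda>\<omega>. U i (x, \<omega>)) \<in> borel_measurable P" for x i
    using measurable_compose[OF measurable_Pair1'[of x borel config_space] seq(1)[of i]] by (simp add: measurable_cong_sets[OF sets_P refl])
  have inc: "i \<le> j \<Longrightarrow> U i p \<le> U j p" for i j p by (rule le_funD[OF incseqD[OF seq(4)]])
  have "(\<integral>\<^sup>+ x. (SUP i. U i) (x, \<omega> - {x}) * indicator \<Lambda> x \<partial>count_space \<omega>) = (SUP i. \<integral>\<^sup>+ x. U i (x, \<omega> - {x}) * indicator \<Lambda> x \<partial>count_space \<omega>)" for \<omega>
  proof -
    have "(\<integral>\<^sup>+ x. (SUP i. U i) (x, \<omega> - {x}) * indicator \<Lambda> x \<partial>count_space \<omega>) = (\<integral>\<^sup>+ x. (SUP i. U i (x, \<omega> - {x}) * indicator \<Lambda> x) \<partial>count_space \<omega>)"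
      by (intro nn_integral_cong) (simp only: SUP_apply, simp add: SUP_mult_right_ennreal)
    also have "\<dots> = (SUP i. \<integral>\<^sup>+ x. U i (x, \<omega> - {x}) * indicator \<Lambda> x \<partial>count_space \<omega>)"
      by (rule nn_integral_monotone_convergence_SUP) (auto simp: incseq_def le_fun_def intro!: mult_right_mono inc)
    finally show ?thesis .
  qed
  moreover have "(\<integral>\<^sup>+ \<omega>. (SUP i. \<integral>\<^sup>+ x. U i (x, \<omega> - {x}) * indicator \<Lambda> x \<partial>count_space \<omega>) \<partial>P) = (SUP i. \<integral>\<^sup>+ \<omega>. \<integral>\<^sup>+ x. U i (x, \<omega> - {x}) * indicator \<Lambda> x \<partial>count_space \<omega> \<partial>P)"
    using m(1) by (intro nn_integral_monotone_convergence_SUP) (auto simp: incseq_def le_fun_def intro!: nn_integral_mono mult_right_mono inc)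
  moreover have "(\<integral>\<^sup>+ \<omega>. (SUP i. U i) (x, \<omega>) \<partial>P) = (SUP i. \<integral>\<^sup>+ \<omega>. U i (x, \<omega>) \<partial>P)" for x
    unfolding SUP_apply using us by (intro nn_integral_monotone_convergence_SUP) (auto simp: incseq_def le_fun_def intro!: inc)
  moreover have "(\<integral>\<^sup>+ x. (SUP i. indicator \<Lambda> x * (\<integral>\<^sup>+ \<omega>. U i (x, \<omega>) \<partial>P)) \<partial>lborel) = (SUP i. \<integral>\<^sup>+ x. indicator \<Lambda> x * (\<integral>\<^sup>+ \<omega>. U i (x, \<omega>) \<partial>P) \<partial>lborel)"
    using m(2) by (intro nn_integral_monotone_convergence_SUP) (auto simp: incseq_def le_fun_def intro!: nn_integral_mono mult_left_mono inc)
  ultimately show ?case using seq(3) by (simp add: SUP_mult_left_ennreal)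
qed

end

section \<open>Stationary processes in generic position\<close>

text \<open>Tiles become triples of points and circles become cotangent equations. Only quantifiers
  over points remain, and \<open>pred_points_ex\<close> applies.\<close>

lemma degenerate_iff:
  "degenerate x \<omega> \<longleftrightarrow> (\<exists>a\<in>\<omega>. x$1 = a$1) \<or> (\<exists>a\<in>\<omega>. \<exists>b\<in>\<omega>. a \<noteq> b \<and> cross a b x = 0) \<or>
     (\<exists>a\<in>\<omega>. \<exists>b\<in>\<omega>. \<exists>c\<in>\<omega>. cross a b c \<noteq> 0 \<and> (x - a) \<bullet> (x - b) = cot_angle a b c * cross a b x)"
proof -
  have "(\<exists>\<tau>. \<tau> \<subseteq> \<omega> \<and> tile \<tau> \<and> x \<in> sphere (tile_centre \<tau>) (tile_radius \<tau>)) \<longleftrightarrow>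
     (\<exists>a\<in>\<omega>. \<exists>b\<in>\<omega>. \<exists>c\<in>\<omega>. cross a b c \<noteq> 0 \<and> (x - a) \<bullet> (x - b) = cot_angle a b c * cross a b x)"
  proof safe
    fix \<tau> assume t: "\<tau> \<subseteq> \<omega>" "tile \<tau>" "x \<in> sphere (tile_centre \<tau>) (tile_radius \<tau>)"
    obtain a b c where abc: "\<tau> = {a, b, c}" "cross a b c > 0" using t(2) by (rule tile_obtain)
    then have "(x - a) \<bullet> (x - b) = cot_angle a b c * cross a b x" "cross a b c \<noteq> 0"
      using t(3) on_tile_circle_iff[of a b c x] by auto
    then show "\<exists>a\<in>\<omega>. \<exists>b\<in>\<omega>. \<exists>c\<in>\<omega>. cross a b c \<noteq> 0 \<and> (x - a) \<bullet> (x - b) = cot_angle a b c * cross a b x"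
      using t(1) abc(1) by (intro bexI[of _ a] bexI[of _ b] bexI[of _ c]) auto
  next
    fix a b c assume "a \<in> \<omega>" "b \<in> \<omega>" "c \<in> \<omega>" "cross a b c \<noteq> 0" "(x - a) \<bullet> (x - b) = cot_angle a b c * cross a b x"
    then show "\<exists>\<tau>. \<tau> \<subseteq> \<omega> \<and> tile \<tau> \<and> x \<in> sphere (tile_centre \<tau>) (tile_radius \<tau>)"
      using on_tile_circle_iff[of a b c x] by (intro exI[of _ "{a, b, c}"]) (simp add: tile_iff_cross)
  qed
  then show ?thesis unfolding degenerate_def by (simp only:)
qed

lemma measurable_degenerate:
  assumes \<kappa>: "\<kappa> \<in> measurable S config_space" and g: "g \<in> borel_measurable S"
  shows "Measurable.pred S (\<lambda>s. degenerate (g s) (\<kappa> s))"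
proof -
  note k1 = measurable_compose[OF measurable_fst \<kappa>]
  note k2 = measurable_compose[OF measurable_fst k1]
  note [measurable] = g measurable_compose[OF measurable_fst g] measurable_compose[OF measurable_fst measurable_compose[OF measurable_fst g]]
     measurable_compose[OF measurable_fst measurable_compose[OF measurable_fst measurable_compose[OF measurable_fst g]]]
  have eq: "Measurable.pred T (\<lambda>t. u t = v t)" if [measurable]: "u \<in> borel_measurable T" "v \<in> borel_measurable T"
    for u v :: "'t \<Rightarrow> 'x :: {second_countable_topology, t2_space}" and T
    using measurable_equality_set[OF that] by (simp add: pred_def)
  have "Measurable.pred S (\<lambda>s. \<exists>a\<in>\<kappa> s. g s $ 1 = a $ 1)"
    by (intro pred_points_ex[OF \<kappa>] eq) measurable
  moreover have "Measurable.pred S (\<lambda>s. \<exists>a\<in>\<kappa> s. \<exists>b\<in>\<kappa> s. a \<noteq> b \<and> cross a b (g s) = 0)"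
    by (intro pred_points_ex[OF \<kappa>] pred_points_ex[OF k1] pred_intros_logic eq) measurable
  moreover have "Measurable.pred S (\<lambda>s. \<exists>a\<in>\<kappa> s. \<exists>b\<in>\<kappa> s. \<exists>c\<in>\<kappa> s. cross a b c \<noteq> 0 \<and> (g s - a) \<bullet> (g s - b) = cot_angle a b c * cross a b (g s))"
    by (intro pred_points_ex[OF \<kappa>] pred_points_ex[OF k1] pred_points_ex[OF k2] pred_intros_logic eq) measurable
  ultimately show ?thesis unfolding degenerate_iff by measurable
qed

lemma AE_lborel_not_in:
  assumes "negligible S" "S \<in> sets borel" shows "AE x in lborel. x \<notin> (S :: plane set)"
proof -
  have "S \<in> null_sets lborel"
    using assms negligible_iff_null_sets[of S] null_sets_completion_iff[of S lborel] by simp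
  then show ?thesis by (rule AE_not_in)
qed

text \<open>A configuration is countable, so the exceptional \<open>x\<close> lie on countably many
  lines and circles.\<close>

lemma AE_not_degenerate:
  assumes w: "\<omega> \<in> configurations" shows "AE x in lborel. \<not> degenerate x \<omega>"
proof -
  note cnt = config_countable[OF w]
  have 1: "AE x in lborel. (x::plane)$1 \<noteq> a$1" for a :: plane
  proof -
    have e: "{x::plane. x$1 = a$1} = {x. axis 1 1 \<bullet> x = a$1}" by (simp add: inner_axis')
    have "negligible {x::plane. x$1 = a$1}" unfolding e by (rule negligible_hyperplane) (simp add: axis_eq_0_iff)
    moreover have "{x::plane. x$1 = a$1} \<in> sets borel" by measurable
    ultimately show ?thesis using AE_lborel_not_in[of "{x::plane. x$1 = a$1}"] by simp
  qed
  have 2: "AE x in lborel. a \<noteq> b \<longrightarrow> cross a b x \<noteq> 0" for a b :: plane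
  proof (cases "a = b")
    case False
    define n :: plane where "n = vector [- (b$2 - a$2), b$1 - a$1]"
    have n: "n \<noteq> 0" using False by (auto simp: n_def plane_eq_iff)
    have e: "{x. cross a b x = 0} = {x. n \<bullet> x = n \<bullet> a}"
      by (auto simp: cross_def n_def inner_plane algebra_simps)
    have "negligible {x. cross a b x = 0}" unfolding e using n by (intro negligible_hyperplane) auto
    moreover have "{x. cross a b x = 0} \<in> sets borel" by measurable
    ultimately show ?thesis using AE_lborel_not_in[of "{x. cross a b x = 0}"] by simp
  qed simp
  have 3: "AE x in lborel. cross a b c \<noteq> 0 \<longrightarrow> (x - a) \<bullet> (x - b) \<noteq> cot_angle a b c * cross a b x" for a b c :: plane
  proof (cases "cross a b c = 0")
    case False
    have "AE x in lborel. x \<notin> sphere (tile_centre {a, b, c}) (tile_radius {a, b, c})"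
      by (rule AE_lborel_not_in) (auto simp: negligible_sphere)
    then show ?thesis by eventually_elim (simp add: on_tile_circle_iff[OF False] del: mem_sphere)
  qed simp
  have "AE x in lborel. \<forall>a\<in>\<omega>. (x::plane)$1 \<noteq> a$1" by (intro AE_ball_countable' cnt 1)
  moreover have "AE x in lborel. \<forall>a\<in>\<omega>. \<forall>b\<in>\<omega>. a \<noteq> b \<longrightarrow> cross a b x \<noteq> 0" by (intro AE_ball_countable' cnt 2)
  moreover have "AE x in lborel. \<forall>a\<in>\<omega>. \<forall>b\<in>\<omega>. \<forall>c\<in>\<omega>. cross a b c \<noteq> 0 \<longrightarrow> (x - a) \<bullet> (x - b) \<noteq> cot_angle a b c * cross a b x"
    by (intro AE_ball_countable' cnt 3)
  ultimately show ?thesis by eventually_elim (auto simp: degenerate_iff)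
qed

text \<open>Each point is tested against the others. This is the form delivered by the Mecke
  formula, where a point is removed before it is tested.\<close>

definition generic :: "plane set \<Rightarrow> bool" where
  "generic \<omega> \<longleftrightarrow> (\<forall>x\<in>\<omega>. \<not> degenerate x (\<omega> - {x}))"

lemma generic_general_position:
  assumes "generic \<omega>" shows "general_position \<omega>"
  unfolding general_position_def
proof (intro allI impI subsetI)
  fix \<tau> y assume t: "\<tau> \<subseteq> \<omega>" "tile \<tau>" and y: "y \<in> \<omega> \<inter> sphere (tile_centre \<tau>) (tile_radius \<tau>)"
  show "y \<in> \<tau>"
  proof (rule ccontr)
    assume "y \<notin> \<tau>"
    then have "\<tau> \<subseteq> \<omega> - {y}" using t by auto
    then have "degenerate y (\<omega> - {y})" using t y unfolding degenerate_def by blast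
    then show False using assms y by (auto simp: generic_def)
  qed
qed

lemma generic_distinct_abscissae:
  assumes "generic \<omega>" "a \<in> \<omega>" "b \<in> \<omega>" "a \<noteq> b" shows "a$1 \<noteq> b$1"
  using assms unfolding generic_def degenerate_def by blast

lemma degenerate_mono: "degenerate x \<omega> \<Longrightarrow> \<omega> \<subseteq> \<omega>' \<Longrightarrow> degenerate x \<omega>'"
  unfolding degenerate_iff by (meson subsetD)

section \<open>Middle vertices of tiles\<close>

definition middle :: "plane \<Rightarrow> plane set \<Rightarrow> bool" where
  "middle v \<tau> \<longleftrightarrow> v \<in> \<tau> \<and> (\<exists>u\<in>\<tau>. u$1 < v$1) \<and> (\<exists>u\<in>\<tau>. v$1 < u$1)"

lemma middle_exists:
  assumes "tile \<tau>" "\<And>a b. a \<in> \<tau> \<Longrightarrow> b \<in> \<tau> \<Longrightarrow> a \<noteq> b \<Longrightarrow> a$1 \<noteq> b$1"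
  shows "\<exists>v\<in>\<tau>. middle v \<tau>"
proof -
  obtain a b c where abc: "\<tau> = {a, b, c}" "a \<noteq> b" "b \<noteq> c" "a \<noteq> c" using tile_obtain[OF assms(1)] by blast
  then have "a$1 \<noteq> b$1" "b$1 \<noteq> c$1" "a$1 \<noteq> c$1" using assms(2) by auto
  then have "middle a \<tau> \<or> middle b \<tau> \<or> middle c \<tau>" unfolding middle_def abc(1) by auto
  then show ?thesis using abc(1) by auto
qed

text \<open>The vertical segment from the middle vertex of a tile to the opposite edge runs inside the tile.
  Two tiles with the same middle vertex whose segments have the same direction overlap.\<close>

lemma same_middle_eq:
  assumes gp: "general_position \<omega>" and t: "\<tau> \<in> empty_disc_tiles \<omega>" "\<tau>' \<in> empty_disc_tiles \<omega>"
    and a: "\<tau> = {a, v, b}" "a$1 < v$1" "v$1 < b$1" and a': "\<tau>' = {a', v, b'}" "a'$1 < v$1" "v$1 < b'$1"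
    and dir: "cross a b v * cross a' b' v > 0"
  shows "\<tau> = \<tau>'"
proof -
  define L where "L y = (dist y (tile_centre \<tau>))\<^sup>2 - (dist y (tile_centre \<tau>'))\<^sup>2
                      - ((tile_radius \<tau>)\<^sup>2 - (tile_radius \<tau>')\<^sup>2)" for y
  have sep: "\<And>y. y \<in> \<tau> \<Longrightarrow> L y \<le> 0" "\<And>y. y \<in> \<tau>' \<Longrightarrow> L y \<ge> 0" "\<And>y. y \<in> \<tau> \<Longrightarrow> L y = 0 \<Longrightarrow> y \<in> \<tau>'"
    using empty_disc_tiles_separated[OF gp t] unfolding L_def by blast+
  define l where "l = - 2 * (tile_centre \<tau> $ 2 - tile_centre \<tau>' $ 2)"
  have Lv: "L v = 0" using sep(1)[of v] sep(2)[of v] a a' by force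
  \<comment> \<open>\<open>L\<close> is affine with vertical slope \<open>l\<close>. At the abscissa
    of \<open>v\<close> it interpolates linearly along the segment from \<open>p\<close> to
    \<open>q\<close>, and \<open>cross p q v\<close> is the height of \<open>v\<close> over this
    segment times \<open>q$1 - p$1\<close>.\<close>
  have key: "(q$1 - p$1) * L v = (v$1 - p$1) * L q + (q$1 - v$1) * L p + l * cross p q v" for p q
    unfolding L_def l_def cross_def dist_plane_sq by (simp add: power2_eq_square algebra_simps)
  have 1: "(v$1 - a$1) * L b + (b$1 - v$1) * L a + l * cross a b v = 0" using key[of b a] Lv by simp
  have 2: "(v$1 - a'$1) * L b' + (b'$1 - v$1) * L a' + l * cross a' b' v = 0" using key[of b' a'] Lv by simp
  have n: "(v$1 - a$1) * L b \<le> 0" "(b$1 - v$1) * L a \<le> 0"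
    using sep(1)[of a] sep(1)[of b] a by (auto intro: mult_nonneg_nonpos)
  have n': "(v$1 - a'$1) * L b' \<ge> 0" "(b'$1 - v$1) * L a' \<ge> 0"
    using sep(2)[of a'] sep(2)[of b'] a' by auto
  \<comment> \<open>The two determinants have the same sign by \<open>dir\<close>, so the opposite
    signs found here force \<open>l = 0\<close>.\<close>
  have p: "l * cross a b v \<ge> 0" "l * cross a' b' v \<le> 0" using 1 2 n n' by linarith+
  have "l = 0"
  proof (rule ccontr)
    assume "l \<noteq> 0"
    then have "0 < l * l" by (metis not_real_square_gt_zero)
    then have "0 < l * l * (cross a b v * cross a' b' v)" using dir by (rule mult_pos_pos)
    also have "\<dots> = (l * cross a b v) * (l * cross a' b' v)" by (simp add: algebra_simps)
    also have "\<dots> \<le> 0" using p by (rule mult_nonneg_nonpos)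
    finally show False by simp
  qed
  then have "(v$1 - a$1) * L b + (b$1 - v$1) * L a = 0" using 1 by simp
  then have "(v$1 - a$1) * L b = 0" "(b$1 - v$1) * L a = 0" using n by linarith+
  then have "L a = 0" "L b = 0" using a by auto
  then have "\<tau> \<subseteq> \<tau>'" using sep(3) a a' by auto
  then show ?thesis using tile_eqI t by (auto simp: empty_disc_tiles_def)
qed

text \<open>By \<open>same_middle_eq\<close> a tile with middle vertex \<open>v\<close> is
  determined by the vertical direction in which its opposite edge lies, and there are two
  directions.\<close>

lemma middle_tiles_le_2:
  assumes gp: "general_position \<omega>"
  shows "emeasure (count_space (empty_disc_tiles \<omega>)) {\<tau> \<in> empty_disc_tiles \<omega>. middle v \<tau>} \<le> 2"
proof -
  define up where "up s = {\<tau> \<in> empty_disc_tiles \<omega>. \<exists>a b. \<tau> = {a, v, b} \<and> a$1 < v$1 \<and> v$1 < b$1 \<and> cross a b v * s > 0}" for s :: real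
  have sub: "{\<tau> \<in> empty_disc_tiles \<omega>. middle v \<tau>} \<subseteq> up 1 \<union> up (- 1)"
  proof
    fix \<tau> assume "\<tau> \<in> {\<tau> \<in> empty_disc_tiles \<omega>. middle v \<tau>}"
    then have t: "\<tau> \<in> empty_disc_tiles \<omega>" "tile \<tau>" "middle v \<tau>" by (auto simp: empty_disc_tiles_def)
    obtain a b where ab: "a \<in> \<tau>" "b \<in> \<tau>" "v \<in> \<tau>" "a$1 < v$1" "v$1 < b$1" using t(3) by (auto simp: middle_def)
    have d: "card {a, v, b} = 3" using ab by (auto simp: card_insert_if)
    have "{a, v, b} = \<tau>"
      by (rule card_subset_eq) (use d ab t(2) finite_tile in \<open>auto simp: tile_def\<close>)
    moreover from this have "cross a b v \<noteq> 0" using t(2) tile_iff_cross[of a b v] by (auto simp: insert_commute)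
    ultimately show "\<tau> \<in> up 1 \<union> up (- 1)" using t(1) ab by (auto simp: up_def) (metis linorder_neqE_linordered_idom)
  qed
  have "\<tau> = \<tau>'" if m: "\<tau> \<in> up s" "\<tau>' \<in> up s" for s \<tau> \<tau>'
  proof -
    obtain a b where 1: "\<tau> = {a, v, b}" "a$1 < v$1" "v$1 < b$1" "cross a b v * s > 0" using m(1) by (auto simp: up_def)
    obtain a' b' where 2: "\<tau>' = {a', v, b'}" "a'$1 < v$1" "v$1 < b'$1" "cross a' b' v * s > 0" using m(2) by (auto simp: up_def)
    have "cross a b v * cross a' b' v > 0" using 1(4) 2(4) by (auto simp: zero_less_mult_iff)
    then show ?thesis using m same_middle_eq[OF gp _ _ 1(1-3) 2(1-3)] by (auto simp: up_def)
  qed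
  then have c: "finite (up s) \<and> card (up s) \<le> 1" for s
  proof -
    have "up s = {} \<or> (\<exists>\<tau>. up s = {\<tau>})" using \<open>\<And>s \<tau> \<tau>'. \<tau> \<in> up s \<Longrightarrow> \<tau>' \<in> up s \<Longrightarrow> \<tau> = \<tau>'\<close> by blast
    then show ?thesis by auto
  qed
  have f: "finite {\<tau> \<in> empty_disc_tiles \<omega>. middle v \<tau>}" using sub c by (meson finite_UnI finite_subset)
  have "card {\<tau> \<in> empty_disc_tiles \<omega>. middle v \<tau>} \<le> card (up 1 \<union> up (- 1))" using sub c by (intro card_mono) auto
  also have "\<dots> \<le> card (up 1) + card (up (- 1))" by (rule card_Un_le)
  also have "\<dots> \<le> 2" using c[of 1] c[of "- 1"] by linarith
  finally have "of_nat (card {\<tau> \<in> empty_disc_tiles \<omega>. middle v \<tau>}) \<le> (of_nat 2 :: ennreal)"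
    by (rule of_nat_mono)
  then show ?thesis using f by (subst emeasure_count_space_finite) auto
qed

section \<open>Stationarity and mass transport\<close>

lemma nn_integral_lborel_translate:
  fixes f :: "plane \<Rightarrow> ennreal"
  assumes [measurable]: "f \<in> borel_measurable borel"
  shows "(\<integral>\<^sup>+ y. f (c + y) \<partial>lborel) = (\<integral>\<^sup>+ y. f y \<partial>lborel)" "(\<integral>\<^sup>+ y. f (c - y) \<partial>lborel) = (\<integral>\<^sup>+ y. f y \<partial>lborel)"
proof -
  have "(\<integral>\<^sup>+ y. f y \<partial>lborel) = (\<integral>\<^sup>+ y. f y \<partial>distr lborel borel ((+) c))" by (simp add: lborel_distr_plus)
  also have "\<dots> = (\<integral>\<^sup>+ y. f (c + y) \<partial>lborel)" by (subst nn_integral_distr) auto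
  finally show "(\<integral>\<^sup>+ y. f (c + y) \<partial>lborel) = (\<integral>\<^sup>+ y. f y \<partial>lborel)" by simp
  have l: "lborel = distr lborel borel (\<lambda>x. c + (- 1) *\<^sub>R x)" using lborel_affine[of "- 1" c] by (simp add: density_1)
  have "(\<integral>\<^sup>+ y. f y \<partial>lborel) = (\<integral>\<^sup>+ y. f y \<partial>distr lborel borel (\<lambda>x. c + (- 1) *\<^sub>R x))" using l by simp
  also have "\<dots> = (\<integral>\<^sup>+ y. f (c - y) \<partial>lborel)" by (subst nn_integral_distr) auto
  finally show "(\<integral>\<^sup>+ y. f (c - y) \<partial>lborel) = (\<integral>\<^sup>+ y. f y \<partial>lborel)" by simp
qed

lemma shift_shift: "shift x (shift y \<omega>) = shift (y + x) \<omega>"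
  by (simp add: shift_eq ac_simps)

lemma shift_zero [simp]: "shift 0 \<omega> = \<omega>"
  by (simp add: shift_eq)

lemma tile_disc_shift: "tile \<tau> \<Longrightarrow> tile_disc (shift x \<tau>) = shift x (tile_disc \<tau>)"
  unfolding tile_disc_def shift_tile(2,3) by (auto simp: shift_eq dist_norm algebra_simps)

lemma empty_disc_tiles_shift: "bij_betw (shift x) (empty_disc_tiles \<omega>) (empty_disc_tiles (shift x \<omega>))"
proof (rule bij_betw_byWitness[where f'="shift (- x)"])
  have *: "shift y \<tau> \<in> empty_disc_tiles (shift y \<omega>)" if t: "\<tau> \<in> empty_disc_tiles \<omega>" for y \<tau> \<omega>
  proof -
    have "tile \<tau>" "\<tau> \<subseteq> \<omega>" "\<omega> \<inter> tile_disc \<tau> = {}" using t by (auto simp: empty_disc_tiles_def)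
    then show ?thesis unfolding empty_disc_tiles_def using shift_tile(1)[of \<tau> y] tile_disc_shift[of \<tau> y]
      by (auto simp: shift_eq)
  qed
  show "shift x ` empty_disc_tiles \<omega> \<subseteq> empty_disc_tiles (shift x \<omega>)" using * by auto
  show "shift (- x) ` empty_disc_tiles (shift x \<omega>) \<subseteq> empty_disc_tiles \<omega>"
    using *[of _ "shift x \<omega>" "- x"] by (auto simp: shift_shift)
qed (auto simp: shift_shift)

lemma countable_empty_disc_tiles: "\<omega> \<in> configurations \<Longrightarrow> countable (empty_disc_tiles \<omega>)"
  using countable_Collect_finite_subset[OF config_countable[of \<omega>]] finite_tile
  by (rule_tac countable_subset[of _ "{A. finite A \<and> A \<subseteq> \<omega>}"]) (auto simp: empty_disc_tiles_def)

text \<open>Openness matters for tiles with a vertex in the box: the open disc has this vertex only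
  on its boundary, but still meets an open box.\<close>

definition unit_box :: "plane set" where
  "unit_box = box 0 (vector [1, 1])"

lemma unit_box: "unit_box \<in> bounded_borel" "open unit_box" "unit_box \<noteq> {}" "emeasure lborel unit_box = 1"
proof -
  show "open unit_box" unfolding unit_box_def by (rule open_box)
  show "unit_box \<in> bounded_borel" by (simp add: bounded_borel_def unit_box_def)
  have "vector [1/2, 1/2] \<in> unit_box" by (simp add: unit_box_def mem_box_cart forall_2)
  then show "unit_box \<noteq> {}" by auto
  have "(0::plane) \<in> cbox 0 (vector [1, 1])" by (simp add: mem_box_cart forall_2)
  then have "measure lborel (cbox 0 (vector [1, 1] :: plane)) = (\<Prod>i\<in>UNIV. (vector [1, 1] :: plane) $ i - 0 $ i)"
    by (intro content_cbox_cart) auto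
  also have "\<dots> = 1" by (simp add: UNIV_2)
  finally have "measure lborel unit_box = 1" by (simp add: unit_box_def measure_lborel_box_eq measure_lborel_cbox_eq)
  then show "emeasure lborel unit_box = 1"
    using emeasure_eq_ennreal_measure[of lborel unit_box] emeasure_bounded_finite[of unit_box]
    by (simp add: unit_box_def less_top[symmetric])
qed

lemma unit_box_borel [measurable]: "unit_box \<in> sets borel"
  using unit_box by (simp add: bounded_borel_def)

locale stationary_process =
  fixes P :: "plane set measure"
  assumes stat: "P \<in> stationary_processes"
begin

lemma pp: "point_process P" using stat by (simp add: stationary_processes_def)

sublocale prob_space P using pp by (simp add: point_process_def)

lemma sets_P: "sets P = sets config_space" using pp by (simp add: point_process_def)

lemma space_P: "space P = configurations" by (rule space_point_process[OF pp])

lemma measurable_P: "measurable P N = measurable config_space N"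
  by (rule measurable_cong_sets[OF sets_P refl])

lemma measurable_id_config: "(\<lambda>\<omega>. \<omega>) \<in> measurable P config_space"
  by (simp add: measurable_P)

lemma nn_integral_shift:
  assumes g: "g \<in> borel_measurable P" shows "(\<integral>\<^sup>+ \<omega>. g (shift x \<omega>) \<partial>P) = (\<integral>\<^sup>+ \<omega>. g \<omega> \<partial>P)"
proof -
  have "(\<integral>\<^sup>+ \<omega>. g \<omega> \<partial>P) = (\<integral>\<^sup>+ \<omega>. g \<omega> \<partial>distr P config_space (shift x))"
    using stat by (simp add: stationary_processes_def)
  also have "\<dots> = (\<integral>\<^sup>+ \<omega>. g (shift x \<omega>) \<partial>P)"
    using g measurable_config_shift[OF measurable_id_config, of "\<lambda>_. x"] by (intro nn_integral_distr) (auto simp: measurable_P)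
  finally show ?thesis by simp
qed

text \<open>The right-hand side of the equation that characterizes the tile distribution, with
  \<open>empty_disc_tiles\<close> in place of \<open>delaunay\<close>.\<close>

definition tile_sum :: "(plane \<Rightarrow> plane set \<Rightarrow> ennreal) \<Rightarrow> ennreal" where
  "tile_sum f = (\<integral>\<^sup>+ \<omega>. \<integral>\<^sup>+ \<tau>. f (tile_centre \<tau>) (shift (tile_centre \<tau>) \<tau>) \<partial>count_space (empty_disc_tiles \<omega>) \<partial>P)"

lemma tile_sum_measurable:
  assumes "case_prod f \<in> borel_measurable (borel \<Otimes>\<^sub>M centred_tile_space)"
  shows "(\<lambda>\<omega>. \<integral>\<^sup>+ \<tau>. f (tile_centre \<tau>) (shift (tile_centre \<tau>) \<tau>) \<partial>count_space (empty_disc_tiles \<omega>)) \<in> borel_measurable P"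
  by (rule nn_integral_tiles_measurable[OF measurable_id_config])
    (use measurable_compose[OF measurable_snd assms] in \<open>simp add: case_prod_beta\<close>)

lemma tile_sum_translate:
  assumes f: "case_prod f \<in> borel_measurable (borel \<Otimes>\<^sub>M centred_tile_space)"
  shows "tile_sum (\<lambda>c \<tau>. f (c - x) \<tau>) = tile_sum f"
proof -
  have "(\<integral>\<^sup>+ \<tau>. f (tile_centre \<tau>) (shift (tile_centre \<tau>) \<tau>) \<partial>count_space (empty_disc_tiles (shift x \<omega>))) =
      (\<integral>\<^sup>+ \<tau>. f (tile_centre \<tau> - x) (shift (tile_centre \<tau>) \<tau>) \<partial>count_space (empty_disc_tiles \<omega>))" for \<omega>
  proof -
    have "(\<integral>\<^sup>+ \<tau>. f (tile_centre \<tau>) (shift (tile_centre \<tau>) \<tau>) \<partial>count_space (empty_disc_tiles (shift x \<omega>))) =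
        (\<integral>\<^sup>+ \<tau>. f (tile_centre (shift x \<tau>)) (shift (tile_centre (shift x \<tau>)) (shift x \<tau>)) \<partial>count_space (empty_disc_tiles \<omega>))"
      by (rule nn_integral_bij_count_space[OF empty_disc_tiles_shift, symmetric])
    also have "\<dots> = (\<integral>\<^sup>+ \<tau>. f (tile_centre \<tau> - x) (shift (tile_centre \<tau>) \<tau>) \<partial>count_space (empty_disc_tiles \<omega>))"
      by (intro nn_integral_cong) (auto simp: empty_disc_tiles_def shift_tile shift_shift)
    finally show ?thesis .
  qed
  then have "tile_sum (\<lambda>c \<tau>. f (c - x) \<tau>) = (\<integral>\<^sup>+ \<omega>. \<integral>\<^sup>+ \<tau>. f (tile_centre \<tau>) (shift (tile_centre \<tau>) \<tau>) \<partial>count_space (empty_disc_tiles (shift x \<omega>)) \<partial>P)"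
    by (simp add: tile_sum_def)
  also have "\<dots> = tile_sum f"
    unfolding tile_sum_def by (rule nn_integral_shift[OF tile_sum_measurable[OF f]])
  finally show ?thesis .
qed

lemma tile_sum_cong:
  assumes "\<And>c \<tau>. \<tau> \<in> centred_tiles \<Longrightarrow> f c \<tau> = g c \<tau>" shows "tile_sum f = tile_sum g"
  unfolding tile_sum_def using assms centred_tile_shift
  by (intro nn_integral_cong) (auto simp: empty_disc_tiles_def)

lemma tile_sum_nn_integral:
  fixes h :: "plane \<Rightarrow> plane \<Rightarrow> plane set \<Rightarrow> ennreal"
  assumes h: "(\<lambda>p. h (fst p) (fst (snd p)) (snd (snd p))) \<in> borel_measurable (borel \<Otimes>\<^sub>M (borel \<Otimes>\<^sub>M centred_tile_space))"
  shows "(\<integral>\<^sup>+ y. tile_sum (h y) \<partial>lborel) = tile_sum (\<lambda>c \<tau>. \<integral>\<^sup>+ y. h y c \<tau> \<partial>lborel)"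
proof -
  interpret pair_sigma_finite lborel P by unfold_locales
  have h': "(\<lambda>p. h (fst (fst p)) (fst (snd p)) (snd (snd p))) \<in> borel_measurable ((lborel \<Otimes>\<^sub>M P) \<Otimes>\<^sub>M (borel \<Otimes>\<^sub>M centred_tile_space))"
  proof -
    have "(\<lambda>p. (fst (fst p), snd p)) \<in> measurable ((lborel \<Otimes>\<^sub>M P) \<Otimes>\<^sub>M (borel \<Otimes>\<^sub>M centred_tile_space)) (borel \<Otimes>\<^sub>M (borel \<Otimes>\<^sub>M centred_tile_space))"
      by measurable
    from measurable_compose[OF this h] show ?thesis by simp
  qed
  have m: "(\<lambda>p. \<integral>\<^sup>+ \<tau>. h (fst p) (tile_centre \<tau>) (shift (tile_centre \<tau>) \<tau>) \<partial>count_space (empty_disc_tiles (snd p))) \<in> borel_measurable (lborel \<Otimes>\<^sub>M P)"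
    by (rule nn_integral_tiles_measurable[OF measurable_compose[OF measurable_snd measurable_id_config] h'])
  have "(\<integral>\<^sup>+ y. tile_sum (h y) \<partial>lborel) =
     (\<integral>\<^sup>+ \<omega>. \<integral>\<^sup>+ y. \<integral>\<^sup>+ \<tau>. h y (tile_centre \<tau>) (shift (tile_centre \<tau>) \<tau>) \<partial>count_space (empty_disc_tiles \<omega>) \<partial>lborel \<partial>P)"
    unfolding tile_sum_def using m by (intro Fubini'[symmetric]) (simp add: case_prod_beta)
  also have "\<dots> = tile_sum (\<lambda>c \<tau>. \<integral>\<^sup>+ y. h y c \<tau> \<partial>lborel)"
    unfolding tile_sum_def
  proof (intro nn_integral_cong)
    fix \<omega> assume w: "\<omega> \<in> space P"
    show "(\<integral>\<^sup>+ y. \<integral>\<^sup>+ \<tau>. h y (tile_centre \<tau>) (shift (tile_centre \<tau>) \<tau>) \<partial>count_space (empty_disc_tiles \<omega>) \<partial>lborel) =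
      (\<integral>\<^sup>+ \<tau>. \<integral>\<^sup>+ y. h y (tile_centre \<tau>) (shift (tile_centre \<tau>) \<tau>) \<partial>lborel \<partial>count_space (empty_disc_tiles \<omega>))"
    proof (rule nn_integral_count_space_nn_integral)
      show "countable (empty_disc_tiles \<omega>)" using w by (intro countable_empty_disc_tiles) (simp add: space_P)
      fix \<tau> assume "\<tau> \<in> empty_disc_tiles \<omega>"
      then have t: "shift (tile_centre \<tau>) \<tau> \<in> space centred_tile_space" using centred_tile_shift by (auto simp: empty_disc_tiles_def)
      have "(\<lambda>y. (y, tile_centre \<tau>, shift (tile_centre \<tau>) \<tau>)) \<in> measurable lborel (borel \<Otimes>\<^sub>M (borel \<Otimes>\<^sub>M centred_tile_space))"
        using t by (intro measurable_Pair measurable_const) auto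
      from measurable_compose[OF this h] show "(\<lambda>y. h y (tile_centre \<tau>) (shift (tile_centre \<tau>) \<tau>)) \<in> borel_measurable lborel" by simp
    qed
  qed
  finally show ?thesis .
qed

text \<open>Stationarity makes the joint intensity of centres and centred tiles a product with
  Lebesgue measure. The proof inserts 1 as the integral of \<open>indicator unit_box (c - y)\<close>
  over \<open>y\<close>, moves the shift from the centre to the other factor and integrates
  \<open>y\<close> out.\<close>

lemma mass_transport:
  assumes f: "case_prod f \<in> borel_measurable (borel \<Otimes>\<^sub>M centred_tile_space)"
  shows "tile_sum f = tile_sum (\<lambda>c \<tau>. indicator unit_box c * (\<integral>\<^sup>+ y. f y \<tau> \<partial>lborel))"
    and "tile_sum f = (\<integral>\<^sup>+ y. tile_sum (\<lambda>c \<tau>. indicator unit_box c * f y \<tau>) \<partial>lborel)"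
proof -
  have fs: "(\<lambda>y. f y \<tau>) \<in> borel_measurable borel" if "\<tau> \<in> centred_tiles" for \<tau>
  proof -
    have "(\<lambda>y. (y, \<tau>)) \<in> measurable borel (borel \<Otimes>\<^sub>M centred_tile_space)" using that by (intro measurable_Pair measurable_const) auto
    from measurable_compose[OF this f] show ?thesis by simp
  qed
  have fc: "(\<lambda>p. f (u p) (snd (snd p))) \<in> borel_measurable (borel \<Otimes>\<^sub>M (borel \<Otimes>\<^sub>M centred_tile_space))"
    if [measurable]: "u \<in> borel_measurable (borel \<Otimes>\<^sub>M (borel \<Otimes>\<^sub>M centred_tile_space))" for u :: "plane \<times> plane \<times> plane set \<Rightarrow> plane"
  proof -
    have "(\<lambda>p. (u p, snd (snd p))) \<in> measurable (borel \<Otimes>\<^sub>M (borel \<Otimes>\<^sub>M centred_tile_space)) (borel \<Otimes>\<^sub>M centred_tile_space)" by measurable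
    from measurable_compose[OF this f] show ?thesis by simp
  qed
  note [measurable] = fc[OF measurable_fst] fc[OF measurable_compose[OF measurable_snd measurable_fst]]
    fc[OF borel_measurable_add[OF measurable_fst measurable_compose[OF measurable_snd measurable_fst]]]
  have "(\<integral>\<^sup>+ y. tile_sum (\<lambda>c \<tau>. indicator unit_box c * f y \<tau>) \<partial>lborel) = tile_sum (\<lambda>c \<tau>. \<integral>\<^sup>+ y. indicator unit_box c * f y \<tau> \<partial>lborel)"
    by (intro tile_sum_nn_integral) measurable
  also have "\<dots> = tile_sum (\<lambda>c \<tau>. indicator unit_box c * (\<integral>\<^sup>+ y. f y \<tau> \<partial>lborel))"
    using fs by (intro tile_sum_cong nn_integral_cmult) simp
  finally have A: "(\<integral>\<^sup>+ y. tile_sum (\<lambda>c \<tau>. indicator unit_box c * f y \<tau>) \<partial>lborel) = tile_sum (\<lambda>c \<tau>. indicator unit_box c * (\<integral>\<^sup>+ y. f y \<tau> \<partial>lborel))" .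
  have "tile_sum f = tile_sum (\<lambda>c \<tau>. \<integral>\<^sup>+ y. indicator unit_box (c - y) * f c \<tau> \<partial>lborel)"
  proof (rule tile_sum_cong)
    fix c \<tau>
    have "(\<integral>\<^sup>+ y. indicator unit_box (c - y) \<partial>lborel) = (\<integral>\<^sup>+ y. indicator unit_box y \<partial>lborel)"
      by (rule nn_integral_lborel_translate(2)) measurable
    also have "\<dots> = 1" using unit_box by simp
    finally have "(\<integral>\<^sup>+ y. indicator unit_box (c - y) \<partial>lborel) = (1::ennreal)" .
    moreover have "(\<integral>\<^sup>+ y. indicator unit_box (c - y) * f c \<tau> \<partial>lborel) = (\<integral>\<^sup>+ y. indicator unit_box (c - y) \<partial>lborel) * f c \<tau>"
      by (rule nn_integral_multc) measurable
    ultimately show "f c \<tau> = (\<integral>\<^sup>+ y. indicator unit_box (c - y) * f c \<tau> \<partial>lborel)" by simp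
  qed
  also have "\<dots> = (\<integral>\<^sup>+ y. tile_sum (\<lambda>c \<tau>. indicator unit_box (c - y) * f c \<tau>) \<partial>lborel)"
    by (intro tile_sum_nn_integral[symmetric]) measurable
  \<comment> \<open>For fixed \<open>y\<close> the whole process is shifted by \<open>y\<close>. The
    function is written as one of \<open>c - y\<close>, with \<open>c\<close> as
    \<open>y + (c - y)\<close>, to match \<open>tile_sum_translate\<close>.\<close>
  also have "\<dots> = (\<integral>\<^sup>+ y. tile_sum (\<lambda>c \<tau>. indicator unit_box c * f (y + c) \<tau>) \<partial>lborel)"
  proof (intro nn_integral_cong)
    fix y :: plane
    have "(\<lambda>p. indicator unit_box (fst p) * f (y + fst p) (snd p)) \<in> borel_measurable (borel \<Otimes>\<^sub>M centred_tile_space)"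
    proof -
      have "(\<lambda>p. (y + fst p, snd p)) \<in> measurable (borel \<Otimes>\<^sub>M centred_tile_space) (borel \<Otimes>\<^sub>M centred_tile_space)" by measurable
      from measurable_compose[OF this f] have [measurable]: "(\<lambda>p. f (y + fst p) (snd p)) \<in> borel_measurable (borel \<Otimes>\<^sub>M centred_tile_space)" by simp
      show ?thesis by measurable
    qed
    then have "tile_sum (\<lambda>c \<tau>. indicator unit_box (c - y) * f (y + (c - y)) \<tau>) = tile_sum (\<lambda>c \<tau>. indicator unit_box c * f (y + c) \<tau>)"
      by (intro tile_sum_translate) (simp add: case_prod_beta)
    then show "tile_sum (\<lambda>c \<tau>. indicator unit_box (c - y) * f c \<tau>) = tile_sum (\<lambda>c \<tau>. indicator unit_box c * f (y + c) \<tau>)" by simp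
  qed
  also have "\<dots> = tile_sum (\<lambda>c \<tau>. \<integral>\<^sup>+ y. indicator unit_box c * f (y + c) \<tau> \<partial>lborel)"
    by (intro tile_sum_nn_integral) measurable
  also have "\<dots> = tile_sum (\<lambda>c \<tau>. indicator unit_box c * (\<integral>\<^sup>+ y. f y \<tau> \<partial>lborel))"
  proof (rule tile_sum_cong)
    fix c \<tau> assume t: "\<tau> \<in> centred_tiles"
    note [measurable] = fs[OF t]
    have "(\<integral>\<^sup>+ y. indicator unit_box c * f (y + c) \<tau> \<partial>lborel) = indicator unit_box c * (\<integral>\<^sup>+ y. f (c + y) \<tau> \<partial>lborel)"
      by (subst nn_integral_cmult) (auto simp: add.commute)
    then show "(\<integral>\<^sup>+ y. indicator unit_box c * f (y + c) \<tau> \<partial>lborel) = indicator unit_box c * (\<integral>\<^sup>+ y. f y \<tau> \<partial>lborel)"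
      using nn_integral_lborel_translate(1)[OF fs[OF t], of c] by simp
  qed
  finally show B: "tile_sum f = tile_sum (\<lambda>c \<tau>. indicator unit_box c * (\<integral>\<^sup>+ y. f y \<tau> \<partial>lborel))" .
  show "tile_sum f = (\<integral>\<^sup>+ y. tile_sum (\<lambda>c \<tau>. indicator unit_box c * f y \<tau>) \<partial>lborel)" unfolding A B ..
qed


lemma tile_sum_cmult:
  assumes "case_prod f \<in> borel_measurable (borel \<Otimes>\<^sub>M centred_tile_space)"
  shows "tile_sum (\<lambda>c \<tau>. k * f c \<tau>) = k * tile_sum f"
  unfolding tile_sum_def using tile_sum_measurable[OF assms] by (simp add: nn_integral_cmult)

lemma tile_sum_add:
  assumes "case_prod f \<in> borel_measurable (borel \<Otimes>\<^sub>M centred_tile_space)" "case_prod g \<in> borel_measurable (borel \<Otimes>\<^sub>M centred_tile_space)"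
  shows "tile_sum (\<lambda>c \<tau>. f c \<tau> + g c \<tau>) = tile_sum f + tile_sum g"
  unfolding tile_sum_def using tile_sum_measurable[OF assms(1)] tile_sum_measurable[OF assms(2)]
  by (simp add: nn_integral_add)

lemma tile_sum_SUP:
  assumes f: "\<And>i::nat. case_prod (f i) \<in> borel_measurable (borel \<Otimes>\<^sub>M centred_tile_space)"
    and inc: "\<And>i j c \<tau>. i \<le> j \<Longrightarrow> f i c \<tau> \<le> f j c \<tau>"
  shows "tile_sum (\<lambda>c \<tau>. SUP i. f i c \<tau>) = (SUP i. tile_sum (f i))"
proof -
  have "(\<integral>\<^sup>+ \<tau>. (SUP i. f i (tile_centre \<tau>) (shift (tile_centre \<tau>) \<tau>)) \<partial>count_space (empty_disc_tiles \<omega>)) =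
     (SUP i. \<integral>\<^sup>+ \<tau>. f i (tile_centre \<tau>) (shift (tile_centre \<tau>) \<tau>) \<partial>count_space (empty_disc_tiles \<omega>))" for \<omega>
    by (rule nn_integral_monotone_convergence_SUP) (auto simp: incseq_def le_fun_def intro: inc)
  then show ?thesis unfolding tile_sum_def
    using tile_sum_measurable[OF f] by (simp, intro nn_integral_monotone_convergence_SUP)
      (auto simp: incseq_def le_fun_def intro!: nn_integral_mono inc)
qed

lemma tile_sum_suminf:
  assumes f: "\<And>i::nat. case_prod (f i) \<in> borel_measurable (borel \<Otimes>\<^sub>M centred_tile_space)"
  shows "tile_sum (\<lambda>c \<tau>. \<Sum>i. f i c \<tau>) = (\<Sum>i. tile_sum (f i))"
  unfolding tile_sum_def using tile_sum_measurable[OF f] by (simp add: nn_integral_suminf)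

text \<open>Pairs of a tile and one of its vertices are counted with the centre in the box on the
  left and with the vertex in the box on the right. Stationarity makes the choice of the reference
  point immaterial.\<close>

lemma vertex_transport:
  assumes h: "case_prod h \<in> borel_measurable (borel \<Otimes>\<^sub>M centred_tile_space)"
    and inv: "\<And>v \<tau> x. tile \<tau> \<Longrightarrow> h (v - x) (shift x \<tau>) = h v \<tau>"
  shows "tile_sum (\<lambda>c \<tau>. indicator unit_box c * (\<integral>\<^sup>+ v. h v \<tau> \<partial>count_space \<tau>)) =
    (\<integral>\<^sup>+ \<omega>. \<integral>\<^sup>+ v. indicator unit_box v * (\<integral>\<^sup>+ \<tau>. of_bool (v \<in> \<tau>) * h v \<tau> \<partial>count_space (empty_disc_tiles \<omega>)) \<partial>count_space \<omega> \<partial>P)"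
proof -
  \<comment> \<open>\<open>y\<close> is the centre and \<open>v\<close> the position of a vertex
    relative to it; the vertices whose actual position lies in the box are collected.\<close>
  define f where "f y \<tau> = (\<integral>\<^sup>+ v. h v \<tau> * indicator unit_box (v + y) \<partial>count_space \<tau>)" for y \<tau>
  have f: "case_prod f \<in> borel_measurable (borel \<Otimes>\<^sub>M centred_tile_space)"
  proof -
    have "(\<lambda>p. (snd p, snd (fst p))) \<in> measurable ((borel \<Otimes>\<^sub>M centred_tile_space) \<Otimes>\<^sub>M borel) (borel \<Otimes>\<^sub>M centred_tile_space)" by measurable
    from measurable_compose[OF this h]
    have [measurable]: "(\<lambda>p. h (snd p) (snd (fst p))) \<in> borel_measurable ((borel \<Otimes>\<^sub>M centred_tile_space) \<Otimes>\<^sub>M (borel :: plane measure))" by simp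
    show ?thesis unfolding f_def case_prod_beta
      by (rule nn_integral_points_measurable'[OF measurable_compose[OF measurable_snd measurable_centred_tile_config]]) measurable
  qed
  have "tile_sum (\<lambda>c \<tau>. indicator unit_box c * (\<integral>\<^sup>+ v. h v \<tau> \<partial>count_space \<tau>)) = tile_sum (\<lambda>c \<tau>. indicator unit_box c * (\<integral>\<^sup>+ y. f y \<tau> \<partial>lborel))"
  proof (rule tile_sum_cong, rule arg_cong[where f="(*) _"])
    fix \<tau> assume "\<tau> \<in> centred_tiles"
    then have "countable \<tau>" using finite_tile by (auto simp: centred_tiles_def intro: countable_finite)
    then have "(\<integral>\<^sup>+ y. f y \<tau> \<partial>lborel) = (\<integral>\<^sup>+ v. \<integral>\<^sup>+ y. h v \<tau> * indicator unit_box (v + y) \<partial>lborel \<partial>count_space \<tau>)"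
      unfolding f_def by (rule nn_integral_count_space_nn_integral) measurable
    also have "\<dots> = (\<integral>\<^sup>+ v. h v \<tau> \<partial>count_space \<tau>)"
    proof (intro nn_integral_cong)
      fix v
      have "(\<integral>\<^sup>+ y. h v \<tau> * indicator unit_box (v + y) \<partial>lborel) = h v \<tau> * (\<integral>\<^sup>+ y. indicator unit_box (v + y) \<partial>lborel)"
        by (rule nn_integral_cmult) measurable
      also have "(\<integral>\<^sup>+ y. indicator unit_box (v + y) \<partial>lborel) = (\<integral>\<^sup>+ y. indicator unit_box y \<partial>lborel :: ennreal)"
        by (rule nn_integral_lborel_translate(1)) measurable
      finally show "(\<integral>\<^sup>+ y. h v \<tau> * indicator unit_box (v + y) \<partial>lborel) = h v \<tau>" using unit_box by simp
    qed
    finally show "(\<integral>\<^sup>+ v. h v \<tau> \<partial>count_space \<tau>) = (\<integral>\<^sup>+ y. f y \<tau> \<partial>lborel)" by simp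
  qed
  also have "\<dots> = tile_sum f" by (rule mass_transport(1)[OF f, symmetric])
  also have "\<dots> = (\<integral>\<^sup>+ \<omega>. \<integral>\<^sup>+ v. indicator unit_box v * (\<integral>\<^sup>+ \<tau>. of_bool (v \<in> \<tau>) * h v \<tau> \<partial>count_space (empty_disc_tiles \<omega>)) \<partial>count_space \<omega> \<partial>P)"
    unfolding tile_sum_def
  proof (intro nn_integral_cong)
    fix \<omega> assume w: "\<omega> \<in> space P"
    have "(\<integral>\<^sup>+ \<tau>. f (tile_centre \<tau>) (shift (tile_centre \<tau>) \<tau>) \<partial>count_space (empty_disc_tiles \<omega>)) =
      (\<integral>\<^sup>+ \<tau>. \<integral>\<^sup>+ v. indicator unit_box v * (of_bool (v \<in> \<tau>) * h v \<tau>) \<partial>count_space \<omega> \<partial>count_space (empty_disc_tiles \<omega>))"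
    proof (intro nn_integral_cong)
      fix \<tau> assume "\<tau> \<in> space (count_space (empty_disc_tiles \<omega>))"
      then have t: "tile \<tau>" "\<tau> \<subseteq> \<omega>" by (auto simp: empty_disc_tiles_def)
      define x where "x = tile_centre \<tau>"
      have b: "bij_betw (\<lambda>v. v - x) \<tau> (shift x \<tau>)" unfolding shift_def by (auto simp: bij_betw_def inj_on_def)
      have "f x (shift x \<tau>) = (\<integral>\<^sup>+ v. h (v - x) (shift x \<tau>) * indicator unit_box (v - x + x) \<partial>count_space \<tau>)"
        unfolding f_def by (rule nn_integral_bij_count_space[OF b, symmetric])
      also have "\<dots> = (\<integral>\<^sup>+ v. h v \<tau> * indicator unit_box v * indicator \<tau> v \<partial>count_space UNIV)"
        using inv[OF t(1)] by (simp add: nn_integral_count_space_indicator)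
      also have "\<dots> = (\<integral>\<^sup>+ v. indicator unit_box v * (of_bool (v \<in> \<tau>) * h v \<tau>) * indicator \<omega> v \<partial>count_space UNIV)"
        using t(2) by (intro nn_integral_cong) (auto split: split_indicator)
      also have "\<dots> = (\<integral>\<^sup>+ v. indicator unit_box v * (of_bool (v \<in> \<tau>) * h v \<tau>) \<partial>count_space \<omega>)"
        by (simp add: nn_integral_count_space_indicator)
      finally show "f (tile_centre \<tau>) (shift (tile_centre \<tau>) \<tau>) = (\<integral>\<^sup>+ v. indicator unit_box v * (of_bool (v \<in> \<tau>) * h v \<tau>) \<partial>count_space \<omega>)"
        by (simp add: x_def)
    qed
    also have "\<dots> = (\<integral>\<^sup>+ v. \<integral>\<^sup>+ \<tau>. indicator unit_box v * (of_bool (v \<in> \<tau>) * h v \<tau>) \<partial>count_space (empty_disc_tiles \<omega>) \<partial>count_space \<omega>)"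
      using config_countable w by (intro nn_integral_count_space_nn_integral) (auto simp: space_P)
    finally show "(\<integral>\<^sup>+ \<tau>. f (tile_centre \<tau>) (shift (tile_centre \<tau>) \<tau>) \<partial>count_space (empty_disc_tiles \<omega>)) =
      (\<integral>\<^sup>+ v. indicator unit_box v * (\<integral>\<^sup>+ \<tau>. of_bool (v \<in> \<tau>) * h v \<tau> \<partial>count_space (empty_disc_tiles \<omega>)) \<partial>count_space \<omega>)"
      by (simp add: nn_integral_cmult)
  qed
  finally show ?thesis .
qed

lemma nn_integral_count_finite: "(\<integral>\<^sup>+ \<omega>. of_nat (count_in unit_box \<omega>) \<partial>P) < \<infinity>"
proof -
  have "intensity P unit_box < \<infinity>"
    using stat unit_box by (auto simp: stationary_processes_def)
  then show ?thesis using unit_box by (simp add: intensity_def divide_ennreal_def)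
qed

end

section \<open>Finite tile intensity and the tile distribution\<close>

lemma measurable_middle:
  assumes \<kappa>: "\<kappa> \<in> measurable S config_space" and g: "g \<in> borel_measurable S"
  shows "Measurable.pred S (\<lambda>s. middle (g s) (\<kappa> s))"
proof -
  note [measurable] = g pred_point_in[OF \<kappa> g]
  have [measurable]: "Measurable.pred S (\<lambda>s. \<exists>u\<in>\<kappa> s. u$1 < g s$1)" "Measurable.pred S (\<lambda>s. \<exists>u\<in>\<kappa> s. g s$1 < u$1)"
    by (rule pred_points_ex[OF \<kappa>], measurable)+
  show ?thesis unfolding middle_def by measurable
qed

lemma middle_shift: "middle (v - x) (shift x \<tau>) \<longleftrightarrow> middle v \<tau>"
proof -
  have "(\<exists>u\<in>shift x \<tau>. Q u) \<longleftrightarrow> (\<exists>u\<in>\<tau>. Q (u - x))" for Q by (auto simp: shift_def)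
  then show ?thesis by (simp add: middle_def shift_eq)
qed

locale generic_process = stationary_process +
  assumes gen: "AE \<omega> in P. generic \<omega>"
begin

text \<open>\<open>vertex_transport\<close> with the indicator of middle vertices: a tile
  contributes at least 1 on one side, a point at most 2 on the other, where the intensity of the
  process is finite.\<close>

lemma tile_intensity_finite: "tile_sum (\<lambda>c \<tau>. indicator unit_box c) < \<infinity>"
proof -
  define h where "h v \<tau> = (of_bool (middle v \<tau>) :: ennreal)" for v \<tau>
  have h: "case_prod h \<in> borel_measurable (borel \<Otimes>\<^sub>M centred_tile_space)"
  proof -
    have [measurable]: "Measurable.pred (borel \<Otimes>\<^sub>M centred_tile_space) (\<lambda>p. middle (fst p) (snd p))"
      by (rule measurable_middle[OF measurable_compose[OF measurable_snd measurable_centred_tile_config] measurable_fst])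
    show ?thesis unfolding h_def case_prod_beta by measurable
  qed
  have inv: "h (v - x) (shift x \<tau>) = h v \<tau>" for v x \<tau> by (simp add: h_def middle_shift)
  have "tile_sum (\<lambda>c \<tau>. indicator unit_box c) \<le> tile_sum (\<lambda>c \<tau>. indicator unit_box c * (\<integral>\<^sup>+ v. h v \<tau> \<partial>count_space \<tau>))"
    unfolding tile_sum_def
  proof (rule nn_integral_mono_AE)
    show "AE \<omega> in P. (\<integral>\<^sup>+ \<tau>. indicator unit_box (tile_centre \<tau>) \<partial>count_space (empty_disc_tiles \<omega>)) \<le>
      (\<integral>\<^sup>+ \<tau>. indicator unit_box (tile_centre \<tau>) * (\<integral>\<^sup>+ v. h v (shift (tile_centre \<tau>) \<tau>) \<partial>count_space (shift (tile_centre \<tau>) \<tau>)) \<partial>count_space (empty_disc_tiles \<omega>))"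
      using gen
    proof eventually_elim
      fix \<omega> assume g: "generic \<omega>"
      show "(\<integral>\<^sup>+ \<tau>. indicator unit_box (tile_centre \<tau>) \<partial>count_space (empty_disc_tiles \<omega>)) \<le>
      (\<integral>\<^sup>+ \<tau>. indicator unit_box (tile_centre \<tau>) * (\<integral>\<^sup>+ v. h v (shift (tile_centre \<tau>) \<tau>) \<partial>count_space (shift (tile_centre \<tau>) \<tau>)) \<partial>count_space (empty_disc_tiles \<omega>))"
      proof (intro nn_integral_mono)
        fix \<tau> assume "\<tau> \<in> space (count_space (empty_disc_tiles \<omega>))"
        then have t: "tile \<tau>" "\<tau> \<subseteq> \<omega>" by (auto simp: empty_disc_tiles_def)
        have "\<And>a b. a \<in> \<tau> \<Longrightarrow> b \<in> \<tau> \<Longrightarrow> a \<noteq> b \<Longrightarrow> a$1 \<noteq> b$1" using generic_distinct_abscissae[OF g] t(2) by blast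
        then obtain v where v: "v \<in> \<tau>" "middle v \<tau>" using middle_exists[OF t(1)] by blast
        define x where "x = tile_centre \<tau>"
        have "1 = (\<integral>\<^sup>+ u. indicator {v - x} u \<partial>count_space (shift x \<tau>))"
          using v by (subst nn_integral_indicator) (auto simp: shift_eq)
        also have "\<dots> \<le> (\<integral>\<^sup>+ u. h u (shift x \<tau>) \<partial>count_space (shift x \<tau>))"
          using v by (intro nn_integral_mono) (auto simp: h_def middle_shift split: split_indicator)
        finally have "(1::ennreal) \<le> (\<integral>\<^sup>+ u. h u (shift x \<tau>) \<partial>count_space (shift x \<tau>))" .
        from mult_left_mono[OF this, of "indicator unit_box x"]
        show "indicator unit_box (tile_centre \<tau>) \<le> indicator unit_box (tile_centre \<tau>) * (\<integral>\<^sup>+ v. h v (shift (tile_centre \<tau>) \<tau>) \<partial>count_space (shift (tile_centre \<tau>) \<tau>))"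
          by (simp add: x_def)
      qed
    qed
  qed
  also have "\<dots> = (\<integral>\<^sup>+ \<omega>. \<integral>\<^sup>+ v. indicator unit_box v * (\<integral>\<^sup>+ \<tau>. of_bool (v \<in> \<tau>) * h v \<tau> \<partial>count_space (empty_disc_tiles \<omega>)) \<partial>count_space \<omega> \<partial>P)"
    by (rule vertex_transport[OF h inv])
  also have "\<dots> \<le> (\<integral>\<^sup>+ \<omega>. 2 * of_nat (count_in unit_box \<omega>) \<partial>P)"
  proof (rule nn_integral_mono_AE, rule AE_mp[OF gen AE_I2], rule impI)
    fix \<omega> assume w: "\<omega> \<in> space P" and g: "generic \<omega>"
    have b: "(\<integral>\<^sup>+ \<tau>. of_bool (v \<in> \<tau>) * h v \<tau> \<partial>count_space (empty_disc_tiles \<omega>)) \<le> 2" for v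
    proof -
      have "(\<integral>\<^sup>+ \<tau>. of_bool (v \<in> \<tau>) * h v \<tau> \<partial>count_space (empty_disc_tiles \<omega>)) = (\<integral>\<^sup>+ \<tau>. indicator {\<tau> \<in> empty_disc_tiles \<omega>. middle v \<tau>} \<tau> \<partial>count_space (empty_disc_tiles \<omega>))"
        by (intro nn_integral_cong) (auto simp: h_def middle_def split: split_indicator)
      also have "\<dots> = emeasure (count_space (empty_disc_tiles \<omega>)) {\<tau> \<in> empty_disc_tiles \<omega>. middle v \<tau>}" by (rule nn_integral_indicator) auto
      also have "\<dots> \<le> 2" by (rule middle_tiles_le_2[OF generic_general_position[OF g]])
      finally show ?thesis .
    qed
    have fin: "finite (\<omega> \<inter> unit_box)" using w unit_box config_finite by (auto simp: space_P bounded_borel_def)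
    have "(\<integral>\<^sup>+ v. indicator unit_box v * (\<integral>\<^sup>+ \<tau>. of_bool (v \<in> \<tau>) * h v \<tau> \<partial>count_space (empty_disc_tiles \<omega>)) \<partial>count_space \<omega>) \<le> (\<integral>\<^sup>+ v. indicator (\<omega> \<inter> unit_box) v * 2 \<partial>count_space \<omega>)"
      using b by (intro nn_integral_mono) (auto split: split_indicator)
    also have "\<dots> = (\<integral>\<^sup>+ v. indicator (\<omega> \<inter> unit_box) v \<partial>count_space \<omega>) * 2" by (rule nn_integral_multc) simp
    also have "\<dots> = 2 * of_nat (count_in unit_box \<omega>)"
      using fin by (subst nn_integral_indicator) (auto simp: emeasure_count_space_finite count_in_def mult.commute)
    finally show "(\<integral>\<^sup>+ v. indicator unit_box v * (\<integral>\<^sup>+ \<tau>. of_bool (v \<in> \<tau>) * h v \<tau> \<partial>count_space (empty_disc_tiles \<omega>)) \<partial>count_space \<omega>) \<le> 2 * of_nat (count_in unit_box \<omega>)" .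
  qed
  also have "\<dots> = 2 * (\<integral>\<^sup>+ \<omega>. of_nat (count_in unit_box \<omega>) \<partial>P)"
    using measurable_count_in[OF unit_box(1)] by (intro nn_integral_cmult) (simp add: measurable_P)
  also have "\<dots> < \<infinity>" using nn_integral_count_finite by (simp add: ennreal_mult_less_top)
  finally show ?thesis .
qed

text \<open>The formula is forced: it results from testing the equation of
  \<open>is_tile_distribution\<close> with the product of the indicators of the unit box and of
  \<open>A\<close>.\<close>

definition tile_measure :: "plane set measure" where
  "tile_measure = measure_of centred_tiles (sets centred_tile_space) (\<lambda>A. tile_sum (\<lambda>c \<tau>. indicator unit_box c * indicator A \<tau>))"

lemma sets_tile_measure [measurable_cong]: "sets tile_measure = sets centred_tile_space"
  unfolding tile_measure_def using sets.sigma_sets_eq[of centred_tile_space] sets.space_closed[of centred_tile_space]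
  by (subst sets_measure_of) auto

lemma space_tile_measure: "space tile_measure = centred_tiles"
  using sets_eq_imp_space_eq[OF sets_tile_measure] by simp

lemma ind_measurable:
  assumes [measurable]: "A \<in> sets centred_tile_space"
  shows "(\<lambda>(c, \<tau>). indicator unit_box c * indicator A \<tau> :: ennreal) \<in> borel_measurable (borel \<Otimes>\<^sub>M centred_tile_space)"
  by measurable

lemma emeasure_tile_measure:
  assumes A: "A \<in> sets centred_tile_space"
  shows "emeasure tile_measure A = tile_sum (\<lambda>c \<tau>. indicator unit_box c * indicator A \<tau>)"
proof (rule emeasure_measure_of[OF tile_measure_def])
  show "sets centred_tile_space \<subseteq> Pow centred_tiles" using sets.space_closed[of centred_tile_space] by simp
  show "A \<in> sets tile_measure" using A by (simp add: sets_tile_measure)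
  show "positive (sets tile_measure) (\<lambda>A. tile_sum (\<lambda>c \<tau>. indicator unit_box c * indicator A \<tau>))"
    by (simp add: positive_def tile_sum_def)
  show "countably_additive (sets tile_measure) (\<lambda>A. tile_sum (\<lambda>c \<tau>. indicator unit_box c * indicator A \<tau>))"
  proof (rule countably_additiveI)
    fix X :: "nat \<Rightarrow> plane set set" assume X: "range X \<subseteq> sets tile_measure" "disjoint_family X"
    have "(\<lambda>(c, \<tau>). indicator unit_box c * indicator (X i) \<tau> :: ennreal) \<in> borel_measurable (borel \<Otimes>\<^sub>M centred_tile_space)" for i
      using X(1) by (intro ind_measurable) (auto simp: sets_tile_measure)
    then have "(\<Sum>i. tile_sum (\<lambda>c \<tau>. indicator unit_box c * indicator (X i) \<tau>)) = tile_sum (\<lambda>c \<tau>. \<Sum>i. indicator unit_box c * indicator (X i) \<tau>)"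
      by (intro tile_sum_suminf[symmetric]) simp
    also have "\<dots> = tile_sum (\<lambda>c \<tau>. indicator unit_box c * indicator (\<Union>i. X i) \<tau>)"
      using suminf_indicator[OF X(2)] by simp
    finally show "(\<Sum>i. tile_sum (\<lambda>c \<tau>. indicator unit_box c * indicator (X i) \<tau>)) = tile_sum (\<lambda>c \<tau>. indicator unit_box c * indicator (\<Union>i. X i) \<tau>)" .
  qed
qed

lemma nn_integral_tile_measure:
  assumes g: "g \<in> borel_measurable centred_tile_space"
  shows "(\<integral>\<^sup>+ \<tau>. g \<tau> \<partial>tile_measure) = tile_sum (\<lambda>c \<tau>. indicator unit_box c * g \<tau>)"
  using g
proof (induct rule: borel_measurable_induct)
  case (cong f g)
  have "(\<integral>\<^sup>+ \<tau>. f \<tau> \<partial>tile_measure) = (\<integral>\<^sup>+ \<tau>. g \<tau> \<partial>tile_measure)"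
    using cong(3) by (intro nn_integral_cong) (simp add: space_tile_measure)
  moreover have "tile_sum (\<lambda>c \<tau>. indicator unit_box c * f \<tau>) = tile_sum (\<lambda>c \<tau>. indicator unit_box c * g \<tau>)"
    using cong(3) by (intro tile_sum_cong) simp
  ultimately show ?case using cong(4) by simp
next
  case (set A)
  then show ?case using emeasure_tile_measure[OF set] by (simp add: sets_tile_measure)
next
  case (mult u c)
  have [measurable]: "u \<in> borel_measurable centred_tile_space" by fact
  have "(\<integral>\<^sup>+ \<tau>. c * u \<tau> \<partial>tile_measure) = c * (\<integral>\<^sup>+ \<tau>. u \<tau> \<partial>tile_measure)" by (rule nn_integral_cmult) measurable
  also have "\<dots> = c * tile_sum (\<lambda>c \<tau>. indicator unit_box c * u \<tau>)" using mult(4) by simp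
  also have "\<dots> = tile_sum (\<lambda>x \<tau>. c * (indicator unit_box x * u \<tau>))" by (rule tile_sum_cmult[symmetric]) measurable
  finally show ?case by (simp add: mult.left_commute)
next
  case (add u v)
  have [measurable]: "u \<in> borel_measurable centred_tile_space" "v \<in> borel_measurable centred_tile_space" by fact+
  have "(\<integral>\<^sup>+ \<tau>. v \<tau> + u \<tau> \<partial>tile_measure) = (\<integral>\<^sup>+ \<tau>. v \<tau> \<partial>tile_measure) + (\<integral>\<^sup>+ \<tau>. u \<tau> \<partial>tile_measure)" by (rule nn_integral_add) measurable
  also have "\<dots> = tile_sum (\<lambda>c \<tau>. indicator unit_box c * v \<tau>) + tile_sum (\<lambda>c \<tau>. indicator unit_box c * u \<tau>)" using add(3,7) by simp
  also have "\<dots> = tile_sum (\<lambda>x \<tau>. indicator unit_box x * v \<tau> + indicator unit_box x * u \<tau>)" by (rule tile_sum_add[symmetric]) measurable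
  finally show ?case by (simp add: distrib_left)
next
  case (seq U)
  have [measurable]: "U i \<in> borel_measurable centred_tile_space" for i by fact
  have inc: "i \<le> j \<Longrightarrow> U i p \<le> U j p" for i j p by (rule le_funD[OF incseqD[OF seq(4)]])
  have "(\<integral>\<^sup>+ \<tau>. (SUP i. U i \<tau>) \<partial>tile_measure) = (SUP i. \<integral>\<^sup>+ \<tau>. U i \<tau> \<partial>tile_measure)"
    by (rule nn_integral_monotone_convergence_SUP[OF seq(4)]) measurable
  also have "\<dots> = (SUP i. tile_sum (\<lambda>c \<tau>. indicator unit_box c * U i \<tau>))" using seq(3) by simp
  also have "\<dots> = tile_sum (\<lambda>c \<tau>. SUP i. indicator unit_box c * U i \<tau>)"
  proof (rule tile_sum_SUP[symmetric])
    show "(\<lambda>(c, \<tau>). indicator unit_box c * U i \<tau>) \<in> borel_measurable (borel \<Otimes>\<^sub>M centred_tile_space)" for i by measurable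
  qed (auto intro: mult_left_mono inc)
  finally show ?case by (simp add: SUP_mult_left_ennreal image_comp)
qed

lemma is_tile_distribution_tile_measure: "is_tile_distribution P tile_measure"
  unfolding is_tile_distribution_def
proof (intro conjI allI impI)
  show "sets tile_measure = sets centred_tile_space" by (rule sets_tile_measure)
  show "finite_measure tile_measure"
  proof (rule finite_measureI)
    have "centred_tiles \<in> sets centred_tile_space" using sets.top[of centred_tile_space] by simp
    from emeasure_tile_measure[OF this]
    have "emeasure tile_measure (space tile_measure) = tile_sum (\<lambda>c \<tau>. indicator unit_box c * indicator centred_tiles \<tau>)" by (simp add: space_tile_measure)
    also have "\<dots> = tile_sum (\<lambda>c \<tau>. indicator unit_box c)" by (rule tile_sum_cong) simp
    finally show "emeasure tile_measure (space tile_measure) \<noteq> \<infinity>" using tile_intensity_finite by simp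
  qed
  fix f :: "plane \<times> plane set \<Rightarrow> ennreal" assume f: "f \<in> borel_measurable (borel \<Otimes>\<^sub>M centred_tile_space)"
  have "(\<integral>\<^sup>+ x. \<integral>\<^sup>+ \<tau>. f (x, \<tau>) \<partial>tile_measure \<partial>lborel) = (\<integral>\<^sup>+ x. tile_sum (\<lambda>c \<tau>. indicator unit_box c * f (x, \<tau>)) \<partial>lborel)"
    using measurable_compose[OF measurable_Pair1' f] by (intro nn_integral_cong nn_integral_tile_measure) simp
  also have "\<dots> = tile_sum (\<lambda>x \<tau>. f (x, \<tau>))" by (rule mass_transport(2)[symmetric]) (use f in simp)
  also have "\<dots> = (\<integral>\<^sup>+ \<omega>. \<integral>\<^sup>+ \<tau>. f (tile_centre \<tau>, shift (tile_centre \<tau>) \<tau>) \<partial>count_space (delaunay \<omega>) \<partial>P)"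
    unfolding tile_sum_def
    by (intro nn_integral_cong_AE AE_mp[OF gen AE_I2]) (auto simp: delaunay_general_position[OF generic_general_position])
  finally show "(\<integral>\<^sup>+ x. \<integral>\<^sup>+ \<tau>. f (x, \<tau>) \<partial>tile_measure \<partial>lborel) =
    (\<integral>\<^sup>+ \<omega>. \<integral>\<^sup>+ \<tau>. f (tile_centre \<tau>, shift (tile_centre \<tau>) \<tau>) \<partial>count_space (delaunay \<omega>) \<partial>P)" .
qed

lemma tile_distribution_eq: "tile_distribution P = tile_measure"
  unfolding tile_distribution_def
proof (rule the_equality)
  show "is_tile_distribution P tile_measure" by (rule is_tile_distribution_tile_measure)
  fix \<mu> assume \<mu>: "is_tile_distribution P \<mu>"
  \<comment> \<open>Since the box has area 1, the test function that separates box and tile recovers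
    the value of any solution on \<open>A\<close>; this gives uniqueness.\<close>
  have *: "emeasure \<mu>' A = (\<integral>\<^sup>+ \<omega>. \<integral>\<^sup>+ \<tau>. indicator unit_box (tile_centre \<tau>) * indicator A (shift (tile_centre \<tau>) \<tau>) \<partial>count_space (delaunay \<omega>) \<partial>P)"
    if \<mu>': "is_tile_distribution P \<mu>'" and A: "A \<in> sets centred_tile_space" for \<mu>' A
  proof -
    have s: "sets \<mu>' = sets centred_tile_space" using \<mu>' by (simp add: is_tile_distribution_def)
    have "(\<lambda>p. indicator unit_box (fst p) * indicator A (snd p) :: ennreal) \<in> borel_measurable (borel \<Otimes>\<^sub>M centred_tile_space)"
      using ind_measurable[OF A] by (simp add: case_prod_beta)
    then have "(\<integral>\<^sup>+ x. \<integral>\<^sup>+ \<tau>. indicator unit_box x * indicator A \<tau> \<partial>\<mu>' \<partial>lborel) = (\<integral>\<^sup>+ \<omega>. \<integral>\<^sup>+ \<tau>. indicator unit_box (tile_centre \<tau>) * indicator A (shift (tile_centre \<tau>) \<tau>) \<partial>count_space (delaunay \<omega>) \<partial>P)"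
      using \<mu>' by (fastforce simp: is_tile_distribution_def)
    moreover have "(\<integral>\<^sup>+ x. \<integral>\<^sup>+ \<tau>. indicator unit_box x * indicator A \<tau> \<partial>\<mu>' \<partial>lborel) = emeasure \<mu>' A"
      using A s unit_box by (simp add: nn_integral_cmult nn_integral_multc)
    ultimately show ?thesis by simp
  qed
  show "\<mu> = tile_measure"
  proof (rule measure_eqI)
    show "sets \<mu> = sets tile_measure" using \<mu> by (simp add: is_tile_distribution_def sets_tile_measure)
    fix A assume "A \<in> sets \<mu>"
    then have "A \<in> sets centred_tile_space" using \<mu> by (simp add: is_tile_distribution_def)
    then show "emeasure \<mu> A = emeasure tile_measure A" using *[OF \<mu>] *[OF is_tile_distribution_tile_measure] by simp
  qed
qed

text \<open>The circle of a centred tile is centred at 0, so the radius is the norm of any of the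
  vertices and its sublevel sets are given by a quantifier over points.\<close>

lemma measurable_tile_radius: "tile_radius \<in> borel_measurable centred_tile_space"
proof (rule borel_measurable_iff_le[THEN iffD2], rule allI)
  fix r :: real
  have "Measurable.pred centred_tile_space (\<lambda>\<tau>. \<exists>v\<in>\<tau>. norm v \<le> r)"
    by (rule pred_points_ex[OF measurable_centred_tile_config]) measurable
  then have "{\<tau> \<in> space centred_tile_space. \<exists>v\<in>\<tau>. norm v \<le> r} \<in> sets centred_tile_space" by (simp add: pred_def)
  moreover have "(\<exists>v\<in>\<tau>. norm v \<le> r) \<longleftrightarrow> tile_radius \<tau> \<le> r" if "\<tau> \<in> centred_tiles" for \<tau>
  proof -
    have t: "tile \<tau>" "tile_centre \<tau> = 0" using that by (auto simp: centred_tiles_def)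
    then have "\<tau> \<noteq> {}" by (auto simp: tile_def)
    moreover have "\<And>v. v \<in> \<tau> \<Longrightarrow> norm v = tile_radius \<tau>" using tile_on_circle[OF t(1)] t(2) by (auto simp: dist_norm)
    ultimately show ?thesis by auto
  qed
  then have "{\<tau> \<in> space centred_tile_space. \<exists>v\<in>\<tau>. norm v \<le> r} = {\<tau> \<in> space centred_tile_space. tile_radius \<tau> \<le> r}" by auto
  ultimately show "{\<tau> \<in> space centred_tile_space. tile_radius \<tau> \<le> r} \<in> sets centred_tile_space" by simp
qed

end

section \<open>Gibbs processes\<close>

text \<open>A large disc through three points of a small window could be placed in an empty half-plane.\<close>

lemma admissible_half_plane:
  assumes adm: "\<omega> \<in> admissible" and bd: "bounded \<Lambda>0" and ab: "a \<noteq> b"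
  shows "\<exists>p\<in>\<omega>. p \<notin> \<Lambda>0 \<and> cross a b p > 0"
proof (rule ccontr)
  assume "\<not> ?thesis"
  then have none: "p \<in> \<Lambda>0" if "p \<in> \<omega>" "cross a b p > 0" for p using that by blast
  define d where "d = dist a b"
  have d: "d > 0" using ab by (simp add: d_def)
  have dd: "(b$1 - a$1)\<^sup>2 + (b$2 - a$2)\<^sup>2 = d\<^sup>2" unfolding d_def dist_plane_sq by (simp add: power2_eq_square algebra_simps)
  define n :: plane where "n = vector [- (b$2 - a$2) / d, (b$1 - a$1) / d]"
  define m :: plane where "m = vector [(b$1 - a$1) / d, (b$2 - a$2) / d]"
  have nc: "n$1 = - (b$2 - a$2) / d" "n$2 = (b$1 - a$1) / d" "m$1 = (b$1 - a$1) / d" "m$2 = (b$2 - a$2) / d"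
    by (simp_all add: n_def m_def)
  have one: "(n$1)\<^sup>2 + (n$2)\<^sup>2 = 1" "m$1 = n$2" "m$2 = - n$1"
  proof -
    have "(n$1)\<^sup>2 + (n$2)\<^sup>2 = ((b$2 - a$2)\<^sup>2 + (b$1 - a$1)\<^sup>2) / d\<^sup>2"
      by (simp only: nc power_divide power2_minus add_divide_distrib)
    then show "(n$1)\<^sup>2 + (n$2)\<^sup>2 = 1" using dd d by (simp add: add.commute)
  qed (use d in \<open>simp_all add: nc field_simps\<close>)
  have nn: "n \<bullet> n = 1" "m \<bullet> m = 1" "m \<bullet> n = 0" "n \<bullet> m = 0"
    using one by (simp_all add: inner_plane power2_eq_square)
  have norm: "norm n = 1" "norm m = 1" using nn by (simp_all add: norm_eq_sqrt_inner)
  have cr: "cross a b p = d * (n \<bullet> (p - a))" for p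
    using d by (simp add: cross_def inner_plane nc field_simps)
  obtain M where M: "\<And>p. p \<in> \<Lambda>0 \<Longrightarrow> norm p \<le> M" using bd by (auto simp: bounded_iff)
  \<comment> \<open>\<open>q\<close> lies so far out along the unit normal \<open>n\<close> that all
    of \<open>\<omega>\<close> stays more than 1 below it: points on the positive side of the line
    are in \<open>\<Lambda>0\<close> and have norm at most \<open>M\<close>.\<close>
  define h where "h = \<bar>M\<bar> + norm a + 2"
  define q where "q = a + h *\<^sub>R n"
  have low: "n \<bullet> (p - q) < - 1" if p: "p \<in> \<omega>" for p
  proof (rule ccontr)
    assume "\<not> n \<bullet> (p - q) < - 1"
    moreover have "n \<bullet> (p - q) = n \<bullet> (p - a) - h" using nn by (simp add: q_def inner_diff_right inner_add_right)
    ultimately have ge: "n \<bullet> (p - a) \<ge> h - 1" by linarith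
    have hp: "h - 1 > 0" unfolding h_def using norm_ge_zero[of a] abs_ge_zero[of M] by linarith
    then have "cross a b p > 0" unfolding cr using ge d by (intro mult_pos_pos) linarith+
    then have "norm p \<le> M" using none[OF p] M by simp
    moreover have "n \<bullet> (p - a) \<le> norm p + norm a"
      using norm_cauchy_schwarz[of n "p - a"] norm norm_triangle_ineq4[of p a] by simp
    ultimately show False using ge by (simp add: h_def)
  qed
  define \<Lambda> where "\<Lambda> = cball q 1"
  have "\<Lambda> \<in> bounded_borel" by (simp add: bounded_borel_def \<Lambda>_def)
  obtain \<Lambda>' where L': "\<Lambda>' \<in> bounded_borel"
    "\<And>\<zeta> \<tau>. \<zeta> \<in> configurations \<Longrightarrow> \<tau> \<in> delaunay ((\<zeta> \<inter> \<Lambda>) \<union> (\<omega> - \<Lambda>)) \<Longrightarrow> tile_disc \<tau> \<inter> \<Lambda> \<noteq> {} \<Longrightarrow> tile_disc \<tau> \<subseteq> \<Lambda>'"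
  proof -
    have "\<forall>\<Lambda>\<in>bounded_borel. \<exists>\<Lambda>'\<in>bounded_borel. \<Lambda> \<subseteq> \<Lambda>' \<and> (\<forall>\<zeta>\<in>configurations. \<forall>\<tau>\<in>delaunay ((\<zeta> \<inter> \<Lambda>) \<union> (\<omega> - \<Lambda>)).
        tile_disc \<tau> \<inter> \<Lambda> \<noteq> {} \<longrightarrow> tile_disc \<tau> \<subseteq> \<Lambda>')" using adm by (simp add: admissible_def)
    from bspec[OF this \<open>\<Lambda> \<in> bounded_borel\<close>] obtain \<Lambda>' where "\<Lambda>' \<in> bounded_borel" and
      a: "\<forall>\<zeta>\<in>configurations. \<forall>\<tau>\<in>delaunay ((\<zeta> \<inter> \<Lambda>) \<union> (\<omega> - \<Lambda>)). tile_disc \<tau> \<inter> \<Lambda> \<noteq> {} \<longrightarrow> tile_disc \<tau> \<subseteq> \<Lambda>'" by blast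
    then show thesis using that[of \<Lambda>'] by (simp add: Ball_def)
  qed
  obtain M' where M': "\<And>p. p \<in> \<Lambda>' \<Longrightarrow> norm p \<le> M'" using L'(1) by (auto simp: bounded_borel_def bounded_iff)
  \<comment> \<open>The centre of the disc will have distance \<open>s\<close> from
    \<open>q\<close>. With \<open>s > N\<close> it lies outside \<open>\<Lambda>'\<close>, whose
    points have norm at most \<open>M'\<close>.\<close>
  define N where "N = \<bar>M'\<bar> + norm q + 1"
  define e where "e = 1 / (2 * N + 2)"
  have N1: "N \<ge> 1" by (simp add: N_def)
  have e: "0 < e" "e < 1" "1 / e = 2 * N + 2" using N1 by (simp_all add: e_def)
  \<comment> \<open>The circle through \<open>q - m\<close>, \<open>q + m\<close> and
    \<open>q - e *\<^sub>R n\<close> has its centre at \<open>q + s *\<^sub>R n\<close>, where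
    \<open>1 + s\<^sup>2 = (s + e)\<^sup>2\<close>. A small \<open>e\<close> makes it huge, while it
    reaches only \<open>e < 1\<close> below \<open>q\<close> and so misses
    \<open>\<omega>\<close>.\<close>
  define s where "s = (1 - e\<^sup>2) / (2 * e)"
  have s: "s > N"
  proof -
    have "s = (1 / e - e) / 2" using e by (simp add: s_def field_simps power2_eq_square)
    then show ?thesis using e by simp
  qed
  have sp: "s > 0" using s N1 by linarith
  have se: "1 + s\<^sup>2 = (s + e)\<^sup>2" using e by (simp add: s_def field_simps power2_eq_square)
  define C where "C = q + s *\<^sub>R n"
  define R where "R = s + e"
  define u v w where "u = q - m" and "v = q + m" and "w = q - e *\<^sub>R n"
  define \<zeta> where "\<zeta> = {u, v, w}"
  have cz: "cross u v w = - 2 * e"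
  proof -
    have "cross u v w = - 2 * e * ((n$1)\<^sup>2 + (n$2)\<^sup>2)"
      using one(2,3) by (simp add: cross_def u_def v_def w_def power2_eq_square algebra_simps)
    then show ?thesis using one by simp
  qed
  then have t: "tile \<zeta>" using e by (simp add: \<zeta>_def tile_iff_cross)
  have on: "\<zeta> \<subseteq> sphere C R"
  proof -
    have R0: "R \<ge> 0" using sp e by (simp add: R_def)
    have sq: "dist C p = R" if "(C - p) \<bullet> (C - p) = R\<^sup>2" for p
    proof -
      have "(dist C p)\<^sup>2 = R\<^sup>2" using that by (simp add: dist_norm power2_norm_eq_inner)
      then show ?thesis using R0 by (simp add: power2_eq_iff_nonneg)
    qed
    have "C - u = s *\<^sub>R n + m" "C - v = s *\<^sub>R n - m" "C - w = (s + e) *\<^sub>R n"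
      by (simp_all add: C_def u_def v_def w_def algebra_simps)
    then have "(C - u) \<bullet> (C - u) = R\<^sup>2" "(C - v) \<bullet> (C - v) = R\<^sup>2" "(C - w) \<bullet> (C - w) = R\<^sup>2"
      using nn se by (simp_all add: inner_add_left inner_add_right inner_diff_left inner_diff_right R_def power2_eq_square)
    then show ?thesis using sq by (auto simp: \<zeta>_def)
  qed
  have tc: "tile_centre \<zeta> = C" "tile_radius \<zeta> = R" using tile_circle_unique[OF t on] by auto
  have far: "p \<notin> cball C R" if "p \<in> \<omega>" for p
  proof
    assume "p \<in> cball C R"
    then have "norm (p - C) \<le> R" by (simp add: dist_norm norm_minus_commute)
    moreover have "- (n \<bullet> (p - C)) \<le> norm (p - C)" using norm_cauchy_schwarz[of "- n" "p - C"] norm by simp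
    moreover have "n \<bullet> (p - C) = n \<bullet> (p - q) - s" using nn by (simp add: C_def inner_diff_right inner_add_right)
    ultimately have "n \<bullet> (p - q) \<ge> - e" by (simp add: R_def)
    then show False using low[OF that] e by linarith
  qed
  have zL: "\<zeta> \<subseteq> \<Lambda>" using norm e by (auto simp: \<zeta>_def \<Lambda>_def u_def v_def w_def dist_norm)
  then have W: "(\<zeta> \<inter> \<Lambda>) \<union> (\<omega> - \<Lambda>) = \<zeta> \<union> (\<omega> - \<Lambda>)" by auto
  have far': "p \<notin> sphere C R" "p \<notin> ball C R" if "p \<in> \<omega>" for p using far[OF that] by auto
  have "(\<zeta> \<union> (\<omega> - \<Lambda>)) \<inter> sphere C R = \<zeta>" using on far'(1) by blast
  moreover have "(\<zeta> \<union> (\<omega> - \<Lambda>)) \<inter> ball C R = {}"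
  proof -
    have "\<zeta> \<inter> ball C R = {}" using on by (auto simp: subset_iff)
    then show ?thesis using far'(2) by blast
  qed
  moreover have "card \<zeta> = 3" using t by (simp add: tile_def)
  ultimately have "\<zeta> \<in> delaunay ((\<zeta> \<inter> \<Lambda>) \<union> (\<omega> - \<Lambda>))"
    unfolding W delaunay_def tile_disc_def by (simp add: tc t Let_def)
  moreover have "q \<in> tile_disc \<zeta> \<inter> \<Lambda>"
    using norm sp e by (simp add: tile_disc_def tc \<Lambda>_def C_def R_def dist_norm)
  moreover have "\<zeta> \<in> configurations" by (rule config_finite_set) (simp add: \<zeta>_def)
  ultimately have "tile_disc \<zeta> \<subseteq> \<Lambda>'" using L'(2) by blast
  moreover have "C \<in> tile_disc \<zeta>" using sp e by (simp add: tile_disc_def tc R_def)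
  ultimately have "norm C \<le> M'" using M' by auto
  moreover have "s \<le> norm C + norm q"
  proof -
    have "s = norm (C - q)" using norm sp by (simp add: C_def)
    then show ?thesis using norm_triangle_ineq4[of C q] by simp
  qed
  ultimately show False using s by (simp add: N_def)
qed

section \<open>Patched configurations and almost sure nondegeneracy\<close>

lemma general_position_subset: "general_position \<omega> \<Longrightarrow> \<omega>' \<subseteq> \<omega> \<Longrightarrow> general_position \<omega>'"
  unfolding general_position_def by blast

lemma general_position_Un:
  assumes fin: "finite F" and gp: "general_position U"
    and nd: "\<And>x. x \<in> F \<Longrightarrow> \<not> degenerate x ((F \<union> U) - {x})"
  shows "general_position (F \<union> U)"
  using fin nd
proof (induct F)
  case empty then show ?case using gp by simp
next
  case (insert x F)
  have "general_position (F \<union> U)"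
  proof (rule insert(3))
    fix y assume "y \<in> F"
    then have "\<not> degenerate y ((insert x F \<union> U) - {y})" using insert(4) by simp
    then show "\<not> degenerate y ((F \<union> U) - {y})" using degenerate_mono[of y "(F \<union> U) - {y}" "(insert x F \<union> U) - {y}"] by auto
  qed
  moreover have "\<not> degenerate x (F \<union> U)" if "x \<notin> F \<union> U"
  proof -
    have "(insert x F \<union> U) - {x} = F \<union> U" using that by auto
    then show ?thesis using insert(4)[of x] by simp
  qed
  ultimately show ?case using general_position_insert[of "F \<union> U" x]
    by (cases "x \<in> F \<union> U") (simp_all only: Un_insert_left insert_absorb not_False_eq_True)
qed

definition patch :: "plane set \<Rightarrow> plane set \<Rightarrow> plane set \<Rightarrow> plane set" where
  "patch \<Lambda> \<omega> \<zeta> = (\<zeta> \<inter> \<Lambda>) \<union> (\<omega> - \<Lambda>)"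

lemma patch_config: "\<omega> \<in> configurations \<Longrightarrow> \<zeta> \<in> configurations \<Longrightarrow> patch \<Lambda> \<omega> \<zeta> \<in> configurations"
  unfolding patch_def by (auto intro!: config_Un intro: config_subset)

lemma measurable_patch [measurable (raw)]:
  assumes "\<kappa> \<in> measurable S config_space" "\<kappa>' \<in> measurable S config_space" "\<Lambda> \<in> sets borel"
  shows "(\<lambda>s. patch \<Lambda> (\<kappa> s) (\<kappa>' s)) \<in> measurable S config_space"
  unfolding patch_def by (rule measurable_config_patch[OF assms(2,1,3)])

lemma patch_remove: "x \<in> \<Lambda> \<Longrightarrow> patch \<Lambda> \<omega> (\<zeta> - {x}) = patch \<Lambda> \<omega> \<zeta> - {x}"
  by (auto simp: patch_def)

lemma patch_insert: "x \<in> \<Lambda> \<Longrightarrow> patch \<Lambda> \<omega> (insert x \<zeta>) = insert x (patch \<Lambda> \<omega> \<zeta>)"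
  by (auto simp: patch_def)

lemma patch_restrict: "patch \<Lambda> \<omega> (\<zeta> \<inter> \<Lambda>) = patch \<Lambda> \<omega> \<zeta>"
  by (auto simp: patch_def)

text \<open>The local version of \<open>generic\<close>: the points outside \<open>\<Lambda>\<close>
  form a boundary condition and are not tested themselves.\<close>

definition nondegenerate_in :: "plane set \<Rightarrow> plane set \<Rightarrow> bool" where
  "nondegenerate_in \<Lambda> \<eta> \<longleftrightarrow> (\<forall>x\<in>\<eta>. x \<in> \<Lambda> \<longrightarrow> \<not> degenerate x (\<eta> - {x}))"

lemma measurable_nondegenerate_in:
  assumes \<kappa>: "\<kappa> \<in> measurable S config_space" and [measurable]: "\<Lambda> \<in> sets borel"
  shows "Measurable.pred S (\<lambda>s. nondegenerate_in \<Lambda> (\<kappa> s))"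
proof -
  have [measurable]: "Measurable.pred (S \<Otimes>\<^sub>M borel) (\<lambda>p. degenerate (snd p) (\<kappa> (fst p) - {snd p}))"
    by (rule measurable_degenerate[OF measurable_config_remove[OF measurable_compose[OF measurable_fst \<kappa>] measurable_snd] measurable_snd])
  show ?thesis unfolding nondegenerate_in_def by (rule pred_points_all[OF \<kappa>]) measurable
qed

context poisson_voids
begin

lemma measurable_P_eq: "measurable P N = measurable config_space N"
  by (rule measurable_cong_sets[OF sets_P refl])

text \<open>By the Mecke formula the expected number of degenerate points in
  \<open>\<Lambda>\<close> is \<open>z\<close> times an integral over \<open>x\<close> of the
  probability that \<open>x\<close> is degenerate for the patched configuration. After exchanging
  the integrals it vanishes, as for a fixed configuration almost no \<open>x\<close> is
  degenerate.\<close>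

lemma AE_nondegenerate_patch:
  assumes w: "\<omega> \<in> configurations" and L: "\<Lambda> \<in> bounded_borel"
  shows "AE \<zeta> in P. nondegenerate_in \<Lambda> (patch \<Lambda> \<omega> \<zeta>)"
proof -
  interpret LP: pair_sigma_finite lborel P by unfold_locales
  have Lb [measurable]: "\<Lambda> \<in> sets borel" using L by (simp add: bounded_borel_def)
  define F where "F = (\<lambda>(x, \<zeta>). of_bool (degenerate x (patch \<Lambda> \<omega> \<zeta>)) :: ennreal)"
  have km: "(\<lambda>p. patch \<Lambda> \<omega> (snd p)) \<in> measurable (borel \<Otimes>\<^sub>M config_space) config_space"
    using w by (intro measurable_patch measurable_const measurable_snd Lb) simp
  have Fm: "F \<in> borel_measurable (borel \<Otimes>\<^sub>M config_space)"
  proof -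
    have [measurable]: "Measurable.pred (borel \<Otimes>\<^sub>M config_space) (\<lambda>p. degenerate (fst p) (patch \<Lambda> \<omega> (snd p)))"
      by (rule measurable_degenerate[OF km measurable_fst])
    show ?thesis unfolding F_def case_prod_beta by measurable
  qed
  have Fm': "(\<lambda>p. indicator \<Lambda> (fst p) * F p) \<in> borel_measurable (lborel \<Otimes>\<^sub>M P)"
  proof -
    have [measurable]: "F \<in> borel_measurable (lborel \<Otimes>\<^sub>M P)"
      using Fm by (simp add: measurable_cong_sets[OF sets_pair_measure_cong[OF sets_lborel sets_P] refl])
    show ?thesis by measurable
  qed
  have "(\<integral>\<^sup>+ x. indicator \<Lambda> x * (\<integral>\<^sup>+ \<zeta>. F (x, \<zeta>) \<partial>P) \<partial>lborel) = (\<integral>\<^sup>+ x. \<integral>\<^sup>+ \<zeta>. indicator \<Lambda> x * F (x, \<zeta>) \<partial>P \<partial>lborel)"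
  proof (intro nn_integral_cong)
    fix x
    have "(\<lambda>\<zeta>. F (x, \<zeta>)) \<in> borel_measurable P"
      using measurable_compose[OF measurable_Pair1'[of x borel config_space] Fm] by (simp add: measurable_P_eq)
    then show "indicator \<Lambda> x * (\<integral>\<^sup>+ \<zeta>. F (x, \<zeta>) \<partial>P) = (\<integral>\<^sup>+ \<zeta>. indicator \<Lambda> x * F (x, \<zeta>) \<partial>P)"
      by (simp add: nn_integral_cmult)
  qed
  also have "\<dots> = (\<integral>\<^sup>+ \<zeta>. \<integral>\<^sup>+ x. indicator \<Lambda> x * F (x, \<zeta>) \<partial>lborel \<partial>P)"
    using Fm' by (intro LP.Fubini'[symmetric]) (simp add: case_prod_beta')
  also have "\<dots> = (\<integral>\<^sup>+ \<zeta>. 0 \<partial>P)"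
  proof (intro nn_integral_cong)
    fix \<zeta> assume "\<zeta> \<in> space P"
    then have "AE x in lborel. \<not> degenerate x (patch \<Lambda> \<omega> \<zeta>)" using w by (intro AE_not_degenerate patch_config) (auto simp: space_P)
    then have "AE x in lborel. indicator \<Lambda> x * F (x, \<zeta>) = 0" by eventually_elim (simp add: F_def)
    then have "(\<integral>\<^sup>+ x. indicator \<Lambda> x * F (x, \<zeta>) \<partial>lborel) = (\<integral>\<^sup>+ x. 0 \<partial>(lborel :: plane measure))" by (rule nn_integral_cong_AE)
    then show "(\<integral>\<^sup>+ x. indicator \<Lambda> x * F (x, \<zeta>) \<partial>lborel) = 0" by simp
  qed
  finally have "(\<integral>\<^sup>+ \<zeta>. \<integral>\<^sup>+ x. F (x, \<zeta> - {x}) * indicator \<Lambda> x \<partial>count_space \<zeta> \<partial>P) = 0"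
    unfolding mecke[OF L Fm] by simp
  then have "AE \<zeta> in P. (\<integral>\<^sup>+ x. F (x, \<zeta> - {x}) * indicator \<Lambda> x \<partial>count_space \<zeta>) = 0"
    using mecke_measurable(1)[OF Fm Lb] by (simp add: nn_integral_0_iff_AE)
  then show ?thesis
  proof eventually_elim
    fix \<zeta> assume z: "(\<integral>\<^sup>+ x. F (x, \<zeta> - {x}) * indicator \<Lambda> x \<partial>count_space \<zeta>) = 0"
    have "F (x, \<zeta> - {x}) * indicator \<Lambda> x = 0" if "x \<in> \<zeta>" for x
      using z that by (subst (asm) nn_integral_0_iff_AE) (auto simp: AE_count_space)
    then have "\<not> degenerate x (patch \<Lambda> \<omega> \<zeta> - {x})" if "x \<in> \<zeta>" "x \<in> \<Lambda>" for x
      using that patch_remove[of x \<Lambda> \<omega> \<zeta>] by (force simp: F_def)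
    then show "nondegenerate_in \<Lambda> (patch \<Lambda> \<omega> \<zeta>)"
      by (auto simp: nondegenerate_in_def patch_def)
  qed
qed

text \<open>The function \<open>h\<close> may contain the tie-breaking rule, so it is only compared
  with a measurable \<open>h'\<close> on the almost sure set of nondegenerate configurations. In
  this way the Hamiltonian enters the integrals.\<close>

lemma nn_integral_restricted:
  assumes w: "\<omega> \<in> configurations" and L: "\<Lambda> \<in> bounded_borel"
    and h': "h' \<in> borel_measurable config_space"
    and eq: "\<And>\<zeta>. \<zeta> \<in> configurations \<Longrightarrow> \<zeta> \<subseteq> \<Lambda> \<Longrightarrow> nondegenerate_in \<Lambda> (patch \<Lambda> \<omega> \<zeta>) \<Longrightarrow> h \<zeta> = h' (patch \<Lambda> \<omega> \<zeta>)"
  shows "(\<integral>\<^sup>+ \<zeta>. h \<zeta> \<partial>restricted_process \<Lambda> P) = (\<integral>\<^sup>+ \<zeta>. h' (patch \<Lambda> \<omega> \<zeta>) \<partial>P)"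
proof -
  have Lb [measurable]: "\<Lambda> \<in> sets borel" using L by (simp add: bounded_borel_def)
  have r: "(\<lambda>\<zeta>. \<zeta> \<inter> \<Lambda>) \<in> measurable P config_space"
    by (rule measurable_config_restrict[OF measurable_P_config Lb])
  have idm: "(\<lambda>\<zeta>. \<zeta>) \<in> measurable config_space config_space" by simp
  have km: "(\<lambda>\<zeta>. patch \<Lambda> \<omega> \<zeta>) \<in> measurable config_space config_space"
    using w by (intro measurable_patch measurable_const idm Lb) simp
  have pr: "Measurable.pred config_space (\<lambda>\<zeta>. (\<forall>x\<in>\<zeta>. x \<in> \<Lambda>) \<and> nondegenerate_in \<Lambda> (patch \<Lambda> \<omega> \<zeta>))"
    by (intro pred_intros_logic pred_points_all[OF idm] measurable_nondegenerate_in[OF km Lb]) measurable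
  have "AE \<zeta> in P. nondegenerate_in \<Lambda> (patch \<Lambda> \<omega> (\<zeta> \<inter> \<Lambda>))"
    using AE_nondegenerate_patch[OF w L] by (simp add: patch_restrict)
  then have "AE \<zeta> in restricted_process \<Lambda> P. (\<forall>x\<in>\<zeta>. x \<in> \<Lambda>) \<and> nondegenerate_in \<Lambda> (patch \<Lambda> \<omega> \<zeta>)"
    unfolding restricted_process_def using pr by (subst AE_distr_iff[OF r]) (auto simp: pred_def)
  then have "AE \<zeta> in restricted_process \<Lambda> P. h \<zeta> = h' (patch \<Lambda> \<omega> \<zeta>)"
  proof (rule AE_mp, intro AE_I2 impI)
    fix \<zeta> assume "\<zeta> \<in> space (restricted_process \<Lambda> P)" "(\<forall>x\<in>\<zeta>. x \<in> \<Lambda>) \<and> nondegenerate_in \<Lambda> (patch \<Lambda> \<omega> \<zeta>)"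
    then show "h \<zeta> = h' (patch \<Lambda> \<omega> \<zeta>)" by (intro eq) (auto simp: restricted_process_def)
  qed
  then have "(\<integral>\<^sup>+ \<zeta>. h \<zeta> \<partial>restricted_process \<Lambda> P) = (\<integral>\<^sup>+ \<zeta>. h' (patch \<Lambda> \<omega> \<zeta>) \<partial>restricted_process \<Lambda> P)"
    by (rule nn_integral_cong_AE)
  also have "\<dots> = (\<integral>\<^sup>+ \<zeta>. h' (patch \<Lambda> \<omega> (\<zeta> \<inter> \<Lambda>)) \<partial>P)"
    unfolding restricted_process_def using measurable_compose[OF km h'] by (intro nn_integral_distr[OF r]) simp
  finally show ?thesis by (simp add: patch_restrict)
qed

end

text \<open>Used with the unit box: hitting it becomes a measurable condition on centre and
  radius.\<close>

lemma tile_disc_meets_iff: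
  assumes "A \<noteq> {}" shows "tile_disc \<tau> \<inter> A \<noteq> {} \<longleftrightarrow> infdist (tile_centre \<tau>) A < tile_radius \<tau>"
proof
  assume "tile_disc \<tau> \<inter> A \<noteq> {}"
  then obtain y where "y \<in> A" "dist (tile_centre \<tau>) y < tile_radius \<tau>" by (auto simp: tile_disc_def)
  then show "infdist (tile_centre \<tau>) A < tile_radius \<tau>" using infdist_le[of y A "tile_centre \<tau>"] by linarith
next
  assume l: "infdist (tile_centre \<tau>) A < tile_radius \<tau>"
  show "tile_disc \<tau> \<inter> A \<noteq> {}"
  proof
    assume "tile_disc \<tau> \<inter> A = {}"
    then have "tile_radius \<tau> \<le> dist (tile_centre \<tau>) y" if "y \<in> A" for y
      using that by (force simp: tile_disc_def)
    then have "tile_radius \<tau> \<le> infdist (tile_centre \<tau>) A"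
      unfolding infdist_notempty[OF assms] by (intro cINF_greatest assms)
    then show False using l by simp
  qed
qed

locale gibbs_process = stationary_process +
  fixes \<phi> :: "plane set \<Rightarrow> real" and z K r :: real and \<psi> :: "real \<Rightarrow> real"
  assumes gibbs: "gibbs_measure \<phi> z P" and z: "z > 0"
    and \<phi>: "\<phi> \<in> borel_measurable centred_tile_space"
    and K: "K \<ge> 0" "\<And>\<tau>. \<tau> \<in> centred_tiles \<Longrightarrow> \<bar>\<phi> \<tau>\<bar> \<le> K"
    and r: "r > 0" "mono_on {r..} \<psi>"
      "\<And>\<tau>. tile \<tau> \<Longrightarrow> r \<le> tile_radius \<tau> \<Longrightarrow> tile_energy \<phi> \<tau> = \<psi> (tile_radius \<tau>)"
begin

abbreviation "Poi \<equiv> poisson_process z"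

sublocale Pi: poisson_voids "Poi" z by (rule poisson_process_voids[OF z])

lemma AE_admissible: "AE \<omega> in P. \<omega> \<in> admissible"
  using gibbs by (simp add: gibbs_measure_def)

lemma dlr: "\<Lambda> \<in> bounded_borel \<Longrightarrow> A \<in> sets config_space \<Longrightarrow> emeasure P A = (\<integral>\<^sup>+ \<omega>. gibbs_kernel \<phi> \<Lambda> z \<omega> A \<partial>P)"
  using gibbs by (simp add: gibbs_measure_def)

text \<open>The Poisson part of the kernel gives probability 0 to degenerate configurations for
  every boundary condition, and the Gibbs equation passes this on to \<open>P\<close>.\<close>

lemma AE_nondegenerate_in:
  assumes L: "\<Lambda> \<in> bounded_borel" shows "AE \<omega> in P. nondegenerate_in \<Lambda> \<omega>"
proof -
  have Lb: "\<Lambda> \<in> sets borel" using L by (simp add: bounded_borel_def)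
  define A where "A = {\<omega> \<in> configurations. \<not> nondegenerate_in \<Lambda> \<omega>}"
  have A: "A \<in> sets config_space"
  proof -
    have "Measurable.pred config_space (\<lambda>\<omega>. \<not> nondegenerate_in \<Lambda> \<omega>)"
      by (intro pred_intros_logic measurable_nondegenerate_in Lb) simp
    then show ?thesis by (simp add: A_def pred_def)
  qed
  have "gibbs_kernel \<phi> \<Lambda> z \<omega> A = 0" if w: "\<omega> \<in> configurations" for \<omega>
  proof -
    have "(\<integral>\<^sup>+ \<zeta>. indicator A (\<zeta> \<union> (\<omega> - \<Lambda>)) * ennreal (exp (- hamiltonian \<phi> \<Lambda> \<omega> \<zeta>)) \<partial>restricted_process \<Lambda> Poi) = (\<integral>\<^sup>+ \<zeta>. 0 \<partial>Poi)"
    proof (rule Pi.nn_integral_restricted[OF w L, of "\<lambda>_. 0"])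
      fix \<zeta> assume z: "\<zeta> \<subseteq> \<Lambda>" "nondegenerate_in \<Lambda> (patch \<Lambda> \<omega> \<zeta>)"
      then have "patch \<Lambda> \<omega> \<zeta> = \<zeta> \<union> (\<omega> - \<Lambda>)" by (auto simp: patch_def)
      then show "indicator A (\<zeta> \<union> (\<omega> - \<Lambda>)) * ennreal (exp (- hamiltonian \<phi> \<Lambda> \<omega> \<zeta>)) = 0"
        using z by (simp add: A_def)
    qed simp
    then show ?thesis by (simp add: gibbs_kernel_def)
  qed
  then have "emeasure P A = (\<integral>\<^sup>+ \<omega>. 0 \<partial>P)" unfolding dlr[OF L A] by (intro nn_integral_cong) (simp add: space_P)
  then have "A \<in> null_sets P" using A by (auto simp: sets_P)
  then have "AE \<omega> in P. \<omega> \<notin> A" by (rule AE_not_in)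
  then show ?thesis by (rule AE_mp) (auto simp: A_def space_P)
qed

sublocale generic_process
proof unfold_locales
  have "AE \<omega> in P. \<forall>n::nat. nondegenerate_in (ball 0 (real n)) \<omega>"
    unfolding AE_all_countable by (intro allI AE_nondegenerate_in) (simp add: bounded_borel_def)
  then show "AE \<omega> in P. generic \<omega>"
  proof eventually_elim
    fix \<omega> assume a: "\<forall>n::nat. nondegenerate_in (ball 0 (real n)) \<omega>"
    show "generic \<omega>" unfolding generic_def
    proof
      fix x assume "x \<in> \<omega>"
      moreover obtain n :: nat where "norm x < n" using reals_Archimedean2 by auto
      ultimately show "\<not> degenerate x (\<omega> - {x})" using a[rule_format, of n] by (auto simp: nondegenerate_in_def)
    qed
  qed
qed

section \<open>The Gibbs kernel of the unit box in measurable form\<close>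

definition hit_tiles :: "plane set \<Rightarrow> plane set set" where
  "hit_tiles U = {\<tau> \<in> empty_disc_tiles U. tile_disc \<tau> \<inter> unit_box \<noteq> {}}"

definition hit :: "plane \<Rightarrow> plane set \<Rightarrow> ennreal" where
  "hit c \<tau> = of_bool (infdist c unit_box < tile_radius \<tau>)"

text \<open>The Boltzmann factor as a function of the complete configuration. The energy is written
  as a difference of sums of the nonnegative terms \<phi> + K and K, for which measurability is
  known; \<open>enn2real\<close> is faithful when finitely many tiles hit the box.\<close>

definition weight :: "plane set \<Rightarrow> ennreal" where
  "weight U = ennreal (exp (
      enn2real (\<integral>\<^sup>+ \<tau>. hit (tile_centre \<tau>) (shift (tile_centre \<tau>) \<tau>) * ennreal K \<partial>count_space (empty_disc_tiles U))
    - enn2real (\<integral>\<^sup>+ \<tau>. hit (tile_centre \<tau>) (shift (tile_centre \<tau>) \<tau>) * ennreal (\<phi> (shift (tile_centre \<tau>) \<tau>) + K) \<partial>count_space (empty_disc_tiles U))))"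

lemma measurable_weight [measurable]: "weight \<in> borel_measurable config_space"
proof -
  have idm: "(\<lambda>U. U) \<in> measurable config_space config_space" by simp
  note [measurable] = \<phi> measurable_tile_radius
  have [measurable]: "(\<lambda>c. infdist c unit_box) \<in> borel_measurable borel"
    by (intro borel_measurable_continuous_onI continuous_on_infdist continuous_on_id)
  have [measurable]: "(\<lambda>p. hit (fst (snd p)) (snd (snd p))) \<in> borel_measurable (config_space \<Otimes>\<^sub>M (borel \<Otimes>\<^sub>M centred_tile_space))"
    unfolding hit_def by measurable
  have [measurable]: "(\<lambda>U. \<integral>\<^sup>+ \<tau>. hit (tile_centre \<tau>) (shift (tile_centre \<tau>) \<tau>) * ennreal K \<partial>count_space (empty_disc_tiles U)) \<in> borel_measurable config_space"
    by (rule nn_integral_tiles_measurable[OF idm]) measurable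
  have [measurable]: "(\<lambda>U. \<integral>\<^sup>+ \<tau>. hit (tile_centre \<tau>) (shift (tile_centre \<tau>) \<tau>) * ennreal (\<phi> (shift (tile_centre \<tau>) \<tau>) + K) \<partial>count_space (empty_disc_tiles U)) \<in> borel_measurable config_space"
    by (rule nn_integral_tiles_measurable[OF idm]) measurable
  show ?thesis unfolding weight_def by measurable
qed

lemma weight_eq:
  assumes fin: "finite (hit_tiles U)"
  shows "weight U = ennreal (exp (- (\<Sum>\<tau>\<in>hit_tiles U. tile_energy \<phi> \<tau>)))"
proof -
  have *: "(\<integral>\<^sup>+ \<tau>. hit (tile_centre \<tau>) (shift (tile_centre \<tau>) \<tau>) * ennreal (g (shift (tile_centre \<tau>) \<tau>)) \<partial>count_space (empty_disc_tiles U))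
      = ennreal (\<Sum>\<tau>\<in>hit_tiles U. g (shift (tile_centre \<tau>) \<tau>))"
    if g: "\<And>\<tau>. \<tau> \<in> centred_tiles \<Longrightarrow> g \<tau> \<ge> 0" for g :: "plane set \<Rightarrow> real"
  proof -
    have t: "tile \<tau>" if "\<tau> \<in> empty_disc_tiles U" for \<tau> using that by (simp add: empty_disc_tiles_def)
    have "(\<integral>\<^sup>+ \<tau>. hit (tile_centre \<tau>) (shift (tile_centre \<tau>) \<tau>) * ennreal (g (shift (tile_centre \<tau>) \<tau>)) \<partial>count_space (empty_disc_tiles U))
      = (\<integral>\<^sup>+ \<tau>. ennreal (g (shift (tile_centre \<tau>) \<tau>)) * indicator (hit_tiles U) \<tau> \<partial>count_space (empty_disc_tiles U))"
      using t by (intro nn_integral_cong)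
        (auto simp: hit_def hit_tiles_def shift_tile(3) tile_disc_meets_iff[OF unit_box(3)] split: split_indicator)
    also have "\<dots> = (\<integral>\<^sup>+ \<tau>. ennreal (g (shift (tile_centre \<tau>) \<tau>)) * indicator (hit_tiles U) \<tau> * indicator (empty_disc_tiles U) \<tau> \<partial>count_space UNIV)"
      by (simp add: nn_integral_count_space_indicator)
    also have "\<dots> = (\<integral>\<^sup>+ \<tau>. ennreal (g (shift (tile_centre \<tau>) \<tau>)) * indicator (hit_tiles U) \<tau> \<partial>count_space UNIV)"
      by (intro nn_integral_cong) (auto simp: hit_tiles_def split: split_indicator)
    also have "\<dots> = (\<integral>\<^sup>+ \<tau>. ennreal (g (shift (tile_centre \<tau>) \<tau>)) \<partial>count_space (hit_tiles U))"
      by (simp add: nn_integral_count_space_indicator)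
    also have "\<dots> = (\<Sum>\<tau>\<in>hit_tiles U. ennreal (g (shift (tile_centre \<tau>) \<tau>)))" by (rule nn_integral_count_space_finite[OF fin])
    also have "\<dots> = ennreal (\<Sum>\<tau>\<in>hit_tiles U. g (shift (tile_centre \<tau>) \<tau>))"
      using t g centred_tile_shift by (intro sum_ennreal) (auto simp: hit_tiles_def)
    finally show ?thesis .
  qed
  have nn: "(\<Sum>\<tau>\<in>hit_tiles U. \<phi> (shift (tile_centre \<tau>) \<tau>) + K) \<ge> 0"
  proof (rule sum_nonneg)
    fix \<tau> assume "\<tau> \<in> hit_tiles U"
    then show "0 \<le> \<phi> (shift (tile_centre \<tau>) \<tau>) + K"
      using K(2)[of "shift (tile_centre \<tau>) \<tau>"] centred_tile_shift[of \<tau>] by (auto simp: hit_tiles_def empty_disc_tiles_def)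
  qed
  have Kp: "\<phi> \<tau> + K \<ge> 0" if "\<tau> \<in> centred_tiles" for \<tau> using K(2)[OF that] by linarith
  show ?thesis unfolding weight_def
    using *[of "\<lambda>_. K"] *[of "\<lambda>\<tau>. \<phi> \<tau> + K"] K(1) Kp nn
    by (simp add: sum_nonneg sum.distrib tile_energy_def)
qed

definition good_boundary :: "plane set \<Rightarrow> bool" where
  "good_boundary \<omega> \<longleftrightarrow> \<omega> \<in> configurations \<and> \<omega> \<in> admissible \<and> general_position \<omega>"

lemma AE_good_boundary: "AE \<omega> in P. good_boundary \<omega>"
  using AE_admissible gen by (rule AE_mp[OF AE_conjI]) (auto simp: good_boundary_def space_P generic_general_position)

lemma patch_general_position:
  assumes w: "good_boundary \<omega>" and \<zeta>: "\<zeta> \<in> configurations" and nd: "nondegenerate_in unit_box (patch unit_box \<omega> \<zeta>)"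
  shows "general_position (patch unit_box \<omega> \<zeta>)"
  unfolding patch_def
proof (rule general_position_Un)
  show "finite (\<zeta> \<inter> unit_box)" using config_finite[OF \<zeta>] unit_box by (auto simp: bounded_borel_def)
  show "general_position (\<omega> - unit_box)" using w by (auto simp: good_boundary_def intro: general_position_subset)
  show "\<not> degenerate x (\<zeta> \<inter> unit_box \<union> (\<omega> - unit_box) - {x})" if "x \<in> \<zeta> \<inter> unit_box" for x
    using nd that by (auto simp: nondegenerate_in_def patch_def)
qed

text \<open>Admissibility confines all discs that meet the box to one bounded set. The vertices lie
  on the boundaries of the discs, hence in its closure, which contains finitely many points.\<close>

lemma hit_tiles_finite:
  assumes w: "good_boundary \<omega>" and \<zeta>: "\<zeta> \<in> configurations" and gp: "general_position (patch unit_box \<omega> \<zeta>)"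
  shows "finite (hit_tiles (patch unit_box \<omega> \<zeta>))"
proof -
  let ?U = "patch unit_box \<omega> \<zeta>"
  obtain \<Lambda>' where L': "\<Lambda>' \<in> bounded_borel" "\<And>\<tau>. \<tau> \<in> delaunay ?U \<Longrightarrow> tile_disc \<tau> \<inter> unit_box \<noteq> {} \<Longrightarrow> tile_disc \<tau> \<subseteq> \<Lambda>'"
  proof -
    have "\<omega> \<in> admissible" using w by (simp add: good_boundary_def)
    then have "\<forall>\<Lambda>\<in>bounded_borel. \<exists>\<Lambda>'\<in>bounded_borel. \<Lambda> \<subseteq> \<Lambda>' \<and> (\<forall>\<zeta>\<in>configurations. \<forall>\<tau>\<in>delaunay ((\<zeta> \<inter> \<Lambda>) \<union> (\<omega> - \<Lambda>)).
        tile_disc \<tau> \<inter> \<Lambda> \<noteq> {} \<longrightarrow> tile_disc \<tau> \<subseteq> \<Lambda>')" by (simp add: admissible_def)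
    from bspec[OF this unit_box(1)] obtain \<Lambda>' where "\<Lambda>' \<in> bounded_borel" and
      a: "\<forall>\<zeta>\<in>configurations. \<forall>\<tau>\<in>delaunay ((\<zeta> \<inter> unit_box) \<union> (\<omega> - unit_box)). tile_disc \<tau> \<inter> unit_box \<noteq> {} \<longrightarrow> tile_disc \<tau> \<subseteq> \<Lambda>'" by blast
    then show thesis using that[of \<Lambda>'] bspec[OF a \<zeta>] by (simp add: patch_def)
  qed
  have U: "?U \<in> configurations" using w \<zeta> by (intro patch_config) (auto simp: good_boundary_def)
  have "hit_tiles ?U \<subseteq> Pow (?U \<inter> closure \<Lambda>')"
  proof (intro subsetI PowI IntI)
    fix \<tau> v assume t: "\<tau> \<in> hit_tiles ?U" "v \<in> \<tau>"
    then show "v \<in> ?U" by (auto simp: hit_tiles_def empty_disc_tiles_def)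
    have tt: "tile \<tau>" "tile_disc \<tau> \<subseteq> \<Lambda>'"
      using t L'(2)[of \<tau>] delaunay_general_position[OF gp] by (auto simp: hit_tiles_def empty_disc_tiles_def)
    have "v \<in> cball (tile_centre \<tau>) (tile_radius \<tau>)" using tile_on_circle[OF tt(1)] t(2) by auto
    also have "\<dots> = closure (tile_disc \<tau>)" using tile_radius_pos[OF tt(1)] by (simp add: tile_disc_def closure_ball)
    also have "\<dots> \<subseteq> closure \<Lambda>'" by (rule closure_mono[OF tt(2)])
    finally show "v \<in> closure \<Lambda>'" .
  qed
  moreover have "finite (?U \<inter> closure \<Lambda>')" using config_finite[OF U] L'(1) by (auto simp: bounded_borel_def bounded_closure)
  ultimately show ?thesis using finite_subset by blast
qed

lemma hamiltonian_weight:
  assumes w: "good_boundary \<omega>" and \<zeta>: "\<zeta> \<in> configurations" and nd: "nondegenerate_in unit_box (patch unit_box \<omega> \<zeta>)"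
  shows "ennreal (exp (- hamiltonian \<phi> unit_box \<omega> \<zeta>)) = weight (patch unit_box \<omega> \<zeta>)"
proof -
  note gp = patch_general_position[OF w \<zeta> nd]
  have "hamiltonian \<phi> unit_box \<omega> \<zeta> = (\<Sum>\<tau>\<in>hit_tiles (patch unit_box \<omega> \<zeta>). tile_energy \<phi> \<tau>)"
    unfolding hamiltonian_def patch_def[symmetric] delaunay_general_position[OF gp] hit_tiles_def ..
  then show ?thesis using weight_eq[OF hit_tiles_finite[OF w \<zeta> gp]] by simp
qed

definition Z :: "plane set \<Rightarrow> ennreal" where
  "Z \<omega> = (\<integral>\<^sup>+ \<zeta>. weight (patch unit_box \<omega> \<zeta>) \<partial>Poi)"

lemma gibbs_kernel_eq:
  assumes w: "good_boundary \<omega>" and A: "A \<in> sets config_space"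
  shows "gibbs_kernel \<phi> unit_box z \<omega> A = (\<integral>\<^sup>+ \<zeta>. indicator A (patch unit_box \<omega> \<zeta>) * weight (patch unit_box \<omega> \<zeta>) \<partial>Poi) / Z \<omega>"
proof -
  have wc: "\<omega> \<in> configurations" using w by (simp add: good_boundary_def)
  have "partition_function \<phi> unit_box z \<omega> = Z \<omega>"
    unfolding partition_function_def Z_def
    by (rule Pi.nn_integral_restricted[OF wc unit_box(1) measurable_weight]) (rule hamiltonian_weight[OF w])
  moreover have "(\<integral>\<^sup>+ \<zeta>. indicator A (\<zeta> \<union> (\<omega> - unit_box)) * ennreal (exp (- hamiltonian \<phi> unit_box \<omega> \<zeta>)) \<partial>restricted_process unit_box Poi) =
     (\<integral>\<^sup>+ \<zeta>. indicator A (patch unit_box \<omega> \<zeta>) * weight (patch unit_box \<omega> \<zeta>) \<partial>Poi)"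
  proof (rule Pi.nn_integral_restricted[OF wc unit_box(1), of "\<lambda>U. indicator A U * weight U"])
    show "(\<lambda>U. indicator A U * weight U) \<in> borel_measurable config_space" using A by measurable
    fix \<zeta> assume z: "\<zeta> \<in> configurations" "\<zeta> \<subseteq> unit_box" "nondegenerate_in unit_box (patch unit_box \<omega> \<zeta>)"
    then have "patch unit_box \<omega> \<zeta> = \<zeta> \<union> (\<omega> - unit_box)" by (auto simp: patch_def)
    then show "indicator A (\<zeta> \<union> (\<omega> - unit_box)) * ennreal (exp (- hamiltonian \<phi> unit_box \<omega> \<zeta>)) = indicator A (patch unit_box \<omega> \<zeta>) * weight (patch unit_box \<omega> \<zeta>)"
      using hamiltonian_weight[OF w z(1,3)] by simp
  qed
  ultimately show ?thesis by (simp add: gibbs_kernel_def)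
qed

lemma measurable_patch_pair: "(\<lambda>p. patch unit_box (fst p) (snd p)) \<in> measurable (P \<Otimes>\<^sub>M Poi) config_space"
  by (rule measurable_patch[OF measurable_compose[OF measurable_fst measurable_id_config] measurable_compose[OF measurable_snd Pi.measurable_P_config] unit_box_borel])

lemma measurable_Z [measurable]: "Z \<in> borel_measurable P"
  unfolding Z_def using measurable_compose[OF measurable_patch_pair measurable_weight]
  by (intro Pi.borel_measurable_nn_integral) (simp add: case_prod_beta)

definition gibbs_density :: "plane set \<Rightarrow> plane set \<Rightarrow> ennreal" where
  "gibbs_density \<omega> \<zeta> = weight (patch unit_box \<omega> \<zeta>) / Z \<omega>"

lemma measurable_gibbs_density: "(\<lambda>p. gibbs_density (fst p) (snd p)) \<in> borel_measurable (P \<Otimes>\<^sub>M Poi)"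
proof -
  note [measurable] = measurable_compose[OF measurable_patch_pair measurable_weight] measurable_compose[OF measurable_fst measurable_Z]
  show ?thesis unfolding gibbs_density_def by measurable
qed

text \<open>The Gibbs equation on sets exhibits \<open>P\<close> as the image under patching of a
  measure with density with respect to the product of \<open>P\<close> and the Poisson process. The
  version for functions is then the change of variables.\<close>

lemma dlr_nn_integral:
  assumes g: "g \<in> borel_measurable config_space"
  shows "(\<integral>\<^sup>+ \<omega>. g \<omega> \<partial>P) = (\<integral>\<^sup>+ \<omega>. \<integral>\<^sup>+ \<zeta>. gibbs_density \<omega> \<zeta> * g (patch unit_box \<omega> \<zeta>) \<partial>Poi \<partial>P)"
proof -
  let ?w = "\<lambda>p. patch unit_box (fst p) (snd p)"
  let ?\<rho> = "\<lambda>p. gibbs_density (fst p) (snd p)"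
  define N where "N = distr (density (P \<Otimes>\<^sub>M Poi) ?\<rho>) config_space ?w"
  have wm: "?w \<in> measurable (density (P \<Otimes>\<^sub>M Poi) ?\<rho>) config_space"
    using measurable_patch_pair by simp
  have N: "(\<integral>\<^sup>+ \<omega>. g \<omega> \<partial>N) = (\<integral>\<^sup>+ \<omega>. \<integral>\<^sup>+ \<zeta>. gibbs_density \<omega> \<zeta> * g (patch unit_box \<omega> \<zeta>) \<partial>Poi \<partial>P)"
    if g: "g \<in> borel_measurable config_space" for g
  proof -
    note [measurable] = measurable_gibbs_density measurable_compose[OF measurable_patch_pair g]
    have "(\<integral>\<^sup>+ \<omega>. g \<omega> \<partial>N) = (\<integral>\<^sup>+ p. g (?w p) \<partial>density (P \<Otimes>\<^sub>M Poi) ?\<rho>)"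
      unfolding N_def by (rule nn_integral_distr[OF wm]) (use g in simp)
    also have "\<dots> = (\<integral>\<^sup>+ p. ?\<rho> p * g (?w p) \<partial>(P \<Otimes>\<^sub>M Poi))" by (rule nn_integral_density) measurable
    also have "\<dots> = (\<integral>\<^sup>+ \<omega>. \<integral>\<^sup>+ \<zeta>. ?\<rho> (\<omega>, \<zeta>) * g (?w (\<omega>, \<zeta>)) \<partial>Poi \<partial>P)"
      by (rule Pi.nn_integral_fst[symmetric]) measurable
    finally show ?thesis by simp
  qed
  have "P = N"
  proof (rule measure_eqI)
    show "sets P = sets N" by (simp add: N_def sets_P)
    fix A assume "A \<in> sets P"
    then have A: "A \<in> sets config_space" by (simp add: sets_P)
    have "emeasure N A = (\<integral>\<^sup>+ \<omega>. indicator A \<omega> \<partial>N)" using A by (simp add: N_def)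
    also have "\<dots> = (\<integral>\<^sup>+ \<omega>. \<integral>\<^sup>+ \<zeta>. gibbs_density \<omega> \<zeta> * indicator A (patch unit_box \<omega> \<zeta>) \<partial>Poi \<partial>P)"
      using A by (intro N) simp
    also have "\<dots> = (\<integral>\<^sup>+ \<omega>. gibbs_kernel \<phi> unit_box z \<omega> A \<partial>P)"
    proof (rule nn_integral_cong_AE, rule AE_mp[OF AE_good_boundary], intro AE_I2 impI)
      fix \<omega> assume "\<omega> \<in> space P" and w: "good_boundary \<omega>"
      then have wc: "\<omega> \<in> configurations" by (simp add: space_P)
      have km: "(\<lambda>\<zeta>. patch unit_box \<omega> \<zeta>) \<in> measurable Poi config_space"
        using wc by (intro measurable_patch measurable_const Pi.measurable_P_config unit_box_borel) simp
      note [measurable] = measurable_compose[OF km measurable_weight] measurable_compose[OF km borel_measurable_indicator[OF A]]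
      have "(\<integral>\<^sup>+ \<zeta>. gibbs_density \<omega> \<zeta> * indicator A (patch unit_box \<omega> \<zeta>) \<partial>Poi) = (\<integral>\<^sup>+ \<zeta>. (indicator A (patch unit_box \<omega> \<zeta>) * weight (patch unit_box \<omega> \<zeta>)) / Z \<omega> \<partial>Poi)"
        by (intro nn_integral_cong) (simp add: gibbs_density_def divide_ennreal_def ac_simps)
      also have "\<dots> = (\<integral>\<^sup>+ \<zeta>. indicator A (patch unit_box \<omega> \<zeta>) * weight (patch unit_box \<omega> \<zeta>) \<partial>Poi) / Z \<omega>"
        by (rule nn_integral_divide) measurable
      also have "\<dots> = gibbs_kernel \<phi> unit_box z \<omega> A" by (rule gibbs_kernel_eq[OF w A, symmetric])
      finally show "(\<integral>\<^sup>+ \<zeta>. gibbs_density \<omega> \<zeta> * indicator A (patch unit_box \<omega> \<zeta>) \<partial>Poi) = gibbs_kernel \<phi> unit_box z \<omega> A" .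
    qed
    also have "\<dots> = emeasure P A" by (rule dlr[OF unit_box(1) A, symmetric])
    finally show "emeasure P A = emeasure N A" by simp
  qed
  then show ?thesis using N[OF g] by metis
qed


section \<open>The insertion inequality and temperedness\<close>

definition degree :: "plane \<Rightarrow> plane set \<Rightarrow> ennreal" where
  "degree x U = (\<integral>\<^sup>+ \<nu>. of_bool (x \<in> \<nu>) \<partial>count_space (empty_disc_tiles (insert x U)))"

definition covering :: "plane \<Rightarrow> plane set \<Rightarrow> ennreal" where
  "covering x U = (\<integral>\<^sup>+ \<tau>. of_bool (x \<in> tile_disc \<tau>) \<partial>count_space (empty_disc_tiles U))"

text \<open>Chords from \<open>x\<close> to the configuration have length at least
  \<open>2 * r\<close>, so circles through \<open>x\<close> and a point of \<open>U\<close> have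
  radius at least \<open>r\<close>.\<close>

definition isolated :: "plane \<Rightarrow> plane set \<Rightarrow> bool" where
  "isolated x U \<longleftrightarrow> (\<forall>a\<in>U. 2 * r \<le> dist x a)"

lemma measurable_isolated:
  assumes \<kappa>: "\<kappa> \<in> measurable S config_space" and [measurable]: "g \<in> borel_measurable S"
  shows "Measurable.pred S (\<lambda>s. isolated (g s) (\<kappa> s))"
  unfolding isolated_def by (rule pred_points_all[OF \<kappa>]) measurable

lemma measurable_degree:
  assumes \<kappa>: "\<kappa> \<in> measurable S config_space" and g: "g \<in> borel_measurable S"
  shows "(\<lambda>s. degree (g s) (\<kappa> s)) \<in> borel_measurable S"
proof -
  note [measurable] = g
  have "Measurable.pred (S \<Otimes>\<^sub>M (borel \<Otimes>\<^sub>M centred_tile_space)) (\<lambda>p. g (fst p) - fst (snd p) \<in> snd (snd p))"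
    by (rule pred_point_in[OF measurable_compose[OF measurable_snd measurable_compose[OF measurable_snd measurable_centred_tile_config]]]) measurable
  then have [measurable]: "(\<lambda>p. of_bool (g (fst p) - fst (snd p) \<in> snd (snd p)) :: ennreal) \<in> borel_measurable (S \<Otimes>\<^sub>M (borel \<Otimes>\<^sub>M centred_tile_space))"
    by measurable
  have "(\<lambda>s. \<integral>\<^sup>+ \<tau>. of_bool (g s - tile_centre \<tau> \<in> shift (tile_centre \<tau>) \<tau>) \<partial>count_space (empty_disc_tiles (insert (g s) (\<kappa> s)))) \<in> borel_measurable S"
    by (rule nn_integral_tiles_measurable[OF measurable_config_insert[OF \<kappa> g]]) measurable
  then show ?thesis by (simp add: degree_def shift_eq)
qed

lemma measurable_covering:
  assumes \<kappa>: "\<kappa> \<in> measurable S config_space" and [measurable]: "g \<in> borel_measurable S"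
  shows "(\<lambda>s. covering (g s) (\<kappa> s)) \<in> borel_measurable S"
proof -
  note [measurable] = measurable_tile_radius
  have "(\<lambda>s. \<integral>\<^sup>+ \<tau>. of_bool (dist (tile_centre \<tau>) (g s) < tile_radius (shift (tile_centre \<tau>) \<tau>)) \<partial>count_space (empty_disc_tiles (\<kappa> s))) \<in> borel_measurable S"
    by (rule nn_integral_tiles_measurable[OF \<kappa>, where f="\<lambda>s c \<tau>. of_bool (dist c (g s) < tile_radius \<tau>)"]) measurable
  moreover have "covering (g s) (\<kappa> s) = (\<integral>\<^sup>+ \<tau>. of_bool (dist (tile_centre \<tau>) (g s) < tile_radius (shift (tile_centre \<tau>) \<tau>)) \<partial>count_space (empty_disc_tiles (\<kappa> s)))" for s
    unfolding covering_def by (intro nn_integral_cong) (auto simp: empty_disc_tiles_def shift_tile(3) tile_disc_def)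
  ultimately show ?thesis by simp
qed

lemma nn_integral_of_bool_card:
  assumes "finite B" "B = {x \<in> A. Q x}"
  shows "(\<integral>\<^sup>+ x. of_bool (Q x) \<partial>count_space A) = of_nat (card B)"
proof -
  have "(\<integral>\<^sup>+ x. of_bool (Q x) \<partial>count_space A) = (\<integral>\<^sup>+ x. indicator B x \<partial>count_space A)"
    using assms(2) by (intro nn_integral_cong) (auto split: split_indicator)
  also have "\<dots> = emeasure (count_space A) B" using assms(2) by (intro nn_integral_indicator) auto
  also have "\<dots> = of_nat (card B)" using assms by (intro emeasure_count_space_finite) auto
  finally show ?thesis .
qed

text \<open>Inserting an isolated point raises the energy by at most \<open>4 K\<close>, whatever the number of tiles
  it destroys, and it creates at least as many tiles as it destroys.\<close>

lemma weight_insert: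
  assumes w: "good_boundary \<omega>" and \<zeta>: "\<zeta> \<in> configurations"
    and nd: "nondegenerate_in unit_box (patch unit_box \<omega> \<zeta>)"
    and x: "x \<in> unit_box" "\<not> degenerate x (patch unit_box \<omega> \<zeta>)" "isolated x (patch unit_box \<omega> \<zeta>)"
  shows "ennreal (exp (- (4 * K))) * weight (patch unit_box \<omega> \<zeta>) \<le> weight (insert x (patch unit_box \<omega> \<zeta>))"
    and "covering x (patch unit_box \<omega> \<zeta>) \<le> degree x (patch unit_box \<omega> \<zeta>)"
proof -
  define U where "U = patch unit_box \<omega> \<zeta>"
  have gp: "general_position U" unfolding U_def by (rule patch_general_position[OF w \<zeta> nd])
  have conf: "U \<in> configurations" unfolding U_def using w \<zeta> by (intro patch_config) (auto simp: good_boundary_def)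
  interpret cavity U x
  proof
    show "U \<in> configurations" "general_position U" "\<not> degenerate x U" using conf gp x by (auto simp: U_def)
    fix a b :: plane assume "a \<noteq> b"
    moreover have "bounded unit_box" "\<omega> \<in> admissible" using unit_box(1) w by (auto simp: bounded_borel_def good_boundary_def)
    \<comment> \<open>The point is sought outside the box, so that it survives the patching.\<close>
    ultimately obtain p where "p \<in> \<omega>" "p \<notin> unit_box" "cross a b p > 0" using admissible_half_plane by blast
    then show "\<exists>p\<in>U. cross a b p > 0" by (auto simp: U_def patch_def)
  qed
  have gp': "general_position (insert x U)" by (rule general_position_insert[OF gp nd])
  have iU: "insert x U = patch unit_box \<omega> (insert x \<zeta>)" unfolding U_def by (rule patch_insert[OF x(1), symmetric])
  have fin: "finite (hit_tiles U)" unfolding U_def by (rule hit_tiles_finite[OF w \<zeta> gp[unfolded U_def]])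
  have fin': "finite (hit_tiles (insert x U))"
    unfolding iU by (rule hit_tiles_finite[OF w config_insert[OF \<zeta>] gp'[unfolded iU]])
  have rsub: "removed \<subseteq> hit_tiles U" using x(1) by (auto simp: removed_def hit_tiles_def)
  then have fr: "finite removed" using fin by (rule finite_subset)
  have nsub: "new \<subseteq> hit_tiles (insert x U)"
  proof
    fix \<nu> assume n: "\<nu> \<in> new"
    then have t: "tile \<nu>" "x \<in> \<nu>" by (auto simp: new_def empty_disc_tiles_def)
    have "x \<in> cball (tile_centre \<nu>) (tile_radius \<nu>)" using tile_on_circle[OF t(1)] t(2) by auto
    then have "x \<in> closure (tile_disc \<nu>)" using tile_radius_pos[OF t(1)] by (simp add: tile_disc_def closure_ball)
    \<comment> \<open>The vertex \<open>x\<close> is only on the boundary of the disc; openness of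
      the box ensures that they meet.\<close>
    then have "unit_box \<inter> tile_disc \<nu> \<noteq> {}" using open_Int_closure_eq_empty[OF unit_box(2), of "tile_disc \<nu>"] x(1) by blast
    then show "\<nu> \<in> hit_tiles (insert x U)" using n by (auto simp: new_def hit_tiles_def)
  qed
  \<comment> \<open>A tile without vertex \<open>x\<close> keeps its empty disc iff \<open>x\<close>
    is not in the disc. Hence the energy changes exactly by that of \<open>new\<close> minus that of
    \<open>removed\<close>.\<close>
  have split: "hit_tiles (insert x U) = (hit_tiles U - removed) \<union> new"
  proof (intro equalityI subsetI)
    fix \<tau> assume t: "\<tau> \<in> hit_tiles (insert x U)"
    show "\<tau> \<in> (hit_tiles U - removed) \<union> new"
    proof (cases "x \<in> \<tau>")
      case True then show ?thesis using t by (auto simp: new_def hit_tiles_def)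
    next
      case False then show ?thesis using t by (auto simp: hit_tiles_def empty_disc_tiles_def removed_def)
    qed
  next
    fix \<tau> assume "\<tau> \<in> (hit_tiles U - removed) \<union> new"
    then show "\<tau> \<in> hit_tiles (insert x U)"
      using nsub by (auto simp: hit_tiles_def empty_disc_tiles_def removed_def)
  qed
  have disj: "(hit_tiles U - removed) \<inter> new = {}"
    using x_notin by (auto simp: hit_tiles_def new_def empty_disc_tiles_def)
  have fnew: "finite new" using nsub fin' by (rule finite_subset)
  have far: "2 * r \<le> dist x a" if "a \<in> U" for a using x(3) that by (simp add: isolated_def U_def)
  \<comment> \<open>A vertex and a point of the open disc have distance less than twice the
    radius.\<close>
  have large: "r \<le> tile_radius \<tau>" if "\<tau> \<in> removed" for \<tau>
  proof -
    have t: "tile \<tau>" "\<tau> \<subseteq> U" "x \<in> tile_disc \<tau>" using that by (auto simp: removed_def empty_disc_tiles_def)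
    have "\<tau> \<noteq> {}" using t(1) by (auto simp: tile_def)
    then obtain a where a: "a \<in> \<tau>" by auto
    have "dist (tile_centre \<tau>) a = tile_radius \<tau>" using tile_on_circle[OF t(1)] a by auto
    moreover have "dist (tile_centre \<tau>) x < tile_radius \<tau>" using t(3) by (simp add: tile_disc_def)
    moreover have "2 * r \<le> dist x a" using far a t(2) by auto
    moreover have "dist x a \<le> dist (tile_centre \<tau>) x + dist (tile_centre \<tau>) a" by (rule dist_triangle3)
    ultimately show ?thesis by linarith
  qed
  have largen: "r \<le> tile_radius \<nu>" if "\<nu> \<in> new" for \<nu>
  proof -
    have t: "tile \<nu>" "x \<in> \<nu>" "\<nu> \<subseteq> insert x U" using that by (auto simp: new_def empty_disc_tiles_def)
    have "\<nu> \<noteq> {x}" using t(1) by (auto simp: tile_def)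
    then obtain a where a: "a \<in> \<nu>" "a \<in> U" using t by auto
    show ?thesis using dist_le_tile_diameter[OF t(1,2) a(1)] far[OF a(2)] by linarith
  qed
  have bnd: "\<bar>\<psi> (tile_radius \<tau>)\<bar> \<le> K" if "tile \<tau>" "r \<le> tile_radius \<tau>" for \<tau>
    using r(3)[OF that] K(2)[OF centred_tile_shift[OF that(1)]] by (simp add: tile_energy_def)
  have e1: "(\<Sum>\<tau>\<in>removed. tile_energy \<phi> \<tau>) = (\<Sum>\<tau>\<in>removed. \<psi> (tile_radius \<tau>))"
    using large r(3) by (intro sum.cong) (auto simp: removed_def empty_disc_tiles_def)
  have e2: "(\<Sum>\<tau>\<in>new. tile_energy \<phi> \<tau>) = (\<Sum>\<tau>\<in>new. \<psi> (tile_radius \<tau>))"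
    using largen r(3) by (intro sum.cong) (auto simp: new_def empty_disc_tiles_def)
  have "(\<Sum>\<tau>\<in>hit_tiles (insert x U). tile_energy \<phi> \<tau>) = (\<Sum>\<tau>\<in>hit_tiles U - removed. tile_energy \<phi> \<tau>) + (\<Sum>\<tau>\<in>new. tile_energy \<phi> \<tau>)"
    unfolding split by (rule sum.union_disjoint) (use fin fnew disj in auto)
  also have "(\<Sum>\<tau>\<in>hit_tiles U - removed. tile_energy \<phi> \<tau>) = (\<Sum>\<tau>\<in>hit_tiles U. tile_energy \<phi> \<tau>) - (\<Sum>\<tau>\<in>removed. tile_energy \<phi> \<tau>)"
    by (rule sum_diff[OF fin rsub])
  finally have "(\<Sum>\<tau>\<in>hit_tiles (insert x U). tile_energy \<phi> \<tau>) \<le> (\<Sum>\<tau>\<in>hit_tiles U. tile_energy \<phi> \<tau>) + 4 * K"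
    using cavity_energy[OF fr r(2) far large bnd K(1)] e1 e2 by linarith
  then have "exp (- (4 * K)) * exp (- (\<Sum>\<tau>\<in>hit_tiles U. tile_energy \<phi> \<tau>)) \<le> exp (- (\<Sum>\<tau>\<in>hit_tiles (insert x U). tile_energy \<phi> \<tau>))"
    by (simp add: exp_add[symmetric])
  then show "ennreal (exp (- (4 * K))) * weight (patch unit_box \<omega> \<zeta>) \<le> weight (insert x (patch unit_box \<omega> \<zeta>))"
    unfolding U_def[symmetric] weight_eq[OF fin] weight_eq[OF fin'] by (simp add: ennreal_mult'[symmetric])
  have "covering x U = of_nat (card removed)"
    unfolding covering_def by (rule nn_integral_of_bool_card[OF fr]) (auto simp: removed_def)
  moreover have "degree x U = of_nat (card new)"
    unfolding degree_def by (rule nn_integral_of_bool_card[OF fnew]) (auto simp: new_def)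
  ultimately show "covering x (patch unit_box \<omega> \<zeta>) \<le> degree x (patch unit_box \<omega> \<zeta>)"
    using cavity_card[OF fr] by (simp add: U_def[symmetric])
qed

text \<open>The Gibbs equation expresses both sides by the Poisson process in the box. There the
  Mecke formula turns the sum over points on the right into \<open>z\<close> times an integral over
  an inserted point, and the integrands are compared by \<open>weight_insert\<close>.\<close>

lemma insertion_inequality:
  "ennreal (z * exp (- (4 * K))) *
     (\<integral>\<^sup>+ \<omega>. \<integral>\<^sup>+ x. indicator unit_box x * (covering x \<omega> * of_bool (isolated x \<omega>)) \<partial>lborel \<partial>P) \<le>
   (\<integral>\<^sup>+ \<omega>. \<integral>\<^sup>+ x. indicator unit_box x * (degree x (\<omega> - {x}) * of_bool (isolated x (\<omega> - {x}))) \<partial>count_space \<omega> \<partial>P)"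
proof -
  define F where "F x U = degree x U * of_bool (isolated x U)" for x U
  define F' where "F' x U = covering x U * of_bool (isolated x U)" for x U
  have Fm: "(\<lambda>s. F (g s) (\<kappa> s)) \<in> borel_measurable S" "(\<lambda>s. F' (g s) (\<kappa> s)) \<in> borel_measurable S"
    if "\<kappa> \<in> measurable S config_space" "g \<in> borel_measurable S" for g \<kappa> and S :: "'s measure"
  proof -
    note [measurable] = measurable_degree[OF that] measurable_covering[OF that] measurable_isolated[OF that]
    show "(\<lambda>s. F (g s) (\<kappa> s)) \<in> borel_measurable S" "(\<lambda>s. F' (g s) (\<kappa> s)) \<in> borel_measurable S"
      unfolding F_def F'_def by measurable
  qed
  have idm: "(\<lambda>U. U) \<in> measurable config_space config_space" by simp
  define g where "g \<omega> = (\<integral>\<^sup>+ x. indicator unit_box x * F x (\<omega> - {x}) \<partial>count_space \<omega>)" for \<omega>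
  define g' where "g' \<omega> = (\<integral>\<^sup>+ x. indicator unit_box x * F' x \<omega> \<partial>lborel)" for \<omega>
  have gm: "g \<in> borel_measurable config_space"
  proof -
    have [measurable]: "(\<lambda>p. F (snd p) (fst p - {snd p})) \<in> borel_measurable (config_space \<Otimes>\<^sub>M borel)"
      by (rule Fm(1)[OF measurable_config_remove[OF measurable_fst measurable_snd] measurable_snd])
    show ?thesis unfolding g_def by (rule nn_integral_points_measurable'[OF idm]) measurable
  qed
  have gm': "g' \<in> borel_measurable config_space"
  proof -
    have [measurable]: "(\<lambda>p. F' (snd p) (fst p)) \<in> borel_measurable (config_space \<Otimes>\<^sub>M lborel)"
      by (rule Fm(2)[OF measurable_fst]) simp
    show ?thesis unfolding g'_def by measurable
  qed
  have key: "ennreal (z * exp (- (4 * K))) * (\<integral>\<^sup>+ \<zeta>. gibbs_density \<omega> \<zeta> * g' (patch unit_box \<omega> \<zeta>) \<partial>Poi)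
      \<le> (\<integral>\<^sup>+ \<zeta>. gibbs_density \<omega> \<zeta> * g (patch unit_box \<omega> \<zeta>) \<partial>Poi)" if w: "good_boundary \<omega>" for \<omega>
  proof -
    have wc: "\<omega> \<in> configurations" using w by (simp add: good_boundary_def)
    interpret LP: pair_sigma_finite lborel Poi by unfold_locales
    let ?p = "patch unit_box \<omega>"
    have km: "?p \<in> measurable Poi config_space" "?p \<in> measurable config_space config_space"
      using wc measurable_patch[OF measurable_const[of \<omega>] Pi.measurable_P_config unit_box_borel]
        measurable_patch[OF measurable_const[of \<omega>] idm unit_box_borel] by auto
    \<comment> \<open>The Mecke formula evaluates \<open>G\<close> at the configuration without
      \<open>x\<close>, while the Gibbs density concerns the one with \<open>x\<close>; hence the
      weight contains \<open>insert x\<close>.\<close>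
    define G where "G = (\<lambda>(x, \<zeta>). F x (?p \<zeta>) * (weight (insert x (?p \<zeta>)) / Z \<omega>))"
    have kp: "(\<lambda>q. ?p (snd q)) \<in> measurable (borel \<Otimes>\<^sub>M config_space) config_space"
      by (rule measurable_compose[OF measurable_snd km(2)])
    have G: "G \<in> borel_measurable (borel \<Otimes>\<^sub>M config_space)"
    proof -
      note [measurable] = Fm(1)[OF kp measurable_fst] measurable_compose[OF measurable_config_insert[OF kp measurable_fst] measurable_weight]
      show ?thesis unfolding G_def case_prod_beta by measurable
    qed
    have G': "(\<lambda>q. indicator unit_box (fst q) * G q) \<in> borel_measurable (lborel \<Otimes>\<^sub>M Poi)"
    proof -
      have [measurable]: "G \<in> borel_measurable (lborel \<Otimes>\<^sub>M Poi)"
        using G by (simp add: measurable_cong_sets[OF sets_pair_measure_cong[OF sets_lborel Pi.sets_P] refl])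
      show ?thesis by measurable
    qed
    have "(\<integral>\<^sup>+ \<zeta>. gibbs_density \<omega> \<zeta> * g (?p \<zeta>) \<partial>Poi) = (\<integral>\<^sup>+ \<zeta>. \<integral>\<^sup>+ x. G (x, \<zeta> - {x}) * indicator unit_box x \<partial>count_space \<zeta> \<partial>Poi)"
    proof (intro nn_integral_cong)
      fix \<zeta>
      have "gibbs_density \<omega> \<zeta> * g (?p \<zeta>) = (\<integral>\<^sup>+ x. gibbs_density \<omega> \<zeta> * (indicator unit_box x * F x (?p \<zeta> - {x})) \<partial>count_space (?p \<zeta>))"
        unfolding g_def by (rule nn_integral_cmult[symmetric]) simp
      also have "\<dots> = (\<integral>\<^sup>+ x. gibbs_density \<omega> \<zeta> * (indicator unit_box x * F x (?p \<zeta> - {x})) * indicator (?p \<zeta>) x \<partial>count_space UNIV)"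
        by (simp add: nn_integral_count_space_indicator)
      also have "\<dots> = (\<integral>\<^sup>+ x. G (x, \<zeta> - {x}) * indicator unit_box x * indicator \<zeta> x \<partial>count_space UNIV)"
      proof (intro nn_integral_cong)
        fix x
        show "gibbs_density \<omega> \<zeta> * (indicator unit_box x * F x (?p \<zeta> - {x})) * indicator (?p \<zeta>) x = G (x, \<zeta> - {x}) * indicator unit_box x * indicator \<zeta> x"
        proof (cases "x \<in> unit_box \<and> x \<in> \<zeta>")
          case True
          then have "x \<in> ?p \<zeta>" by (simp add: patch_def)
          then have "insert x (?p \<zeta> - {x}) = ?p \<zeta>" by auto
          then show ?thesis using True patch_remove[of x unit_box \<omega> \<zeta>] \<open>x \<in> ?p \<zeta>\<close>
            by (simp add: G_def gibbs_density_def mult.commute)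
        next
          case False
          then show ?thesis by (auto simp: patch_def split: split_indicator)
        qed
      qed
      also have "\<dots> = (\<integral>\<^sup>+ x. G (x, \<zeta> - {x}) * indicator unit_box x \<partial>count_space \<zeta>)"
        by (simp add: nn_integral_count_space_indicator)
      finally show "gibbs_density \<omega> \<zeta> * g (?p \<zeta>) = (\<integral>\<^sup>+ x. G (x, \<zeta> - {x}) * indicator unit_box x \<partial>count_space \<zeta>)" .
    qed
    also have "\<dots> = ennreal z * (\<integral>\<^sup>+ x. indicator unit_box x * (\<integral>\<^sup>+ \<zeta>. G (x, \<zeta>) \<partial>Poi) \<partial>lborel)"
      by (rule Pi.mecke[OF unit_box(1) G])
    also have "(\<integral>\<^sup>+ x. indicator unit_box x * (\<integral>\<^sup>+ \<zeta>. G (x, \<zeta>) \<partial>Poi) \<partial>lborel) = (\<integral>\<^sup>+ x. \<integral>\<^sup>+ \<zeta>. indicator unit_box x * G (x, \<zeta>) \<partial>Poi \<partial>lborel)"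
    proof (intro nn_integral_cong)
      fix x
      have "(\<lambda>\<zeta>. G (x, \<zeta>)) \<in> borel_measurable Poi"
        using measurable_compose[OF measurable_Pair1'[of x borel config_space] G] by (simp add: Pi.measurable_P_eq)
      then show "indicator unit_box x * (\<integral>\<^sup>+ \<zeta>. G (x, \<zeta>) \<partial>Poi) = (\<integral>\<^sup>+ \<zeta>. indicator unit_box x * G (x, \<zeta>) \<partial>Poi)"
        by (simp add: nn_integral_cmult)
    qed
    also have "\<dots> = (\<integral>\<^sup>+ \<zeta>. \<integral>\<^sup>+ x. indicator unit_box x * G (x, \<zeta>) \<partial>lborel \<partial>Poi)"
      using G' by (intro LP.Fubini'[symmetric]) (simp add: case_prod_beta')
    finally have eq: "(\<integral>\<^sup>+ \<zeta>. gibbs_density \<omega> \<zeta> * g (?p \<zeta>) \<partial>Poi) = ennreal z * (\<integral>\<^sup>+ \<zeta>. \<integral>\<^sup>+ x. indicator unit_box x * G (x, \<zeta>) \<partial>lborel \<partial>Poi)" .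
    have "ennreal (exp (- (4 * K))) * (\<integral>\<^sup>+ \<zeta>. gibbs_density \<omega> \<zeta> * g' (?p \<zeta>) \<partial>Poi) = (\<integral>\<^sup>+ \<zeta>. ennreal (exp (- (4 * K))) * (gibbs_density \<omega> \<zeta> * g' (?p \<zeta>)) \<partial>Poi)"
    proof (rule nn_integral_cmult[symmetric])
      note [measurable] = measurable_compose[OF km(1) measurable_weight] measurable_compose[OF km(1) gm']
      show "(\<lambda>\<zeta>. gibbs_density \<omega> \<zeta> * g' (?p \<zeta>)) \<in> borel_measurable Poi"
        unfolding gibbs_density_def by measurable
    qed
    also have "\<dots> \<le> (\<integral>\<^sup>+ \<zeta>. \<integral>\<^sup>+ x. indicator unit_box x * G (x, \<zeta>) \<partial>lborel \<partial>Poi)"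
    proof (rule nn_integral_mono_AE, rule AE_mp[OF Pi.AE_nondegenerate_patch[OF wc unit_box(1)]], intro AE_I2 impI)
      fix \<zeta> assume "\<zeta> \<in> space Poi" and nd: "nondegenerate_in unit_box (?p \<zeta>)"
      then have \<zeta>: "\<zeta> \<in> configurations" by (simp add: Pi.space_P)
      have pc: "?p \<zeta> \<in> configurations" by (rule patch_config[OF wc \<zeta>])
      have [measurable]: "(\<lambda>x. F' x (?p \<zeta>)) \<in> borel_measurable lborel"
        using pc by (intro Fm(2) measurable_const) auto
      have "ennreal (exp (- (4 * K))) * (gibbs_density \<omega> \<zeta> * g' (?p \<zeta>)) = (\<integral>\<^sup>+ x. ennreal (exp (- (4 * K))) * gibbs_density \<omega> \<zeta> * (indicator unit_box x * F' x (?p \<zeta>)) \<partial>lborel)"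
        unfolding g'_def by (subst nn_integral_cmult) (auto simp: mult.assoc)
      also have "\<dots> \<le> (\<integral>\<^sup>+ x. indicator unit_box x * G (x, \<zeta>) \<partial>lborel)"
      \<comment> \<open>Almost every \<open>x\<close> is nondegenerate for the fixed patched
        configuration, as \<open>weight_insert\<close> requires.\<close>
      proof (rule nn_integral_mono_AE, rule AE_mp[OF AE_not_degenerate[OF pc]], intro AE_I2 impI)
        fix x assume x: "\<not> degenerate x (?p \<zeta>)"
        show "ennreal (exp (- (4 * K))) * gibbs_density \<omega> \<zeta> * (indicator unit_box x * F' x (?p \<zeta>)) \<le> indicator unit_box x * G (x, \<zeta>)"
        proof (cases "x \<in> unit_box \<and> isolated x (?p \<zeta>)")
          case True
          note wi = weight_insert[OF w \<zeta> nd _ x]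
          have "ennreal (exp (- (4 * K))) * weight (?p \<zeta>) * covering x (?p \<zeta>) \<le> weight (insert x (?p \<zeta>)) * degree x (?p \<zeta>)"
            using wi True by (intro mult_mono) auto
          \<comment> \<open>Multiplication by the inverse in \<open>ennreal\<close> is monotone
            whatever the value of \<open>Z \<omega>\<close>.\<close>
          then have "ennreal (exp (- (4 * K))) * weight (?p \<zeta>) * covering x (?p \<zeta>) * inverse (Z \<omega>) \<le> weight (insert x (?p \<zeta>)) * degree x (?p \<zeta>) * inverse (Z \<omega>)"
            by (rule mult_right_mono) simp
          then show ?thesis using True
            by (simp add: G_def F_def F'_def gibbs_density_def divide_ennreal_def ac_simps)
        next
          case False
          then show ?thesis by (auto simp: F'_def split: split_indicator)
        qed
      qed
      finally show "ennreal (exp (- (4 * K))) * (gibbs_density \<omega> \<zeta> * g' (?p \<zeta>)) \<le> (\<integral>\<^sup>+ x. indicator unit_box x * G (x, \<zeta>) \<partial>lborel)" .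
    qed
    finally have "ennreal z * (ennreal (exp (- (4 * K))) * (\<integral>\<^sup>+ \<zeta>. gibbs_density \<omega> \<zeta> * g' (?p \<zeta>) \<partial>Poi)) \<le> ennreal z * (\<integral>\<^sup>+ \<zeta>. \<integral>\<^sup>+ x. indicator unit_box x * G (x, \<zeta>) \<partial>lborel \<partial>Poi)"
      by (rule mult_left_mono) simp
    then show ?thesis unfolding eq using z by (simp add: ennreal_mult mult.assoc)
  qed
  have "ennreal (z * exp (- (4 * K))) * (\<integral>\<^sup>+ \<omega>. g' \<omega> \<partial>P) = (\<integral>\<^sup>+ \<omega>. ennreal (z * exp (- (4 * K))) * (\<integral>\<^sup>+ \<zeta>. gibbs_density \<omega> \<zeta> * g' (patch unit_box \<omega> \<zeta>) \<partial>Poi) \<partial>P)"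
  proof -
    note [measurable] = measurable_gibbs_density measurable_compose[OF measurable_patch_pair gm']
    have "(\<lambda>\<omega>. \<integral>\<^sup>+ \<zeta>. gibbs_density \<omega> \<zeta> * g' (patch unit_box \<omega> \<zeta>) \<partial>Poi) \<in> borel_measurable P"
      by (rule Pi.borel_measurable_nn_integral) (unfold case_prod_beta, measurable)
    then show ?thesis unfolding dlr_nn_integral[OF gm'] by (rule nn_integral_cmult[symmetric])
  qed
  also have "\<dots> \<le> (\<integral>\<^sup>+ \<omega>. \<integral>\<^sup>+ \<zeta>. gibbs_density \<omega> \<zeta> * g (patch unit_box \<omega> \<zeta>) \<partial>Poi \<partial>P)"
    by (rule nn_integral_mono_AE) (rule AE_mp[OF AE_good_boundary], simp add: key)
  also have "\<dots> = (\<integral>\<^sup>+ \<omega>. g \<omega> \<partial>P)" by (rule dlr_nn_integral[OF gm, symmetric])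
  finally show ?thesis unfolding g_def g'_def F_def F'_def .
qed

text \<open>The expected number of tiles at the points in the box is, by
  \<open>vertex_transport\<close> with the constant 1, three times the tile intensity: each tile has
  three vertices.\<close>

lemma covering_finite:
  "(\<integral>\<^sup>+ \<omega>. \<integral>\<^sup>+ x. indicator unit_box x * (covering x \<omega> * of_bool (isolated x \<omega>)) \<partial>lborel \<partial>P) < \<infinity>"
proof -
  have "(\<integral>\<^sup>+ \<omega>. \<integral>\<^sup>+ x. indicator unit_box x * (degree x (\<omega> - {x}) * of_bool (isolated x (\<omega> - {x}))) \<partial>count_space \<omega> \<partial>P)
     \<le> (\<integral>\<^sup>+ \<omega>. \<integral>\<^sup>+ v. indicator unit_box v * (\<integral>\<^sup>+ \<tau>. of_bool (v \<in> \<tau>) * 1 \<partial>count_space (empty_disc_tiles \<omega>)) \<partial>count_space \<omega> \<partial>P)"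
  proof (intro nn_integral_mono mult_left_mono)
    fix \<omega> and x :: plane assume "x \<in> space (count_space \<omega>)"
    then have "insert x (\<omega> - {x}) = \<omega>" by auto
    then show "degree x (\<omega> - {x}) * of_bool (isolated x (\<omega> - {x})) \<le> (\<integral>\<^sup>+ \<tau>. of_bool (x \<in> \<tau>) * 1 \<partial>count_space (empty_disc_tiles \<omega>))"
      by (simp add: degree_def)
  qed simp
  also have "\<dots> = tile_sum (\<lambda>c \<tau>. indicator unit_box c * (\<integral>\<^sup>+ v. 1 \<partial>count_space \<tau>))"
    by (rule vertex_transport[symmetric]) auto
  also have "\<dots> = tile_sum (\<lambda>c \<tau>. 3 * indicator unit_box c)"
  proof (rule tile_sum_cong)
    fix c \<tau> assume "\<tau> \<in> centred_tiles"
    then have "finite \<tau>" "card \<tau> = 3" using finite_tile by (auto simp: centred_tiles_def tile_def)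
    then show "indicator unit_box c * (\<integral>\<^sup>+ v. 1 \<partial>count_space \<tau>) = (3 * indicator unit_box c :: ennreal)"
      by (simp add: emeasure_count_space_finite mult.commute)
  qed
  also have "\<dots> = 3 * tile_sum (\<lambda>c \<tau>. indicator unit_box c)" by (rule tile_sum_cmult) measurable
  also have "\<dots> < \<infinity>" using tile_intensity_finite by (simp add: ennreal_mult_less_top)
  finally have "ennreal (z * exp (- (4 * K))) * (\<integral>\<^sup>+ \<omega>. \<integral>\<^sup>+ x. indicator unit_box x * (covering x \<omega> * of_bool (isolated x \<omega>)) \<partial>lborel \<partial>P) < \<infinity>"
    using insertion_inequality by (rule order.strict_trans1[rotated])
  then show ?thesis using z by (auto simp: ennreal_mult_less_top)
qed

text \<open>If \<open>x\<close> is closer to the centre of an empty disc than its radius minus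
  \<open>2 * r\<close>, then \<open>x\<close> is in the disc and every point of the configuration
  has distance at least \<open>2 * r\<close> from it, so the pair is counted by
  \<open>covering\<close> at an isolated point. Mass transport converts the number of covering discs
  into an area.\<close>

lemma shrunk_discs_finite:
  "tile_sum (\<lambda>c \<tau>. indicator unit_box c * emeasure lborel (ball (0::plane) (tile_radius \<tau> - 2 * r))) < \<infinity>"
proof -
  \<comment> \<open>The area of the part of the box covered by the shrunk disc around
    \<open>y\<close>. Integrated over all \<open>y\<close> it is the full area of the shrunk disc,
    as the box has area 1.\<close>
  define f where "f y \<tau> = (\<integral>\<^sup>+ x. indicator unit_box x * of_bool (dist x y < tile_radius \<tau> - 2 * r) \<partial>(lborel :: plane measure))" for y \<tau>
  note [measurable] = measurable_tile_radius
  have f: "case_prod f \<in> borel_measurable (borel \<Otimes>\<^sub>M centred_tile_space)"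
    unfolding f_def case_prod_beta by measurable
  have "tile_sum (\<lambda>c \<tau>. indicator unit_box c * emeasure lborel (ball (0::plane) (tile_radius \<tau> - 2 * r))) = tile_sum (\<lambda>c \<tau>. indicator unit_box c * (\<integral>\<^sup>+ y. f y \<tau> \<partial>lborel))"
  proof (rule tile_sum_cong, rule arg_cong[where f="(*) _"])
    fix \<tau>
    let ?s = "tile_radius \<tau> - 2 * r"
    have "(\<integral>\<^sup>+ y. f y \<tau> \<partial>lborel) = (\<integral>\<^sup>+ x. \<integral>\<^sup>+ y. indicator unit_box x * of_bool (dist x y < ?s) \<partial>lborel \<partial>(lborel :: plane measure))"
      unfolding f_def by (rule lborel_pair.Fubini') measurable
    also have "\<dots> = (\<integral>\<^sup>+ x. indicator unit_box x * emeasure lborel (ball (0::plane) ?s) \<partial>(lborel :: plane measure))"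
    proof (intro nn_integral_cong)
      fix x :: plane
      have "(\<integral>\<^sup>+ y. indicator unit_box x * of_bool (dist x y < ?s) \<partial>lborel) = indicator unit_box x * (\<integral>\<^sup>+ y. of_bool (dist x y < ?s) \<partial>lborel)"
        by (rule nn_integral_cmult) measurable
      also have "(\<integral>\<^sup>+ y. of_bool (dist x y < ?s) \<partial>lborel) = (\<integral>\<^sup>+ y. indicator (ball 0 ?s) (x - y) \<partial>(lborel :: plane measure))"
        by (intro nn_integral_cong) (auto simp: dist_norm norm_minus_commute indicator_def)
      also have "\<dots> = (\<integral>\<^sup>+ y. indicator (ball 0 ?s) y \<partial>(lborel :: plane measure))" by (rule nn_integral_lborel_translate(2)[OF borel_measurable_indicator]) simp
      finally show "(\<integral>\<^sup>+ y. indicator unit_box x * of_bool (dist x y < ?s) \<partial>lborel) = indicator unit_box x * emeasure lborel (ball (0::plane) ?s)" by simp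
    qed
    also have "\<dots> = emeasure lborel (ball (0::plane) ?s)" using unit_box(4) by (simp add: nn_integral_multc)
    finally show "emeasure lborel (ball (0::plane) ?s) = (\<integral>\<^sup>+ y. f y \<tau> \<partial>lborel)" by simp
  qed
  also have "\<dots> = tile_sum f" by (rule mass_transport(1)[OF f, symmetric])
  also have "\<dots> \<le> (\<integral>\<^sup>+ \<omega>. \<integral>\<^sup>+ x. indicator unit_box x * (covering x \<omega> * of_bool (isolated x \<omega>)) \<partial>lborel \<partial>P)"
    unfolding tile_sum_def
  proof (intro nn_integral_mono)
    fix \<omega> assume "\<omega> \<in> space P"
    then have c: "countable (empty_disc_tiles \<omega>)" by (intro countable_empty_disc_tiles) (simp add: space_P)
    have "(\<integral>\<^sup>+ \<tau>. f (tile_centre \<tau>) (shift (tile_centre \<tau>) \<tau>) \<partial>count_space (empty_disc_tiles \<omega>)) =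
      (\<integral>\<^sup>+ x. \<integral>\<^sup>+ \<tau>. indicator unit_box x * of_bool (dist x (tile_centre \<tau>) < tile_radius (shift (tile_centre \<tau>) \<tau>) - 2 * r) \<partial>count_space (empty_disc_tiles \<omega>) \<partial>lborel)"
      unfolding f_def by (rule nn_integral_count_space_nn_integral[OF c, symmetric]) measurable
    also have "\<dots> \<le> (\<integral>\<^sup>+ x. indicator unit_box x * (covering x \<omega> * of_bool (isolated x \<omega>)) \<partial>lborel)"
    proof (intro nn_integral_mono)
      fix x :: plane
      have tr: "tile_radius (shift (tile_centre \<tau>) \<tau>) = tile_radius \<tau>" if "\<tau> \<in> empty_disc_tiles \<omega>" for \<tau>
        using that by (simp add: empty_disc_tiles_def shift_tile(3))
      have "(\<integral>\<^sup>+ \<tau>. indicator unit_box x * of_bool (dist x (tile_centre \<tau>) < tile_radius (shift (tile_centre \<tau>) \<tau>) - 2 * r) \<partial>count_space (empty_disc_tiles \<omega>)) \<le>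
        (\<integral>\<^sup>+ \<tau>. (indicator unit_box x * of_bool (isolated x \<omega>)) * of_bool (x \<in> tile_disc \<tau>) \<partial>count_space (empty_disc_tiles \<omega>))"
      proof (rule nn_integral_mono)
        fix \<tau> assume "\<tau> \<in> space (count_space (empty_disc_tiles \<omega>))"
        then have t: "\<tau> \<in> empty_disc_tiles \<omega>" by simp
        have iso: "isolated x \<omega>" "x \<in> tile_disc \<tau>" if d: "dist x (tile_centre \<tau>) < tile_radius \<tau> - 2 * r"
        proof -
          show "x \<in> tile_disc \<tau>" using d r(1) by (simp add: tile_disc_def dist_commute)
          show "isolated x \<omega>" unfolding isolated_def
          proof
            fix a assume "a \<in> \<omega>"
            then have "a \<notin> tile_disc \<tau>" using t by (auto simp: empty_disc_tiles_def)
            then have "tile_radius \<tau> \<le> dist (tile_centre \<tau>) a" by (simp add: tile_disc_def)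
            also have "\<dots> \<le> dist x (tile_centre \<tau>) + dist x a" by (rule dist_triangle3)
            finally show "2 * r \<le> dist x a" using d by linarith
          qed
        qed
        then show "indicator unit_box x * of_bool (dist x (tile_centre \<tau>) < tile_radius (shift (tile_centre \<tau>) \<tau>) - 2 * r) \<le>
          ((indicator unit_box x * of_bool (isolated x \<omega>)) * of_bool (x \<in> tile_disc \<tau>) :: ennreal)"
          unfolding tr[OF t] by (cases "dist x (tile_centre \<tau>) < tile_radius \<tau> - 2 * r") auto
      qed
      also have "\<dots> = (indicator unit_box x * of_bool (isolated x \<omega>)) * covering x \<omega>"
        unfolding covering_def by (rule nn_integral_cmult) simp
      finally show "(\<integral>\<^sup>+ \<tau>. indicator unit_box x * of_bool (dist x (tile_centre \<tau>) < tile_radius (shift (tile_centre \<tau>) \<tau>) - 2 * r) \<partial>count_space (empty_disc_tiles \<omega>)) \<le>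
        indicator unit_box x * (covering x \<omega> * of_bool (isolated x \<omega>))" by (simp add: ac_simps)
    qed
    finally show "(\<integral>\<^sup>+ \<tau>. f (tile_centre \<tau>) (shift (tile_centre \<tau>) \<tau>) \<partial>count_space (empty_disc_tiles \<omega>)) \<le>
      (\<integral>\<^sup>+ x. indicator unit_box x * (covering x \<omega> * of_bool (isolated x \<omega>)) \<partial>lborel)" .
  qed
  also have "\<dots> < \<infinity>" by (rule covering_finite)
  finally show ?thesis .
qed

lemma emeasure_disc: "0 \<le> s \<Longrightarrow> emeasure lborel (ball (c::plane) s) = ennreal (unit_ball_vol 2 * s\<^sup>2)"
  using emeasure_ball[of s c] by simp

text \<open>The area of a disc of radius s is at most that of radius 4 r plus four times that of
  radius s - 2 r: beyond 4 r, s is at most 2 (s - 2 r). The first term is handled by the tile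
  intensity, the second by \<open>shrunk_discs_finite\<close>.\<close>

lemma tempered: "tempered P"
proof -
  note [measurable] = measurable_tile_radius
  define V where "V = unit_ball_vol 2"
  have V: "V \<ge> 0" by (simp add: V_def)
  have disc: "emeasure lborel (tile_disc \<tau>) = ennreal (V * (tile_radius \<tau>)\<^sup>2)" if "\<tau> \<in> centred_tiles" for \<tau>
    using that tile_radius_pos[of \<tau>] by (auto simp: centred_tiles_def tile_disc_def emeasure_disc V_def)
  have "(\<integral>\<^sup>+ \<tau>. emeasure lborel (tile_disc \<tau>) \<partial>tile_distribution P) = (\<integral>\<^sup>+ \<tau>. ennreal (V * (tile_radius \<tau>)\<^sup>2) \<partial>tile_measure)"
    unfolding tile_distribution_eq by (intro nn_integral_cong) (simp add: disc space_tile_measure)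
  also have "\<dots> = tile_sum (\<lambda>c \<tau>. indicator unit_box c * ennreal (V * (tile_radius \<tau>)\<^sup>2))"
    by (rule nn_integral_tile_measure) measurable
  also have "\<dots> \<le> tile_sum (\<lambda>c \<tau>. ennreal (V * (4 * r)\<^sup>2) * indicator unit_box c + 4 * (indicator unit_box c * emeasure lborel (ball (0::plane) (tile_radius \<tau> - 2 * r))))"
    unfolding tile_sum_def
  proof (intro nn_integral_mono)
    fix \<omega> \<tau> assume "\<tau> \<in> space (count_space (empty_disc_tiles \<omega>))"
    define s where "s = tile_radius (shift (tile_centre \<tau>) \<tau>)"
    have s0: "s \<ge> 0" using \<open>\<tau> \<in> _\<close> tile_radius_pos[of \<tau>] by (simp add: s_def empty_disc_tiles_def shift_tile(3))
    have "ennreal (V * s\<^sup>2) \<le> ennreal (V * (4 * r)\<^sup>2) + 4 * emeasure lborel (ball (0::plane) (s - 2 * r))"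
    proof (cases "s \<le> 4 * r")
      case True
      then have "V * s\<^sup>2 \<le> V * (4 * r)\<^sup>2" using s0 V by (intro mult_left_mono power_mono) auto
      then have "ennreal (V * s\<^sup>2) \<le> ennreal (V * (4 * r)\<^sup>2)" by (rule ennreal_leI)
      then show ?thesis by (rule order_trans) simp
    next
      case False
      then have "s\<^sup>2 \<le> (2 * (s - 2 * r))\<^sup>2" using s0 by (intro power_mono) auto
      then have "V * s\<^sup>2 \<le> 4 * (V * (s - 2 * r)\<^sup>2)" 
        using mult_left_mono[of "s\<^sup>2" "(2 * (s - 2 * r))\<^sup>2" V] V unfolding power_mult_distrib by simp
      then have "ennreal (V * s\<^sup>2) \<le> ennreal (4 * (V * (s - 2 * r)\<^sup>2))" by (rule ennreal_leI)
      also have "\<dots> = 4 * emeasure lborel (ball (0::plane) (s - 2 * r))"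
        using False r(1) V by (simp add: emeasure_disc V_def[symmetric] ennreal_mult')
      finally show ?thesis by (rule order_trans) simp
    qed
    from mult_left_mono[OF this, of "indicator unit_box (tile_centre \<tau>)"]
    show "indicator unit_box (tile_centre \<tau>) * ennreal (V * (tile_radius (shift (tile_centre \<tau>) \<tau>))\<^sup>2) \<le>
      ennreal (V * (4 * r)\<^sup>2) * indicator unit_box (tile_centre \<tau>) + 4 * (indicator unit_box (tile_centre \<tau>) * emeasure lborel (ball (0::plane) (tile_radius (shift (tile_centre \<tau>) \<tau>) - 2 * r)))"
      by (simp add: s_def distrib_left ac_simps)
  qed
  also have "\<dots> = ennreal (V * (4 * r)\<^sup>2) * tile_sum (\<lambda>c \<tau>. indicator unit_box c) + 4 * tile_sum (\<lambda>c \<tau>. indicator unit_box c * emeasure lborel (ball (0::plane) (tile_radius \<tau> - 2 * r)))"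
  proof -
    \<comment> \<open>The radius may be negative here, when the ball is empty; the maximum gives one
      formula for all cases, from which measurability is read off.\<close>
    have b: "emeasure lborel (ball (0::plane) s) = ennreal (V * (max 0 s)\<^sup>2)" for s
    proof (cases "s \<ge> 0")
      case False
      then have e: "ball (0::plane) s = {}" by (simp add: ball_eq_empty)
      show ?thesis unfolding e using False by (simp add: max_def)
    qed (simp add: emeasure_disc V_def)
    have m1: "(\<lambda>(c, \<tau>). indicator unit_box c :: ennreal) \<in> borel_measurable (borel \<Otimes>\<^sub>M centred_tile_space)" by measurable
    have m2: "(\<lambda>(c, \<tau>). indicator unit_box c * emeasure lborel (ball (0::plane) (tile_radius \<tau> - 2 * r))) \<in> borel_measurable (borel \<Otimes>\<^sub>M centred_tile_space)"
      unfolding b by measurable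
    have m1': "(\<lambda>(c, \<tau>). ennreal (V * (4 * r)\<^sup>2) * indicator unit_box c) \<in> borel_measurable (borel \<Otimes>\<^sub>M centred_tile_space)" by measurable
    have m2': "(\<lambda>(c, \<tau>). 4 * (indicator unit_box c * emeasure lborel (ball (0::plane) (tile_radius \<tau> - 2 * r)))) \<in> borel_measurable (borel \<Otimes>\<^sub>M centred_tile_space)"
      unfolding b by measurable
    show ?thesis unfolding tile_sum_add[OF m1' m2'] tile_sum_cmult[OF m1] tile_sum_cmult[OF m2] ..
  qed
  also have "\<dots> < \<infinity>" using tile_intensity_finite shrunk_discs_finite by (simp add: ennreal_mult_less_top)
  finally show ?thesis by (simp add: tempered_def)
qed

end

theorem theorem3p4:
  fixes \<phi> :: "plane set \<Rightarrow> real" and z :: real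
  assumes "triangle_potential \<phi>" and "bounded_potential \<phi>"
    and "eventually_increasing \<phi>"
    and "z > 0"
  shows "(\<forall>P \<in> stationary_gibbs z \<phi>. tempered P) \<and>
         tempered_gibbs z \<phi> = stationary_gibbs z \<phi>"
proof -
  have "tempered P" if P: "P \<in> stationary_gibbs z \<phi>" for P
  proof -
    obtain K0 where K0: "\<And>\<tau>. \<tau> \<in> centred_tiles \<Longrightarrow> \<bar>\<phi> \<tau>\<bar> \<le> K0" using assms(2) by (auto simp: bounded_potential_def)
    obtain r \<psi> where r: "mono_on {r..} \<psi>" "\<And>\<tau>. tile \<tau> \<Longrightarrow> r \<le> tile_radius \<tau> \<Longrightarrow> tile_energy \<phi> \<tau> = \<psi> (tile_radius \<tau>)"
      using assms(3) by (auto simp: eventually_increasing_def)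
    \<comment> \<open>The maxima ensure \<open>K \<ge> 0\<close> and \<open>r > 0\<close>; the bound
      and the monotonicity persist for larger constants.\<close>
    interpret gibbs_process P \<phi> z "max 0 K0" "max 1 r" \<psi>
    proof unfold_locales
      show "P \<in> stationary_processes" "gibbs_measure \<phi> z P" using P by (auto simp: stationary_gibbs_def)
      show "\<phi> \<in> borel_measurable centred_tile_space" using assms(1) by (simp add: triangle_potential_def)
      show "\<bar>\<phi> \<tau>\<bar> \<le> max 0 K0" if "\<tau> \<in> centred_tiles" for \<tau> using K0[OF that] by simp
      show "mono_on {max 1 r..} \<psi>" using r(1) by (rule mono_on_subset) auto
      show "tile_energy \<phi> \<tau> = \<psi> (tile_radius \<tau>)" if "tile \<tau>" "max 1 r \<le> tile_radius \<tau>" for \<tau> using r(2) that by simp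
    qed (use assms(4) in auto)
    show ?thesis by (rule tempered)
  qed
  then show ?thesis by (auto simp: tempered_gibbs_def)
qed

end
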